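(* Let $x \in [0,1]^m$, let $\delta,\varepsilon$ be parameters with $0 < \varepsilon \leq \delta^2 \leq 1$, and let $A \in \mathbb{Z}_{\geq 0}^{n \times m}$ be a matrix and $1 \geq s_1 \geq \cdots \geq s_n > 0$ numbers with $m \geq 100 \log(\min_i \{2/s_i\})$. Suppose that every column $A^p$ ($p\in[m]$) satisfies $s^T A^p \leq 1$, and that every row $A_i$ with $s_i \leq \varepsilon$ satisfies $\|A_i\|_\infty \leq \delta \|A_i\|_1$. Then there is a randomized algorithm with expected polynomial running time that computes $y \in [0,1]^m$ with $|\{ p \in [m] : y_p \in \{0,1\}\}| \geq m/2$, $\mathbf{1}^T y = \mathbf{1}^T x$, and for all $i \in [n]$ $$\Big|\sum_{j \leq i} A_j (y - x)\Big| \leq \begin{cases} O(1/s_i) & \text{if } s_i > \varepsilon,\\ O\big(\sqrt{\ln(2/\delta)\cdot \delta}\cdot \tfrac{1}{s_i}\big) & \text{if } s_i \leq \varepsilon.\end{cases}$$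
   Context: $A_i$ denotes the $i$-th row and $A^p$ the $p$-th column of $A$; the constants in the $O(\cdot)$ are absolute. *)

theory Defs
  imports "HOL-Probability.Probability" "HOL-Library.Log_Nat"
    "HOL-Computational_Algebra.Polynomial"
begin

section \<open>The rounding problem\<close>

text \<open>
  Rows are indexed by \<open>{..<n}\<close> and columns by \<open>{..<m}\<close>, so row \<open>i\<close> here is row \<open>i + 1\<close> in
  one-based notation. Values outside these ranges are irrelevant.
\<close>

definition row_norm1 :: "nat \<Rightarrow> (nat \<Rightarrow> nat \<Rightarrow> nat) \<Rightarrow> nat \<Rightarrow> real" where
  "row_norm1 m A i = (\<Sum>p<m. real (A i p))"

definition row_norm_inf :: "nat \<Rightarrow> (nat \<Rightarrow> nat \<Rightarrow> nat) \<Rightarrow> nat \<Rightarrow> real" where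
  "row_norm_inf m A i = Max ((\<lambda>p. real (A i p)) ` {..<m})"

text \<open>
  The lower bound on \<open>m\<close> makes \<open>m\<close> positive, because all \<open>s i\<close> are at most \<open>1\<close>; hence the maximum in
  \<^const>\<open>row_norm_inf\<close> is over a nonempty set. The logarithm in that bound is natural; a base-2
  logarithm would be a stronger hypothesis. The parameter \<open>\<delta>\<close> is taken to be positive, as
  \<open>sqrt (ln (2 / \<delta>) * \<delta>)\<close> requires.
\<close>

definition admissible ::
  "nat \<Rightarrow> nat \<Rightarrow> (nat \<Rightarrow> nat \<Rightarrow> nat) \<Rightarrow> (nat \<Rightarrow> real) \<Rightarrow> (nat \<Rightarrow> real) \<Rightarrow> real \<Rightarrow> real \<Rightarrow> bool" where
  "admissible n m A s x \<delta> \<epsilon> \<longleftrightarrow>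
     0 < n \<and>
     (\<forall>p<m. x p \<in> {0..1}) \<and>
     0 < \<delta> \<and> 0 < \<epsilon> \<and> \<epsilon> \<le> \<delta>\<^sup>2 \<and> \<delta>\<^sup>2 \<le> 1 \<and>
     (\<forall>i<n. 0 < s i \<and> s i \<le> 1) \<and> (\<forall>i j. i \<le> j \<longrightarrow> j < n \<longrightarrow> s j \<le> s i) \<and>
     real m \<ge> 100 * ln (Min ((\<lambda>i. 2 / s i) ` {..<n})) \<and>
     (\<forall>p<m. (\<Sum>i<n. s i * real (A i p)) \<le> 1) \<and>
     (\<forall>i<n. s i \<le> \<epsilon> \<longrightarrow> row_norm_inf m A i \<le> \<delta> * row_norm1 m A i)"

definition good_rounding ::
  "real \<Rightarrow> nat \<Rightarrow> nat \<Rightarrow> (nat \<Rightarrow> nat \<Rightarrow> nat) \<Rightarrow> (nat \<Rightarrow> real) \<Rightarrow> (nat \<Rightarrow> real) \<Rightarrow> real \<Rightarrow> real \<Rightarrow>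
   (nat \<Rightarrow> real) \<Rightarrow> bool" where
  "good_rounding C n m A s x \<delta> \<epsilon> y \<longleftrightarrow>
     (\<forall>p<m. y p \<in> {0..1}) \<and>
     real (card {p. p < m \<and> y p \<in> {0, 1}}) \<ge> real m / 2 \<and>
     (\<Sum>p<m. y p) = (\<Sum>p<m. x p) \<and>
     (\<forall>i<n. \<bar>\<Sum>j\<le>i. \<Sum>p<m. real (A j p) * (y p - x p)\<bar> \<le>
        (if s i > \<epsilon> then C * (1 / s i) else C * (sqrt (ln (2 / \<delta>) * \<delta>) * (1 / s i))))"


section \<open>Randomized algorithms with logarithmic cost\<close>

text \<open>
  The machine model is a structured random access machine over unbounded integers with fair coin
  flips. Every variable is an integer array. Every value that occurs during an evaluation,
  addresses included, is charged its bit length, so running times agree with those of randomized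
  Turing machines up to a polynomial.
\<close>

type_synonym store = "string \<Rightarrow> int \<Rightarrow> int"

datatype aexp =
    Const int
  | Get string aexp
  | Plus aexp aexp
  | Minus aexp aexp
  | Times aexp aexp
  | Quot aexp aexp

datatype bexp = Less aexp aexp | Neg bexp | Conj bexp bexp

datatype com =
    Skip
  | Put string aexp aexp
  | Flip string
  | Seq com com
  | Cond bexp com com
  | While bexp com

definition bits :: "int \<Rightarrow> nat" where
  "bits k = 1 + nat (bitlen \<bar>k\<bar>)"

fun aval :: "aexp \<Rightarrow> store \<Rightarrow> int" where
  "aval (Const k) \<sigma> = k"
| "aval (Get v a) \<sigma> = \<sigma> v (aval a \<sigma>)"
| "aval (Plus a b) \<sigma> = aval a \<sigma> + aval b \<sigma>"
| "aval (Minus a b) \<sigma> = aval a \<sigma> - aval b \<sigma>"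
| "aval (Times a b) \<sigma> = aval a \<sigma> * aval b \<sigma>"
| "aval (Quot a b) \<sigma> = aval a \<sigma> div aval b \<sigma>"

fun acost :: "aexp \<Rightarrow> store \<Rightarrow> nat" where
  "acost (Const k) \<sigma> = bits k"
| "acost (Get v a) \<sigma> = acost a \<sigma> + bits (aval (Get v a) \<sigma>)"
| "acost (Plus a b) \<sigma> = acost a \<sigma> + acost b \<sigma> + bits (aval (Plus a b) \<sigma>)"
| "acost (Minus a b) \<sigma> = acost a \<sigma> + acost b \<sigma> + bits (aval (Minus a b) \<sigma>)"
| "acost (Times a b) \<sigma> = acost a \<sigma> + acost b \<sigma> + bits (aval (Times a b) \<sigma>)"
| "acost (Quot a b) \<sigma> = acost a \<sigma> + acost b \<sigma> + bits (aval (Quot a b) \<sigma>)"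

fun bval :: "bexp \<Rightarrow> store \<Rightarrow> bool" where
  "bval (Less a b) \<sigma> \<longleftrightarrow> aval a \<sigma> < aval b \<sigma>"
| "bval (Neg b) \<sigma> \<longleftrightarrow> \<not> bval b \<sigma>"
| "bval (Conj b c) \<sigma> \<longleftrightarrow> bval b \<sigma> \<and> bval c \<sigma>"

fun bcost :: "bexp \<Rightarrow> store \<Rightarrow> nat" where
  "bcost (Less a b) \<sigma> = 1 + acost a \<sigma> + acost b \<sigma>"
| "bcost (Neg b) \<sigma> = 1 + bcost b \<sigma>"
| "bcost (Conj b c) \<sigma> = 1 + bcost b \<sigma> + bcost c \<sigma>"

text \<open>
  \<open>exec c \<sigma> cs t \<tau>\<close>: started in store \<open>\<sigma>\<close>, the program \<open>c\<close> halts in store \<open>\<tau>\<close> at cost \<open>t\<close>, and \<open>cs\<close>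
  is the list of outcomes of exactly those coins that it flips.
\<close>

inductive exec :: "com \<Rightarrow> store \<Rightarrow> bool list \<Rightarrow> nat \<Rightarrow> store \<Rightarrow> bool" where
  exec_Skip: "exec Skip \<sigma> [] 1 \<sigma>"
| exec_Put: "exec (Put v a e) \<sigma> [] (1 + acost a \<sigma> + acost e \<sigma>)
     (\<sigma>(v := (\<sigma> v)(aval a \<sigma> := aval e \<sigma>)))"
| exec_Flip: "exec (Flip v) \<sigma> [c] 1 (\<sigma>(v := (\<sigma> v)(0 := of_bool c)))"
| exec_Seq: "exec c1 \<sigma> cs t \<tau> \<Longrightarrow> exec c2 \<tau> cs' t' \<tau>' \<Longrightarrow>
     exec (Seq c1 c2) \<sigma> (cs @ cs') (1 + t + t') \<tau>'"
| exec_Cond: "exec (if bval b \<sigma> then c1 else c2) \<sigma> cs t \<tau> \<Longrightarrow>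
     exec (Cond b c1 c2) \<sigma> cs (1 + bcost b \<sigma> + t) \<tau>"
| exec_While_False: "\<not> bval b \<sigma> \<Longrightarrow> exec (While b c) \<sigma> [] (1 + bcost b \<sigma>) \<sigma>"
| exec_While_True: "bval b \<sigma> \<Longrightarrow> exec c \<sigma> cs t \<tau> \<Longrightarrow> exec (While b c) \<tau> cs' t' \<tau>' \<Longrightarrow>
     exec (While b c) \<sigma> (cs @ cs') (1 + bcost b \<sigma> + t + t') \<tau>'"

inductive_cases exec_SkipE: "exec Skip \<sigma> cs t \<tau>"
inductive_cases exec_PutE: "exec (Put v a e) \<sigma> cs t \<tau>"
inductive_cases exec_FlipE: "exec (Flip v) \<sigma> cs t \<tau>"
inductive_cases exec_SeqE: "exec (Seq c1 c2) \<sigma> cs t \<tau>"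
inductive_cases exec_CondE: "exec (Cond b c1 c2) \<sigma> cs t \<tau>"
inductive_cases exec_WhileE: "exec (While b c) \<sigma> cs t \<tau>"

text \<open>On every infinite sequence of coin outcomes there is at most one halting run.\<close>

lemma exec_deterministic:
  assumes "exec c \<sigma> cs t \<tau>" "exec c \<sigma> cs' t' \<tau>'" "cs @ r = cs' @ r'"
  shows "cs = cs' \<and> t = t' \<and> \<tau> = \<tau>'"
  using assms
proof (induction arbitrary: cs' t' \<tau>' r r' rule: exec.induct)
  case (exec_Skip \<sigma>)
  then show ?case by (auto elim: exec_SkipE)
next
  case (exec_Put v a e \<sigma>)
  then show ?case by (auto elim: exec_PutE)
next
  case (exec_Flip v \<sigma> c)
  then show ?case by (auto elim: exec_FlipE)
next
  case (exec_Seq c1 \<sigma> cs1 t1 \<tau>1 c2 cs2 t2 \<tau>2)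
  from exec_Seq.prems(1) obtain ds1 u1 \<rho>1 ds2 u2 where
    *: "exec c1 \<sigma> ds1 u1 \<rho>1" "exec c2 \<rho>1 ds2 u2 \<tau>'" "cs' = ds1 @ ds2" "t' = Suc (u1 + u2)"
    by (rule exec_SeqE) blast
  have "cs1 = ds1 \<and> t1 = u1 \<and> \<tau>1 = \<rho>1"
    using exec_Seq.IH(1)[OF *(1), of "cs2 @ r" "ds2 @ r'"] exec_Seq.prems(2) *(3) by simp
  with exec_Seq.IH(2)[of ds2 u2 \<tau>' r r'] exec_Seq.prems(2) * show ?case by simp
next
  case (exec_Cond b \<sigma> c1 c2 cs t \<tau>)
  from exec_Cond.prems(1) obtain u where
    "exec (if bval b \<sigma> then c1 else c2) \<sigma> cs' u \<tau>'" "t' = 1 + bcost b \<sigma> + u"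
    by (auto elim!: exec_CondE)
  with exec_Cond.IH exec_Cond.prems(2) show ?case by blast
next
  case (exec_While_False b \<sigma> c)
  from exec_While_False.prems(1) show ?case
    by (rule exec_WhileE) (use exec_While_False.hyps in simp_all)
next
  case (exec_While_True b \<sigma> c cs1 t1 \<tau>1 cs2 t2 \<tau>2)
  from exec_While_True.prems(1) obtain ds1 u1 \<rho>1 ds2 u2 where
    *: "exec c \<sigma> ds1 u1 \<rho>1" "exec (While b c) \<rho>1 ds2 u2 \<tau>'" "cs' = ds1 @ ds2"
       "t' = Suc (bcost b \<sigma> + u1 + u2)"
    by (rule exec_WhileE) (use exec_While_True.hyps in blast)+
  have "cs1 = ds1 \<and> t1 = u1 \<and> \<tau>1 = \<rho>1"
    using exec_While_True.IH(1)[OF *(1), of "cs2 @ r" "ds2 @ r'"] exec_While_True.prems(2) *(3)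
    by simp
  with exec_While_True.IH(2)[of ds2 u2 \<tau>' r r'] exec_While_True.prems(2) * show ?case by simp
qed

definition coin_space :: "bool stream measure" where
  "coin_space = stream_space (measure_pmf (bernoulli_pmf (1 / 2)))"

text \<open>The infimum is \<open>\<infinity>\<close> if the program does not halt on the coin sequence \<open>\<omega>\<close>.\<close>

definition run_time :: "com \<Rightarrow> store \<Rightarrow> bool stream \<Rightarrow> ennreal" where
  "run_time c \<sigma> \<omega> = (INF k. INF t \<in> {t. \<exists>\<tau>. exec c \<sigma> (stake k \<omega>) t \<tau>}. of_nat t)"

definition expected_run_time :: "com \<Rightarrow> store \<Rightarrow> ennreal" where
  "expected_run_time c \<sigma> = (\<integral>\<^sup>+ \<omega>. run_time c \<sigma> \<omega> \<partial>coin_space)"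

lemma run_time_exec:
  assumes "exec c \<sigma> (stake k \<omega>) t \<tau>"
  shows "run_time c \<sigma> \<omega> = of_nat t"
proof -
  have same: "t' = t" if "exec c \<sigma> (stake k' \<omega>) t' \<tau>'" for k' t' \<tau>'
    using exec_deterministic[OF that assms,
        of "stake (k - k') (sdrop k' \<omega>)" "stake (k' - k) (sdrop k \<omega>)"]
    by (cases "k \<le> k'") (simp_all add: stake_add)
  show ?thesis
    unfolding run_time_def
  proof (rule antisym)
    show "(INF k. INF t \<in> {t. \<exists>\<tau>. exec c \<sigma> (stake k \<omega>) t \<tau>}. of_nat t) \<le> (of_nat t :: ennreal)"
      using assms by (intro INF_lower2[of k] INF_lower) auto
    show "(of_nat t :: ennreal) \<le> (INF k. INF t \<in> {t. \<exists>\<tau>. exec c \<sigma> (stake k \<omega>) t \<tau>}. of_nat t)"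
      using same by (intro INF_greatest) auto
  qed
qed

lemma run_time_measurable: "run_time c \<sigma> \<in> borel_measurable coin_space"
proof -
  have "(\<lambda>\<omega>. (INF t \<in> {t. \<exists>\<tau>. exec c \<sigma> (stake k \<omega>) t \<tau>}. of_nat t) :: ennreal)
          \<in> borel_measurable coin_space" for k
  proof -
    have "sets coin_space = sets (stream_space (count_space UNIV))"
      unfolding coin_space_def by (rule sets_stream_space_cong) simp
    then have "stake k \<in> coin_space \<rightarrow>\<^sub>M count_space UNIV"
      using measurable_stake measurable_cong_sets by blast
    then show ?thesis
      by (rule measurable_compose) simp
  qed
  then show ?thesis
    unfolding run_time_def by (intro borel_measurable_INF) auto
qed


section \<open>Input and output\<close>

text \<open>
  Integers are stored as such, rational numbers as a numerator and a denominator, matrices row by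
  row, and scalars in cell \<open>0\<close>.
\<close>

definition arr :: "nat \<Rightarrow> (nat \<Rightarrow> int) \<Rightarrow> int \<Rightarrow> int" where
  "arr l f k = (if 0 \<le> k \<and> k < int l then f (nat k) else 0)"

definition rat_num :: "rat \<Rightarrow> int" where
  "rat_num r = fst (quotient_of r)"

definition rat_den :: "rat \<Rightarrow> int" where
  "rat_den r = snd (quotient_of r)"

definition input_store ::
  "nat \<Rightarrow> nat \<Rightarrow> (nat \<Rightarrow> nat \<Rightarrow> nat) \<Rightarrow> (nat \<Rightarrow> rat) \<Rightarrow> (nat \<Rightarrow> rat) \<Rightarrow> rat \<Rightarrow> rat \<Rightarrow> store" where
  "input_store n m A s x \<delta> \<epsilon> = (\<lambda>_ _. 0)
     (''n'' := arr 1 (\<lambda>_. int n),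
      ''m'' := arr 1 (\<lambda>_. int m),
      ''A'' := arr (n * m) (\<lambda>k. int (A (k div m) (k mod m))),
      ''s_num'' := arr n (\<lambda>i. rat_num (s i)),
      ''s_den'' := arr n (\<lambda>i. rat_den (s i)),
      ''x_num'' := arr m (\<lambda>p. rat_num (x p)),
      ''x_den'' := arr m (\<lambda>p. rat_den (x p)),
      ''delta_num'' := arr 1 (\<lambda>_. rat_num \<delta>),
      ''delta_den'' := arr 1 (\<lambda>_. rat_den \<delta>),
      ''eps_num'' := arr 1 (\<lambda>_. rat_num \<epsilon>),
      ''eps_den'' := arr 1 (\<lambda>_. rat_den \<epsilon>))"

definition rat_bits :: "rat \<Rightarrow> nat" where
  "rat_bits r = bits (rat_num r) + bits (rat_den r)"

definition input_size ::
  "nat \<Rightarrow> nat \<Rightarrow> (nat \<Rightarrow> nat \<Rightarrow> nat) \<Rightarrow> (nat \<Rightarrow> rat) \<Rightarrow> (nat \<Rightarrow> rat) \<Rightarrow> rat \<Rightarrow> rat \<Rightarrow> nat" where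
  "input_size n m A s x \<delta> \<epsilon> =
     bits (int n) + bits (int m) + (\<Sum>i<n. \<Sum>p<m. bits (int (A i p))) +
     (\<Sum>i<n. rat_bits (s i)) + (\<Sum>p<m. rat_bits (x p)) + rat_bits \<delta> + rat_bits \<epsilon>"

definition well_formed_output :: "nat \<Rightarrow> store \<Rightarrow> bool" where
  "well_formed_output m \<tau> \<longleftrightarrow> (\<forall>p<m. 0 < \<tau> ''y_den'' (int p))"

definition output_vector :: "store \<Rightarrow> nat \<Rightarrow> real" where
  "output_vector \<tau> p = of_int (\<tau> ''y_num'' (int p)) / of_int (\<tau> ''y_den'' (int p))"

text \<open>
  Running time is measured in the bit length of the input, so the numbers given to the program are
  rational. The program is one fixed program for all dimensions and inputs. A halting run consumes finitely
  many coins and so has positive probability; hence correctness of all halting runs is the same as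
  almost sure correctness, and a finite expected running time implies almost sure termination.
\<close>

definition computes_rounding_in_expected_poly_time :: "real \<Rightarrow> com \<Rightarrow> nat poly \<Rightarrow> bool" where
  "computes_rounding_in_expected_poly_time C prog q \<longleftrightarrow>
     (\<forall>n m A s x \<delta> \<epsilon>.
        admissible n m A (\<lambda>i. real_of_rat (s i)) (\<lambda>p. real_of_rat (x p))
          (real_of_rat \<delta>) (real_of_rat \<epsilon>) \<longrightarrow>
        expected_run_time prog (input_store n m A s x \<delta> \<epsilon>)
          \<le> of_nat (poly q (input_size n m A s x \<delta> \<epsilon>)) \<and>
        (\<forall>cs t \<tau>. exec prog (input_store n m A s x \<delta> \<epsilon>) cs t \<tau> \<longrightarrow>
           well_formed_output m \<tau> \<and>
           good_rounding C n m A (\<lambda>i. real_of_rat (s i)) (\<lambda>p. real_of_rat (x p))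
             (real_of_rat \<delta>) (real_of_rat \<epsilon>) (output_vector \<tau>)))"

end

theory Submission
  imports Defs
begin

text \<open>
  Put \<open>z = y - x\<close> and weight row \<open>j\<close> by \<open>s j\<close>. By Abel summation it is enough to bound the prefix sums of
  the weighted rows applied to \<open>z\<close>. Laying the weighted rows end to end on a line of length at most \<open>m\<close>
  turns prefixes into a flow that is 1-Lipschitz in the sum norm. The flow of the rows with
  \<open>s j > \<epsilon>\<close> is controlled on a grid of width 64. The flow of the other rows is chained along grids of
  width \<open>64 / 8\<^sup>h\<close>; its increments on level \<open>h\<close> are allowed an error of order \<open>sqrt \<delta> / 2\<^sup>h\<close>, and since they
  are small in the maximum norm, the squared norms of all normalised increments add up to at most
  \<open>m / 512\<close>. Only few constraints, those on the coarsest grids, are hard. Two constraints, the sum of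
  \<open>z\<close> and the sum of the rows with \<open>s j > \<epsilon>\<close>, are kept exactly.

  The point \<open>y\<close> is the end of a deterministic walk. The potential, an eighth of the squared norm of \<open>z\<close> minus
  the sum of the squared soft errors, stays nonnegative, so that at most \<open>m / 8\<close> soft constraints are ever
  active. As long as more than half of the coordinates are strictly between 0 and 1, a dimension
  count and Bessel's inequality yield a direction along which the active constraints hardly change
  and the potential does not decrease. A step either fixes a coordinate or raises the potential by at least
  \<open>1 / (16 * m)\<close>, hence \<open>4 * m\<^sup>2\<close> steps suffice. Power iteration, started from the projections of
  the unit vectors, finds such a direction in polynomial time, so no coin is needed.

  Bit lengths stay polynomial because the variables can be ranked in such a way that every assignment is linear
  in the variables of its own rank with coefficients of lower rank.
\<close>

section \<open>Short directions for a quadratic form\<close>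

text \<open>The constants form one chain. While more than half of the coordinates move, the hard,
  active and exact constraints number at most \<open>m / 32 + 2 + m / 8 + 2\<close>, which leaves at
  least \<open>m / 8\<close> free dimensions; a total squared norm of \<open>m / 512\<close> then
  averages to \<open>1 / 64\<close> per dimension. Power iteration loses a factor 4, and the
  resulting \<open>1 / 16\<close> is half of the \<open>1 / 8\<close> in the potential, so the
  second-order gain of a step is positive. Grids shrink by 8 and errors by 2 because an increment on
  level \<open>h\<close> has squared norm of order \<open>\<delta> / 64 ^ h\<close>, normalisation
  multiplies it by \<open>4 ^ h / \<delta>\<close>, and there are about
  \<open>m * 8 ^ h / 64\<close> of them: the ratio of consecutive levels is
  \<open>8 * 4 / 64 = 1 / 2\<close>. Below the finest grid the Lipschitz bound costs
  \<open>64 / m\<close>, which must be of order \<open>sqrt \<delta>\<close>; it is, because a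
  nonzero small row forces \<open>m * \<delta> \<ge> 1\<close>. Directions stay integral:
  projections carry a common factor instead of divisions, and steps are measured in the sum norm,
  since the Euclidean norm would be irrational.\<close>

definition dot :: "nat \<Rightarrow> (nat \<Rightarrow> real) \<Rightarrow> (nat \<Rightarrow> real) \<Rightarrow> real" where
  "dot m v w = (\<Sum>p<m. v p * w p)"

lemma dot_commute: "dot m v w = dot m w v"
  unfolding dot_def by (simp add: mult.commute)

lemma dot_nonneg [simp]: "0 \<le> dot m v v"
  unfolding dot_def by (simp add: sum_nonneg)

lemma dot_cong: "(\<And>p. p < m \<Longrightarrow> v p = v' p) \<Longrightarrow> (\<And>p. p < m \<Longrightarrow> w p = w' p) \<Longrightarrow> dot m v w = dot m v' w'"
  unfolding dot_def by simp

lemma dot_add_right: "dot m v (\<lambda>p. w p + w' p) = dot m v w + dot m v w'"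
  and dot_diff_right: "dot m v (\<lambda>p. w p - w' p) = dot m v w - dot m v w'"
  and dot_scale_right: "dot m v (\<lambda>p. c * w p) = c * dot m v w"
  unfolding dot_def
  by (simp_all add: algebra_simps sum.distrib sum_subtractf sum_distrib_left)

lemma dot_add_left: "dot m (\<lambda>p. w p + w' p) v = dot m w v + dot m w' v"
  and dot_diff_left: "dot m (\<lambda>p. w p - w' p) v = dot m w v - dot m w' v"
  and dot_scale_left: "dot m (\<lambda>p. c * w p) v = c * dot m w v"
  by (simp_all add: dot_commute[of m _ v] dot_add_right dot_diff_right dot_scale_right)

lemmas dot_simps = dot_add_right dot_diff_right dot_scale_right
  dot_add_left dot_diff_left dot_scale_left

lemma dot_sum_right: "dot m v (\<lambda>p. \<Sum>i\<in>I. f i p) = (\<Sum>i\<in>I. dot m v (f i))"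
  unfolding dot_def by (simp add: sum_distrib_left) (rule sum.swap)

lemma dot_Cauchy_Schwarz: "(dot m v w)\<^sup>2 \<le> dot m v v * dot m w w"
  using Cauchy_Schwarz_ineq_sum[of v w "{..<m}"] unfolding dot_def by (simp add: power2_eq_square)

lemma dot_abs_le: "\<bar>dot m v w\<bar> \<le> sqrt (dot m v v) * sqrt (dot m w w)"
  using dot_Cauchy_Schwarz[of m v w] by (metis real_sqrt_abs real_sqrt_le_iff real_sqrt_mult)

section \<open>Linear systems and orthonormal families of solutions\<close>

text \<open>Gaussian elimination, one equation per induction step. An equation without nonzero
  coefficients costs nothing; otherwise it is solved for a pivot variable, and the numbers of
  equations and of variables both drop by one, so the strict inequality survives.\<close>

lemma nontrivial_solution:
  fixes c :: "'i \<Rightarrow> 'j \<Rightarrow> real"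
  assumes "finite J" "finite I" "card J < card I"
  shows "\<exists>v. (\<forall>p. p \<notin> I \<longrightarrow> v p = 0) \<and> (\<exists>p\<in>I. v p \<noteq> 0) \<and> (\<forall>j\<in>J. (\<Sum>p\<in>I. c j p * v p) = 0)"
  using assms
proof (induction J arbitrary: c I rule: finite_induct)
  case empty
  then obtain p0 where "p0 \<in> I" by (metis card.empty ex_in_conv less_irrefl)
  then show ?case by (intro exI[of _ "\<lambda>p. if p = p0 then 1 else 0"]) auto
next
  case (insert j J)
  have cJ: "card J < card I - 1" using insert by simp
  show ?case
  proof (cases "\<forall>p\<in>I. c j p = 0")
    case True
    obtain v where "(\<forall>p. p \<notin> I \<longrightarrow> v p = 0) \<and> (\<exists>p\<in>I. v p \<noteq> 0) \<and> (\<forall>j\<in>J. (\<Sum>p\<in>I. c j p * v p) = 0)"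
      using insert.IH[of I c] insert.prems cJ by (metis less_imp_diff_less less_le_trans diff_le_self)
    with True show ?thesis by (intro exI[of _ v]) auto
  next
    case False
    then obtain q where q: "q \<in> I" "c j q \<noteq> 0" by auto
    define I' where "I' = I - {q}"
    have I': "finite I'" "card J < card I'" "I = insert q I'" "q \<notin> I'"
      using q insert.prems cJ by (auto simp: I'_def)
    \<comment> \<open>Coefficient of \<open>p\<close> in equation \<open>i\<close> after
      \<open>q\<close> has been eliminated by means of equation \<open>j\<close>.\<close>
    define d where "d i p = c i p - c i q * c j p / c j q" for i p
    obtain v where v: "\<forall>p. p \<notin> I' \<longrightarrow> v p = 0" "\<exists>p\<in>I'. v p \<noteq> 0" "\<forall>i\<in>J. (\<Sum>p\<in>I'. d i p * v p) = 0"
      using insert.IH[of I' d] I' by blast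
    define w where "w = v(q := - (\<Sum>p\<in>I'. c j p * v p) / c j q)"
    have sw: "(\<Sum>p\<in>I'. f p * w p) = (\<Sum>p\<in>I'. f p * v p)" for f
      using I'(4) by (intro sum.cong) (auto simp: w_def)
    have S: "(\<Sum>p\<in>I. f p * w p) = (\<Sum>p\<in>I'. f p * v p) - f q * (\<Sum>p\<in>I'. c j p * v p) / c j q" for f
      using I' by (simp add: sw) (simp add: w_def)
    have "(\<Sum>p\<in>I. c j p * w p) = 0" using q by (simp add: S)
    moreover have "(\<Sum>p\<in>I. c i p * w p) = 0" if "i \<in> J" for i
    proof -
      have "0 = (\<Sum>p\<in>I'. d i p * v p)" using v(3) that by simp
      also have "\<dots> = (\<Sum>p\<in>I'. c i p * v p) - c i q * (\<Sum>p\<in>I'. c j p * v p) / c j q"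
        unfolding d_def by (simp add: algebra_simps sum_subtractf sum_distrib_left sum_divide_distrib)
      finally show ?thesis using S by simp
    qed
    moreover have "\<forall>p. p \<notin> I \<longrightarrow> w p = 0" using v(1) I' by (auto simp: w_def)
    moreover have "\<exists>p\<in>I. w p \<noteq> 0" using v(2) I' by (auto simp: w_def)
    ultimately show ?thesis by (intro exI[of _ w]) auto
  qed
qed

text \<open>Instead of orthogonalising afterwards, orthogonality to the vectors found so far is
  added as \<open>d\<close> further linear equations; the next vector is a nontrivial solution of
  the enlarged system, scaled to norm 1.\<close>

lemma orthonormal_solutions:
  fixes c :: "'i \<Rightarrow> nat \<Rightarrow> real"
  assumes "finite J" "I \<subseteq> {..<m}" "card J + d \<le> card I"
  shows "\<exists>e::nat \<Rightarrow> nat \<Rightarrow> real. (\<forall>k<d. \<forall>p. p \<notin> I \<longrightarrow> e k p = 0) \<and> (\<forall>k<d. \<forall>j\<in>J. dot m (c j) (e k) = 0) \<and>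
    (\<forall>k<d. \<forall>l<d. dot m (e k) (e l) = (if k = l then 1 else 0))"
  using assms(3)
proof (induction d)
  case 0
  show ?case by simp
next
  case (Suc d)
  then obtain e :: "nat \<Rightarrow> nat \<Rightarrow> real" where
    e: "\<forall>k<d. \<forall>p. p \<notin> I \<longrightarrow> e k p = 0" "\<forall>k<d. \<forall>j\<in>J. dot m (c j) (e k) = 0"
       "\<forall>k<d. \<forall>l<d. dot m (e k) (e l) = (if k = l then 1 else 0)" by auto
  have fI: "finite I" using assms(2) finite_subset by blast
  define cc where "cc s = (case s of Inl j \<Rightarrow> c j | Inr k \<Rightarrow> e k)" for s
  have "card (J <+> {..<d}) < card I" using Suc.prems assms(1) by (simp add: card_Plus)
  then obtain v where v: "\<forall>p. p \<notin> I \<longrightarrow> v p = 0" "\<exists>p\<in>I. v p \<noteq> 0"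
      "\<forall>s\<in>J <+> {..<d}. (\<Sum>p\<in>I. cc s p * v p) = 0"
    using nontrivial_solution[of "J <+> {..<d}" I cc] assms(1) fI by auto
  have dI: "dot m w v = (\<Sum>p\<in>I. w p * v p)" for w
    unfolding dot_def using v(1) assms(2) by (intro sum.mono_neutral_right) auto
  have pos: "0 < dot m v v"
  proof -
    obtain p where "p \<in> I" "v p \<noteq> 0" using v(2) by auto
    then have "0 < (\<Sum>p\<in>I. v p * v p)" using fI
      by (intro sum_pos2[of I p]) (auto simp: zero_less_mult_iff)
    then show ?thesis by (simp add: dI)
  qed
  define r where "r = sqrt (dot m v v)"
  have r: "0 < r" "r * r = dot m v v" using pos by (auto simp: r_def)
  define w where "w = (\<lambda>p. (1 / r) * v p)"
  have w: "dot m u w = dot m u v / r" for u unfolding w_def by (simp only: dot_scale_right) simp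
  have w1: "dot m w w = 1"
    using r pos by (simp add: w dot_commute[of m w v])
  have cw: "dot m (c j) w = 0" if "j \<in> J" for j
    using v(3)[rule_format, of "Inl j"] that by (auto simp: w dI cc_def)
  have ew: "dot m (e k) w = 0" if "k < d" for k
    using v(3)[rule_format, of "Inr k"] that by (auto simp: w dI cc_def)
  have supp: "w p = 0" if "p \<notin> I" for p using v(1) that by (simp add: w_def)
  show ?case
  proof (intro exI[of _ "e(d := w)"] conjI allI impI ballI)
    fix k p assume "k < Suc d" "p \<notin> I"
    then show "(e(d := w)) k p = 0" using e(1) supp by (cases "k = d") auto
  next
    fix k j assume "k < Suc d" "j \<in> J"
    then show "dot m (c j) ((e(d := w)) k) = 0" using e(2) cw by (cases "k = d") auto
  next
    fix k l assume "k < Suc d" "l < Suc d"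
    then show "dot m ((e(d := w)) k) ((e(d := w)) l) = (if k = l then 1 else 0)"
      using e(3) ew w1 dot_commute[of m w "e l"] by (cases "k = d"; cases "l = d") auto
  qed
qed

text \<open>\<open>r n\<close> is \<open>b\<close> minus its first \<open>n\<close> projections.
  Each projection removed lowers the squared norm by exactly the square of its coefficient, and what
  remains is nonnegative.\<close>

lemma Bessel_inequality:
  fixes e :: "nat \<Rightarrow> nat \<Rightarrow> real"
  assumes "\<forall>k<d. \<forall>l<d. dot m (e k) (e l) = (if k = l then 1 else 0)"
  shows "(\<Sum>k<d. (dot m b (e k))\<^sup>2) \<le> dot m b b"
proof -
  define r where "r n = (\<lambda>p. b p - (\<Sum>k<n. dot m b (e k) * e k p))" for n
  have ort: "dot m (r n) (e j) = dot m b (e j)" if "n \<le> j" "j < d" for n j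
  proof -
    have "dot m (r n) (e j) = dot m b (e j) - dot m (e j) (\<lambda>p. \<Sum>k<n. dot m b (e k) * e k p)"
      unfolding r_def by (simp only: dot_diff_left dot_commute[of m "\<lambda>p. \<Sum>k<n. dot m b (e k) * e k p"])
    also have "dot m (e j) (\<lambda>p. \<Sum>k<n. dot m b (e k) * e k p) = 0"
      unfolding dot_sum_right
    proof (rule sum.neutral, rule ballI)
      fix k assume "k \<in> {..<n}"
      then have "k < d" "j \<noteq> k" using that by auto
      then have "dot m (e j) (e k) = 0" using assms that(2) by simp
      then show "dot m (e j) (\<lambda>p. dot m b (e k) * e k p) = 0" by (simp add: dot_scale_right)
    qed
    finally show ?thesis by simp
  qed
  have "n \<le> d \<Longrightarrow> dot m (r n) (r n) = dot m b b - (\<Sum>k<n. (dot m b (e k))\<^sup>2)" for n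
  proof (induction n)
    case 0
    show ?case by (simp add: r_def)
  next
    case (Suc n)
    have rS: "r (Suc n) = (\<lambda>p. r n p - dot m b (e n) * e n p)" by (auto simp: r_def)
    have "dot m (r (Suc n)) (r (Suc n)) = dot m (r n) (r n) - (dot m b (e n))\<^sup>2"
    proof -
      have "dot m (e n) (e n) = 1" "dot m (r n) (e n) = dot m b (e n)" "dot m (e n) (r n) = dot m b (e n)"
        using ort[of n n] Suc.prems assms[rule_format, of n n] dot_commute[of m "e n" "r n"] by auto
      then show ?thesis unfolding rS by (simp only: dot_simps) (simp add: power2_eq_square)
    qed
    then show ?case using Suc by simp
  qed
  from this[of d] show ?thesis using dot_nonneg[of m "r d"] by linarith
qed

text \<open>Averaging over \<open>d\<close> orthonormal solutions: by Bessel, the form summed over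
  them is at most the sum of the squared norms of the \<open>b i\<close>, so one of them does not
  exceed the mean \<open>X / d\<close>.\<close>

lemma small_quadratic_form_direction:
  fixes c :: "'i \<Rightarrow> nat \<Rightarrow> real"
  assumes "finite J" "I \<subseteq> {..<m}" "card J + d \<le> card I" "0 < d"
    and "finite S" "(\<Sum>i\<in>S. dot m (b i) (b i)) \<le> X"
  shows "\<exists>u. (\<forall>p. p \<notin> I \<longrightarrow> u p = 0) \<and> (\<forall>j\<in>J. dot m (c j) u = 0) \<and> dot m u u = 1 \<and>
    (\<Sum>i\<in>S. (dot m (b i) u)\<^sup>2) \<le> X / real d"
proof -
  obtain e :: "nat \<Rightarrow> nat \<Rightarrow> real" where e: "\<forall>k<d. \<forall>p. p \<notin> I \<longrightarrow> e k p = 0" "\<forall>k<d. \<forall>j\<in>J. dot m (c j) (e k) = 0"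
    "\<forall>k<d. \<forall>l<d. dot m (e k) (e l) = (if k = l then 1 else 0)"
    using orthonormal_solutions[OF assms(1-3)] by blast
  have "\<exists>k<d. (\<Sum>i\<in>S. (dot m (b i) (e k))\<^sup>2) \<le> X / real d"
  proof (rule ccontr)
    assume "\<not> ?thesis"
    then have "\<forall>k<d. X / real d < (\<Sum>i\<in>S. (dot m (b i) (e k))\<^sup>2)" by force
    then have "(\<Sum>k<d. X / real d) < (\<Sum>k<d. \<Sum>i\<in>S. (dot m (b i) (e k))\<^sup>2)"
      using assms(4) by (intro sum_strict_mono) auto
    also have "\<dots> = (\<Sum>i\<in>S. \<Sum>k<d. (dot m (b i) (e k))\<^sup>2)" by (rule sum.swap)
    also have "\<dots> \<le> (\<Sum>i\<in>S. dot m (b i) (b i))" by (intro sum_mono Bessel_inequality e(3))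
    finally show False using assms by simp
  qed
  then obtain k where "k < d" "(\<Sum>i\<in>S. (dot m (b i) (e k))\<^sup>2) \<le> X / real d" by auto
  then show ?thesis using e by (intro exI[of _ "e k"]) auto
qed

section \<open>Power iteration, argued without eigenvalues\<close>

text \<open>\<open>B\<close> plays the role of \<open>s\<close> times a projected
  \<open>c - Q\<close>, with \<open>Q\<close> a quadratic form and \<open>s\<close> the factor of
  the division-free projection. By symmetry and Cauchy-Schwarz the growth factors along an orbit of
  \<open>B\<close> never decrease. If every start failed, the last factor of each of their orbits,
  hence every factor, would be at most \<open>s * (c - a / 2)\<close>, whereas the orbit of
  \<open>u\<close> grows by at least \<open>s * (c - a / 4)\<close>. Since the orbit of
  \<open>u\<close> is controlled by those of the \<open>m\<close> starts, this is impossible for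
  large \<open>T\<close>.\<close>

lemma power_iteration:
  fixes B :: "(nat \<Rightarrow> real) \<Rightarrow> (nat \<Rightarrow> real)"
  assumes BU: "\<And>v. v \<in> U \<Longrightarrow> B v \<in> U"
    and sym: "\<And>v w. v \<in> U \<Longrightarrow> w \<in> U \<Longrightarrow> dot m (B v) w = dot m v (B w)"
    and wU: "\<And>p. p < m \<Longrightarrow> w p \<in> U"
    and w: "\<And>p y. p < m \<Longrightarrow> y \<in> U \<Longrightarrow> dot m (w p) y = s * y p"
    and w1: "\<And>p. p < m \<Longrightarrow> dot m (w p) (w p) \<le> s\<^sup>2"
    and Bsq: "\<And>v. v \<in> U \<Longrightarrow> dot m (B v) (B v) \<le> s\<^sup>2 * (c\<^sup>2 * dot m v v - c * Q v)"
    and Bq: "\<And>v. v \<in> U \<Longrightarrow> dot m v (B v) = s * (c * dot m v v - Q v)"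
    and Q0: "\<And>v. 0 \<le> Q v"
    and u: "u \<in> U" "dot m u u = 1" "Q u \<le> a / 4"
    and pos: "0 < a" "a \<le> c" "0 < s"
    and T: "4 * c * real m / a \<le> real T"
  shows "\<exists>p<m. 0 < dot m ((B ^^ T) (w p)) ((B ^^ T) (w p)) \<and>
    Q ((B ^^ T) (w p)) \<le> a * dot m ((B ^^ T) (w p)) ((B ^^ T) (w p))"
proof (rule ccontr)
  assume "\<not> ?thesis"
  then have bad: "dot m ((B ^^ T) (w p)) ((B ^^ T) (w p)) = 0 \<or>
      Q ((B ^^ T) (w p)) > a * dot m ((B ^^ T) (w p)) ((B ^^ T) (w p))" if "p < m" for p
    using that dot_nonneg[of m "(B ^^ T) (w p)"] by (meson less_eq_real_def not_less order_antisym_conv)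
  define nm where "nm v = sqrt (dot m v v)" for v
  have nm0: "0 \<le> nm v" for v by (simp add: nm_def)
  have nmsq: "(nm v)\<^sup>2 = dot m v v" for v by (simp add: nm_def)
  have cpos: "0 < c" using pos by linarith
  \<comment> \<open>A failed end vector gives the factor \<open>c\<^sup>2 - c * a\<close>, which is
    at most \<open>(c - a / 2)\<^sup>2\<close>.\<close>
  define \<rho> where "\<rho> = s * (c - a / 2)"
  have \<rho>0: "0 < \<rho>" using pos by (simp add: \<rho>_def)
  have powU: "(B ^^ k) v \<in> U" if "v \<in> U" for k v by (induction k) (auto simp: that BU)
  have sympow: "dot m ((B ^^ k) v) w = dot m v ((B ^^ k) w)" if "v \<in> U" "w \<in> U" for k v w
    using that
  proof (induction k arbitrary: v w)
    case (Suc k)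
    have "dot m ((B ^^ Suc k) v) w = dot m ((B ^^ k) v) (B w)"
      using sym[OF powU[OF Suc.prems(1)] Suc.prems(2)] by simp
    also have "\<dots> = dot m v ((B ^^ k) (B w))" using Suc BU by blast
    finally show ?case using funpow_swap1[of B k w] by simp
  qed simp
  \<comment> \<open>The growth bound is inherited backwards along an orbit, because the squared norm
    of \<open>B v\<close> is the inner product of \<open>v\<close> with
    \<open>B (B v)\<close>.\<close>
  have step: "nm (B v) \<le> \<rho> * nm v" if "v \<in> U" "nm (B (B v)) \<le> \<rho> * nm (B v)" for v
  proof (cases "nm (B v) = 0")
    case True
    then show ?thesis using nm0 \<rho>0 by simp
  next
    case False
    have "(nm (B v))\<^sup>2 = dot m v (B (B v))" using that sym BU by (simp add: nmsq)
    also have "\<dots> \<le> nm v * nm (B (B v))" using dot_abs_le[of m v "B (B v)"] by (simp add: nm_def)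
    also have "\<dots> \<le> nm v * (\<rho> * nm (B v))" using that nm0 by (intro mult_left_mono) auto
    finally have "nm (B v) * nm (B v) \<le> (\<rho> * nm v) * nm (B v)" by (simp add: power2_eq_square mult_ac)
    then show ?thesis using False nm0[of "B v"] by simp
  qed
  have bound: "nm ((B ^^ T) (w p)) \<le> \<rho> ^ T * s" if p: "p < m" for p
  proof -
    let ?v = "\<lambda>k. (B ^^ k) (w p)"
    have vU: "?v k \<in> U" for k using powU wU p by blast
    have last: "nm (?v (Suc T)) \<le> \<rho> * nm (?v T)"
    proof -
      let ?N = "dot m (?v T) (?v T)"
      have "Q (?v T) \<ge> a * ?N" using bad[OF p] Q0[of "?v T"] by auto
      have "(nm (?v (Suc T)))\<^sup>2 \<le> s\<^sup>2 * (c\<^sup>2 * ?N - c * Q (?v T))"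
        using Bsq[OF vU[of T]] by (simp add: nmsq)
      also have "\<dots> \<le> s\<^sup>2 * (c\<^sup>2 * ?N - c * (a * ?N))"
        using \<open>Q (?v T) \<ge> a * ?N\<close> cpos by (intro mult_left_mono diff_left_mono) auto
      also have "\<dots> = s\<^sup>2 * ((c\<^sup>2 - c * a) * ?N)" by (simp add: algebra_simps)
      also have "\<dots> \<le> s\<^sup>2 * ((c - a / 2)\<^sup>2 * ?N)"
        by (intro mult_left_mono mult_right_mono) (auto simp: power2_eq_square algebra_simps)
      also have "\<dots> = (\<rho> * nm (?v T))\<^sup>2" by (simp add: \<rho>_def power_mult_distrib nmsq)
      finally show ?thesis using \<rho>0 nm0 by (simp add: power2_le_iff_abs_le abs_of_nonneg)
    qed
    have desc: "k \<le> T \<Longrightarrow> nm (?v (Suc (T - k))) \<le> \<rho> * nm (?v (T - k))" for k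
    proof (induction k)
      case 0
      show ?case using last by simp
    next
      case (Suc k)
      then have "T - k = Suc (T - Suc k)" by simp
      then have "nm (B (B (?v (T - Suc k)))) \<le> \<rho> * nm (B (?v (T - Suc k)))"
        using Suc by simp
      from step[OF vU this] show ?case by simp
    qed
    have "k \<le> T \<Longrightarrow> nm (?v k) \<le> \<rho> ^ k * s" for k
    proof (induction k)
      case 0
      show ?case using w1[OF p] pos unfolding nm_def by (simp add: real_le_lsqrt)
    next
      case (Suc k)
      have "nm (?v (Suc k)) \<le> \<rho> * nm (?v k)" using desc[of "T - k"] Suc.prems by simp
      also have "\<dots> \<le> \<rho> * (\<rho> ^ k * s)" using Suc \<rho>0 by (intro mult_left_mono) auto
      finally show ?case by (simp add: mult_ac)
    qed
    then show ?thesis by simp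
  qed
  let ?u = "\<lambda>k. (B ^^ k) u"
  have uU: "?u k \<in> U" for k using powU u by blast
  define \<mu> where "\<mu> = s * (c - a / 4)"
  have \<mu>0: "0 < \<mu>" using pos by (simp add: \<mu>_def)
  \<comment> \<open>The same inequality read forwards; the first factor is bounded below through
    \<open>dot m u (B u)\<close>, where \<open>Q u \<le> a / 4\<close> enters.\<close>
  have grow: "\<mu> * nm (?u k) \<le> nm (?u (Suc k)) \<and> 0 < nm (?u k)" for k
  proof (induction k)
    case 0
    have "\<mu> \<le> dot m u (B u)" using Bq[OF u(1)] u pos by (simp add: \<mu>_def)
    also have "\<dots> \<le> nm u * nm (B u)" using dot_abs_le[of m u "B u"] by (simp add: nm_def)
    finally show ?case using u by (simp add: nm_def)
  next
    case (Suc k)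
    let ?x = "nm (?u k)" let ?y = "nm (?u (Suc k))" let ?z = "nm (?u (Suc (Suc k)))"
    have y: "0 < ?y" using Suc \<mu>0 by (metis less_le_trans mult_pos_pos)
    have "?y\<^sup>2 = dot m (?u k) (?u (Suc (Suc k)))"
      using sym[OF uU[of k] uU[of "Suc k"]] by (simp add: nmsq)
    also have "\<dots> \<le> ?x * ?z" using dot_abs_le[of m "?u k" "?u (Suc (Suc k))"] by (simp add: nm_def)
    finally have 1: "?y * ?y \<le> ?x * ?z" by (simp add: power2_eq_square)
    have "?x * (\<mu> * ?y) \<le> ?y * ?y" using Suc y by (simp add: mult_ac)
    also note 1
    finally have "\<mu> * ?y \<le> ?z" using Suc by simp
    then show ?case using y by simp
  qed
  have low: "\<mu> ^ k \<le> nm (?u k)" for k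
  proof (induction k)
    case 0
    show ?case using u by (simp add: nm_def)
  next
    case (Suc k)
    have "\<mu> ^ Suc k \<le> \<mu> * nm (?u k)" using Suc \<mu>0 by simp
    also have "\<dots> \<le> nm (?u (Suc k))" using grow by blast
    finally show ?case .
  qed
  let ?y = "?u T"
  have up: "\<bar>u p\<bar> \<le> 1" if "p < m" for p
  proof -
    have "u p * u p \<le> dot m u u" unfolding dot_def using that
      by (intro member_le_sum[of p "{..<m}" "\<lambda>p. u p * u p"]) auto
    then show ?thesis using u(2) by (metis abs_square_le_1 power2_eq_square)
  qed
  \<comment> \<open>Moving powers of \<open>B\<close> across the inner product writes this through
    the coordinates of a vector of \<open>U\<close>, and \<open>w p\<close> reads off coordinate
    \<open>p\<close> up to the factor \<open>s\<close>. So only the orbits of the \<open>m\<close>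
    starts occur, each with a coefficient \<open>u p\<close> of absolute value at most 1.\<close>
  have "s * (nm ?y)\<^sup>2 = s * dot m u ((B ^^ T) ?y)"
    using sympow[OF u(1) uU[of T], of T] by (simp add: nmsq)
  also have "\<dots> = (\<Sum>p<m. u p * (s * (B ^^ T) ?y p))"
    unfolding dot_def by (simp add: sum_distrib_left mult_ac)
  also have "\<dots> = (\<Sum>p<m. u p * dot m ((B ^^ T) (w p)) ?y)"
    using w[OF _ powU[OF uU[of T]], of _ T] sympow[OF wU uU[of T], of _ T] by simp
  also have "\<dots> \<le> (\<Sum>p<m. (\<rho> ^ T * s) * nm ?y)"
  proof (rule sum_mono)
    fix p assume p: "p \<in> {..<m}"
    let ?d = "dot m ((B ^^ T) (w p)) ?y"
    have "u p * ?d \<le> \<bar>u p\<bar> * \<bar>?d\<bar>" by (simp add: abs_mult[symmetric])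
    also have "\<dots> \<le> 1 * (nm ((B ^^ T) (w p)) * nm ?y)"
      using up p dot_abs_le[of m "(B ^^ T) (w p)" ?y] by (intro mult_mono) (auto simp: nm_def)
    also have "\<dots> \<le> (\<rho> ^ T * s) * nm ?y" using bound p nm0 by (simp add: mult_right_mono)
    finally show "u p * ?d \<le> (\<rho> ^ T * s) * nm ?y" .
  qed
  finally have "s * (nm ?y * nm ?y) \<le> s * (real m * \<rho> ^ T * nm ?y)" by (simp add: power2_eq_square mult_ac)
  then have "nm ?y * nm ?y \<le> real m * \<rho> ^ T * nm ?y" using pos by simp
  then have "nm ?y \<le> real m * \<rho> ^ T" using grow[of T] by (meson mult_le_cancel_right_pos)
  with low[of T] have le: "\<mu> ^ T \<le> real m * \<rho> ^ T" by linarith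
  \<comment> \<open>The gap between the two growth factors. By Bernoulli its \<open>T\<close>-th
    power exceeds the factor \<open>m\<close> lost by summing over the starts.\<close>
  have "1 + a / (4 * c) \<le> \<mu> / \<rho>"
  proof -
    have "a / (4 * c) * \<rho> \<le> s * a / 4" using pos cpos by (simp add: \<rho>_def field_simps)
    then have "(1 + a / (4 * c)) * \<rho> \<le> \<mu>" by (simp add: \<rho>_def \<mu>_def algebra_simps)
    then show ?thesis using \<rho>0 by (simp add: pos_le_divide_eq)
  qed
  then have "(1 + a / (4 * c)) ^ T \<le> (\<mu> / \<rho>) ^ T" using pos cpos by (intro power_mono) auto
  also have "\<dots> \<le> real m" using le \<rho>0 by (simp add: power_divide pos_divide_le_eq)
  finally have "(1 + a / (4 * c)) ^ T \<le> real m" .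
  moreover have "1 + real T * (a / (4 * c)) \<le> (1 + a / (4 * c)) ^ T"
    using pos cpos by (intro Bernoulli_inequality) (simp add: order_trans[of _ 0])
  moreover have "real m \<le> real T * (a / (4 * c))"
    using T pos cpos by (simp add: field_simps)
  ultimately show False by linarith
qed

section \<open>The walk\<close>

text \<open>In the program \<open>G\<close> is a common denominator that makes the vectors \<open>b i\<close> integral. At the end of the
  walk, the error of constraint \<open>i\<close> is at most \<open>G\<close> if \<open>i\<close> is hard and at most \<open>3 * G\<close> otherwise.\<close>

locale walk =
  fixes m N :: nat and b :: "nat \<Rightarrow> nat \<Rightarrow> real" and G :: real and hard :: "nat \<Rightarrow> bool"
    and \<beta> x :: "nat \<Rightarrow> real"
  assumes G: "0 < G" and m: "64 \<le> m"
    and soft: "(\<Sum>i | i < N \<and> \<not> hard i. dot m (b i) (b i)) \<le> G\<^sup>2 * real m / 512"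
    and hard: "real (card {i. i < N \<and> hard i}) \<le> real m / 32 + 2"
    and x: "\<And>p. p < m \<Longrightarrow> 0 \<le> x p \<and> x p \<le> 1"
begin

definition "disp y = (\<lambda>p. y p - x p :: real)"
definition "potential y = dot m (disp y) (disp y) / 8 -
  (\<Sum>i | i < N \<and> \<not> hard i. (dot m (b i) (disp y))\<^sup>2) / G\<^sup>2"
text \<open>Half the derivative of \<open>potential\<close> at \<open>y\<close> along
  \<open>v\<close>.\<close>

definition "slope y v = dot m (disp y) v / 8 -
  (\<Sum>i | i < N \<and> \<not> hard i. dot m (b i) (disp y) * dot m (b i) v) / G\<^sup>2"
definition "active y i \<longleftrightarrow> hard i \<or> G \<le> \<bar>dot m (b i) (disp y)\<bar>"

text \<open>The weight \<open>16 * m\<^sup>4\<close> makes every step along a good direction move an active constraint by at most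
  \<open>G / (16 * m\<^sup>2)\<close>.\<close>

definition "stiff y i = (if active y i then 16 * real m ^ 4 else 1)"
definition "qform y v = (\<Sum>i<N. stiff y i * (dot m (b i) v)\<^sup>2)"
definition "alive y p \<longleftrightarrow> 0 < y p \<and> y p < (1::real)"
definition "frozen y = card {p. p < m \<and> \<not> alive y p}"
definition "admdir y v \<longleftrightarrow> (\<forall>p<m. \<not> alive y p \<longrightarrow> v p = 0) \<and> (\<Sum>p<m. v p) = 0 \<and> dot m \<beta> v = 0"
definition "gooddir y v \<longleftrightarrow> admdir y v \<and> 0 < dot m v v \<and> 16 * qform y v \<le> G\<^sup>2 * dot m v v"
text \<open>The state after \<open>k\<close> steps. A soft constraint has error below
  \<open>G\<close> while inactive, moves by at most \<open>G\<close> in the step that activates it,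
  and then drifts by at most \<open>G / (16 * m\<^sup>2)\<close> per step; a hard one only drifts.
  The last conjunct is the progress measure: a step freezes a coordinate or raises
  \<open>16 * m * potential\<close> by 1, until half of the coordinates are frozen.\<close>

definition "winv k y \<longleftrightarrow> (\<forall>p<m. 0 \<le> y p \<and> y p \<le> 1) \<and> (\<Sum>p<m. disp y p) = 0 \<and> dot m \<beta> (disp y) = 0 \<and>
  0 \<le> potential y \<and>
  (\<forall>i<N. \<bar>dot m (b i) (disp y)\<bar> \<le> G * ((if hard i then 0 else 2) + real k / (16 * (real m)\<^sup>2))) \<and>
  (m \<le> 2 * frozen y \<or> real k \<le> real (frozen y) + 16 * real m * potential y)"

lemma frozen_le: "frozen y \<le> m"
  unfolding frozen_def using card_mono[of "{..<m}" "{p. p < m \<and> \<not> alive y p}"] by auto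

lemma disp_norm: "(\<And>p. p < m \<Longrightarrow> 0 \<le> y p \<and> y p \<le> 1) \<Longrightarrow> dot m (disp y) (disp y) \<le> real m"
proof -
  assume y: "\<And>p. p < m \<Longrightarrow> 0 \<le> y p \<and> y p \<le> 1"
  have "disp y p * disp y p \<le> 1" if "p < m" for p
  proof -
    have "\<bar>disp y p\<bar> \<le> 1" using y[OF that] x[OF that] by (auto simp: disp_def)
    then show ?thesis by (metis abs_square_le_1 power2_eq_square)
  qed
  then have "dot m (disp y) (disp y) \<le> (\<Sum>p<m. 1)" unfolding dot_def by (intro sum_mono) auto
  then show ?thesis by simp
qed

lemma potential_le: "(\<And>p. p < m \<Longrightarrow> 0 \<le> y p \<and> y p \<le> 1) \<Longrightarrow> potential y \<le> real m / 8"
proof -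
  assume "\<And>p. p < m \<Longrightarrow> 0 \<le> y p \<and> y p \<le> 1"
  from disp_norm[OF this] have "dot m (disp y) (disp y) \<le> real m" .
  moreover have "0 \<le> (\<Sum>i | i < N \<and> \<not> hard i. (dot m (b i) (disp y))\<^sup>2) / G\<^sup>2"
    by (intro divide_nonneg_nonneg sum_nonneg) auto
  ultimately show ?thesis unfolding potential_def by linarith
qed

lemma winv_start: "winv 0 x"
  using x G by (auto simp: winv_def disp_def dot_def potential_def)

lemma winv_stay: "winv k y \<Longrightarrow> m \<le> 2 * frozen y \<Longrightarrow> winv (Suc k) y"
proof -
  assume a: "winv k y" "m \<le> 2 * frozen y"
  have "G * ((if hard i then 0 else 2) + real k / (16 * (real m)\<^sup>2)) \<le>
      G * ((if hard i then 0 else 2) + real (Suc k) / (16 * (real m)\<^sup>2))" for i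
    using G by (intro mult_left_mono add_left_mono divide_right_mono) auto
  with a show ?thesis unfolding winv_def by (meson order_trans)
qed

section \<open>Existence of a good direction\<close>

text \<open>Every active soft constraint contributes at least \<open>G\<^sup>2\<close> to the sum of
  squares in \<open>potential\<close>. Nonnegativity of the potential caps this sum by
  \<open>G\<^sup>2\<close> times an eighth of the squared displacement, which is at most
  \<open>m\<close>.\<close>

lemma card_active:
  assumes "winv k y"
  shows "real (card {i. i < N \<and> \<not> hard i \<and> active y i}) \<le> real m / 8"
proof -
  let ?S = "{i. i < N \<and> \<not> hard i \<and> active y i}"
  have fS: "finite ?S" by simp
  have "real (card ?S) * G\<^sup>2 = (\<Sum>i\<in>?S. G\<^sup>2)" by simp
  also have "\<dots> \<le> (\<Sum>i\<in>?S. (dot m (b i) (disp y))\<^sup>2)"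
    using G by (intro sum_mono) (auto simp: active_def abs_le_square_iff[symmetric])
  also have "\<dots> \<le> (\<Sum>i | i < N \<and> \<not> hard i. (dot m (b i) (disp y))\<^sup>2)"
    by (intro sum_mono2) auto
  also have "\<dots> \<le> dot m (disp y) (disp y) / 8 * G\<^sup>2"
    using assms G unfolding winv_def potential_def by (simp add: field_simps)
  also have "\<dots> \<le> real m / 8 * G\<^sup>2"
    using disp_norm[of y] assms unfolding winv_def by (intro mult_right_mono) auto
  finally show ?thesis using G by simp
qed

text \<open>Active constraints are imposed here exactly, as equations, so their large weights meet
  zeros in the form; the weights are there for the approximate directions produced by power
  iteration. What remains is the averaging argument over at least \<open>m / 8\<close>
  dimensions.\<close>

lemma direction_exists:
  assumes inv: "winv k y" and unf: "2 * frozen y < m"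
  shows "\<exists>u. admdir y u \<and> dot m u u = 1 \<and> qform y u \<le> G\<^sup>2 / 64"
proof -
  define I where "I = {p. p < m \<and> alive y p}"
  define Jt where "Jt = {i. i < N \<and> active y i}"
  have cI: "real (card I) > real m / 2"
  proof -
    have "card {..<m} = card I + frozen y"
    proof -
      have "{..<m} = I \<union> {p. p < m \<and> \<not> alive y p}" by (auto simp: I_def)
      moreover have "card (I \<union> {p. p < m \<and> \<not> alive y p}) = card I + frozen y"
        unfolding frozen_def I_def by (intro card_Un_disjoint) auto
      ultimately show ?thesis by simp
    qed
    with unf show ?thesis by simp
  qed
  define J where "J = {True, False} <+> Jt"
  \<comment> \<open>\<open>Inl True\<close> is the preservation of the coordinate sum,
    \<open>Inl False\<close> that of the inner product with \<open>\<beta>\<close>.\<close>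
  define c where "c s = (case s of Inl t \<Rightarrow> (if t then (\<lambda>_. 1) else \<beta>) | Inr i \<Rightarrow> b i)" for s :: "bool + nat"
  have "Jt = {i. i < N \<and> hard i} \<union> {i. i < N \<and> \<not> hard i \<and> active y i}"
    by (auto simp: Jt_def active_def)
  then have "card Jt \<le> card {i. i < N \<and> hard i} + card {i. i < N \<and> \<not> hard i \<and> active y i}"
    using card_Un_le by metis
  then have cJt: "real (card Jt) \<le> real m / 32 + 2 + real m / 8"
    using hard card_active[OF inv] by linarith
  have fJ: "finite J" "finite Jt" by (auto simp: J_def Jt_def)
  have cJ: "card J = 2 + card Jt" unfolding J_def using fJ by (simp add: card_Plus)
  define d where "d = card I - card J"
  have d: "real m / 8 \<le> real d" "card J + d \<le> card I"
  proof -
    have "real (card J) + real m / 8 \<le> real (card I)" using cI cJt cJ m by simp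
    then show "real m / 8 \<le> real d" "card J + d \<le> card I" unfolding d_def by linarith+
  qed
  have "0 < d" using d(1) m by (cases "d = 0") auto
  let ?S = "{i. i < N \<and> \<not> active y i}"
  have "(\<Sum>i\<in>?S. dot m (b i) (b i)) \<le> (\<Sum>i | i < N \<and> \<not> hard i. dot m (b i) (b i))"
    by (intro sum_mono2) (auto simp: active_def)
  also note soft
  finally have tr: "(\<Sum>i\<in>?S. dot m (b i) (b i)) \<le> G\<^sup>2 * real m / 512" .
  obtain u where u: "\<forall>p. p \<notin> I \<longrightarrow> u p = 0" "\<forall>j\<in>J. dot m (c j) u = 0" "dot m u u = 1"
      "(\<Sum>i\<in>?S. (dot m (b i) u)\<^sup>2) \<le> G\<^sup>2 * real m / 512 / real d"
    using small_quadratic_form_direction[OF fJ(1) _ d(2) \<open>0 < d\<close> _ tr, of c] by (auto simp: I_def)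
  have "qform y u = (\<Sum>i\<in>?S. (dot m (b i) u)\<^sup>2)"
  proof -
    have "qform y u = (\<Sum>i\<in>?S. stiff y i * (dot m (b i) u)\<^sup>2)"
      unfolding qform_def
    proof (rule sum.mono_neutral_right)
      show "\<forall>i\<in>{..<N} - ?S. stiff y i * (dot m (b i) u)\<^sup>2 = 0"
      proof
        fix i assume "i \<in> {..<N} - ?S"
        then have "Inr i \<in> J" by (auto simp: J_def Jt_def)
        then have "dot m (c (Inr i)) u = 0" using u(2) by blast
        then show "stiff y i * (dot m (b i) u)\<^sup>2 = 0" by (simp add: c_def)
      qed
    qed auto
    also have "\<dots> = (\<Sum>i\<in>?S. (dot m (b i) u)\<^sup>2)"
      by (intro sum.cong) (auto simp: stiff_def)
    finally show ?thesis .
  qed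
  also have "\<dots> \<le> G\<^sup>2 / 64"
  proof -
    have "G\<^sup>2 * real m / 512 / real d \<le> G\<^sup>2 * real m / 512 / (real m / 8)"
      using d(1) m G by (intro divide_left_mono) auto
    also have "\<dots> = G\<^sup>2 / 64" using m by simp
    finally show ?thesis using u(4) by linarith
  qed
  finally have q: "qform y u \<le> G\<^sup>2 / 64" .
  have "Inl True \<in> J" "Inl False \<in> J" by (auto simp: J_def)
  then have "dot m (c (Inl True)) u = 0" "dot m (c (Inl False)) u = 0" using u(2) by blast+
  then have "(\<Sum>p<m. u p) = 0" "dot m \<beta> u = 0" by (auto simp: c_def dot_def)
  then show ?thesis using u q by (intro exI[of _ u]) (auto simp: admdir_def I_def)
qed

section \<open>The effect of one step\<close>

text \<open>\<open>\<theta>\<close> is limited by the box and by the bound 1 on the sum norm of the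
  move, and \<open>hit\<close> says that one of the limits is attained. At the box a coordinate
  freezes. At the sum norm limit the squared length of the move is at least \<open>1 / m\<close>,
  and the potential rises by at least \<open>1 / (16 * m)\<close>.\<close>

lemma winv_step:
  assumes inv: "winv k y" and v: "gooddir y v" and sl: "0 \<le> slope y v"
    and \<theta>: "0 \<le> \<theta>" "\<theta> * (\<Sum>p<m. \<bar>v p\<bar>) \<le> 1"
    and room: "\<And>p. p < m \<Longrightarrow> \<theta> * \<bar>v p\<bar> \<le> (if 0 < v p then 1 - y p else y p)"
    and hit: "\<theta> * (\<Sum>p<m. \<bar>v p\<bar>) = 1 \<or>
      (\<exists>p<m. v p \<noteq> 0 \<and> \<theta> * \<bar>v p\<bar> = (if 0 < v p then 1 - y p else y p))"
    and y': "\<And>p. p < m \<Longrightarrow> y' p = y p + \<theta> * v p"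
  shows "winv (Suc k) y'"
proof -
  have dd: "disp y' p = disp y p + \<theta> * v p" if "p < m" for p using y'[OF that] by (simp add: disp_def)
  have ddot: "dot m w (disp y') = dot m w (disp y) + \<theta> * dot m w v" for w
  proof -
    have "dot m w (disp y') = dot m w (\<lambda>p. disp y p + \<theta> * v p)" using dd by (intro dot_cong) auto
    then show ?thesis by (simp only: dot_simps)
  qed
  have dsq: "dot m (disp y') (disp y') = dot m (disp y) (disp y) + 2 * \<theta> * dot m (disp y) v + \<theta>\<^sup>2 * dot m v v"
    by (simp only: ddot dot_commute[of m "disp y'" "disp y"] dot_commute[of m "disp y'" v])
       (simp add: ddot dot_commute[of m v "disp y"] algebra_simps power2_eq_square)
  have box: "0 \<le> y' p \<and> y' p \<le> 1" if p: "p < m" for p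
  proof -
    have "0 \<le> y p \<and> y p \<le> 1" using inv p by (auto simp: winv_def)
    moreover have "0 \<le> \<theta> * v p" if "0 < v p" using that \<theta> by simp
    moreover have "\<theta> * v p \<le> 0" if "\<not> 0 < v p" using that \<theta> by (simp add: mult_nonneg_nonpos)
    ultimately show ?thesis using room[OF p] y'[OF p] by (auto split: if_splits)
  qed
  have sum0: "(\<Sum>p<m. disp y' p) = 0"
    using inv v by (simp add: dd sum.distrib winv_def gooddir_def admdir_def flip: sum_distrib_left)
  have beta0: "dot m \<beta> (disp y') = 0" using inv v by (simp add: ddot winv_def gooddir_def admdir_def)
  have vv: "0 < dot m v v" and qf: "16 * qform y v \<le> G\<^sup>2 * dot m v v" using v by (auto simp: gooddir_def)
  let ?W = "\<Sum>p<m. \<bar>v p\<bar>"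
  have vvW: "dot m v v \<le> ?W\<^sup>2"
  proof -
    have "dot m v v = (\<Sum>p<m. \<bar>v p\<bar> * \<bar>v p\<bar>)" unfolding dot_def by simp
    also have "\<dots> \<le> (\<Sum>p<m. \<bar>v p\<bar> * ?W)"
      by (intro sum_mono mult_left_mono member_le_sum) auto
    also have "\<dots> = ?W\<^sup>2" by (simp add: power2_eq_square sum_distrib_right)
    finally show ?thesis .
  qed
  have tvv: "\<theta>\<^sup>2 * dot m v v \<le> 1"
  proof -
    have "\<theta>\<^sup>2 * dot m v v \<le> (\<theta> * ?W)\<^sup>2" using vvW by (simp add: power_mult_distrib mult_left_mono)
    also have "\<dots> \<le> 1" using \<theta> by (simp add: power_le_one sum_nonneg)
    finally show ?thesis .
  qed
  \<comment> \<open>The move has squared length at most 1, so a weighted square changes by at most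
    \<open>G\<^sup>2 / 16\<close>: an active constraint moves by at most
    \<open>G / (16 * m\<^sup>2)\<close>, an inactive one by at most \<open>G\<close>.\<close>
  have each: "stiff y i * (\<theta> * dot m (b i) v)\<^sup>2 \<le> G\<^sup>2 / 16" if "i < N" for i
  proof -
    have s0: "0 \<le> stiff y i" for i by (simp add: stiff_def)
    have "stiff y i * (dot m (b i) v)\<^sup>2 \<le> qform y v"
      unfolding qform_def using that s0
      by (intro member_le_sum[of i "{..<N}" "\<lambda>i. stiff y i * (dot m (b i) v)\<^sup>2"]) auto
    then have "\<theta>\<^sup>2 * (stiff y i * (dot m (b i) v)\<^sup>2) \<le> \<theta>\<^sup>2 * (G\<^sup>2 * dot m v v / 16)"
      using qf by (intro mult_left_mono) auto
    also have "\<dots> = G\<^sup>2 / 16 * (\<theta>\<^sup>2 * dot m v v)" by simp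
    also have "\<dots> \<le> G\<^sup>2 / 16 * 1" using tvv by (intro mult_left_mono) auto
    finally show ?thesis by (simp add: power_mult_distrib mult_ac)
  qed
  have disc: "\<bar>dot m (b i) (disp y')\<bar> \<le> G * ((if hard i then 0 else 2) + real (Suc k) / (16 * (real m)\<^sup>2))"
    if i: "i < N" for i
  proof -
    have old: "\<bar>dot m (b i) (disp y)\<bar> \<le> G * ((if hard i then 0 else 2) + real k / (16 * (real m)\<^sup>2))"
      using inv i by (auto simp: winv_def)
    show ?thesis
    proof (cases "active y i")
      case True
      have "16 * real m ^ 4 * (\<theta> * dot m (b i) v)\<^sup>2 \<le> G\<^sup>2 / 16"
        using each[OF i] True by (simp add: stiff_def)
      then have "(\<theta> * dot m (b i) v)\<^sup>2 \<le> (G / (16 * (real m)\<^sup>2))\<^sup>2"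
        using m by (simp add: power_divide power_mult_distrib field_simps)
      then have "\<bar>\<theta> * dot m (b i) v\<bar> \<le> G / (16 * (real m)\<^sup>2)"
        using G by (simp add: abs_le_square_iff[symmetric])
      then have "\<bar>dot m (b i) (disp y')\<bar> \<le>
          G * ((if hard i then 0 else 2) + real k / (16 * (real m)\<^sup>2)) + G / (16 * (real m)\<^sup>2)"
        using old unfolding ddot by linarith
      also have "\<dots> = G * ((if hard i then 0 else 2) + real (Suc k) / (16 * (real m)\<^sup>2))"
        by (simp add: algebra_simps add_divide_distrib)
      finally show ?thesis .
    next
      case False
      then have nh: "\<not> hard i" "\<bar>dot m (b i) (disp y)\<bar> < G" by (auto simp: active_def)
      have "(\<theta> * dot m (b i) v)\<^sup>2 \<le> G\<^sup>2" using each[OF i] False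
        by (simp add: stiff_def) (smt (verit) zero_le_power2)
      then have "\<bar>\<theta> * dot m (b i) v\<bar> \<le> G" using G by (simp add: abs_le_square_iff[symmetric])
      then have "\<bar>dot m (b i) (disp y')\<bar> \<le> G * 2" using nh unfolding ddot by linarith
      also have "\<dots> \<le> G * ((if hard i then 0 else 2) + real (Suc k) / (16 * (real m)\<^sup>2))"
        using G nh by (intro mult_left_mono) auto
      finally show ?thesis .
    qed
  qed
  let ?Sf = "{i. i < N \<and> \<not> hard i}"
  \<comment> \<open>Along \<open>v\<close> the potential is quadratic in \<open>\<theta>\<close>
    with linear coefficient \<open>2 * slope y v\<close>; the soft sum takes at most half of the
    \<open>1 / 8\<close> in the quadratic coefficient.\<close>
  have pot: "potential y' \<ge> potential y + \<theta>\<^sup>2 * dot m v v / 16"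
  proof -
    have 1: "(\<Sum>i\<in>?Sf. (dot m (b i) (disp y'))\<^sup>2) = (\<Sum>i\<in>?Sf. (dot m (b i) (disp y))\<^sup>2) +
        2 * \<theta> * (\<Sum>i\<in>?Sf. dot m (b i) (disp y) * dot m (b i) v) + \<theta>\<^sup>2 * (\<Sum>i\<in>?Sf. (dot m (b i) v)\<^sup>2)"
      unfolding ddot by (simp add: power2_sum sum.distrib sum_distrib_left power_mult_distrib algebra_simps)
    have "(\<Sum>i\<in>?Sf. (dot m (b i) v)\<^sup>2) \<le> (\<Sum>i\<in>?Sf. stiff y i * (dot m (b i) v)\<^sup>2)"
    proof (rule sum_mono)
      fix i
      have "1 * 1 \<le> (16::real) * real m ^ 4" using m by (intro mult_mono one_le_power) auto
      then have "1 \<le> stiff y i" by (simp add: stiff_def)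
      then show "(dot m (b i) v)\<^sup>2 \<le> stiff y i * (dot m (b i) v)\<^sup>2"
        using mult_right_mono[of 1 "stiff y i" "(dot m (b i) v)\<^sup>2"] by simp
    qed
    also have "\<dots> \<le> qform y v" unfolding qform_def
      by (intro sum_mono2) (auto simp: stiff_def)
    finally have 2: "(\<Sum>i\<in>?Sf. (dot m (b i) v)\<^sup>2) / G\<^sup>2 \<le> dot m v v / 16"
      using qf G by (simp add: field_simps)
    have "potential y' = potential y + 2 * \<theta> * slope y v +
        \<theta>\<^sup>2 * (dot m v v / 8 - (\<Sum>i\<in>?Sf. (dot m (b i) v)\<^sup>2) / G\<^sup>2)"
    proof -
      have gen: "(A + 2 * \<theta> * B + \<theta>\<^sup>2 * C) / 8 - (P + 2 * \<theta> * R + \<theta>\<^sup>2 * S) / g =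
          (A / 8 - P / g) + 2 * \<theta> * (B / 8 - R / g) + \<theta>\<^sup>2 * (C / 8 - S / g)" for A B C P R S g
        by (simp add: add_divide_distrib algebra_simps)
      show ?thesis unfolding potential_def slope_def 1 dsq by (rule gen)
    qed
    moreover have "\<theta>\<^sup>2 * (dot m v v / 16) \<le> \<theta>\<^sup>2 * (dot m v v / 8 - (\<Sum>i\<in>?Sf. (dot m (b i) v)\<^sup>2) / G\<^sup>2)"
      using 2 by (intro mult_left_mono) auto
    moreover have "0 \<le> 2 * \<theta> * slope y v" using \<theta> sl by simp
    ultimately show ?thesis by simp
  qed
  have pot1: "potential y \<le> potential y'" using pot vv by (smt (verit) divide_nonneg_nonneg mult_nonneg_nonneg zero_le_power2)
  \<comment> \<open>\<open>v\<close> vanishes on coordinates that have stopped, so frozen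
    coordinates are never released.\<close>
  have dead: "\<not> alive y' p" if "p < m" "\<not> alive y p" for p
    using that v y'[OF that(1)] by (auto simp: gooddir_def admdir_def alive_def)
  have sub: "{p. p < m \<and> \<not> alive y p} \<subseteq> {p. p < m \<and> \<not> alive y' p}" using dead by auto
  have frz: "frozen y \<le> frozen y'"
    unfolding frozen_def using sub by (intro card_mono) auto
  have prog: "m \<le> 2 * frozen y' \<or> real (Suc k) \<le> real (frozen y') + 16 * real m * potential y'"
  proof (cases "m \<le> 2 * frozen y")
    case True
    then show ?thesis using frz by linarith
  next
    case False
    then have k: "real k \<le> real (frozen y) + 16 * real m * potential y" using inv by (auto simp: winv_def)
    from hit show ?thesis
    proof
      assume full: "\<theta> * ?W = 1"
      have "?W\<^sup>2 \<le> real m * dot m v v"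
        using Cauchy_Schwarz_ineq_sum[of "\<lambda>_. 1" "\<lambda>p. \<bar>v p\<bar>" "{..<m}"]
        by (simp add: dot_def power2_eq_square)
      then have "(\<theta> * ?W)\<^sup>2 \<le> \<theta>\<^sup>2 * (real m * dot m v v)"
        by (simp add: power_mult_distrib mult_left_mono)
      then have "1 \<le> real m * (\<theta>\<^sup>2 * dot m v v)" using full by (simp add: mult_ac)
      moreover have "16 * real m * (potential y + \<theta>\<^sup>2 * dot m v v / 16) \<le> 16 * real m * potential y'"
        using pot by (intro mult_left_mono) auto
      ultimately have "16 * real m * potential y + 1 \<le> 16 * real m * potential y'"
        by (simp add: algebra_simps)
      then show ?thesis using k frz by linarith
    next
      assume "\<exists>p<m. v p \<noteq> 0 \<and> \<theta> * \<bar>v p\<bar> = (if 0 < v p then 1 - y p else y p)"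
      then obtain p where p: "p < m" "v p \<noteq> 0" "\<theta> * \<bar>v p\<bar> = (if 0 < v p then 1 - y p else y p)" by auto
      have "y' p = 1 \<or> y' p = 0" using p y'[OF p(1)] by (auto simp: abs_if split: if_splits)
      then have "\<not> alive y' p" by (auto simp: alive_def)
      moreover have "alive y p" using p v by (auto simp: gooddir_def admdir_def)
      ultimately have "{p. p < m \<and> \<not> alive y p} \<subset> {p. p < m \<and> \<not> alive y' p}" using sub p(1) by auto
      then have "frozen y < frozen y'" unfolding frozen_def by (intro psubset_card_mono) auto
      moreover have "16 * real m * potential y \<le> 16 * real m * potential y'"
        using pot1 by (intro mult_left_mono) auto
      ultimately show ?thesis using k by linarith
    qed
  qed
  show ?thesis
    unfolding winv_def using box sum0 beta0 pot1 disc prog inv by (auto simp: winv_def)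
qed

text \<open>The walk over the reals, with the minimum of finitely many limits as step length. It
  serves arbitrary real data, where only the existence of a rounding is claimed.\<close>

lemma step_exists:
  assumes inv: "winv k y"
  shows "\<exists>y'. winv (Suc k) y'"
proof (cases "m \<le> 2 * frozen y")
  case True
  then show ?thesis using winv_stay[OF inv] by blast
next
  case False
  obtain u where u: "admdir y u" "dot m u u = 1" "qform y u \<le> G\<^sup>2 / 64"
    using direction_exists[OF inv] False by auto
  \<comment> \<open>One of \<open>u\<close> and its negative has nonnegative slope; the other
    requirements are invariant under the change of sign.\<close>
  define v where "v = (if 0 \<le> slope y u then u else (\<lambda>p. - 1 * u p))"
  have sl: "0 \<le> slope y v"
  proof (cases "0 \<le> slope y u")
    case False
    have "slope y (\<lambda>p. - 1 * u p) = - slope y u"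
      unfolding slope_def by (simp only: dot_scale_right) (simp add: sum_negf)
    then show ?thesis using False by (simp add: v_def)
  qed (simp add: v_def)
  have "16 * qform y u \<le> G\<^sup>2" using u(3) zero_le_power2[of G] by linarith
  then have good: "gooddir y u" using u by (auto simp: gooddir_def)
  have gv: "gooddir y v"
  proof -
    have "gooddir y (\<lambda>p. - 1 * u p)" using good
      unfolding gooddir_def admdir_def qform_def
      by (simp only: dot_scale_right dot_scale_left) (simp add: sum_negf)
    then show ?thesis using good by (simp add: v_def)
  qed
  let ?W = "\<Sum>p<m. \<bar>v p\<bar>"
  let ?room = "\<lambda>p. if 0 < v p then 1 - y p else y p"
  define S where "S = insert (1 / ?W) ((\<lambda>p. ?room p / \<bar>v p\<bar>) ` {p. p < m \<and> v p \<noteq> 0})"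
  have fS: "finite S" "S \<noteq> {}" by (auto simp: S_def)
  have "\<exists>p<m. v p \<noteq> 0"
  proof (rule ccontr)
    assume "\<not> ?thesis"
    then have "dot m v v = 0" by (simp add: dot_def)
    then show False using gv by (simp add: gooddir_def)
  qed
  then have Wpos: "0 < ?W" by (auto intro!: sum_pos2)
  define \<theta> where "\<theta> = Min S"
  have in_S: "\<theta> \<in> S" and le_S: "\<And>s. s \<in> S \<Longrightarrow> \<theta> \<le> s" using fS by (auto simp: \<theta>_def)
  have ybox: "0 \<le> y p \<and> y p \<le> 1" if "p < m" for p using inv that by (auto simp: winv_def)
  have S0: "0 \<le> s" if "s \<in> S" for s
    using that ybox Wpos unfolding S_def by auto
  have "winv (Suc k) (\<lambda>p. y p + \<theta> * v p)"
  proof (rule winv_step[OF inv gv sl])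
    show "0 \<le> \<theta>" using S0 in_S by blast
    have "\<theta> \<le> 1 / ?W" using le_S by (simp add: S_def)
    then show "\<theta> * ?W \<le> 1" using Wpos by (simp add: field_simps)
    show "\<theta> * \<bar>v p\<bar> \<le> ?room p" if p: "p < m" for p
    proof (cases "v p = 0")
      case False
      then have "\<theta> \<le> ?room p / \<bar>v p\<bar>" using p by (intro le_S) (auto simp: S_def)
      then show ?thesis using False by (simp add: field_simps split: if_splits)
    qed (use ybox[OF p] in auto)
    show "\<theta> * ?W = 1 \<or> (\<exists>p<m. v p \<noteq> 0 \<and> \<theta> * \<bar>v p\<bar> = ?room p)"
      using in_S Wpos unfolding S_def by (auto simp: divide_simps)
  qed auto
  then show ?thesis by blast
qed

lemma winv_exists: "\<exists>y. winv k y"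
  by (induction k) (use winv_start step_exists in blast)+

text \<open>Were more than half of the coordinates still moving, the progress measure would give
  \<open>4 * m\<^sup>2 \<le> m + 2 * m\<^sup>2\<close>. The accumulated drift is
  \<open>4 * m\<^sup>2 / (16 * m\<^sup>2) = 1 / 4\<close> in units of \<open>G\<close>, which fits
  into both bounds.\<close>

lemma winv_final:
  assumes "winv (4 * m\<^sup>2) y"
  shows "m \<le> 2 * frozen y" "\<And>i. i < N \<Longrightarrow> \<bar>dot m (b i) (disp y)\<bar> \<le> (if hard i then G else 3 * G)"
proof -
  have pl: "potential y \<le> real m / 8" using assms by (intro potential_le) (auto simp: winv_def)
  show "m \<le> 2 * frozen y"
  proof (rule ccontr)
    assume "\<not> ?thesis"
    then have "real (4 * m\<^sup>2) \<le> real (frozen y) + 16 * real m * potential y"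
      using assms by (auto simp: winv_def)
    also have "\<dots> \<le> real m + 16 * real m * (real m / 8)"
      using pl frozen_le[of y] by (intro add_mono mult_left_mono) auto
    also have "\<dots> = real m + 2 * (real m)\<^sup>2" by (simp add: power2_eq_square)
    finally have "2 * (real m)\<^sup>2 \<le> real m" by simp
    then show False using m by (simp add: power2_eq_square)
  qed
  fix i assume i: "i < N"
  have "\<bar>dot m (b i) (disp y)\<bar> \<le> G * ((if hard i then 0 else 2) + real (4 * m\<^sup>2) / (16 * (real m)\<^sup>2))"
    using assms i unfolding winv_def by blast
  also have "real (4 * m\<^sup>2) / (16 * (real m)\<^sup>2) = 1 / 4" using m by simp
  finally show "\<bar>dot m (b i) (disp y)\<bar> \<le> (if hard i then G else 3 * G)" using G by (auto split: if_splits)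
qed

end

section \<open>Finding a direction by power iteration\<close>

text \<open>The matrix of the quadratic form, that is the sum of \<open>k i\<close> times the outer
  product of \<open>b i\<close> with itself, applied to \<open>v\<close>.\<close>

definition rad :: "nat \<Rightarrow> (nat \<Rightarrow> nat \<Rightarrow> real) \<Rightarrow> nat \<Rightarrow> (nat \<Rightarrow> real) \<Rightarrow> (nat \<Rightarrow> real) \<Rightarrow> nat \<Rightarrow> real" where
  "rad m b N k v p = (\<Sum>i<N. k i * dot m (b i) v * b i p)"

lemma dot_rad: "dot m w (rad m b N k v) = (\<Sum>i<N. k i * dot m (b i) v * dot m (b i) w)"
proof -
  have "dot m w (rad m b N k v) = dot m w (\<lambda>p. \<Sum>i<N. (k i * dot m (b i) v) * b i p)"
    by (simp add: rad_def[abs_def])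
  also have "\<dots> = (\<Sum>i<N. dot m w (\<lambda>p. (k i * dot m (b i) v) * b i p))" by (rule dot_sum_right)
  also have "\<dots> = (\<Sum>i<N. k i * dot m (b i) v * dot m (b i) w)"
    by (intro sum.cong refl) (simp only: dot_scale_right dot_commute[of m w])
  finally show ?thesis .
qed

lemma dot_rad_sym: "dot m w (rad m b N k v) = dot m v (rad m b N k w)"
  unfolding dot_rad by (intro sum.cong) auto

lemma dot_rad_self: "dot m v (rad m b N k v) = (\<Sum>i<N. k i * (dot m (b i) v)\<^sup>2)"
  unfolding dot_rad by (simp add: power2_eq_square mult_ac)

text \<open>A positive semidefinite matrix satisfies \<open>M\<^sup>2 \<le> trace M * M\<close>, and
  \<open>c\<close> bounds the trace. Cauchy-Schwarz is applied to each \<open>b i\<close> separately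
  and then to the weighted sum over \<open>i\<close>.\<close>

lemma rad_norm:
  assumes k: "\<And>i. i < N \<Longrightarrow> 0 \<le> k i" and c: "(\<Sum>i<N. k i * dot m (b i) (b i)) \<le> c"
  shows "dot m (rad m b N k v) (rad m b N k v) \<le> c * (\<Sum>i<N. k i * (dot m (b i) v)\<^sup>2)"
proof -
  let ?r = "rad m b N k v"
  let ?q = "\<Sum>i<N. k i * (dot m (b i) v)\<^sup>2" and ?h = "\<Sum>i<N. k i * (dot m (b i) ?r)\<^sup>2"
  have q0: "0 \<le> ?q" using k by (intro sum_nonneg) auto
  have "?h \<le> (\<Sum>i<N. k i * dot m (b i) (b i) * dot m ?r ?r)"
    using k dot_Cauchy_Schwarz[of m "b _" ?r]
    by (intro sum_mono) (auto simp: mult.assoc intro!: mult_left_mono)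
  also have "\<dots> \<le> c * dot m ?r ?r"
    using c by (simp add: sum_distrib_right[symmetric] mult_right_mono)
  finally have h: "?h \<le> c * dot m ?r ?r" .
  have "dot m ?r ?r = (\<Sum>i<N. (sqrt (k i) * dot m (b i) v) * (sqrt (k i) * dot m (b i) ?r))"
    unfolding dot_rad[of m ?r] using k by (intro sum.cong) (auto simp: algebra_simps)
  then have "(dot m ?r ?r)\<^sup>2 \<le> (\<Sum>i<N. (sqrt (k i) * dot m (b i) v)\<^sup>2) * (\<Sum>i<N. (sqrt (k i) * dot m (b i) ?r)\<^sup>2)"
    by (simp only:) (rule Cauchy_Schwarz_ineq_sum)
  also have "\<dots> = ?q * ?h" using k by (simp add: power_mult_distrib)
  also have "\<dots> \<le> ?q * (c * dot m ?r ?r)" using h q0 by (rule mult_left_mono)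
  finally have *: "dot m ?r ?r * dot m ?r ?r \<le> (c * ?q) * dot m ?r ?r"
    by (simp add: power2_eq_square mult_ac)
  have "0 \<le> c" using c k by (smt (verit) dot_nonneg lessThan_iff mult_nonneg_nonneg sum_nonneg)
  show ?thesis
  proof (cases "dot m ?r ?r = 0")
    case True
    then show ?thesis using \<open>0 \<le> c\<close> q0 by simp
  next
    case False
    then have "0 < dot m ?r ?r" using dot_nonneg[of m ?r] by linarith
    then show ?thesis using * by (simp only: mult_le_cancel_right_pos)
  qed
qed

text \<open>A positive multiple of the orthogonal projection onto the vectors supported on the mask
  \<open>a\<close> that are orthogonal to \<open>1\<close> and to \<open>\<beta>\<close>; it is free of divisions, so it preserves integrality.\<close>

definition center :: "nat \<Rightarrow> (nat \<Rightarrow> real) \<Rightarrow> (nat \<Rightarrow> real) \<Rightarrow> nat \<Rightarrow> real" where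
  "center m a v p = a p * ((\<Sum>q<m. a q) * v p - (\<Sum>q<m. v q))"

text \<open>A multiple of \<open>\<beta>\<close> on the mask made orthogonal to \<open>1\<close>, so
  that the two projections can be carried out one after the other.\<close>

definition bal :: "nat \<Rightarrow> (nat \<Rightarrow> real) \<Rightarrow> (nat \<Rightarrow> real) \<Rightarrow> nat \<Rightarrow> real" where
  "bal m a \<beta> = center m a (\<lambda>q. a q * \<beta> q)"

text \<open>A Gram-Schmidt step with its denominator cleared; \<open>\<kappa>\<close> stands for the
  squared norm of \<open>bal\<close>.\<close>

definition pj :: "nat \<Rightarrow> (nat \<Rightarrow> real) \<Rightarrow> (nat \<Rightarrow> real) \<Rightarrow> real \<Rightarrow> (nat \<Rightarrow> real) \<Rightarrow> nat \<Rightarrow> real" where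
  "pj m a \<beta> \<kappa> v p = \<kappa> * center m a v p - dot m (bal m a \<beta>) (center m a v) * bal m a \<beta> p"

lemma sum_center:
  assumes "\<And>p. p < m \<Longrightarrow> a p * v p = v p"
  shows "(\<Sum>p<m. center m a v p) = 0"
proof -
  have gen: "(\<Sum>p<m. a p * (A * v p - V)) = A * (\<Sum>p<m. a p * v p) - (\<Sum>p<m. a p) * V" for A V :: real
    by (simp add: algebra_simps sum_subtractf sum_distrib_left sum_distrib_right)
  have "(\<Sum>p<m. center m a v p) = (\<Sum>q<m. a q) * (\<Sum>p<m. a p * v p) - (\<Sum>p<m. a p) * (\<Sum>q<m. v q)"
    unfolding center_def by (rule gen)
  also have "(\<Sum>p<m. a p * v p) = (\<Sum>p<m. v p)" by (intro sum.cong refl) (simp only: assms lessThan_iff)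
  finally show ?thesis by simp
qed

lemma dot_center:
  assumes "\<And>p. p < m \<Longrightarrow> a p * w p = w p" "(\<Sum>p<m. w p) = 0"
  shows "dot m (center m a v) w = (\<Sum>q<m. a q) * dot m v w"
proof -
  have "dot m (center m a v) w = (\<Sum>p<m. ((\<Sum>q<m. a q) * v p - (\<Sum>q<m. v q)) * (a p * w p))"
    unfolding dot_def center_def by (simp add: mult_ac)
  also have "\<dots> = (\<Sum>p<m. ((\<Sum>q<m. a q) * v p - (\<Sum>q<m. v q)) * w p)"
    by (intro sum.cong refl) (simp only: assms(1) lessThan_iff)
  also have "\<dots> = (\<Sum>q<m. a q) * dot m v w - (\<Sum>q<m. v q) * (\<Sum>p<m. w p)"
  proof -
    have gen: "(\<Sum>p<m. (A * v p - V) * w p) = A * (\<Sum>p<m. v p * w p) - V * (\<Sum>p<m. w p)" for A V :: real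
      by (simp add: algebra_simps sum_subtractf sum_distrib_left)
    show ?thesis unfolding dot_def by (rule gen)
  qed
  finally show ?thesis using assms(2) by simp
qed

text \<open>If \<open>bal\<close> vanishes, \<open>\<beta>\<close> is constant on the mask and
  orthogonality to it follows from that to \<open>1\<close>. The value \<open>\<kappa> = 0\<close>
  would then collapse the projection, so another positive number is allowed in its place.\<close>

locale proj =
  fixes m :: nat and a \<beta> :: "nat \<Rightarrow> real" and \<kappa> :: real
  assumes a01: "\<And>p. p < m \<Longrightarrow> a p = 0 \<or> a p = 1" and apos: "0 < (\<Sum>p<m. a p)"
    and \<kappa>: "0 < \<kappa>" "dot m (bal m a \<beta>) (bal m a \<beta>) = 0 \<or> \<kappa> = dot m (bal m a \<beta>) (bal m a \<beta>)"
begin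

definition "sc = (\<Sum>p<m. a p) * \<kappa>"
definition "U = {v. (\<forall>p<m. a p * v p = v p) \<and> (\<Sum>p<m. v p) = 0 \<and> dot m \<beta> v = 0}"

lemma sc_pos: "0 < sc" using apos \<kappa> by (simp add: sc_def)

lemma aa: "p < m \<Longrightarrow> a p * (a p * z) = a p * z" using a01[of p] by auto

lemma supp_center: "p < m \<Longrightarrow> a p * center m a v p = center m a v p"
  unfolding center_def by (rule aa)

lemma supp_bal: "p < m \<Longrightarrow> a p * bal m a \<beta> p = bal m a \<beta> p"
  unfolding bal_def by (rule supp_center)

lemma sum_bal: "(\<Sum>p<m. bal m a \<beta> p) = 0"
  unfolding bal_def by (rule sum_center) (rule aa)

lemma dot_bal:
  assumes "\<And>p. p < m \<Longrightarrow> a p * w p = w p" "(\<Sum>p<m. w p) = 0"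
  shows "dot m (bal m a \<beta>) w = (\<Sum>q<m. a q) * dot m \<beta> w"
proof -
  have "dot m (bal m a \<beta>) w = (\<Sum>q<m. a q) * dot m (\<lambda>q. a q * \<beta> q) w"
    unfolding bal_def by (rule dot_center[OF assms])
  also have "dot m (\<lambda>q. a q * \<beta> q) w = (\<Sum>p<m. \<beta> p * (a p * w p))" unfolding dot_def by (simp add: mult_ac)
  also have "\<dots> = dot m \<beta> w" unfolding dot_def by (intro sum.cong refl) (simp only: assms(1) lessThan_iff)
  finally show ?thesis .
qed

lemma pj_eq: "pj m a \<beta> \<kappa> v = (\<lambda>p. \<kappa> * center m a v p - dot m (bal m a \<beta>) (center m a v) * bal m a \<beta> p)"
  by (simp add: pj_def[abs_def])

text \<open>Orthogonality to \<open>\<beta>\<close> is checked against \<open>bal\<close>, which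
  differs from a positive multiple of \<open>\<beta>\<close> only by terms that masked vectors of
  sum 0 do not see.\<close>

lemma pj_U:
  assumes "\<And>p. p < m \<Longrightarrow> a p * v p = v p"
  shows "pj m a \<beta> \<kappa> v \<in> U"
proof -
  let ?b = "bal m a \<beta>" and ?v = "center m a v"
  have 1: "a p * pj m a \<beta> \<kappa> v p = pj m a \<beta> \<kappa> v p" if "p < m" for p
    unfolding pj_def by (simp only: right_diff_distrib mult.left_commute[of "a p"] supp_center[OF that] supp_bal[OF that])
  have 2: "(\<Sum>p<m. pj m a \<beta> \<kappa> v p) = 0"
    unfolding pj_def using sum_center[OF assms] sum_bal
    by (simp add: sum_subtractf sum_distrib_left[symmetric])
  have "dot m ?b (pj m a \<beta> \<kappa> v) = \<kappa> * dot m ?b ?v - dot m ?b ?v * dot m ?b ?b"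
    unfolding pj_eq by (simp only: dot_simps)
  moreover have "dot m ?b ?v = 0" if z: "dot m ?b ?b = 0"
  proof -
    have "(dot m ?b ?v)\<^sup>2 \<le> 0" using dot_Cauchy_Schwarz[of m ?b ?v] z by simp
    then show ?thesis by simp
  qed
  ultimately have "dot m ?b (pj m a \<beta> \<kappa> v) = 0" using \<kappa>(2) by auto
  then have "dot m \<beta> (pj m a \<beta> \<kappa> v) = 0" using dot_bal[of "pj m a \<beta> \<kappa> v"] 1 2 apos by auto
  then show ?thesis using 1 2 by (simp add: U_def)
qed

text \<open>The subtracted directions \<open>1\<close> and \<open>bal\<close> are orthogonal to
  \<open>U\<close>, so only the scale survives.\<close>

lemma dot_pj:
  assumes "w \<in> U"
  shows "dot m (pj m a \<beta> \<kappa> v) w = sc * dot m v w"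
proof -
  have w: "\<And>p. p < m \<Longrightarrow> a p * w p = w p" "(\<Sum>p<m. w p) = 0" "dot m \<beta> w = 0" using assms by (auto simp: U_def)
  have "dot m (pj m a \<beta> \<kappa> v) w = \<kappa> * dot m (center m a v) w
      - dot m (bal m a \<beta>) (center m a v) * dot m (bal m a \<beta>) w"
    unfolding pj_eq by (simp only: dot_simps)
  then show ?thesis using dot_bal[OF w(1,2)] dot_center[OF w(1,2)] w(3) by (simp add: sc_def)
qed

text \<open>As for every orthogonal projection, the squared norm of the image is, up to the scale,
  its inner product with the original vector; Cauchy-Schwarz does the rest.\<close>

lemma pj_norm:
  assumes "\<And>p. p < m \<Longrightarrow> a p * v p = v p"
  shows "dot m (pj m a \<beta> \<kappa> v) (pj m a \<beta> \<kappa> v) \<le> sc\<^sup>2 * dot m v v"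
proof -
  let ?p = "pj m a \<beta> \<kappa> v"
  have e: "dot m ?p ?p = sc * dot m v ?p" by (rule dot_pj[OF pj_U[OF assms]])
  then have "(dot m ?p ?p)\<^sup>2 = sc\<^sup>2 * (dot m v ?p)\<^sup>2" by (simp add: power_mult_distrib)
  also have "\<dots> \<le> sc\<^sup>2 * (dot m v v * dot m ?p ?p)" by (intro mult_left_mono dot_Cauchy_Schwarz) auto
  finally have "dot m ?p ?p * dot m ?p ?p \<le> (sc\<^sup>2 * dot m v v) * dot m ?p ?p"
    by (simp add: power2_eq_square mult_ac)
  then show ?thesis
    by (cases "dot m ?p ?p = 0") (use dot_nonneg[of m ?p] in \<open>auto simp: mult_le_cancel_right\<close>)
qed

end

text \<open>A multiple of the projected \<open>c - M\<close>, where \<open>M\<close> is the matrix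
  behind \<open>rad\<close>.\<close>

definition pstep where
  "pstep m a \<beta> \<kappa> b N k c v = pj m a \<beta> \<kappa> (\<lambda>p. a p * (c * v p - rad m b N k v p))"

text \<open>A multiple of the projected unit vector at \<open>w\<close>; its inner products with
  vectors of \<open>U\<close> read off coordinate \<open>w\<close>.\<close>

definition pstart :: "nat \<Rightarrow> (nat \<Rightarrow> real) \<Rightarrow> (nat \<Rightarrow> real) \<Rightarrow> real \<Rightarrow> nat \<Rightarrow> nat \<Rightarrow> real" where
  "pstart m a \<beta> \<kappa> w = pj m a \<beta> \<kappa> (\<lambda>p. of_bool (p = w) * a p)"

text \<open>This is \<open>power_iteration\<close> for \<open>pstep\<close>. In the bound on a step,
  expanding \<open>c - M\<close> gives twice \<open>c\<close> times the form with a minus sign, and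
  \<open>rad_norm\<close> shows that the squared norm of \<open>rad\<close> uses up only one of
  these two copies.\<close>

lemma (in proj) search:
  assumes k: "\<And>i. i < N \<Longrightarrow> 0 \<le> k i" and c: "(\<Sum>i<N. k i * dot m (b i) (b i)) \<le> c"
    and u: "u \<in> U" "dot m u u = 1" "(\<Sum>i<N. k i * (dot m (b i) u)\<^sup>2) \<le> e / 4"
    and e: "0 < e" "e \<le> c" and T: "4 * c * real m / e \<le> real T"
  shows "\<exists>p<m. let v = (pstep m a \<beta> \<kappa> b N k c ^^ T) (pstart m a \<beta> \<kappa> p) in
    0 < dot m v v \<and> (\<Sum>i<N. k i * (dot m (b i) v)\<^sup>2) \<le> e * dot m v v"
    "\<And>T w. (pstep m a \<beta> \<kappa> b N k c ^^ T) (pstart m a \<beta> \<kappa> w) \<in> U"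
proof -
  let ?Q = "\<lambda>v. \<Sum>i<N. k i * (dot m (b i) v)\<^sup>2"
  define B where "B = pstep m a \<beta> \<kappa> b N k c"
  define h where "h v = (\<lambda>p. c * v p - rad m b N k v p)" for v
  have Bh: "B v = pj m a \<beta> \<kappa> (\<lambda>p. a p * h v p)" for v by (simp add: B_def pstep_def[abs_def] h_def)
  have BU: "B v \<in> U" for v unfolding Bh by (rule pj_U) (rule aa)
  \<comment> \<open>Masking is invisible in inner products with \<open>U\<close>; hence
    \<open>B\<close> is symmetric on \<open>U\<close>.\<close>
  have adot: "dot m (\<lambda>p. a p * z p) w = dot m z w" if "w \<in> U" for z w
  proof -
    have "dot m (\<lambda>p. a p * z p) w = (\<Sum>p<m. z p * (a p * w p))" unfolding dot_def by (simp add: mult_ac)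
    also have "\<dots> = dot m z w" unfolding dot_def
    proof (intro sum.cong refl)
      fix p assume "p \<in> {..<m}"
      then have "a p * w p = w p" using that unfolding U_def by blast
      then show "z p * (a p * w p) = z p * w p" by (simp only:)
    qed
    finally show ?thesis .
  qed
  have Bdot: "dot m (B v) w = sc * (c * dot m v w - dot m (rad m b N k v) w)" if "w \<in> U" for v w
    unfolding Bh dot_pj[OF that] adot[OF that] unfolding h_def by (simp only: dot_simps)
  have sU: "pstart m a \<beta> \<kappa> w \<in> U" for w unfolding pstart_def by (rule pj_U) (use a01 in auto)
  have "(B ^^ T) (pstart m a \<beta> \<kappa> w) \<in> U" for T w by (induction T) (auto simp: sU BU)
  then show "\<And>T w. (pstep m a \<beta> \<kappa> b N k c ^^ T) (pstart m a \<beta> \<kappa> w) \<in> U" by (simp add: B_def)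
  have cpos: "0 < c" using e by linarith
  have "\<exists>p<m. 0 < dot m ((B ^^ T) (pstart m a \<beta> \<kappa> p)) ((B ^^ T) (pstart m a \<beta> \<kappa> p)) \<and>
    ?Q ((B ^^ T) (pstart m a \<beta> \<kappa> p)) \<le> e * dot m ((B ^^ T) (pstart m a \<beta> \<kappa> p)) ((B ^^ T) (pstart m a \<beta> \<kappa> p))"
  proof (rule power_iteration[where U = U and s = sc and c = c and u = u])
    show "B v \<in> U" for v by (rule BU)
    show "dot m (B v) w = dot m v (B w)" if "v \<in> U" "w \<in> U" for v w
      using Bdot[OF that(2), of v] Bdot[OF that(1), of w] dot_rad_sym[of m w b N k v]
      unfolding dot_commute[of m v "B w"] dot_commute[of m w v] dot_commute[of m "rad m b N k v" w]
        dot_commute[of m "rad m b N k w" v] by simp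
    show "pstart m a \<beta> \<kappa> p \<in> U" for p by (rule sU)
    show "dot m (pstart m a \<beta> \<kappa> p) y = sc * y p" if "p < m" "y \<in> U" for p y
    proof -
      have "dot m (\<lambda>q. of_bool (q = p) * a q) y = (\<Sum>q<m. if q = p then a q * y q else 0)"
        unfolding dot_def by (intro sum.cong) auto
      also have "\<dots> = y p" using that by (simp add: U_def)
      finally show ?thesis unfolding pstart_def using dot_pj[OF that(2)] by simp
    qed
    show "dot m (pstart m a \<beta> \<kappa> p) (pstart m a \<beta> \<kappa> p) \<le> sc\<^sup>2" if "p < m" for p
    proof -
      let ?z = "\<lambda>q. of_bool (q = p) * a q"
      have "dot m ?z ?z = (\<Sum>q<m. if q = p then a q * a q else 0)"
        unfolding dot_def by (intro sum.cong) auto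
      also have "\<dots> \<le> 1" using that a01[OF that] by auto
      finally have "sc\<^sup>2 * dot m ?z ?z \<le> sc\<^sup>2 * 1" by (intro mult_left_mono) auto
      moreover have "dot m (pstart m a \<beta> \<kappa> p) (pstart m a \<beta> \<kappa> p) \<le> sc\<^sup>2 * dot m ?z ?z"
        unfolding pstart_def by (rule pj_norm) (use a01 in auto)
      ultimately show ?thesis by linarith
    qed
    show "dot m (B v) (B v) \<le> sc\<^sup>2 * (c\<^sup>2 * dot m v v - c * ?Q v)" if "v \<in> U" for v
    proof -
      have "dot m (B v) (B v) \<le> sc\<^sup>2 * dot m (\<lambda>p. a p * h v p) (\<lambda>p. a p * h v p)"
        unfolding Bh by (rule pj_norm) (rule aa)
      also have "dot m (\<lambda>p. a p * h v p) (\<lambda>p. a p * h v p) \<le> dot m (h v) (h v)"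
        unfolding dot_def by (intro sum_mono) (use a01 in force)
      also have "dot m (h v) (h v) = c\<^sup>2 * dot m v v - 2 * c * dot m v (rad m b N k v) + dot m (rad m b N k v) (rad m b N k v)"
        unfolding h_def by (simp only: dot_simps dot_commute[of m "rad m b N k v" v])
          (simp add: algebra_simps power2_eq_square)
      also have "\<dots> \<le> c\<^sup>2 * dot m v v - c * ?Q v"
        using rad_norm[OF k c, of v] by (simp add: dot_rad_self)
      finally show ?thesis by (simp add: mult_left_mono)
    qed
    show "dot m v (B v) = sc * (c * dot m v v - ?Q v)" if "v \<in> U" for v
      using Bdot[OF that, of v]
      unfolding dot_commute[of m v "B v"] dot_commute[of m "rad m b N k v" v] dot_rad_self .
    show "0 \<le> ?Q v" for v using k by (intro sum_nonneg) auto
  qed (use u e sc_pos T in auto)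
  then show "\<exists>p<m. let v = (pstep m a \<beta> \<kappa> b N k c ^^ T) (pstart m a \<beta> \<kappa> p) in
    0 < dot m v v \<and> ?Q v \<le> e * dot m v v" by (simp add: B_def Let_def)
qed

text \<open>The weights are at most \<open>16 * m ^ 4\<close>, so \<open>tot\<close> bounds the
  trace by \<open>c = 16 * m ^ 9 * G\<^sup>2\<close>. The direction known to exist has value at most
  \<open>G\<^sup>2 / 64\<close>, a quarter of \<open>e = G\<^sup>2 / 16\<close>, and the number of
  iterations is \<open>4 * c * m / e = 1024 * m ^ 10\<close>.\<close>

lemma (in walk) search_gooddir:
  assumes inv: "winv k y" and unf: "2 * frozen y < m"
    and tot: "(\<Sum>i<N. dot m (b i) (b i)) \<le> real m ^ 5 * G\<^sup>2"
    and \<kappa>: "0 < \<kappa>" "dot m (bal m a \<beta>) (bal m a \<beta>) = 0 \<or> \<kappa> = dot m (bal m a \<beta>) (bal m a \<beta>)"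
    and a: "\<And>p. p < m \<Longrightarrow> a p = of_bool (alive y p)"
    and st: "\<And>i. i < N \<Longrightarrow> st i = stiff y i"
  shows "\<exists>w<m. gooddir y ((pstep m a \<beta> \<kappa> b N st (16 * real m ^ 9 * G\<^sup>2) ^^ (1024 * m ^ 10)) (pstart m a \<beta> \<kappa> w))"
    (is "\<exists>w<m. gooddir y (?v w)")
    and "\<And>T w. admdir y ((pstep m a \<beta> \<kappa> b N st (16 * real m ^ 9 * G\<^sup>2) ^^ T) (pstart m a \<beta> \<kappa> w))"
proof -
  have "\<exists>p<m. alive y p"
  proof (rule ccontr)
    assume "\<not> ?thesis"
    then have "{p. p < m \<and> \<not> alive y p} = {..<m}" by auto
    then show False using unf by (simp add: frozen_def)
  qed
  then obtain p where "p < m" "alive y p" by blast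
  then have ap: "0 < (\<Sum>p<m. a p)" using a by (intro sum_pos2[of _ p]) auto
  interpret P: proj m a \<beta> \<kappa>
    by unfold_locales (use a ap \<kappa> in auto)
  \<comment> \<open>For the mask of moving coordinates, \<open>U\<close> is the space of admissible
    directions.\<close>
  have Uadm: "v \<in> P.U \<longleftrightarrow> admdir y v" for v
    unfolding P.U_def admdir_def using a by (auto split: if_splits)
  obtain u where u: "admdir y u" "dot m u u = 1" "qform y u \<le> G\<^sup>2 / 64"
    using direction_exists[OF inv unf] by blast
  have qf: "qform y v = (\<Sum>i<N. st i * (dot m (b i) v)\<^sup>2)" for v
    using st by (simp add: qform_def)
  have m1: "1 \<le> real m" using m by simp
  have stle: "0 \<le> st i \<and> st i \<le> 16 * real m ^ 4" if "i < N" for i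
  proof -
    have "1 * 1 \<le> (16::real) * real m ^ 4" using m1 by (intro mult_mono one_le_power) auto
    then show ?thesis using st[OF that] by (auto simp: stiff_def)
  qed
  have "(\<Sum>i<N. st i * dot m (b i) (b i)) \<le> (\<Sum>i<N. 16 * real m ^ 4 * dot m (b i) (b i))"
    using stle by (intro sum_mono mult_right_mono) auto
  also have "\<dots> = 16 * real m ^ 4 * (\<Sum>i<N. dot m (b i) (b i))" by (simp add: sum_distrib_left)
  also have "\<dots> \<le> 16 * real m ^ 4 * (real m ^ 5 * G\<^sup>2)" using tot by (intro mult_left_mono) auto
  also have "\<dots> = 16 * real m ^ 9 * G\<^sup>2" by (simp add: power_add[symmetric])
  finally have c: "(\<Sum>i<N. st i * dot m (b i) (b i)) \<le> 16 * real m ^ 9 * G\<^sup>2" .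
  have e2: "G\<^sup>2 / 16 \<le> 16 * real m ^ 9 * G\<^sup>2"
  proof -
    have "1 / 16 * 1 \<le> (16::real) * real m ^ 9" using m1 by (intro mult_mono one_le_power) auto
    then have "1 / 16 * G\<^sup>2 \<le> (16 * real m ^ 9) * G\<^sup>2" by (intro mult_right_mono) auto
    then show ?thesis by simp
  qed
  have T: "4 * (16 * real m ^ 9 * G\<^sup>2) * real m / (G\<^sup>2 / 16) \<le> real (1024 * m ^ 10)"
    using G by (simp add: power_Suc[symmetric] mult_ac del: power_Suc)
  have s1: "(\<Sum>i<N. st i * (dot m (b i) u)\<^sup>2) \<le> (G\<^sup>2 / 16) / 4" using u(3) qf by simp
  have s0: "\<And>i. i < N \<Longrightarrow> 0 \<le> st i" using stle by blast
  have s2: "0 < G\<^sup>2 / 16" using G by simp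
  note S = P.search[OF s0 c _ u(2) s1 s2 e2 T, unfolded Uadm, OF _ u(1)]
  show adm: "\<And>T w. admdir y ((pstep m a \<beta> \<kappa> b N st (16 * real m ^ 9 * G\<^sup>2) ^^ T) (pstart m a \<beta> \<kappa> w))"
    by (rule S(2))
  from S(1) show "\<exists>w<m. gooddir y (?v w)"
    unfolding gooddir_def qf Let_def using adm by (auto simp: mult.commute)
qed

section \<open>From the rounding problem to the walk\<close>

lemma sum_div_mod:
  fixes f :: "nat \<Rightarrow> nat \<Rightarrow> real"
  assumes "0 < Q"
  shows "(\<Sum>i<K * Q. f (i div Q) (i mod Q)) = (\<Sum>k<K. \<Sum>q<Q. f k q)"
proof (induction K)
  case (Suc K)
  have "{..<Suc K * Q} = {..<K * Q} \<union> {K * Q..<K * Q + Q}" by auto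
  then have "(\<Sum>i<Suc K * Q. f (i div Q) (i mod Q)) =
      (\<Sum>i<K * Q. f (i div Q) (i mod Q)) + (\<Sum>i=K * Q..<K * Q + Q. f (i div Q) (i mod Q))"
    by (simp add: sum.union_disjoint[symmetric] ivl_disj_int)
  also have "(\<Sum>i=K * Q..<K * Q + Q. f (i div Q) (i mod Q)) = (\<Sum>q<Q. f ((q + K * Q) div Q) ((q + K * Q) mod Q))"
    using sum.shift_bounds_nat_ivl[of "\<lambda>i. f (i div Q) (i mod Q)" 0 "K * Q" Q]
    by (simp add: atLeast0LessThan add.commute)
  also have "\<dots> = (\<Sum>q<Q. f K q)" using assms by (intro sum.cong) auto
  finally show ?case using Suc by simp
qed simp

lemma card_mult_le: "0 < (a::nat) \<Longrightarrow> card {q. q < Q \<and> a * q \<le> M} \<le> M div a + 1"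
proof -
  assume "0 < a"
  then have "{q. q < Q \<and> a * q \<le> M} \<subseteq> {..M div a}" by (auto simp: less_eq_div_iff_mult_less_eq mult.commute)
  from card_mono[OF _ this] show ?thesis by simp
qed

text \<open>Summation by parts leaves \<open>w i\<close> times the last prefix sum and a sum of
  prefix sums times increments of \<open>w\<close>; the increments telescope because
  \<open>w\<close> is monotone. It is applied with \<open>w j = 1 / s j\<close>.\<close>

lemma Abel_bound:
  fixes w e :: "nat \<Rightarrow> real"
  assumes w0: "\<And>j. j \<le> i \<Longrightarrow> 0 \<le> w j" and wm: "\<And>j k. j \<le> k \<Longrightarrow> k \<le> i \<Longrightarrow> w j \<le> w k"
    and T: "\<And>c. c \<le> Suc i \<Longrightarrow> \<bar>\<Sum>j<c. e j\<bar> \<le> T"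
  shows "\<bar>\<Sum>j\<le>i. w j * e j\<bar> \<le> 2 * T * w i"
proof -
  define E where "E c = (\<Sum>j<c. e j)" for c
  have key: "k \<le> i \<Longrightarrow> \<bar>(\<Sum>j\<le>k. w j * e j) - w k * E (Suc k)\<bar> \<le> T * (w k - w 0)" for k
  proof (induction k)
    case (Suc k)
    have "(\<Sum>j\<le>Suc k. w j * e j) - w (Suc k) * E (Suc (Suc k)) =
        ((\<Sum>j\<le>k. w j * e j) - w k * E (Suc k)) - (w (Suc k) - w k) * E (Suc k)"
      by (simp add: E_def algebra_simps)
    also have "\<bar>\<dots>\<bar> \<le> T * (w k - w 0) + (w (Suc k) - w k) * T"
    proof -
      have "\<bar>(w (Suc k) - w k) * E (Suc k)\<bar> \<le> (w (Suc k) - w k) * T"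
        using wm[of k "Suc k"] Suc.prems T[of "Suc k"] unfolding E_def abs_mult
        by (intro mult_mono) auto
      then show ?thesis using Suc by linarith
    qed
    finally show ?case by (simp add: algebra_simps)
  qed (simp add: E_def)
  have "\<bar>w i * E (Suc i)\<bar> \<le> w i * T" using w0[of i] T[of "Suc i"] unfolding E_def abs_mult
    by (intro mult_mono) auto
  moreover have "0 \<le> T * w 0" using T[of 0] w0[of 0] by simp
  moreover have "T * (w i - w 0) = T * w i - T * w 0" by (simp add: algebra_simps)
  ultimately show ?thesis using key[of i] by (simp add: mult_ac)
qed

section \<open>Number of grid levels and allowed error\<close>

text \<open>The least \<open>k\<close> with \<open>m \<le> 8 ^ k\<close>, written as a count so that
  the program obtains it as a sum of comparisons.\<close>

definition depth :: "nat \<Rightarrow> nat" where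
  "depth m = card {k. k < m \<and> 8 ^ k < m}"

lemma depth: "m \<le> 8 ^ depth m" "depth m \<le> m" "0 < m \<Longrightarrow> 8 ^ depth m \<le> 8 * m"
proof -
  define L where "L = (LEAST k. m \<le> 8 ^ k)"
  have ex: "m \<le> 8 ^ m" using less_exp[of m] power_mono[of "2::nat" 8 m] by linarith
  have L: "m \<le> 8 ^ L" unfolding L_def using ex by (rule LeastI)
  have Lm: "L \<le> m" unfolding L_def using ex by (rule Least_le)
  have iff: "8 ^ k < m \<longleftrightarrow> k < L" for k
  proof
    assume "k < L"
    then show "8 ^ k < m" unfolding L_def using not_less_Least not_le by blast
  next
    assume "8 ^ k < m"
    then have "(8::nat) ^ k < 8 ^ L" using L by linarith
    then show "k < L" by simp
  qed
  have "{k. k < m \<and> 8 ^ k < m} = {..<L}" unfolding iff using Lm by auto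
  then have "depth m = L" by (simp add: depth_def)
  then show "m \<le> 8 ^ depth m" "depth m \<le> m" using L Lm by auto
  show "8 ^ depth m \<le> 8 * m" if "0 < m"
    using that iff[of "L - 1"] \<open>depth m = L\<close> by (cases L) auto
qed

text \<open>A natural number of order \<open>1 / sqrt \<delta>\<close> (but at most \<open>m\<close>), so that no irrational number is needed.\<close>

definition rate :: "nat \<Rightarrow> real \<Rightarrow> nat" where
  "rate m \<delta> = card {r. r < m \<and> real (Suc r) ^ 2 * \<delta> \<le> 1}"

text \<open>The counted set is an initial segment, so \<open>rate\<close> is the largest
  \<open>r \<le> m\<close> with \<open>r\<^sup>2 * \<delta> \<le> 1\<close>. For the last claim: if
  the cap \<open>m\<close> is reached, \<open>1 / m \<le> \<delta> \<le> sqrt \<delta>\<close>;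
  otherwise \<open>r + 1\<close> violates the inequality, and
  \<open>r + 1 \<le> 2 * r\<close>.\<close>

lemma rate:
  assumes "0 < \<delta>" "\<delta> \<le> 1" "0 < m"
  shows "1 \<le> rate m \<delta>" "rate m \<delta> \<le> m" "real (rate m \<delta>) ^ 2 * \<delta> \<le> 1"
    "1 / real m \<le> \<delta> \<Longrightarrow> 1 / real (rate m \<delta>) \<le> 2 * sqrt \<delta>"
proof -
  define S where "S = {r. r < m \<and> real (Suc r) ^ 2 * \<delta> \<le> 1}"
  have fS: "finite S" by (simp add: S_def)
  have S0: "0 \<in> S" using assms by (simp add: S_def)
  define M where "M = Max S"
  have M: "M \<in> S" unfolding M_def using fS S0 by (intro Max_in) auto
  have "S = {..M}"
  proof
    show "S \<subseteq> {..M}" using fS by (auto simp: M_def)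
    show "{..M} \<subseteq> S"
    proof
      fix r assume "r \<in> {..M}"
      then have "real (Suc r) ^ 2 * \<delta> \<le> real (Suc M) ^ 2 * \<delta>"
        using assms by (intro mult_right_mono power_mono) auto
      then show "r \<in> S" using M \<open>r \<in> {..M}\<close> by (auto simp: S_def)
    qed
  qed
  then have R: "rate m \<delta> = Suc M" unfolding rate_def S_def[symmetric] by simp
  show "1 \<le> rate m \<delta>" "rate m \<delta> \<le> m" "real (rate m \<delta>) ^ 2 * \<delta> \<le> 1"
    using R M by (auto simp: S_def)
  assume dm: "1 / real m \<le> \<delta>"
  show "1 / real (rate m \<delta>) \<le> 2 * sqrt \<delta>"
  proof (cases "rate m \<delta> = m")
    case True
    have "\<delta> \<le> sqrt \<delta>" using assms by (simp add: real_le_rsqrt power2_eq_square mult_left_le)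
    then show ?thesis using True dm assms by (smt (verit) real_sqrt_ge_zero)
  next
    case False
    then have "Suc M < m" using R M by (auto simp: S_def)
    moreover have "Suc M \<notin> S" using \<open>S = {..M}\<close> by auto
    ultimately have "1 < real (Suc (Suc M)) ^ 2 * \<delta>" by (auto simp: S_def)
    then have "1 < (real (Suc (Suc M)) * sqrt \<delta>) ^ 2" using assms by (simp add: power_mult_distrib)
    then have "1 < real (Suc (Suc M)) * sqrt \<delta>"
      using assms by (metis abs_of_nonneg mult_nonneg_nonneg of_nat_0_le_iff one_power2 power2_less_imp_less real_sqrt_ge_zero less_imp_le)
    also have "\<dots> \<le> (2 * real (Suc M)) * sqrt \<delta>" using assms by (intro mult_right_mono) auto
    finally show ?thesis using R by (simp add: field_simps)
  qed
qed

section \<open>The flow of the weighted rows\<close>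

locale inst =
  fixes n m :: nat and A :: "nat \<Rightarrow> nat \<Rightarrow> nat" and s x :: "nat \<Rightarrow> real" and \<delta> \<epsilon> :: real
  assumes m64: "64 \<le> m" and x01: "\<And>p. p < m \<Longrightarrow> x p \<in> {0..1}"
    and \<delta>: "0 < \<delta>" "\<delta> \<le> 1" and s0: "\<And>i. i < n \<Longrightarrow> 0 < s i"
    and smono: "\<And>i j. i \<le> j \<Longrightarrow> j < n \<Longrightarrow> s j \<le> s i"
    and col: "\<And>p. p < m \<Longrightarrow> (\<Sum>i<n. s i * real (A i p)) \<le> 1"
    and row: "\<And>i. i < n \<Longrightarrow> s i \<le> \<epsilon> \<Longrightarrow> row_norm_inf m A i \<le> \<delta> * row_norm1 m A i"
begin

definition "big j \<longleftrightarrow> \<epsilon> < s j"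
definition "wt j p = s j * real (A j p)"
definition "len j = (\<Sum>p<m. wt j p)"
definition "cum j = (\<Sum>i<j. len i)"
text \<open>The length of the part of row \<open>j\<close> that lies before
  \<open>t\<close>.\<close>

definition "clp t j = min (max (t - cum j) 0) (len j)"

text \<open>The rows are laid end to end on a line, row \<open>j\<close> occupying the interval from \<open>cum j\<close> to
  \<open>cum (Suc j)\<close>; \<open>flow J t\<close> accumulates the rows in \<open>J\<close> continuously up to \<open>t\<close>. Rows of length \<open>0\<close> vanish
  in all columns, so the division by \<open>0\<close> is harmless.\<close>

definition "flow J t p = (\<Sum>j<n. of_bool (J j) * (clp t j / len j) * wt j p)"
text \<open>A prefix ending in a small row contains all big rows. Bounding their share by Abel
  summation would give \<open>1 / s j\<close> without the factor \<open>sqrt \<delta>\<close>, so it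
  is kept exactly instead. The rows enter unweighted, as they do in the prefix sums to be
  bounded.\<close>

definition "lead p = (\<Sum>j<n. of_bool (big j) * real (A j p))"

text \<open>The constraint with index \<open>k * Q + q\<close> is, for \<open>k = 0\<close>, the flow of the big rows up to \<open>64 * q\<close> and, for
  \<open>k > 0\<close> and \<open>h = k - 1\<close>, the increment of the flow of the small rows up to \<open>64 * q / 8\<^sup>h\<close> over its value
  at the next grid point below on level \<open>h - 1\<close>.\<close>

definition "H = depth m"
definition "R = rate m \<delta>"
definition "Q = m * 8 ^ H + 1"
definition "N = (H + 2) * Q"
definition "kd i = i div Q"
definition "ht i = kd i - 1"
definition "loc i = i mod Q"
definition "inr i \<longleftrightarrow> 64 * loc i \<le> m * 8 ^ ht i"
definition "t1 i = 64 * real (loc i) / 8 ^ ht i"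
text \<open>Level \<open>h - 1\<close> is coarser by 8, so its next grid point below has index
  \<open>loc i div 8\<close> there; the factor 8 converts this to units of level
  \<open>h\<close>.\<close>

definition "t2 i = (if ht i = 0 then 0 else 64 * (8 * real (loc i div 8)) / 8 ^ ht i)"
definition "sel i j \<longleftrightarrow> (big j \<longleftrightarrow> kd i = 0)"
definition "piece i p = flow (sel i) (t1 i) p - flow (sel i) (t2 i) p"
text \<open>Normalised so that the value 1 means an error of \<open>2048 / (2 ^ h * R)\<close>, with
  \<open>R\<close> of order \<open>1 / sqrt \<delta>\<close>. The number 2048 is four times 512, and
  \<open>512 / 8 ^ h\<close> bounds the length of an increment; the square of this quarter is the
  \<open>1 / 16\<close> in \<open>norm_soft\<close>.\<close>

definition "g i p = of_bool (inr i) * 2 ^ ht i * real R / 2048 * piece i p"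
definition "hard i \<longleftrightarrow> inr i \<and> kd i < 2"

lemma wt0: "j < n \<Longrightarrow> 0 \<le> wt j p" using s0[of j] by (simp add: wt_def)
lemma len0: "j < n \<Longrightarrow> 0 \<le> len j" unfolding len_def using wt0 by (intro sum_nonneg) auto
lemma cum0: "j \<le> n \<Longrightarrow> 0 \<le> cum j" unfolding cum_def using len0 by (intro sum_nonneg) auto
lemma cum_mono: "i \<le> j \<Longrightarrow> j \<le> n \<Longrightarrow> cum i \<le> cum j"
  unfolding cum_def using len0 by (intro sum_mono2) auto
lemma cum_Suc: "cum (Suc j) = cum j + len j" by (simp add: cum_def)

lemma wt_le_len: "j < n \<Longrightarrow> p < m \<Longrightarrow> wt j p \<le> len j"
  unfolding len_def using wt0 by (intro member_le_sum[of p "{..<m}" "wt j"]) auto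

lemma wt_len0: "j < n \<Longrightarrow> p < m \<Longrightarrow> len j = 0 \<Longrightarrow> wt j p = 0"
  using wt_le_len[of j p] wt0[of j p] by linarith

lemma cum_le: "c \<le> n \<Longrightarrow> cum c \<le> real m"
proof -
  assume "c \<le> n"
  then have "cum c \<le> cum n" by (rule cum_mono) simp
  also have "cum n = (\<Sum>p<m. \<Sum>j<n. wt j p)" unfolding cum_def len_def by (rule sum.swap)
  also have "\<dots> \<le> (\<Sum>p<m. 1)" unfolding wt_def using col by (intro sum_mono) auto
  finally show ?thesis by simp
qed

lemma clp0: "j < n \<Longrightarrow> 0 \<le> clp t j" using len0[of j] by (simp add: clp_def)
lemma clp_le: "clp t j \<le> len j" by (simp add: clp_def)
lemma clp_mono: "t \<le> t' \<Longrightarrow> clp t j \<le> clp t' j" unfolding clp_def by linarith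

lemma sum_clp: "k \<le> n \<Longrightarrow> 0 \<le> t \<Longrightarrow> (\<Sum>j<k. clp t j) = min t (cum k)"
proof (induction k)
  case 0
  then show ?case by (simp add: cum_def)
next
  case (Suc k)
  have "0 \<le> len k" "0 \<le> cum k" using Suc.prems len0 cum0 by auto
  then show ?case using Suc unfolding cum_Suc by (simp add: clp_def min_def max_def)
qed

lemma sum_clp_diff: "0 \<le> t \<Longrightarrow> t \<le> t' \<Longrightarrow> (\<Sum>j<n. clp t' j - clp t j) \<le> t' - t"
  by (simp add: sum_subtractf sum_clp)

lemma flow_diff:
  "flow J t' p - flow J t p = (\<Sum>j<n. of_bool (J j) * ((clp t' j - clp t j) / len j) * wt j p)"
  unfolding flow_def by (simp add: sum_subtractf[symmetric] diff_divide_distrib algebra_simps)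

lemma ratio0: "j < n \<Longrightarrow> t \<le> t' \<Longrightarrow> 0 \<le> (clp t' j - clp t j) / len j"
  using clp_mono[of t t' j] len0[of j] by simp

lemma flow_diff_nonneg: "t \<le> t' \<Longrightarrow> 0 \<le> flow J t' p - flow J t p"
  unfolding flow_diff using ratio0 wt0 by (intro sum_nonneg mult_nonneg_nonneg) auto

lemma ratio_len: "j < n \<Longrightarrow> (clp t' j - clp t j) / len j * len j = clp t' j - clp t j"
  using clp0[of j t] clp0[of j t'] clp_le[of t j] clp_le[of t' j] by (cases "len j = 0") auto

text \<open>Summed over the columns, the fraction of a row passed between \<open>t\<close> and
  \<open>t'\<close> becomes the length passed.\<close>

lemma flow_diff_sum: "0 \<le> t \<Longrightarrow> t \<le> t' \<Longrightarrow> (\<Sum>p<m. flow J t' p - flow J t p) \<le> t' - t"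
proof -
  assume t: "0 \<le> t" "t \<le> t'"
  have "(\<Sum>p<m. flow J t' p - flow J t p) =
      (\<Sum>j<n. of_bool (J j) * ((clp t' j - clp t j) / len j) * len j)"
    unfolding flow_diff len_def sum_distrib_left by (rule sum.swap)
  also have "\<dots> \<le> (\<Sum>j<n. clp t' j - clp t j)"
  proof (rule sum_mono)
    fix j assume "j \<in> {..<n}"
    then have "j < n" by simp
    then show "of_bool (J j) * ((clp t' j - clp t j) / len j) * len j \<le> clp t' j - clp t j"
      using ratio_len[of j t' t] clp_mono[OF t(2), of j] by (cases "J j") auto
  qed
  also have "\<dots> \<le> t' - t" using t by (rule sum_clp_diff)
  finally show ?thesis .
qed

text \<open>The row hypothesis multiplied by \<open>s j\<close>: it bounds the entries of a small
  weighted row by \<open>\<delta>\<close> times the length of its interval.\<close>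

lemma small_row: "j < n \<Longrightarrow> p < m \<Longrightarrow> \<not> big j \<Longrightarrow> wt j p \<le> \<delta> * len j"
proof -
  assume a: "j < n" "p < m" "\<not> big j"
  have "real (A j p) \<le> row_norm_inf m A j" unfolding row_norm_inf_def using a(2) by (intro Max_ge) auto
  also have "\<dots> \<le> \<delta> * row_norm1 m A j" using a row by (simp add: big_def)
  finally have "s j * real (A j p) \<le> s j * (\<delta> * row_norm1 m A j)" using s0[OF a(1)] by simp
  also have "\<dots> = \<delta> * len j" unfolding len_def row_norm1_def wt_def by (simp add: sum_distrib_left mult_ac)
  finally show ?thesis by (simp add: wt_def)
qed

text \<open>Per unit of length, a small row passes at most \<open>\<delta>\<close> through a single
  column, and the lengths passed add up to at most \<open>t' - t\<close>.\<close>

lemma flow_diff_small: "0 \<le> t \<Longrightarrow> t \<le> t' \<Longrightarrow> p < m \<Longrightarrow> (\<And>j. J j \<Longrightarrow> \<not> big j) \<Longrightarrow>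
  flow J t' p - flow J t p \<le> \<delta> * (t' - t)"
proof -
  assume a: "0 \<le> t" "t \<le> t'" "p < m" "\<And>j. J j \<Longrightarrow> \<not> big j"
  have "flow J t' p - flow J t p \<le> (\<Sum>j<n. \<delta> * (clp t' j - clp t j))"
    unfolding flow_diff
  proof (rule sum_mono)
    fix j assume "j \<in> {..<n}"
    then have j: "j < n" by simp
    have d0: "0 \<le> \<delta> * (clp t' j - clp t j)" using clp_mono[OF a(2), of j] \<delta> by simp
    show "of_bool (J j) * ((clp t' j - clp t j) / len j) * wt j p \<le> \<delta> * (clp t' j - clp t j)"
    proof (cases "J j")
      case True
      have "(clp t' j - clp t j) / len j * wt j p \<le> (clp t' j - clp t j) / len j * (\<delta> * len j)"
        using small_row[OF j a(3) a(4)[OF True]] ratio0[OF j a(2)] by (rule mult_left_mono)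
      also have "\<dots> = \<delta> * ((clp t' j - clp t j) / len j * len j)" by simp
      also have "\<dots> = \<delta> * (clp t' j - clp t j)" by (simp only: ratio_len[OF j])
      finally show ?thesis using True by simp
    qed (use d0 in simp)
  qed
  also have "\<dots> = \<delta> * (\<Sum>j<n. clp t' j - clp t j)" by (simp add: sum_distrib_left)
  also have "\<dots> \<le> \<delta> * (t' - t)" using sum_clp_diff[OF a(1,2)] \<delta> by (intro mult_left_mono) auto
  finally show ?thesis .
qed

lemma flow_0 [simp]: "flow J 0 p = 0"
proof -
  have "clp 0 j = 0" if "j < n" for j using cum0[of j] len0[of j] that by (simp add: clp_def)
  then show ?thesis by (simp add: flow_def)
qed

text \<open>By the column hypothesis all rows together put at most 1 into a column.\<close>

lemma flow_le_1: "p < m \<Longrightarrow> flow J t p \<le> 1"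
proof -
  assume p: "p < m"
  have "flow J t p \<le> (\<Sum>j<n. wt j p)" unfolding flow_def
  proof (rule sum_mono)
    fix j assume "j \<in> {..<n}"
    then have j: "j < n" by simp
    have "clp t j / len j \<le> 1" "0 \<le> clp t j / len j" using clp_le[of t j] clp0[OF j, of t] len0[OF j]
      by (auto simp: divide_le_eq_1)
    then show "of_bool (J j) * (clp t j / len j) * wt j p \<le> wt j p"
      using wt0[OF j, of p] mult_right_mono[of "clp t j / len j" 1 "wt j p"] by (cases "J j") auto
  qed
  also have "\<dots> \<le> 1" using col[OF p] by (simp add: wt_def)
  finally show ?thesis .
qed

text \<open>No row is cut at a row boundary, so the flow there is a genuine prefix sum; this links
  the grid errors to the prefixes in the claim.\<close>

lemma flow_cum: "c \<le> n \<Longrightarrow> p < m \<Longrightarrow> flow J (cum c) p = (\<Sum>j<c. of_bool (J j) * wt j p)"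
proof -
  assume c: "c \<le> n" "p < m"
  have "flow J (cum c) p = (\<Sum>j<n. if j < c then of_bool (J j) * wt j p else 0)"
    unfolding flow_def
  proof (rule sum.cong[OF refl])
    fix j assume "j \<in> {..<n}"
    then have j: "j < n" by simp
    show "of_bool (J j) * (clp (cum c) j / len j) * wt j p = (if j < c then of_bool (J j) * wt j p else 0)"
    proof (cases "j < c")
      case True
      then have "cum j + len j \<le> cum c" using cum_mono[of "Suc j" c] c by (simp add: cum_Suc)
      then have "clp (cum c) j = len j" using len0[OF j] by (simp add: clp_def)
      then show ?thesis using True wt_len0[OF j c(2)] by (cases "len j = 0") auto
    next
      case False
      then have "cum c \<le> cum j" using cum_mono[of c j] j by simp
      then have "clp (cum c) j = 0" using len0[OF j] by (simp add: clp_def)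
      then show ?thesis using False by simp
    qed
  qed
  also have "\<dots> = (\<Sum>j<c. of_bool (J j) * wt j p)"
    using c(1) by (intro sum.mono_neutral_cong_right) auto
  finally show ?thesis .
qed

lemma flow_dot_diff:
  assumes "0 \<le> t" "t \<le> t'" "\<And>p. p < m \<Longrightarrow> \<bar>z p\<bar> \<le> 1"
  shows "\<bar>dot m (flow J t') z - dot m (flow J t) z\<bar> \<le> t' - t"
proof -
  have eq: "dot m (flow J t') z - dot m (flow J t) z = (\<Sum>p<m. (flow J t' p - flow J t p) * z p)"
    unfolding dot_def by (simp add: sum_subtractf[symmetric] algebra_simps)
  have "\<bar>\<Sum>p<m. (flow J t' p - flow J t p) * z p\<bar> \<le> (\<Sum>p<m. \<bar>(flow J t' p - flow J t p) * z p\<bar>)"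
    by (rule sum_abs)
  also have "\<dots> \<le> (\<Sum>p<m. flow J t' p - flow J t p)"
  proof (rule sum_mono)
    fix p assume "p \<in> {..<m}"
    then show "\<bar>(flow J t' p - flow J t p) * z p\<bar> \<le> flow J t' p - flow J t p"
      using flow_diff_nonneg[OF assms(2), of J p] assms(3)[of p] by (simp add: abs_mult mult_left_le)
  qed
  also have "\<dots> \<le> t' - t" by (rule flow_diff_sum[OF assms(1,2)])
  finally show ?thesis unfolding eq .
qed

section \<open>Norms and number of the constraints\<close>

lemma R: "1 \<le> R" "R \<le> m" "real R ^ 2 * \<delta> \<le> 1" "1 / real m \<le> \<delta> \<Longrightarrow> 1 / real R \<le> 2 * sqrt \<delta>"
  using rate[OF \<delta>, of m] m64 unfolding R_def by auto

lemma H: "m \<le> 8 ^ H" "H \<le> m" "8 ^ H \<le> 8 * m" using depth[of m] m64 by (auto simp: H_def)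

lemma Qpos: "0 < Q" by (simp add: Q_def)

lemma t12: "0 \<le> t2 i" "t2 i \<le> t1 i" "0 < ht i \<Longrightarrow> t1 i - t2 i \<le> 512 / 8 ^ ht i"
proof -
  show "0 \<le> t2 i" by (simp add: t2_def)
  have le: "8 * (loc i div 8) \<le> loc i" "loc i \<le> 8 * (loc i div 8) + 8" by presburger+
  have "real (8 * (loc i div 8)) \<le> real (loc i)" using le(1) of_nat_mono by blast
  then have l1: "8 * real (loc i div 8) \<le> real (loc i)" by simp
  have "real (loc i) \<le> real (8 * (loc i div 8) + 8)" using le(2) of_nat_mono by blast
  then have l2: "real (loc i) \<le> 8 * real (loc i div 8) + 8" by simp
  show "t2 i \<le> t1 i" unfolding t1_def t2_def using l1 by (auto simp: divide_right_mono)
  assume "0 < ht i"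
  then have "t1 i - t2 i = (64 * real (loc i) - 64 * (8 * real (loc i div 8))) / 8 ^ ht i"
    by (simp add: t1_def t2_def diff_divide_distrib)
  also have "\<dots> \<le> 512 / 8 ^ ht i" using l2 by (intro divide_right_mono) auto
  finally show "t1 i - t2 i \<le> 512 / 8 ^ ht i" .
qed

lemma piece0: "0 \<le> piece i p" unfolding piece_def by (rule flow_diff_nonneg) (rule t12)
lemma piece_sum: "(\<Sum>p<m. piece i p) \<le> t1 i - t2 i" unfolding piece_def by (intro flow_diff_sum t12)

lemma norm_g: "dot m (g i) (g i) = of_bool (inr i) * (4 ^ ht i * real R ^ 2 / 2048 ^ 2) * dot m (piece i) (piece i)"
proof -
  have "g i = (\<lambda>p. (of_bool (inr i) * 2 ^ ht i * real R / 2048) * piece i p)" by (auto simp: g_def)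
  then have "dot m (g i) (g i) = (of_bool (inr i) * 2 ^ ht i * real R / 2048)^2 * dot m (piece i) (piece i)"
    by (simp only: dot_simps) (simp add: power2_eq_square)
  also have "(of_bool (inr i) * 2 ^ ht i * real R / 2048)^2 = of_bool (inr i) * (4 ^ ht i * real R ^ 2 / 2048 ^ 2)"
    by (simp add: power_mult_distrib power_divide power2_eq_square power_mult_distrib[symmetric])
  finally show ?thesis .
qed

text \<open>Entries are at most 1 and add up to at most \<open>m\<close>, and
  \<open>R \<le> m\<close>. For big rows no smallness in \<open>\<delta>\<close> is available; a
  polynomial bound is enough for the trace that sets the length of the power iteration.\<close>

lemma norm_hard: "hard i \<Longrightarrow> dot m (g i) (g i) \<le> real m ^ 3 / 2048 ^ 2"
proof -
  assume h: "hard i"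
  then have h0: "ht i = 0" by (auto simp: hard_def ht_def)
  have "t2 i = 0" using h0 by (simp add: t2_def)
  then have "piece i p = flow (sel i) (t1 i) p" for p by (simp add: piece_def)
  then have p1: "p < m \<Longrightarrow> piece i p \<le> 1" for p using flow_le_1 by simp
  have "t1 i \<le> real m"
  proof -
    have "64 * loc i \<le> m" using h h0 by (simp add: hard_def inr_def)
    then have "real (64 * loc i) \<le> real m" by (simp only: of_nat_le_iff)
    then show ?thesis using h0 by (simp add: t1_def)
  qed
  have "dot m (piece i) (piece i) \<le> (\<Sum>p<m. piece i p)"
    unfolding dot_def using p1 piece0 by (intro sum_mono) (auto intro: mult_left_le)
  also have "\<dots> \<le> real m" using piece_sum[of i] \<open>t2 i = 0\<close> \<open>t1 i \<le> real m\<close> by simp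
  finally have d: "dot m (piece i) (piece i) \<le> real m" .
  have "real R ^ 2 \<le> real m ^ 2" using R(2) by (intro power_mono) auto
  then have "real R ^ 2 / 2048 ^ 2 * dot m (piece i) (piece i) \<le> real m ^ 2 / 2048 ^ 2 * real m"
    using d by (intro mult_mono divide_right_mono) auto
  then show ?thesis unfolding norm_g using h h0 by (simp add: hard_def power3_eq_cube power2_eq_square)
qed

text \<open>The squared norm of an increment is at most its maximum times its sum, that is
  \<open>\<delta> * D * D\<close> with \<open>D = 512 / 8 ^ h\<close>. Then
  \<open>R\<^sup>2 * \<delta> \<le> 1\<close> removes \<open>\<delta>\<close>, and
  \<open>4 ^ h / 64 ^ h = 1 / 16 ^ h\<close>.\<close>

lemma norm_soft:
  assumes "\<not> hard i"
  shows "dot m (g i) (g i) \<le> of_bool (inr i \<and> 2 \<le> kd i) * (1 / 16 / 16 ^ ht i)"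
proof (cases "inr i")
  case True
  then have k: "2 \<le> kd i" using assms by (auto simp: hard_def)
  then have h: "0 < ht i" by (simp add: ht_def)
  let ?D = "512 / 8 ^ ht i :: real"
  have sm: "piece i p \<le> \<delta> * ?D" if "p < m" for p
  proof -
    have "piece i p \<le> \<delta> * (t1 i - t2 i)" unfolding piece_def
      by (rule flow_diff_small[OF t12(1,2) that]) (use k in \<open>auto simp: sel_def\<close>)
    also have "\<dots> \<le> \<delta> * ?D" using t12(3)[OF h] \<delta> by (intro mult_left_mono) auto
    finally show ?thesis .
  qed
  have "dot m (piece i) (piece i) \<le> (\<Sum>p<m. (\<delta> * ?D) * piece i p)"
    unfolding dot_def using sm piece0 by (intro sum_mono mult_right_mono) auto
  also have "\<dots> = (\<delta> * ?D) * (\<Sum>p<m. piece i p)" by (simp add: sum_distrib_left)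
  also have "\<dots> \<le> (\<delta> * ?D) * ?D"
    using piece_sum[of i] t12(3)[OF h] \<delta> by (intro mult_left_mono) auto
  finally have d: "dot m (piece i) (piece i) \<le> \<delta> * ?D * ?D" .
  have "dot m (g i) (g i) \<le> (4 ^ ht i * real R ^ 2 / 2048 ^ 2) * (\<delta> * ?D * ?D)"
    unfolding norm_g using True mult_left_mono[OF d, of "4 ^ ht i * real R ^ 2 / 2048 ^ 2"] by (simp del: divide_le_cancel)
  also have "\<dots> = (real R ^ 2 * \<delta>) * (4 ^ ht i / (16 * (8 ^ ht i * 8 ^ ht i)))" by (simp add: field_simps)
  also have "\<dots> \<le> 1 * (4 ^ ht i / (16 * (8 ^ ht i * 8 ^ ht i)))" using R(3) by (intro mult_right_mono) auto
  also have "\<dots> = 1 / 16 / 16 ^ ht i"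
    by (simp add: power_mult_distrib[symmetric] power_divide[symmetric])
       (simp add: divide_simps power_mult_distrib[symmetric])
  finally show ?thesis using True k by simp
qed (simp add: norm_g)

lemma card_inr: "real (card {q. q < Q \<and> 64 * q \<le> m * 8 ^ h}) \<le> real m * 8 ^ h / 64 + 1"
proof -
  have "real (card {q. q < Q \<and> 64 * q \<le> m * 8 ^ h}) \<le> real (m * 8 ^ h div 64 + 1)"
    using card_mult_le[of 64 Q "m * 8 ^ h"] by (intro of_nat_mono) auto
  also have "\<dots> \<le> real (m * 8 ^ h) / 64 + 1" using of_nat_div_le_of_nat[of "m * 8 ^ h" 64, where 'a = real] by simp
  finally show ?thesis by simp
qed

lemma sum_of_bool_card: "(\<Sum>q<(M::nat). of_bool (P q) * (c::real)) = real (card {q. q < M \<and> P q}) * c"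
proof -
  have "{q. q < M \<and> P q} = {..<M} \<inter> {q. P q}" by auto
  then show ?thesis by (simp add: sum_distrib_right[symmetric])
qed

text \<open>Level \<open>h\<close> has at most \<open>m * 8 ^ h / 64 + 1\<close> constraints of
  squared norm at most \<open>1 / (16 * 16 ^ h)\<close>. The main terms add up to at most
  \<open>m / 1024\<close>, the extra points to at most \<open>1 / 128\<close>.\<close>

lemma soft_total: "(\<Sum>i | i < N \<and> \<not> hard i. dot m (g i) (g i)) \<le> real m / 512"
proof -
  let ?f = "\<lambda>k q. of_bool (64 * q \<le> m * 8 ^ (k - 1) \<and> 2 \<le> k) * (1 / 16 / 16 ^ (k - 1)) :: real"
  have "(\<Sum>i | i < N \<and> \<not> hard i. dot m (g i) (g i)) \<le> (\<Sum>i | i < N \<and> \<not> hard i. ?f (kd i) (loc i))"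
    using norm_soft by (intro sum_mono) (auto simp: inr_def ht_def)
  also have "\<dots> \<le> (\<Sum>i<N. ?f (kd i) (loc i))" by (intro sum_mono2) auto
  also have "\<dots> = (\<Sum>k<H+2. \<Sum>q<Q. ?f k q)"
    unfolding N_def kd_def loc_def by (rule sum_div_mod[OF Qpos])
  \<comment> \<open>The blocks 0 and 1 are hard and drop out, which shifts the index by two.\<close>
  also have "\<dots> = (\<Sum>k<H. \<Sum>q<Q. ?f (Suc (Suc k)) q)"
    by (simp only: add_2_eq_Suc' sum.lessThan_Suc_shift) simp
  also have "\<dots> = (\<Sum>k<H. real (card {q. q < Q \<and> 64 * q \<le> m * 8 ^ Suc k}) * (1 / 16 / 16 ^ Suc k))"
    by (simp only: sum_of_bool_card diff_Suc_1) simp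
  also have "\<dots> \<le> (\<Sum>k<H. (real m * 8 ^ Suc k / 64 + 1) * (1 / 16 / 16 ^ Suc k))"
    by (intro sum_mono mult_right_mono card_inr) simp
  also have "\<dots> \<le> (\<Sum>k<H. real m / 1024 * (1 / 2) ^ Suc k + 1 / 16 * (1 / 2) ^ Suc k / 8)"
  proof (rule sum_mono)
    fix k :: nat
    have e: "(8::real) ^ Suc k / 16 ^ Suc k = (1 / 2) ^ Suc k" by (simp add: power_divide[symmetric])
    have "(1 / 16) ^ Suc k \<le> (1 / 2) ^ Suc k / (8::real)"
    proof -
      have "(1 / 16 :: real) ^ k \<le> (1 / 2) ^ k" by (intro power_mono) auto
      then show ?thesis by simp
    qed
    moreover have "(real m * 8 ^ Suc k / 64 + 1) * (1 / 16 / 16 ^ Suc k) =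
        real m / 1024 * (8 ^ Suc k / 16 ^ Suc k) + 1 / 16 * (1 / 16) ^ Suc k"
      by (simp add: field_simps power_divide)
    ultimately show "(real m * 8 ^ Suc k / 64 + 1) * (1 / 16 / 16 ^ Suc k)
        \<le> real m / 1024 * (1 / 2) ^ Suc k + 1 / 16 * (1 / 2) ^ Suc k / 8" unfolding e by simp
  qed
  also have "\<dots> = (real m / 1024 + 1 / 128) * (\<Sum>k<H. (1 / 2) ^ Suc k)"
    by (simp add: sum.distrib sum_distrib_left[symmetric] sum_divide_distrib[symmetric] algebra_simps)
  also have "\<dots> \<le> (real m / 1024 + 1 / 128) * 1"
  proof (intro mult_left_mono)
    have "(\<Sum>k<h. (1 / 2) ^ Suc k) = 1 - (1 / 2 :: real) ^ h" for h by (induction h) auto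
    from this[of H] show "(\<Sum>k<H. (1 / 2) ^ Suc k) \<le> (1::real)" by simp
  qed simp
  also have "\<dots> \<le> real m / 512" using m64 by simp
  finally show ?thesis .
qed

text \<open>There are two grids of width 64 on a line of length \<open>m\<close>, that of the big
  rows and level 0 of the small rows, each with at most \<open>m / 64 + 1\<close> points.\<close>

lemma hard_count: "real (card {i. i < N \<and> hard i}) \<le> real m / 32 + 2"
proof -
  let ?f = "\<lambda>k q. of_bool (64 * q \<le> m * 8 ^ (k - 1) \<and> k < 2) :: real"
  have "real (card {i. i < N \<and> hard i}) = (\<Sum>i<N. ?f (kd i) (loc i))"
    using sum_of_bool_card[of "\<lambda>i. hard i" 1 N] by (simp add: hard_def inr_def ht_def)
  also have "\<dots> = (\<Sum>k<H+2. \<Sum>q<Q. ?f k q)"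
    unfolding N_def kd_def loc_def by (rule sum_div_mod[OF Qpos])
  also have "\<dots> = (\<Sum>q<Q. ?f 0 q) + (\<Sum>q<Q. ?f 1 q)"
    by (simp only: add_2_eq_Suc' sum.lessThan_Suc_shift) simp
  also have "\<dots> = 2 * real (card {q. q < Q \<and> 64 * q \<le> m * 8 ^ 0})"
    using sum_of_bool_card[of "\<lambda>q. 64 * q \<le> m" 1 Q] by simp
  also have "\<dots> \<le> real m / 32 + 2" using card_inr[of 0] by simp
  finally show ?thesis .
qed

lemma total: "(\<Sum>i<N. dot m (g i) (g i)) \<le> real m ^ 5"
proof -
  have m1: "1 \<le> real m" using m64 by simp
  have "{..<N} = {i. i < N \<and> \<not> hard i} \<union> {i. i < N \<and> hard i}" by auto
  then have "(\<Sum>i<N. dot m (g i) (g i)) =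
      (\<Sum>i | i < N \<and> \<not> hard i. dot m (g i) (g i)) + (\<Sum>i | i < N \<and> hard i. dot m (g i) (g i))"
    by (simp only:) (rule sum.union_disjoint, auto)
  also have "\<dots> \<le> real m / 512 + (\<Sum>i | i < N \<and> hard i. real m ^ 3 / 2048 ^ 2)"
    using soft_total norm_hard by (intro add_mono sum_mono) auto
  also have "\<dots> \<le> real m / 512 + (real m / 32 + 2) * (real m ^ 3 / 2048 ^ 2)"
    using hard_count by (simp add: mult_right_mono)
  also have "\<dots> \<le> real m ^ 5 / 2 + real m * (real m ^ 3 / 2)"
  proof (intro add_mono mult_mono)
    have "real m \<le> real m ^ 5" using m1 by (rule self_le_power) simp
    then show "real m / 512 \<le> real m ^ 5 / 2" using m1 by linarith
  qed (use m64 in auto)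
  also have "\<dots> \<le> real m ^ 5"
  proof -
    have "real m ^ 4 \<le> real m ^ 5" using m1 by (intro power_increasing) auto
    then show ?thesis by (simp add: power4_eq_xxxx power3_eq_cube)
  qed
  finally show ?thesis .
qed

text \<open>The requirements are homogeneous in \<open>G\<close>: the walk over the reals takes
  \<open>G = 1\<close>, the program a common denominator.\<close>

lemma walk_scaled:
  assumes "0 < G"
  shows "walk m N (\<lambda>i p. G * g i p) G hard x"
proof
  have sc: "dot m (\<lambda>p. G * g i p) (\<lambda>p. G * g i p) = G\<^sup>2 * dot m (g i) (g i)" for i
    by (simp only: dot_simps) (simp add: power2_eq_square)
  show "(\<Sum>i | i < N \<and> \<not> hard i. dot m (\<lambda>p. G * g i p) (\<lambda>p. G * g i p)) \<le> G\<^sup>2 * real m / 512"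
    unfolding sc sum_distrib_left[symmetric] using mult_left_mono[OF soft_total, of "G\<^sup>2"] by simp
  show "real (card {i. i < N \<and> hard i}) \<le> real m / 32 + 2" by (rule hard_count)
qed (use assms m64 x01 in auto)

lemma total_scaled: "(\<Sum>i<N. dot m (\<lambda>p. G * g i p) (\<lambda>p. G * g i p)) \<le> real m ^ 5 * G\<^sup>2"
proof -
  have sc: "dot m (\<lambda>p. G * g i p) (\<lambda>p. G * g i p) = G\<^sup>2 * dot m (g i) (g i)" for i
    by (simp only: dot_simps) (simp add: power2_eq_square)
  show ?thesis
    unfolding sc sum_distrib_left[symmetric] using mult_left_mono[OF total, of "G\<^sup>2"] by (simp add: mult.commute)
qed

section \<open>Chaining along the grids\<close>

lemma flow_step:
  assumes "q < Q" "k < H + 2" and q: "64 * q \<le> m * 8 ^ (k - 1)"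
  defines "i \<equiv> k * Q + q"
  shows "i < N" "inr i" "kd i = k" "ht i = k - 1" "loc i = q" "hard i \<longleftrightarrow> k < 2"
    "dot m (g i) z = 2 ^ (k - 1) * real R / 2048 * (dot m (flow (sel i) (t1 i)) z - dot m (flow (sel i) (t2 i)) z)"
proof -
  have "i < (k + 1) * Q" using assms by simp
  also have "\<dots> \<le> N" using assms(2) unfolding N_def by (intro mult_right_mono) auto
  finally show "i < N" .
  show kd: "kd i = k" and lc: "loc i = q" using assms(1) by (auto simp: kd_def loc_def i_def)
  show ht: "ht i = k - 1" using kd by (simp add: ht_def)
  show inr: "inr i" using q ht lc by (simp add: inr_def)
  show "hard i \<longleftrightarrow> k < 2" using inr kd by (simp add: hard_def)
  have "g i = (\<lambda>p. (2 ^ (k - 1) * real R / 2048) * (flow (sel i) (t1 i) p - flow (sel i) (t2 i) p))"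
    using inr ht by (auto simp: g_def piece_def)
  then show "dot m (g i) z = 2 ^ (k - 1) * real R / 2048 * (dot m (flow (sel i) (t1 i)) z - dot m (flow (sel i) (t2 i)) z)"
    by (simp only: dot_simps)
qed

definition "cell h t = nat \<lfloor>t * 8 ^ h / 64\<rfloor>"

text \<open>The last claim makes the increments telescope: the cell of \<open>t\<close> on level
  \<open>h + 1\<close> lies inside its cell on level \<open>h\<close>, so the lower end of one
  increment is the upper end of the previous one.\<close>

lemma cell:
  assumes "0 \<le> t" "t \<le> real m"
  shows "64 * real (cell h t) / 8 ^ h \<le> t" "t < 64 * real (cell h t) / 8 ^ h + 64 / 8 ^ h"
    "64 * cell h t \<le> m * 8 ^ h" "h \<le> H \<Longrightarrow> cell h t < Q" "cell (Suc h) t div 8 = cell h t"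
proof -
  have "0 \<le> t * 8 ^ h / 64" using assms by simp
  then have c: "real (cell h t) = of_int \<lfloor>t * 8 ^ h / 64\<rfloor>" by (simp add: cell_def)
  have le: "real (cell h t) \<le> t * 8 ^ h / 64" unfolding c by (rule of_int_floor_le)
  then show "64 * real (cell h t) / 8 ^ h \<le> t" by (simp add: field_simps)
  have lt: "t * 8 ^ h / 64 < real (cell h t) + 1" unfolding c by linarith
  then show "t < 64 * real (cell h t) / 8 ^ h + 64 / 8 ^ h" by (simp add: field_simps)
  have "64 * real (cell h t) \<le> t * 8 ^ h" using le by simp
  also have "\<dots> \<le> real m * 8 ^ h" using assms by (intro mult_right_mono) auto
  finally have "real (64 * cell h t) \<le> real (m * 8 ^ h)" by simp
  then show 1: "64 * cell h t \<le> m * 8 ^ h" by (simp only: of_nat_le_iff)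
  show "cell h t < Q" if "h \<le> H"
  proof -
    have "m * 8 ^ h \<le> m * 8 ^ H" using that by simp
    then show ?thesis using 1 unfolding Q_def by linarith
  qed
  have "\<lfloor>t * 8 ^ h / 64\<rfloor> = \<lfloor>t * 8 ^ Suc h / 64\<rfloor> div 8"
    using floor_divide_real_eq_div[of 8 "t * 8 ^ Suc h / 64"] by simp
  then show "cell (Suc h) t div 8 = cell h t"
    using assms by (simp add: cell_def nat_div_distrib)
qed

text \<open>Level 0 is hard and errs by at most \<open>2048 / R\<close>, level \<open>h > 0\<close>
  by at most three times \<open>2048 / (2 ^ h * R)\<close>; together this is less than
  \<open>4 * 2048 / R\<close>. From the finest grid point to \<open>t\<close> at most
  \<open>64 / 8 ^ H \<le> 64 / m\<close> is missing, by Lipschitz continuity.\<close>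

lemma small_bound:
  assumes z: "\<And>p. p < m \<Longrightarrow> \<bar>z p\<bar> \<le> 1"
    and g: "\<And>i. i < N \<Longrightarrow> \<bar>dot m (g i) z\<bar> \<le> (if hard i then 1 else 3)"
    and t: "0 \<le> t" "t \<le> real m"
  shows "\<bar>dot m (flow (\<lambda>j. \<not> big j) t) z\<bar> \<le> 8192 / real R + 64 / real m"
proof -
  let ?F = "\<lambda>t. dot m (flow (\<lambda>j. \<not> big j) t) z"
  let ?t = "\<lambda>h. 64 * real (cell h t) / 8 ^ h"
  have Rpos: "0 < real R" using R(1) by simp
  \<comment> \<open>\<open>4 - 3 / 2 ^ h\<close> is 1 plus the sum of \<open>3 / 2 ^ l\<close> over
    \<open>0 < l \<le> h\<close>.\<close>
  have "h \<le> H \<Longrightarrow> \<bar>?F (?t h)\<bar> \<le> 2048 / real R * (4 - 3 / 2 ^ h)" for h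
  proof (induction h)
    case 0
    note s = flow_step[of "cell 0 t" 1]
    have c: "cell 0 t < Q" "64 * cell 0 t \<le> m * 8 ^ (1 - 1)" using cell[OF t, of 0] by auto
    let ?i = "1 * Q + cell 0 t"
    have "sel ?i = (\<lambda>j. \<not> big j)" using s(3)[OF c(1) _ c(2)] by (auto simp: sel_def)
    moreover have "t1 ?i = ?t 0" "t2 ?i = 0" using s(4,5)[OF c(1) _ c(2)] by (auto simp: t1_def t2_def)
    moreover have "\<bar>dot m (g ?i) z\<bar> \<le> 1" using g[of ?i] s(1,6)[OF c(1) _ c(2)] by auto
    ultimately have "\<bar>real R / 2048 * ?F (?t 0)\<bar> \<le> 1"
      using s(7)[OF c(1) _ c(2), of z] by (simp add: dot_def)
    then have "real R / 2048 * \<bar>?F (?t 0)\<bar> \<le> 1" by (simp add: abs_mult)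
    then show ?case using Rpos by (simp add: field_simps)
  next
    case (Suc h)
    let ?k = "Suc (Suc h)"
    note s = flow_step[of "cell (Suc h) t" ?k]
    have c: "cell (Suc h) t < Q" "?k < H + 2" "64 * cell (Suc h) t \<le> m * 8 ^ (?k - 1)"
      using cell(3,4)[OF t, of "Suc h"] Suc.prems by auto
    let ?i = "?k * Q + cell (Suc h) t"
    have ht: "ht ?i = Suc h" using s(4)[OF c] by simp
    have "sel ?i = (\<lambda>j. \<not> big j)" using s(3)[OF c] by (auto simp: sel_def)
    moreover have "t1 ?i = ?t (Suc h)" using s(5)[OF c] ht by (simp add: t1_def)
    moreover have "t2 ?i = ?t h" using s(5)[OF c] ht cell(5)[OF t, of h] by (simp add: t2_def)
    moreover have "\<bar>dot m (g ?i) z\<bar> \<le> 3" using g[of ?i] s(1,6)[OF c] by auto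
    ultimately have "\<bar>2 ^ Suc h * real R / 2048 * (?F (?t (Suc h)) - ?F (?t h))\<bar> \<le> 3"
      using s(7)[OF c, of z] by simp
    then have "2 ^ Suc h * real R / 2048 * \<bar>?F (?t (Suc h)) - ?F (?t h)\<bar> \<le> 3"
      by (simp add: abs_mult)
    then have "\<bar>?F (?t (Suc h)) - ?F (?t h)\<bar> \<le> 2048 / real R * (3 / 2 ^ Suc h)"
      using Rpos by (simp add: field_simps)
    then have "\<bar>?F (?t (Suc h))\<bar> \<le> 2048 / real R * (4 - 3 / 2 ^ h) + 2048 / real R * (3 / 2 ^ Suc h)"
      using Suc by linarith
    also have "\<dots> = 2048 / real R * ((4 - 3 / 2 ^ h) + 3 / 2 ^ Suc h)" by (simp only: distrib_left)
    also have "(4 - 3 / 2 ^ h) + 3 / 2 ^ Suc h = 4 - 3 / (2 ^ Suc h :: real)" by simp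
    finally show ?case .
  qed
  from this[of H] have "\<bar>?F (?t H)\<bar> \<le> 2048 / real R * (4 - 3 / 2 ^ H)" by simp
  also have "\<dots> \<le> 2048 / real R * 4" using Rpos by (intro mult_left_mono) auto
  finally have 1: "\<bar>?F (?t H)\<bar> \<le> 8192 / real R" by simp
  have "\<bar>?F t - ?F (?t H)\<bar> \<le> t - ?t H" using cell(1)[OF t, of H] z by (intro flow_dot_diff) auto
  also have "\<dots> \<le> 64 / 8 ^ H" using cell(2)[OF t, of H] by simp
  also have "\<dots> \<le> 64 / real m"
  proof -
    have "real m \<le> real (8 ^ H)" using H(1) by (simp only: of_nat_le_iff)
    then show ?thesis using m64 by (intro divide_left_mono) auto
  qed
  finally show ?thesis using 1 by linarith
qed

text \<open>A constant error is allowed here, so one grid is enough: \<open>2048\<close> comes from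
  the grid point and \<open>64\<close> from the width of a cell.\<close>

lemma big_bound:
  assumes z: "\<And>p. p < m \<Longrightarrow> \<bar>z p\<bar> \<le> 1"
    and g: "\<And>i. i < N \<Longrightarrow> \<bar>dot m (g i) z\<bar> \<le> (if hard i then 1 else 3)"
    and t: "0 \<le> t" "t \<le> real m"
  shows "\<bar>dot m (flow big t) z\<bar> \<le> 2112"
proof -
  let ?F = "\<lambda>t. dot m (flow big t) z"
  let ?t = "64 * real (cell 0 t)"
  note s = flow_step[of "cell 0 t" 0]
  have c: "cell 0 t < Q" "64 * cell 0 t \<le> m * 8 ^ (0 - 1)" using cell[OF t, of 0] by auto
  let ?i = "0 * Q + cell 0 t"
  have "sel ?i = big" using s(3)[OF c(1) _ c(2)] by (auto simp: sel_def)
  moreover have "t1 ?i = ?t" "t2 ?i = 0" using s(4,5)[OF c(1) _ c(2)] by (auto simp: t1_def t2_def)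
  moreover have "\<bar>dot m (g ?i) z\<bar> \<le> 1" using g[of ?i] s(1,6)[OF c(1) _ c(2)] by auto
  ultimately have "\<bar>real R / 2048 * ?F ?t\<bar> \<le> 1"
    using s(7)[OF c(1) _ c(2), of z] by (simp add: dot_def)
  then have "real R * \<bar>?F ?t\<bar> \<le> 2048" by (simp add: abs_mult)
  moreover have "1 * \<bar>?F ?t\<bar> \<le> real R * \<bar>?F ?t\<bar>" using R(1) by (intro mult_right_mono) auto
  moreover have "\<bar>?F t - ?F ?t\<bar> \<le> t - ?t" using cell(1)[OF t, of 0] z by (intro flow_dot_diff) auto
  moreover have "t - ?t \<le> 64" using cell(2)[OF t, of 0] by simp
  ultimately show ?thesis by linarith
qed

lemma flow_no_small:
  assumes "\<And>j p. j < n \<Longrightarrow> p < m \<Longrightarrow> \<not> big j \<Longrightarrow> wt j p = 0"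
  shows "dot m (flow (\<lambda>j. \<not> big j) t) z = 0"
  unfolding dot_def flow_def using assms by (intro sum.neutral ballI) (auto intro!: sum.neutral)

text \<open>The 1-norm of a row is at most \<open>m\<close> times its maximum norm, so the row
  hypothesis for a nonzero small row forces \<open>m * \<delta> \<ge> 1\<close>. This makes the
  leftover \<open>64 / m\<close> of order \<open>\<delta>\<close>.\<close>

lemma delta_ge:
  assumes "j < n" "p < m" "\<not> big j" "wt j p \<noteq> 0"
  shows "1 / real m \<le> \<delta>"
proof -
  have "0 < wt j p" using wt0[OF assms(1), of p] assms(4) by simp
  then have l: "0 < len j" using wt_le_len[OF assms(1,2)] by linarith
  have "len j \<le> (\<Sum>p<m. \<delta> * len j)" unfolding len_def[of j]
    using small_row[OF assms(1) _ assms(3)] by (intro sum_mono) (simp add: len_def)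
  also have "\<dots> = real m * \<delta> * len j" by simp
  finally have "1 \<le> real m * \<delta>" using l by simp
  then show ?thesis using m64 by (simp add: field_simps)
qed

section \<open>From constraint errors to the rounding bounds\<close>

lemma good_rounding_if:
  assumes y: "\<And>p. p < m \<Longrightarrow> 0 \<le> y p \<and> y p \<le> 1"
    and sum0: "(\<Sum>p<m. y p - x p) = 0"
    and lead0: "dot m lead (\<lambda>p. y p - x p) = 0"
    and g: "\<And>i. i < N \<Longrightarrow> \<bar>dot m (g i) (\<lambda>p. y p - x p)\<bar> \<le> (if hard i then 1 else 3)"
    and fr: "m \<le> 2 * card {p. p < m \<and> \<not> (0 < y p \<and> y p < 1)}"
  shows "good_rounding 100000 n m A s x \<delta> \<epsilon> y"
proof -
  define z where "z = (\<lambda>p. y p - x p)"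
  have z: "\<bar>z p\<bar> \<le> 1" if "p < m" for p using y[OF that] x01[OF that] by (auto simp: z_def)
  have g': "\<bar>dot m (g i) z\<bar> \<le> (if hard i then 1 else 3)" if "i < N" for i using g[OF that] by (simp add: z_def)
  define e where "e J j = of_bool (J j) * (\<Sum>p<m. wt j p * z p)" for J :: "nat \<Rightarrow> bool" and j
  have sum_e: "(\<Sum>j<c. e J j) = dot m (flow J (cum c)) z" if "c \<le> n" for J c
  proof -
    have "dot m (flow J (cum c)) z = (\<Sum>p<m. (\<Sum>j<c. of_bool (J j) * wt j p) * z p)"
      unfolding dot_def using flow_cum[OF that] by (intro sum.cong) auto
    also have "\<dots> = (\<Sum>p<m. \<Sum>j<c. of_bool (J j) * (wt j p * z p))"
      by (simp add: sum_distrib_right mult.assoc)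
    also have "\<dots> = (\<Sum>j<c. e J j)" unfolding e_def sum_distrib_left by (rule sum.swap)
    finally show ?thesis by simp
  qed
  have rowz: "(\<Sum>p<m. real (A j p) * z p) = (1 / s j) * (\<Sum>p<m. wt j p * z p)" if "j < n" for j
    using s0[OF that] unfolding wt_def by (simp add: sum_distrib_left mult.assoc)
  \<comment> \<open>The weights \<open>1 / s j\<close> increase along the prefix, and prefix sums of
    weighted rows are flows at row boundaries.\<close>
  have abel: "\<bar>\<Sum>j\<le>i. of_bool (J j) * (\<Sum>p<m. real (A j p) * z p)\<bar> \<le> 2 * T * (1 / s i)"
    if i: "i < n" and T: "\<And>c. c \<le> Suc i \<Longrightarrow> \<bar>dot m (flow J (cum c)) z\<bar> \<le> T" for J i T
  proof -
    have "(\<Sum>j\<le>i. of_bool (J j) * (\<Sum>p<m. real (A j p) * z p)) = (\<Sum>j\<le>i. (1 / s j) * e J j)"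
      using i rowz by (intro sum.cong) (auto simp: e_def)
    also have "\<bar>\<dots>\<bar> \<le> 2 * T * (1 / s i)"
    proof (rule Abel_bound)
      show "0 \<le> 1 / s j" if "j \<le> i" for j using s0[of j] that i by simp
      show "1 / s j \<le> 1 / s k" if "j \<le> k" "k \<le> i" for j k
        using smono[OF that(1)] s0[of k] that i by (intro divide_left_mono) auto
      show "\<bar>\<Sum>j<c. e J j\<bar> \<le> T" if "c \<le> Suc i" for c
        using sum_e[of c J] T[OF that] that i by simp
    qed
    finally show ?thesis .
  qed
  have main: "\<bar>\<Sum>j\<le>i. \<Sum>p<m. real (A j p) * z p\<bar> \<le>
      (if s i > \<epsilon> then 100000 * (1 / s i) else 100000 * (sqrt (ln (2 / \<delta>) * \<delta>) * (1 / s i)))" if i: "i < n" for i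
  proof (cases "big i")
    case True
    have allbig: "big j" if "j \<le> i" for j using smono[OF that i] True by (auto simp: big_def)
    have "(\<Sum>j\<le>i. \<Sum>p<m. real (A j p) * z p) = (\<Sum>j\<le>i. of_bool (big j) * (\<Sum>p<m. real (A j p) * z p))"
      using allbig by (intro sum.cong) auto
    also have "\<bar>\<dots>\<bar> \<le> 2 * 2112 * (1 / s i)"
      using cum0 cum_le i by (intro abel[OF i] big_bound[OF z g']) auto
    also have "\<dots> \<le> 100000 * (1 / s i)" using s0[OF i] by (intro mult_right_mono) auto
    finally show ?thesis using True by (simp add: big_def)
  next
    case False
    let ?a = "\<lambda>j. \<Sum>p<m. real (A j p) * z p"
    have split: "(\<Sum>j\<le>i. ?a j) = (\<Sum>j\<le>i. of_bool (big j) * ?a j) + (\<Sum>j\<le>i. of_bool (\<not> big j) * ?a j)"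
      unfolding sum.distrib[symmetric] by (intro sum.cong) auto
    \<comment> \<open>As row \<open>i\<close> is small, all big rows precede it; their sum is
      complete and equals the exactly kept \<open>lead\<close>.\<close>
    have "(\<Sum>j\<le>i. of_bool (big j) * ?a j) = (\<Sum>j<n. of_bool (big j) * ?a j)"
    proof (rule sum.mono_neutral_left)
      show "\<forall>j\<in>{..<n} - {..i}. of_bool (big j) * ?a j = 0"
      proof
        fix j assume "j \<in> {..<n} - {..i}"
        then have "s j \<le> s i" using smono[of i j] by auto
        then show "of_bool (big j) * ?a j = 0" using False by (auto simp: big_def)
      qed
    qed (use i in auto)
    also have "\<dots> = (\<Sum>p<m. \<Sum>j<n. of_bool (big j) * real (A j p) * z p)"
      unfolding sum_distrib_left mult.assoc by (rule sum.swap)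
    also have "\<dots> = dot m lead z" unfolding dot_def by (simp only: lead_def sum_distrib_right)
    also have "\<dots> = 0" using lead0 by (simp add: z_def)
    finally have b0: "(\<Sum>j\<le>i. of_bool (big j) * ?a j) = 0" .
    \<comment> \<open>\<open>16448 = 2 * 8192 + 64\<close>, from
      \<open>1 / R \<le> 2 * sqrt \<delta>\<close> and
      \<open>1 / m \<le> \<delta> \<le> sqrt \<delta>\<close>; without a nonzero small row the flow
      is 0.\<close>
    have flow: "\<bar>dot m (flow (\<lambda>j. \<not> big j) t) z\<bar> \<le> 16448 * sqrt \<delta>" if t: "0 \<le> t" "t \<le> real m" for t
    proof (cases "\<forall>j<n. \<forall>p<m. \<not> big j \<longrightarrow> wt j p = 0")
      case True
      then show ?thesis using flow_no_small[of t z] \<delta> by simp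
    next
      case False
      then have d: "1 / real m \<le> \<delta>" using delta_ge by blast
      have "1 / real R \<le> 2 * sqrt \<delta>" using R(4) d by simp
      moreover have "\<delta> \<le> sqrt \<delta>" using \<delta> by (simp add: real_le_rsqrt power2_eq_square mult_left_le)
      moreover have "\<bar>dot m (flow (\<lambda>j. \<not> big j) t) z\<bar> \<le> 8192 * (1 / real R) + 64 * (1 / real m)"
        using small_bound[OF z g' t] by simp
      ultimately show ?thesis using d by linarith
    qed
    have "\<bar>\<Sum>j\<le>i. of_bool (\<not> big j) * ?a j\<bar> \<le> 2 * (16448 * sqrt \<delta>) * (1 / s i)"
      using cum0 cum_le i by (intro abel[OF i] flow) auto
    \<comment> \<open>Since \<open>ln (2 / \<delta>) \<ge> ln 2 \<ge> 1 / 4\<close>,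
      \<open>sqrt \<delta>\<close> is at most twice the claimed square root, and
      \<open>4 * 16448 \<le> 100000\<close>.\<close>
    also have "\<dots> \<le> 100000 * (sqrt (ln (2 / \<delta>) * \<delta>) * (1 / s i))"
    proof -
      have "1 / 4 \<le> ln (2::real)" using ln2_ge_two_thirds by linarith
      also have "\<dots> \<le> ln (2 / \<delta>)" using \<delta> by (simp add: field_simps)
      finally have "(1 / 4) * \<delta> \<le> ln (2 / \<delta>) * \<delta>" using \<delta> by (intro mult_right_mono) auto
      then have "sqrt ((1 / 4) * \<delta>) \<le> sqrt (ln (2 / \<delta>) * \<delta>)" by (rule real_sqrt_le_mono)
      also have "sqrt ((1 / 4) * \<delta>) = sqrt \<delta> / 2" by (simp add: real_sqrt_mult real_sqrt_divide)
      finally have "2 * (16448 * sqrt \<delta>) \<le> 100000 * sqrt (ln (2 / \<delta>) * \<delta>)"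
        using real_sqrt_ge_zero[of \<delta>] \<delta> by linarith
      then show ?thesis using s0[OF i] mult_right_mono[of "2 * (16448 * sqrt \<delta>)" _ "1 / s i"] by simp
    qed
    finally show ?thesis using False b0 split by (simp add: big_def)
  qed
  have "{p. p < m \<and> \<not> (0 < y p \<and> y p < 1)} = {p. p < m \<and> y p \<in> {0, 1}}" using y by force
  then have "real m / 2 \<le> real (card {p. p < m \<and> y p \<in> {0, 1}})" using fr by simp
  then show ?thesis
    using y sum0 main unfolding good_rounding_def z_def by (auto simp: sum_subtractf)
qed

lemma good_rounding_walk:
  assumes "0 < G" and y: "walk.winv m N (\<lambda>i p. G * g i p) G hard lead x (4 * m\<^sup>2) y"
  shows "good_rounding 100000 n m A s x \<delta> \<epsilon> y"
proof -
  interpret W: walk m N "\<lambda>i p. G * g i p" G hard lead x by (rule walk_scaled[OF assms(1)])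
  note w = y[unfolded W.winv_def W.disp_def]
  show ?thesis
  proof (rule good_rounding_if)
    show "\<bar>dot m (g i) (\<lambda>p. y p - x p)\<bar> \<le> (if hard i then 1 else 3)" if "i < N" for i
    proof -
      have "dot m (\<lambda>p. G * g i p) (W.disp y) = G * dot m (g i) (W.disp y)" by (rule dot_scale_left)
      then have "G * \<bar>dot m (g i) (W.disp y)\<bar> \<le> G * (if hard i then 1 else 3)"
        using W.winv_final(2)[OF y that] assms(1) by (simp add: abs_mult split: if_splits)
      then show ?thesis using assms(1) by (simp add: W.disp_def)
    qed
    show "m \<le> 2 * card {p. p < m \<and> \<not> (0 < y p \<and> y p < 1)}"
      using W.winv_final(1)[OF y] by (simp add: W.frozen_def W.alive_def)
  qed (use w in auto)
qed

lemma rounding_exists: "\<exists>y. good_rounding 100000 n m A s x \<delta> \<epsilon> y"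
proof -
  interpret W: walk m N "\<lambda>i p. 1 * g i p" 1 hard lead x by (rule walk_scaled) simp
  obtain y where "W.winv (4 * m\<^sup>2) y" using W.winv_exists by blast
  then show ?thesis using good_rounding_walk[of 1] by auto
qed

end

lemma inst_if_admissible:
  assumes "admissible n m A s x \<delta> \<epsilon>"
  shows "inst n m A s x \<delta> \<epsilon>"
proof
  have a: "0 < n" "0 < \<delta>" "\<delta>\<^sup>2 \<le> 1" "\<forall>i<n. 0 < s i \<and> s i \<le> 1"
    "real m \<ge> 100 * ln (Min ((\<lambda>i. 2 / s i) ` {..<n}))" using assms by (auto simp: admissible_def)
  \<comment> \<open>All \<open>s i\<close> are at most 1, so every \<open>2 / s i\<close> is at
    least 2; then \<open>100 * ln 2 \<ge> 200 / 3 > 64\<close>.\<close>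
  have "2 \<le> Min ((\<lambda>i. 2 / s i) ` {..<n})"
    using a(1,4) by (subst Min_ge_iff) (auto simp: field_simps)
  then have "ln 2 \<le> ln (Min ((\<lambda>i. 2 / s i) ` {..<n}))" by simp
  moreover have "2 / 3 \<le> ln (2::real)" by (rule ln2_ge_two_thirds)
  ultimately have "64 < real m" using a(5) by linarith
  then show "64 \<le> m" by linarith
  show "\<delta> \<le> 1" using a(2,3) by (simp add: power2_le_iff_abs_le abs_square_le_1)
qed (use assms in \<open>auto simp: admissible_def\<close>)

section \<open>Step counts and bit lengths\<close>

text \<open>Commands are counted regardless of bit lengths, which \<open>run_exec\<close> brings
  back. There are no rules for \<open>Flip\<close> and \<open>Cond\<close>: the programs below are
  deterministic and branch by arithmetic.\<close>

inductive run :: "com \<Rightarrow> store \<Rightarrow> nat \<Rightarrow> store \<Rightarrow> bool" where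
  run_Skip: "run Skip \<sigma> 1 \<sigma>"
| run_Put: "run (Put v a e) \<sigma> 1 (\<sigma>(v := (\<sigma> v)(aval a \<sigma> := aval e \<sigma>)))"
| run_Seq: "run c1 \<sigma> S \<tau> \<Longrightarrow> run c2 \<tau> S' \<tau>' \<Longrightarrow> run (Seq c1 c2) \<sigma> (1 + S + S') \<tau>'"
| run_While_False: "\<not> bval b \<sigma> \<Longrightarrow> run (While b c) \<sigma> 1 \<sigma>"
| run_While_True: "bval b \<sigma> \<Longrightarrow> run c \<sigma> S \<tau> \<Longrightarrow> run (While b c) \<tau> S' \<tau>' \<Longrightarrow>
     run (While b c) \<sigma> (1 + S + S') \<tau>'"

text \<open>A factor by which an expression can lengthen its inputs; constants therefore count with
  their own bits.\<close>

primrec asz :: "aexp \<Rightarrow> nat" where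
  "asz (Const k) = bits k"
| "asz (Get v a) = 1 + asz a"
| "asz (Plus a b) = 1 + asz a + asz b"
| "asz (Minus a b) = 1 + asz a + asz b"
| "asz (Times a b) = 1 + asz a + asz b"
| "asz (Quot a b) = 1 + asz a + asz b"

primrec bsz :: "bexp \<Rightarrow> nat" where
  "bsz (Less a b) = 1 + asz a + asz b"
| "bsz (Neg b) = 1 + bsz b"
| "bsz (Conj b c) = 1 + bsz b + bsz c"

primrec csz :: "com \<Rightarrow> nat" where
  "csz Skip = 0"
| "csz (Put v a e) = asz a + asz e"
| "csz (Flip v) = 0"
| "csz (Seq c d) = csz c + csz d"
| "csz (Cond b c d) = bsz b + csz c + csz d"
| "csz (While b c) = bsz b + csz c"

lemma bits_le: "\<bar>k\<bar> \<le> 2 ^ L \<Longrightarrow> bits k \<le> L + 2"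
proof -
  assume "\<bar>k\<bar> \<le> 2 ^ L"
  also have "(2::int) ^ L < 2 ^ (L + 1)" by simp
  finally have "bitlen \<bar>k\<bar> \<le> int (L + 1)" by (subst bitlen_le_iff_power) (auto simp: nat_add_distrib)
  then show ?thesis by (simp add: bits_def)
qed

lemma abs_le_bits: "\<bar>k\<bar> \<le> 2 ^ bits k"
proof -
  have "\<bar>k\<bar> < 2 ^ nat (bitlen \<bar>k\<bar>)" using bitlen_le_iff_power[of "\<bar>k\<bar>" "bitlen \<bar>k\<bar>"] by simp
  also have "(2::int) ^ nat (bitlen \<bar>k\<bar>) \<le> 2 ^ bits k" unfolding bits_def by (intro power_increasing) auto
  finally show ?thesis by simp
qed

lemma abs_div_le: "\<bar>a div b\<bar> \<le> \<bar>a :: int\<bar>"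
proof (cases "b = 0 \<or> a = 0")
  case False
  show ?thesis
  proof (cases "0 < b")
    case True
    have "a div b \<le> \<bar>a\<bar>" 
      using True by (smt (verit) div_by_1 pos_imp_zdiv_neg_iff zdiv_mono2)
    moreover have "- \<bar>a\<bar> \<le> a div b"
      using True by (smt (verit) div_by_1 pos_imp_zdiv_neg_iff zdiv_mono2_neg)
    ultimately show ?thesis by linarith
  next
    case F: False
    then have b: "0 < - b" using False by linarith
    have e: "a div b = (- a) div (- b)" by simp
    have "(-a) div (-b) \<le> \<bar>a\<bar>" 
      using b by (smt (verit) div_by_1 pos_imp_zdiv_neg_iff zdiv_mono2)
    moreover have "- \<bar>a\<bar> \<le> (-a) div (-b)"
      using b by (smt (verit) div_by_1 pos_imp_zdiv_neg_iff zdiv_mono2_neg)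
    ultimately show ?thesis using e by linarith
  qed
qed auto

text \<open>The basis of comparisons without branching: since division rounds down and
  \<open>\<bar>a\<bar> < 1 + a * a\<close>, only the sign of \<open>a\<close> remains.\<close>

lemma div_square: "a div (1 + a * a) = (if a < 0 then - 1 else (0::int))"
proof (cases "a < 0")
  case True
  have "a div (1 + a * a) = - 1"
  proof (rule int_div_pos_eq)
    have "0 \<le> a * a" by simp
    show "a = (1 + a * a) * - 1 + (a + 1 + a * a)" by simp
    have "- a \<le> a * a" using True by (smt (verit) mult_le_cancel_right1 mult_minus_left minus_mult_minus)
    then show "0 \<le> a + 1 + a * a" by linarith
    show "a + 1 + a * a < 1 + a * a" using True by linarith
  qed
  then show ?thesis using True by simp
next
  case False
  then have "a \<le> a * a" by (cases "a = 0") (auto simp: mult_le_cancel_right1)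
  then show ?thesis using False by (intro div_pos_pos_trivial[THEN trans]) auto
qed

text \<open>The additional 1 in \<open>1 + p + q\<close> pays for the carry bit.\<close>

lemma pow2_add_le: "1 \<le> L \<Longrightarrow> \<bar>x\<bar> \<le> 2 ^ (B + p * L) \<Longrightarrow> \<bar>y\<bar> \<le> 2 ^ (B + q * L) \<Longrightarrow>
  \<bar>x\<bar> + \<bar>y\<bar> \<le> (2 :: int) ^ (B + (1 + p + q) * L)"
proof -
  assume a: "1 \<le> L" "\<bar>x\<bar> \<le> 2 ^ (B + p * L)" "\<bar>y\<bar> \<le> 2 ^ (B + q * L)"
  have "(2::int) ^ (B + p * L) \<le> 2 ^ (B + (p + q) * L)" "(2::int) ^ (B + q * L) \<le> 2 ^ (B + (p + q) * L)"
    by (intro power_increasing; simp add: algebra_simps)+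
  then have "\<bar>x\<bar> + \<bar>y\<bar> \<le> 2 * 2 ^ (B + (p + q) * L)" using a by linarith
  also have "\<dots> = (2::int) ^ (B + (p + q) * L + 1)" by simp
  also have "\<dots> \<le> 2 ^ (B + (1 + p + q) * L)" using a(1) by (intro power_increasing) (auto simp: algebra_simps)
  finally show ?thesis .
qed

lemma pow2_mult_le: "\<bar>x\<bar> \<le> 2 ^ p \<Longrightarrow> \<bar>y\<bar> \<le> 2 ^ q \<Longrightarrow> p + q \<le> r \<Longrightarrow> \<bar>x * y\<bar> \<le> (2 :: int) ^ r"
proof -
  assume a: "\<bar>x\<bar> \<le> 2 ^ p" "\<bar>y\<bar> \<le> 2 ^ q" "p + q \<le> r"
  have "\<bar>x * y\<bar> \<le> 2 ^ p * 2 ^ q" unfolding abs_mult using a by (intro mult_mono) auto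
  also have "\<dots> = (2::int) ^ (p + q)" by (simp add: power_add)
  also have "\<dots> \<le> 2 ^ r" using a by (intro power_increasing) auto
  finally show ?thesis .
qed

section \<open>Ranks and the growth of values\<close>

locale ranks =
  fixes rk :: "string \<Rightarrow> nat"
begin

text \<open>An assignment is admitted if it is linear in the variables of the rank of its target, with
  coefficients of lower rank. The denominator \<open>1 + a\<^sup>2\<close> marks the encoding of a truth value, whose size
  does not depend on \<open>a\<close>.\<close>

primrec arank :: "aexp \<Rightarrow> nat" where
  "arank (Const k) = 0"
| "arank (Get v a) = rk v"
| "arank (Plus a b) = max (arank a) (arank b)"
| "arank (Minus a b) = max (arank a) (arank b)"
| "arank (Times a b) = max (arank a) (arank b)"
| "arank (Quot a b) = (if b = Plus (Const 1) (Times a a) then 0 else arank a)"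

primrec lin :: "nat \<Rightarrow> aexp \<Rightarrow> bool" where
  "lin r (Const k) = True"
| "lin r (Get v a) = (rk v \<le> r)"
| "lin r (Plus a b) = (lin r a \<and> lin r b)"
| "lin r (Minus a b) = (lin r a \<and> lin r b)"
| "lin r (Times a b) = (lin r a \<and> arank b < r \<or> arank a < r \<and> lin r b)"
| "lin r (Quot a b) = (b = Plus (Const 1) (Times a a) \<or> lin r a)"

primrec ranked :: "com \<Rightarrow> bool" where
  "ranked Skip = True"
| "ranked (Put v a e) = lin (rk v) e"
| "ranked (Flip v) = True"
| "ranked (Seq c d) = (ranked c \<and> ranked d)"
| "ranked (Cond b c d) = (ranked c \<and> ranked d)"
| "ranked (While b c) = ranked c"

text \<open>Products add bit lengths and sums cost one more bit, so lengths grow by the factor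
  \<open>asz a\<close>. This is affordable for coefficients, whose rank is lower, but would be
  exponential if iterated.\<close>

lemma aval_arank:
  assumes "1 \<le> L" "\<And>v k. rk v \<le> R \<Longrightarrow> \<bar>\<sigma> v k\<bar> \<le> 2 ^ L"
  shows "arank a \<le> R \<Longrightarrow> \<bar>aval a \<sigma>\<bar> \<le> 2 ^ (asz a * L)"
proof (induction a)
  case (Const k)
  have "\<bar>k\<bar> \<le> 2 ^ bits k" by (rule abs_le_bits)
  also have "(2::int) ^ bits k \<le> 2 ^ (bits k * L)" using assms(1) by (intro power_increasing) auto
  finally show ?case by simp
next
  case (Get v a)
  then have "\<bar>\<sigma> v (aval a \<sigma>)\<bar> \<le> 2 ^ L" using assms(2) by simp
  also have "(2::int) ^ L \<le> 2 ^ (asz (Get v a) * L)" by (intro power_increasing) auto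
  finally show ?case by simp
next
  case (Plus a b)
  then show ?case using pow2_add_le[OF assms(1), of "aval a \<sigma>" 0 "asz a" "aval b \<sigma>" "asz b"]
    by (simp add: order_trans[OF abs_triangle_ineq])
next
  case (Minus a b)
  then show ?case using pow2_add_le[OF assms(1), of "aval a \<sigma>" 0 "asz a" "aval b \<sigma>" "asz b"]
    by (simp add: order_trans[OF abs_triangle_ineq4])
next
  case (Times a b)
  then show ?case using pow2_mult_le[of "aval a \<sigma>" "asz a * L" "aval b \<sigma>" "asz b * L"]
    by (simp add: algebra_simps)
next
  case (Quot a b)
  show ?case
  proof (cases "b = Plus (Const 1) (Times a a)")
    case True
    then show ?thesis by (simp add: div_square)
  next
    case False
    then have "\<bar>aval a \<sigma>\<bar> \<le> 2 ^ (asz a * L)" using Quot by simp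
    also have "(2::int) ^ (asz a * L) \<le> 2 ^ (asz (Quot a b) * L)" by (intro power_increasing) (auto simp: add_mult_distrib)
    finally show ?thesis using abs_div_le[of "aval a \<sigma>" "aval b \<sigma>"] by simp
  qed
qed

text \<open>Only one factor of a product contains variables of rank \<open>r\<close>, so
  \<open>Lr\<close> enters the exponent just once. An assignment thus adds to the bit length of its
  target instead of multiplying it.\<close>

lemma aval_lin:
  assumes Lq: "1 \<le> Lq" "\<And>v k. rk v < r \<Longrightarrow> \<bar>\<sigma> v k\<bar> \<le> 2 ^ Lq"
    and Lr: "\<And>v k. rk v \<le> r \<Longrightarrow> \<bar>\<sigma> v k\<bar> \<le> 2 ^ Lr"
  shows "lin r a \<Longrightarrow> \<bar>aval a \<sigma>\<bar> \<le> 2 ^ (Lr + asz a * Lq)"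
proof (induction a)
  case (Const k)
  have "\<bar>k\<bar> \<le> 2 ^ bits k" by (rule abs_le_bits)
  also have "(2::int) ^ bits k \<le> 2 ^ (Lr + bits k * Lq)"
    using assms(1) by (intro power_increasing) (auto intro: trans_le_add2)
  finally show ?case by simp
next
  case (Get v a)
  then have "\<bar>\<sigma> v (aval a \<sigma>)\<bar> \<le> 2 ^ Lr" using Lr by simp
  also have "(2::int) ^ Lr \<le> 2 ^ (Lr + asz (Get v a) * Lq)" by (intro power_increasing) auto
  finally show ?case by simp
next
  case (Plus a b)
  then show ?case using pow2_add_le[OF Lq(1), of "aval a \<sigma>" Lr "asz a" "aval b \<sigma>" "asz b"]
    by (simp add: order_trans[OF abs_triangle_ineq])
next
  case (Minus a b)
  then show ?case using pow2_add_le[OF Lq(1), of "aval a \<sigma>" Lr "asz a" "aval b \<sigma>" "asz b"]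
    by (simp add: order_trans[OF abs_triangle_ineq4])
next
  case (Times a b)
  have low: "\<bar>aval c \<sigma>\<bar> \<le> 2 ^ (asz c * Lq)" if "arank c < r" for c
    using that Lq by (intro aval_arank[of Lq "arank c"]) auto
  from Times.prems show ?case
  proof (simp only: lin.simps, elim disjE conjE)
    assume "lin r a" "arank b < r"
    then show ?thesis using Times.IH(1) low[of b]
      pow2_mult_le[of "aval a \<sigma>" "Lr + asz a * Lq" "aval b \<sigma>" "asz b * Lq" "Lr + asz (Times a b) * Lq"]
      by (simp add: algebra_simps)
  next
    assume "arank a < r" "lin r b"
    then show ?thesis using Times.IH(2) low[of a]
      pow2_mult_le[of "aval a \<sigma>" "asz a * Lq" "aval b \<sigma>" "Lr + asz b * Lq" "Lr + asz (Times a b) * Lq"]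
      by (simp add: algebra_simps)
  qed
next
  case (Quot a b)
  show ?case
  proof (cases "b = Plus (Const 1) (Times a a)")
    case True
    then show ?thesis by (simp add: div_square)
  next
    case False
    then have "\<bar>aval a \<sigma>\<bar> \<le> 2 ^ (Lr + asz a * Lq)" using Quot by simp
    also have "(2::int) ^ (Lr + asz a * Lq) \<le> 2 ^ (Lr + asz (Quot a b) * Lq)" by (intro power_increasing) (auto simp: add_mult_distrib)
    finally show ?thesis using abs_div_le[of "aval a \<sigma>" "aval b \<sigma>"] by simp
  qed
qed

end

text \<open>An expression of size \<open>k\<close> over variables of \<open>L\<close> bits has at
  most \<open>k\<close> nodes, each with a value of at most \<open>k * L + 2\<close> bits.\<close>

definition cst :: "nat \<Rightarrow> nat \<Rightarrow> nat" where "cst L k = k * (k * L + 2)"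

lemma cst_add: "cst L p + cst L q \<le> cst L (p + q)" by (simp add: cst_def algebra_simps)
lemma cst_mono: "p \<le> q \<Longrightarrow> L \<le> L' \<Longrightarrow> cst L p \<le> cst L' q"
  unfolding cst_def by (intro mult_le_mono add_le_mono) auto

lemma acost_le:
  assumes "1 \<le> L" "\<And>v k. \<bar>\<sigma> v k\<bar> \<le> 2 ^ L"
  shows "acost a \<sigma> \<le> cst L (asz a)"
proof -
  \<comment> \<open>The constant ranking makes the rank hypothesis cover all variables.\<close>
  have val: "\<bar>aval e \<sigma>\<bar> \<le> 2 ^ (asz e * L)" for e
    using assms by (intro ranks.aval_arank[where rk = "\<lambda>_. 0" and R = "ranks.arank (\<lambda>_. 0) e"]) auto
  have top: "bits (aval e \<sigma>) \<le> asz e * L + 2" for e using bits_le[OF val] .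
  have bin: "cst L p + cst L q + ((1 + p + q) * L + 2) \<le> cst L (1 + p + q)" for p q
    unfolding cst_def by (simp add: algebra_simps)
  show ?thesis
  proof (induction a)
    case (Const k)
    have "bits k * 1 \<le> bits k * L" using assms(1) by (intro mult_le_mono) auto
    then have b: "bits k \<le> bits k * L" by simp
    have "bits k * 1 \<le> bits k * (bits k * L + 2)" by (intro mult_le_mono) auto
    then show ?case by (simp add: cst_def)
  next
    case (Get v a)
    have "acost (Get v a) \<sigma> \<le> cst L (asz a) + (asz (Get v a) * L + 2)"
      using Get top[of "Get v a"] by simp
    also have "\<dots> \<le> cst L (asz (Get v a))" unfolding cst_def by (simp add: algebra_simps)
    finally show ?case .
  next
    case (Plus a b) then show ?case using top[of "Plus a b"] bin[of "asz a" "asz b"] by simp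
  next
    case (Minus a b) then show ?case using top[of "Minus a b"] bin[of "asz a" "asz b"] by simp
  next
    case (Times a b) then show ?case using top[of "Times a b"] bin[of "asz a" "asz b"] by simp
  next
    case (Quot a b) then show ?case using top[of "Quot a b"] bin[of "asz a" "asz b"] by simp
  qed
qed

lemma bcost_le:
  assumes "1 \<le> L" "\<And>v k. \<bar>\<sigma> v k\<bar> \<le> 2 ^ L"
  shows "bcost b \<sigma> \<le> cst L (bsz b)"
proof -
  have bin: "cst L p + cst L q + 1 \<le> cst L (1 + p + q)" for p q
    unfolding cst_def by (simp add: algebra_simps)
  show ?thesis
  proof (induction b)
    case (Less a b)
    then show ?case using acost_le[of L \<sigma> a, OF assms] acost_le[of L \<sigma> b, OF assms] bin[of "asz a" "asz b"] by simp
  next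
    case (Neg b)
    then show ?case using bin[of "bsz b" 0] by (simp add: cst_def)
  next
    case (Conj b c)
    then show ?case using bin[of "bsz b" "bsz c"] by simp
  qed
qed

section \<open>Bit lengths along a run\<close>

text \<open>Bit length at rank \<open>r\<close> after \<open>t\<close> commands from an input of
  \<open>L\<close> bits: each assignment adds at most \<open>\<kappa>\<close> times the length one
  rank below, hence the factor \<open>\<kappa> * t\<close>. For fixed \<open>r\<close> this is
  polynomial in \<open>L\<close> and \<open>t\<close>.\<close>

primrec size_bound :: "nat \<Rightarrow> nat \<Rightarrow> nat \<Rightarrow> nat \<Rightarrow> nat" where
  "size_bound \<kappa> L t 0 = L + \<kappa> * t"
| "size_bound \<kappa> L t (Suc r) = L + \<kappa> * t * size_bound \<kappa> L t r"

lemma size_bound_mono_t: "t \<le> t' \<Longrightarrow> size_bound \<kappa> L t r \<le> size_bound \<kappa> L t' r"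
  by (induction r) (auto intro!: mult_le_mono)

lemma size_bound_ge: "L \<le> size_bound \<kappa> L t r" by (cases r) auto

lemma size_bound_mono_r:
  assumes "1 \<le> \<kappa>" "1 \<le> t" "r \<le> r'"
  shows "size_bound \<kappa> L t r \<le> size_bound \<kappa> L t r'"
  using assms(3)
proof (induction r' rule: dec_induct)
  case (step k)
  have "1 * size_bound \<kappa> L t k \<le> \<kappa> * t * size_bound \<kappa> L t k"
    using assms by (intro mult_le_mono) (auto simp: Suc_le_eq)
  then have "size_bound \<kappa> L t k \<le> size_bound \<kappa> L t (Suc k)"
    unfolding size_bound.simps mult_1 by (rule trans_le_add2)
  then show ?case using step by linarith
qed simp

lemma size_bound_weaken:
  "\<bar>x\<bar> \<le> (2::int) ^ size_bound \<kappa> L t r \<Longrightarrow> t \<le> t' \<Longrightarrow> \<bar>x\<bar> \<le> 2 ^ size_bound \<kappa> L t' r"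
  by (rule order_trans, assumption) (intro power_increasing size_bound_mono_t; simp)

definition step_cost :: "nat \<Rightarrow> nat \<Rightarrow> nat" where "step_cost \<kappa> L = 1 + cst L \<kappa>"

text \<open>The clock \<open>t\<close> counts the commands already executed, so that the size bound
  passes through compositions. The cost is then the number of commands times the cost of one command
  at the final bit length.\<close>

lemma (in ranks) run_exec:
  assumes "run c \<sigma> S \<tau>" "ranked c" "csz c \<le> \<kappa>" "1 \<le> \<kappa>" "1 \<le> L" "1 \<le> t"
    and M: "\<And>v. rk v \<le> M"
    and "\<And>v k. \<bar>\<sigma> v k\<bar> \<le> 2 ^ size_bound \<kappa> L t (rk v)"
  shows "(\<forall>v k. \<bar>\<tau> v k\<bar> \<le> 2 ^ size_bound \<kappa> L (t + S) (rk v)) \<and>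
    (\<exists>u. exec c \<sigma> [] u \<tau> \<and> u \<le> S * step_cost \<kappa> (size_bound \<kappa> L (t + S) M))"
  using assms(1,2,3,6,8)
proof (induction arbitrary: t rule: run.induct)
  case (run_Skip \<sigma>)
  have "\<bar>\<sigma> v k\<bar> \<le> 2 ^ size_bound \<kappa> L (t + 1) (rk v)" for v k
    by (rule size_bound_weaken[OF run_Skip(4)]) simp
  then show ?case using exec_Skip[of \<sigma>] by (auto simp: step_cost_def intro!: exI[of _ 1])
next
  case (run_Put v a e \<sigma>)
  let ?q = "size_bound \<kappa> L"
  \<comment> \<open>Below rank 0 there are no variables; the length 1 stands in for theirs.\<close>
  define Lq where "Lq = (if rk v = 0 then 1 else ?q t (rk v - 1))"
  have Lq1: "1 \<le> Lq" using assms(5) size_bound_ge[of L \<kappa> t "rk v - 1"] by (auto simp: Lq_def)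
  have low: "\<bar>\<sigma> w k\<bar> \<le> 2 ^ ?q t r'" if "rk w \<le> r'" for w k r'
  proof -
    have "\<bar>\<sigma> w k\<bar> \<le> 2 ^ ?q t (rk w)" by (rule run_Put.prems)
    also have "(2::int) ^ ?q t (rk w) \<le> 2 ^ ?q t r'"
      using size_bound_mono_r[OF assms(4) run_Put.prems(3) that] by (intro power_increasing) auto
    finally show ?thesis .
  qed
  have "\<bar>aval e \<sigma>\<bar> \<le> 2 ^ (?q t (rk v) + asz e * Lq)"
  proof (rule aval_lin)
    show "1 \<le> Lq" by (rule Lq1)
    show "\<bar>\<sigma> w k\<bar> \<le> 2 ^ Lq" if "rk w < rk v" for w k
      using that low[of w "rk v - 1" k] by (auto simp: Lq_def)
    show "\<bar>\<sigma> w k\<bar> \<le> 2 ^ ?q t (rk v)" if "rk w \<le> rk v" for w k using low[OF that] .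
    show "lin (rk v) e" using run_Put.prems by simp
  qed
  also have "(2::int) ^ (?q t (rk v) + asz e * Lq) \<le> 2 ^ ?q (t + 1) (rk v)"
  proof (intro power_increasing)
    have "asz e * Lq \<le> \<kappa> * Lq" using run_Put.prems(2) by (intro mult_le_mono) auto
    moreover have "?q t (rk v) + \<kappa> * Lq \<le> ?q (t + 1) (rk v)"
    proof (cases "rk v")
      case 0
      then show ?thesis by (simp add: Lq_def)
    next
      case (Suc r)
      \<comment> \<open>From \<open>t\<close> to \<open>t + 1\<close> the bound for rank
        \<open>Suc r\<close> grows by at least \<open>\<kappa> * ?q t r\<close>, the increment of
        one assignment.\<close>
      have "\<kappa> * t * ?q t r + \<kappa> * ?q t r \<le> \<kappa> * (t + 1) * ?q (t + 1) r"
        using size_bound_mono_t[of t "t + 1" \<kappa> L r]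
        by (simp add: distrib_left distrib_right[symmetric] add_mult_distrib2[symmetric] del: add_mult_distrib)
           (metis add_mult_distrib mult_le_mono order_refl add.commute)
      then show ?thesis using Suc by (simp add: Lq_def)
    qed
    ultimately show "?q t (rk v) + asz e * Lq \<le> ?q (t + 1) (rk v)" by linarith
  qed simp
  finally have new: "\<bar>aval e \<sigma>\<bar> \<le> 2 ^ ?q (t + 1) (rk v)" .
  have old: "\<bar>\<sigma> w k\<bar> \<le> 2 ^ ?q (t + 1) (rk w)" for w k
    by (rule size_bound_weaken[OF run_Put.prems(4)]) simp
  have allM: "\<bar>\<sigma> w k\<bar> \<le> 2 ^ ?q (t + 1) M" for w k
  proof -
    have "(2::int) ^ ?q (t + 1) (rk w) \<le> 2 ^ ?q (t + 1) M"
      using size_bound_mono_r[OF assms(4) _ M[of w], of "t + 1"] by (intro power_increasing) auto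
    then show ?thesis using old[of w k] by linarith
  qed
  have L1: "1 \<le> ?q (t + 1) M" using assms(5) size_bound_ge[of L \<kappa> "t + 1" M] by linarith
  have "acost a \<sigma> + acost e \<sigma> \<le> cst (?q (t + 1) M) (asz a) + cst (?q (t + 1) M) (asz e)"
    by (intro add_mono acost_le L1 allM)
  also have "\<dots> \<le> cst (?q (t + 1) M) (asz a + asz e)" by (rule cst_add)
  also have "\<dots> \<le> cst (?q (t + 1) M) \<kappa>" using run_Put.prems(2) by (intro cst_mono) auto
  finally have "1 + acost a \<sigma> + acost e \<sigma> \<le> 1 * step_cost \<kappa> (?q (t + 1) M)" by (simp add: step_cost_def)
  then have "\<exists>u. exec (Put v a e) \<sigma> [] u (\<sigma>(v := (\<sigma> v)(aval a \<sigma> := aval e \<sigma>))) \<and>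
      u \<le> 1 * step_cost \<kappa> (?q (t + 1) M)" using exec_Put by blast
  moreover have "\<forall>w k. \<bar>(\<sigma>(v := (\<sigma> v)(aval a \<sigma> := aval e \<sigma>))) w k\<bar> \<le> 2 ^ ?q (t + 1) (rk w)"
    using new old by (simp del: size_bound.simps)
  ultimately show ?case by blast
next
  case (run_Seq c1 \<sigma> S \<tau> c2 S' \<tau>')
  obtain u where u: "exec c1 \<sigma> [] u \<tau>" "u \<le> S * step_cost \<kappa> (size_bound \<kappa> L (t + S) M)"
    and b: "\<forall>v k. \<bar>\<tau> v k\<bar> \<le> 2 ^ size_bound \<kappa> L (t + S) (rk v)"
    using run_Seq.IH(1)[of t] run_Seq.prems by auto
  obtain u' where u': "exec c2 \<tau> [] u' \<tau>'" "u' \<le> S' * step_cost \<kappa> (size_bound \<kappa> L (t + S + S') M)"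
    and b': "\<forall>v k. \<bar>\<tau>' v k\<bar> \<le> 2 ^ size_bound \<kappa> L (t + S + S') (rk v)"
    using run_Seq.IH(2)[of "t + S"] run_Seq.prems b by auto
  let ?W = "step_cost \<kappa> (size_bound \<kappa> L (t + (1 + S + S')) M)"
  have W: "step_cost \<kappa> (size_bound \<kappa> L t' M) \<le> ?W" if "t' \<le> t + (1 + S + S')" for t'
    unfolding step_cost_def using size_bound_mono_t[OF that] by (intro add_left_mono cst_mono) auto
  have "u \<le> S * ?W" by (rule order_trans[OF u(2) mult_le_mono2[OF W]]) simp
  moreover have "u' \<le> S' * ?W" by (rule order_trans[OF u'(2) mult_le_mono2[OF W]]) simp
  moreover have "1 \<le> ?W" by (simp add: step_cost_def)
  ultimately have "u + u' + 1 \<le> S * ?W + S' * ?W + ?W" by linarith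
  moreover have "\<bar>\<tau>' v k\<bar> \<le> 2 ^ size_bound \<kappa> L (t + (1 + S + S')) (rk v)" for v k
    by (rule size_bound_weaken[OF b'[rule_format]]) simp
  ultimately show ?case using exec_Seq[OF u(1) u'(1)]
    by (auto intro!: exI[of _ "1 + u + u'"] simp: algebra_simps)
next
  case (run_While_False b \<sigma> c)
  let ?q = "size_bound \<kappa> L"
  have old: "\<bar>\<sigma> w k\<bar> \<le> 2 ^ ?q (t + 1) (rk w)" for w k
    by (rule size_bound_weaken[OF run_While_False.prems(4)]) simp
  have allM: "\<bar>\<sigma> w k\<bar> \<le> 2 ^ ?q (t + 1) M" for w k
  proof -
    have "(2::int) ^ ?q (t + 1) (rk w) \<le> 2 ^ ?q (t + 1) M"
      using size_bound_mono_r[OF assms(4) _ M[of w], of "t + 1"] by (intro power_increasing) auto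
    then show ?thesis using old[of w k] by linarith
  qed
  have L1: "1 \<le> ?q (t + 1) M" using assms(5) size_bound_ge[of L \<kappa> "t + 1" M] by linarith
  have "bcost b \<sigma> \<le> cst (?q (t + 1) M) (bsz b)" by (rule bcost_le[OF L1 allM])
  also have "\<dots> \<le> cst (?q (t + 1) M) \<kappa>" using run_While_False.prems(2) by (intro cst_mono) auto
  finally have "1 + bcost b \<sigma> \<le> 1 * step_cost \<kappa> (?q (t + 1) M)" by (simp add: step_cost_def)
  then show ?case using exec_While_False[OF run_While_False.hyps] old by auto
next
  case (run_While_True b \<sigma> c S \<tau> S' \<tau>')
  let ?q = "size_bound \<kappa> L"
  obtain u where u: "exec c \<sigma> [] u \<tau>" "u \<le> S * step_cost \<kappa> (?q (t + S) M)"
    and b: "\<forall>v k. \<bar>\<tau> v k\<bar> \<le> 2 ^ ?q (t + S) (rk v)"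
    using run_While_True.IH(1)[of t] run_While_True.prems by auto
  obtain u' where u': "exec (While b c) \<tau> [] u' \<tau>'" "u' \<le> S' * step_cost \<kappa> (?q (t + S + S') M)"
    and b': "\<forall>v k. \<bar>\<tau>' v k\<bar> \<le> 2 ^ ?q (t + S + S') (rk v)"
    using run_While_True.IH(2)[of "t + S"] run_While_True.prems b by auto
  let ?W = "step_cost \<kappa> (?q (t + (1 + S + S')) M)"
  have W: "step_cost \<kappa> (?q t' M) \<le> ?W" if "t' \<le> t + (1 + S + S')" for t'
    unfolding step_cost_def using size_bound_mono_t[OF that] by (intro add_left_mono cst_mono) auto
  have allM: "\<bar>\<sigma> w k\<bar> \<le> 2 ^ ?q t M" for w k
  proof -
    have "(2::int) ^ ?q t (rk w) \<le> 2 ^ ?q t M"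
      using size_bound_mono_r[OF assms(4) run_While_True.prems(3) M[of w]] by (intro power_increasing) auto
    then show ?thesis using run_While_True.prems(4)[of w k] by linarith
  qed
  have L1: "1 \<le> ?q t M" using assms(5) size_bound_ge[of L \<kappa> t M] by linarith
  have "bcost b \<sigma> \<le> cst (?q t M) (bsz b)" by (rule bcost_le[OF L1 allM])
  also have "\<dots> \<le> cst (?q t M) \<kappa>" using run_While_True.prems(2) by (intro cst_mono) auto
  finally have "1 + bcost b \<sigma> \<le> step_cost \<kappa> (?q t M)" by (simp add: step_cost_def)
  then have "1 + bcost b \<sigma> \<le> ?W" using W[of t] by linarith
  moreover have "u \<le> S * ?W" by (rule order_trans[OF u(2) mult_le_mono2[OF W]]) simp
  moreover have "u' \<le> S' * ?W" by (rule order_trans[OF u'(2) mult_le_mono2[OF W]]) simp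
  ultimately have "1 + bcost b \<sigma> + u + u' \<le> ?W + S * ?W + S' * ?W" by linarith
  moreover have "\<bar>\<tau>' v k\<bar> \<le> 2 ^ ?q (t + (1 + S + S')) (rk v)" for v k
    by (rule size_bound_weaken[OF b'[rule_format]]) simp
  ultimately show ?case using exec_While_True[OF run_While_True.hyps(1) u(1) u'(1)]
    by (auto intro!: exI[of _ "1 + bcost b \<sigma> + u + u'"] simp: algebra_simps)
qed

section \<open>Loops and array assignments\<close>

definition runb :: "com \<Rightarrow> store \<Rightarrow> nat \<Rightarrow> store \<Rightarrow> bool" where
  "runb c \<sigma> B \<tau> \<longleftrightarrow> (\<exists>S\<le>B. run c \<sigma> S \<tau>)"

lemma runb_mono: "runb c \<sigma> B \<tau> \<Longrightarrow> B \<le> B' \<Longrightarrow> runb c \<sigma> B' \<tau>"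
  unfolding runb_def using order_trans by blast

lemma runb_Put: "runb (Put v a e) \<sigma> 1 (\<sigma>(v := (\<sigma> v)(aval a \<sigma> := aval e \<sigma>)))"
  unfolding runb_def using run_Put by blast

lemma runb_Seq: "runb c \<sigma> B \<tau> \<Longrightarrow> runb d \<tau> B' \<rho> \<Longrightarrow> runb (Seq c d) \<sigma> (1 + B + B') \<rho>"
  unfolding runb_def by (meson run_Seq add_mono order_refl)

primrec blk :: "com list \<Rightarrow> com" where
  "blk [] = Skip"
| "blk (c # cs) = Seq c (blk cs)"

lemma blk_Nil: "runb (blk []) \<sigma> 1 \<sigma>"
  unfolding runb_def using run_Skip by auto

lemma blk_Cons: "runb c \<sigma> B \<tau> \<Longrightarrow> runb (blk cs) \<tau> B' \<rho> \<Longrightarrow> runb (blk (c # cs)) \<sigma> (1 + B + B') \<rho>"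
  using runb_Seq[of c \<sigma> B \<tau> "blk cs" B' \<rho>] by simp

abbreviation (input) V :: "string \<Rightarrow> aexp" where "V v \<equiv> Get v (Const 0)"

definition For :: "string \<Rightarrow> aexp \<Rightarrow> com \<Rightarrow> com" where
  "For i N c = Seq (Put i (Const 0) (Const 0))
     (While (Less (V i) N) (Seq c (Put i (Const 0) (Plus (V i) (Const 1)))))"

abbreviation setc :: "store \<Rightarrow> string \<Rightarrow> int \<Rightarrow> store" where
  "setc \<sigma> i z \<equiv> \<sigma>(i := (\<sigma> i)(0 := z))"

text \<open>\<open>cnt\<close> makes the invariant independent of the counter cell, which the loop
  itself rewrites. A round costs 3 beyond its body, for composition, increment and test.\<close>

lemma For_runb:
  assumes start: "I 0 \<sigma>"
    and step: "\<And>k \<sigma>. k < M \<Longrightarrow> I k \<sigma> \<Longrightarrow> \<sigma> i 0 = int k \<Longrightarrow> \<exists>\<tau>. runb c \<sigma> B \<tau> \<and> I (Suc k) \<tau> \<and> \<tau> i 0 = int k"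
    and cnt: "\<And>k \<sigma> z. I k \<sigma> \<Longrightarrow> I k (setc \<sigma> i z)"
    and N: "\<And>k \<sigma>. k \<le> M \<Longrightarrow> I k \<sigma> \<Longrightarrow> aval N \<sigma> = int M"
  shows "\<exists>\<tau>. runb (For i N c) \<sigma> (M * (B + 3) + 3) \<tau> \<and> I M \<tau> \<and> \<tau> i 0 = int M"
proof -
  let ?w = "While (Less (V i) N) (Seq c (Put i (Const 0) (Plus (V i) (Const 1))))"
  have loop: "\<exists>\<tau>. runb ?w \<sigma> ((M - k) * (B + 3) + 1) \<tau> \<and> I M \<tau> \<and> \<tau> i 0 = int M"
    if "k \<le> M" "I k \<sigma>" "\<sigma> i 0 = int k" for k \<sigma>
    using that
  proof (induction "M - k" arbitrary: k \<sigma>)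
    case 0
    then have k: "k = M" by simp
    then have "\<not> bval (Less (V i) N) \<sigma>" using 0 N[of M \<sigma>] by simp
    then have "runb ?w \<sigma> 1 \<sigma>" unfolding runb_def using run_While_False by blast
    then show ?case using 0 k by auto
  next
    case (Suc d)
    then have k: "k < M" by simp
    obtain \<tau> where \<tau>: "runb c \<sigma> B \<tau>" "I (Suc k) \<tau>" "\<tau> i 0 = int k" using step[OF k] Suc by blast
    define \<tau>' where "\<tau>' = setc \<tau> i (int (Suc k))"
    have "runb (Put i (Const 0) (Plus (V i) (Const 1))) \<tau> 1 \<tau>'"
      using runb_Put[of i "Const 0" "Plus (V i) (Const 1)" \<tau>] \<tau>(3) by (simp add: \<tau>'_def add.commute)
    from runb_Seq[OF \<tau>(1) this]
    obtain S where S: "S \<le> 1 + B + 1" "run (Seq c (Put i (Const 0) (Plus (V i) (Const 1)))) \<sigma> S \<tau>'"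
      unfolding runb_def by blast
    have "I (Suc k) \<tau>'" "\<tau>' i 0 = int (Suc k)" using cnt \<tau> by (auto simp: \<tau>'_def)
    moreover have "d = M - Suc k" "Suc k \<le> M" using Suc.hyps(2) k by auto
    ultimately have "\<exists>\<rho>. runb ?w \<tau>' ((M - Suc k) * (B + 3) + 1) \<rho> \<and> I M \<rho> \<and> \<rho> i 0 = int M"
      by (intro Suc.hyps(1))
    then obtain \<rho> S' where \<rho>: "S' \<le> (M - Suc k) * (B + 3) + 1" "run ?w \<tau>' S' \<rho>" "I M \<rho>" "\<rho> i 0 = int M"
      unfolding runb_def by blast
    have "bval (Less (V i) N) \<sigma>" using N[of k \<sigma>] Suc.prems k by simp
    from run_While_True[OF this S(2) \<rho>(2)] have "run ?w \<sigma> (1 + S + S') \<rho>" .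
    moreover have "1 + S + S' \<le> (M - k) * (B + 3) + 1"
    proof -
      have "(M - k) * (B + 3) = (B + 3) + (M - Suc k) * (B + 3)" using k
        by (metis Suc_diff_Suc mult_Suc)
      then show ?thesis using S(1) \<rho>(1) by simp
    qed
    ultimately show ?case using \<rho> unfolding runb_def by blast
  qed
  have "I 0 (setc \<sigma> i 0)" using start by (rule cnt)
  then obtain \<tau> where \<tau>: "runb ?w (setc \<sigma> i 0) (M * (B + 3) + 1) \<tau>" "I M \<tau>" "\<tau> i 0 = int M"
    using loop[of 0 "setc \<sigma> i 0"] by auto
  have "runb (Put i (Const 0) (Const 0)) \<sigma> 1 (setc \<sigma> i 0)"
    using runb_Put[of i "Const 0" "Const 0" \<sigma>] by simp
  from runb_Seq[OF this \<tau>(1)] have "runb (For i N c) \<sigma> (1 + 1 + (M * (B + 3) + 1)) \<tau>"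
    unfolding For_def .
  then have "runb (For i N c) \<sigma> (M * (B + 3) + 3) \<tau>" by (rule runb_mono) simp
  then show ?thesis using \<tau> by blast
qed

section \<open>Array assignments and folds\<close>

primrec rds :: "aexp \<Rightarrow> string set" where
  "rds (Const k) = {}"
| "rds (Get v a) = insert v (rds a)"
| "rds (Plus a b) = rds a \<union> rds b"
| "rds (Minus a b) = rds a \<union> rds b"
| "rds (Times a b) = rds a \<union> rds b"
| "rds (Quot a b) = rds a \<union> rds b"

lemma aval_cong: "(\<And>v. v \<in> rds a \<Longrightarrow> \<sigma> v = \<tau> v) \<Longrightarrow> aval a \<sigma> = aval a \<tau>"
  by (induction a) auto

text \<open>Meant as a parallel assignment to all entries of \<open>dst\<close>: in its use
  \<open>e\<close> does not read \<open>dst\<close>. This is why updates such as those of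
  \<open>u\<close> and \<open>Y\<close> go through copies \<open>u2\<close> and
  \<open>Y2\<close>.\<close>

definition Asg :: "string \<Rightarrow> string \<Rightarrow> aexp \<Rightarrow> aexp \<Rightarrow> com" where
  "Asg dst k N e = For k N (Put dst (V k) e)"

lemma fun_upd_eqI: "f(0 := z) = g(0 := z) \<Longrightarrow> f 0 = w \<Longrightarrow> f = g(0 := w)"
  by (metis fun_upd_triv fun_upd_upd)

lemma Asg_runb:
  assumes d: "dst \<noteq> k" "dst \<notin> rds e" "dst \<notin> rds N" "k \<notin> rds N" and N: "aval N \<sigma> = int M"
  shows "\<exists>\<tau>. runb (Asg dst k N e) \<sigma> (4 * M + 3) \<tau> \<and>
    (\<forall>j<M. \<tau> dst (int j) = aval e (setc \<sigma> k (int j))) \<and> (\<forall>v. v \<noteq> dst \<longrightarrow> v \<noteq> k \<longrightarrow> \<tau> v = \<sigma> v)"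
proof -
  \<comment> \<open>Only cell 0 of the counter array may change; the last conjunct keeps its other
    cells.\<close>
  define I where "I j \<tau> \<longleftrightarrow> (\<forall>l<j. \<tau> dst (int l) = aval e (setc \<sigma> k (int l))) \<and>
    (\<forall>v. v \<noteq> dst \<longrightarrow> v \<noteq> k \<longrightarrow> \<tau> v = \<sigma> v) \<and> (\<tau> k)(0 := 0) = (\<sigma> k)(0 := 0)" for j \<tau>
  have "\<exists>\<tau>. runb (For k N (Put dst (V k) e)) \<sigma> (M * (1 + 3) + 3) \<tau> \<and> I M \<tau> \<and> \<tau> k 0 = int M"
  proof (rule For_runb)
    fix j \<tau> assume j: "j < M" "I j \<tau>" "\<tau> k 0 = int j"
    have k: "\<tau> k = (\<sigma> k)(0 := int j)" using j by - (rule fun_upd_eqI[where z = 0], auto simp: I_def)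
    have "aval e \<tau> = aval e (setc \<sigma> k (int j))"
      using d j k by (intro aval_cong) (auto simp: I_def)
    then have "I (Suc j) (\<tau>(dst := (\<tau> dst)(aval (V k) \<tau> := aval e \<tau>)))"
      using j d unfolding I_def by (auto simp: less_Suc_eq)
    then show "\<exists>\<tau>'. runb (Put dst (V k) e) \<tau> 1 \<tau>' \<and> I (Suc j) \<tau>' \<and> \<tau>' k 0 = int j"
      using runb_Put[of dst "V k" e \<tau>] d(1) j(3)
      by (intro exI[of _ "\<tau>(dst := (\<tau> dst)(aval (V k) \<tau> := aval e \<tau>))"] conjI) auto
  next
    fix j \<tau> assume "I j \<tau>"
    then have "aval N \<tau> = aval N \<sigma>" using d by (intro aval_cong) (auto simp: I_def)
    then show "aval N \<tau> = int M" using N by simp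
  qed (use d in \<open>auto simp: I_def\<close>)
  then show ?thesis unfolding Asg_def I_def by (auto simp: mult.commute)
qed

text \<open>The inner bound \<open>M\<close> may depend on \<open>k\<close>, which covers prefix
  sums and prefix products; \<open>N = Const 1\<close> yields a scalar.\<close>

definition Fold :: "(aexp \<Rightarrow> aexp \<Rightarrow> aexp) \<Rightarrow> int \<Rightarrow> string \<Rightarrow> string \<Rightarrow> aexp \<Rightarrow> string \<Rightarrow> aexp \<Rightarrow> aexp \<Rightarrow> com" where
  "Fold f z dst k N i M e =
     For k N (Seq (Put dst (V k) (Const z)) (For i M (Put dst (V k) (f (Get dst (V k)) e))))"

abbreviation "SumA \<equiv> Fold Plus 0"
abbreviation "ProdA \<equiv> Fold Times 1"

text \<open>\<open>F j l\<close> is the accumulator of entry \<open>j\<close> after \<open>l\<close>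
  rounds. The inner invariant \<open>K\<close> is the outer one together with the current value of
  the accumulator.\<close>

lemma Fold_runb:
  assumes f: "\<And>a b \<tau>. aval (f a b) \<tau> = g (aval a \<tau>) (aval b \<tau>)"
    and d: "dst \<noteq> k" "dst \<noteq> i" "i \<noteq> k" "dst \<notin> rds e" "dst \<notin> rds N" "k \<notin> rds N" "i \<notin> rds N" "dst \<notin> rds M" "i \<notin> rds M"
    and N: "aval N \<sigma> = int NN" and M: "\<And>j. j < NN \<Longrightarrow> aval M (setc \<sigma> k (int j)) = int (MM j)"
    and B: "\<And>j. j < NN \<Longrightarrow> MM j \<le> B"
    and F0: "\<And>j. F j 0 = z"
    and FS: "\<And>j l. F j (Suc l) = g (F j l) (aval e (setc (setc \<sigma> k (int j)) i (int l)))"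
  shows "\<exists>\<tau>. runb (Fold f z dst k N i M e) \<sigma> (NN * (4 * B + 8) + 3) \<tau> \<and>
    (\<forall>j<NN. \<tau> dst (int j) = F j (MM j)) \<and> (\<forall>v. v \<noteq> dst \<longrightarrow> v \<noteq> k \<longrightarrow> v \<noteq> i \<longrightarrow> \<tau> v = \<sigma> v)"
proof -
  define I where "I j \<tau> \<longleftrightarrow> (\<forall>l<j. \<tau> dst (int l) = F l (MM l)) \<and>
    (\<forall>v. v \<noteq> dst \<longrightarrow> v \<noteq> k \<longrightarrow> v \<noteq> i \<longrightarrow> \<tau> v = \<sigma> v) \<and> (\<tau> k)(0 := 0) = (\<sigma> k)(0 := 0) \<and>
    (\<tau> i)(0 := 0) = (\<sigma> i)(0 := 0)" for j \<tau>
  let ?in = "For i M (Put dst (V k) (f (Get dst (V k)) e))"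
  let ?body = "Seq (Put dst (V k) (Const z)) ?in"
  have "\<exists>\<tau>. runb (For k N ?body) \<sigma> (NN * ((4 * B + 5) + 3) + 3) \<tau> \<and> I NN \<tau> \<and> \<tau> k 0 = int NN"
  proof (rule For_runb)
    fix j \<tau> assume j: "j < NN" "I j \<tau>" "\<tau> k 0 = int j"
    define \<tau>1 where "\<tau>1 = \<tau>(dst := (\<tau> dst)(int j := z))"
    have r1: "runb (Put dst (V k) (Const z)) \<tau> 1 \<tau>1"
      using runb_Put[of dst "V k" "Const z" \<tau>] j(3) by (simp add: \<tau>1_def)
    define K where "K l \<rho> \<longleftrightarrow> I j \<rho> \<and> \<rho> k 0 = int j \<and> \<rho> dst (int j) = F j l" for l \<rho>
    have "\<exists>\<rho>. runb ?in \<tau>1 (MM j * (1 + 3) + 3) \<rho> \<and> K (MM j) \<rho> \<and> \<rho> i 0 = int (MM j)"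
    proof (rule For_runb)
      show "K 0 \<tau>1" using j d F0 unfolding K_def I_def \<tau>1_def by auto
    next
      fix l \<rho> assume l: "l < MM j" "K l \<rho>" "\<rho> i 0 = int l"
      have k: "\<rho> k = (\<sigma> k)(0 := int j)" using l by - (rule fun_upd_eqI[where z = 0], auto simp: K_def I_def)
      have i: "\<rho> i = (\<sigma> i)(0 := int l)" using l by - (rule fun_upd_eqI[where z = 0], auto simp: K_def I_def)
      have "aval e \<rho> = aval e (setc (setc \<sigma> k (int j)) i (int l))"
        using d k i l by (intro aval_cong) (auto simp: K_def I_def)
      then have "aval (f (Get dst (V k)) e) \<rho> = F j (Suc l)" using l by (simp add: f FS K_def)
      then have "K (Suc l) (\<rho>(dst := (\<rho> dst)(aval (V k) \<rho> := aval (f (Get dst (V k)) e) \<rho>)))"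
        using l d unfolding K_def I_def by auto
      then show "\<exists>\<rho>'. runb (Put dst (V k) (f (Get dst (V k)) e)) \<rho> 1 \<rho>' \<and> K (Suc l) \<rho>' \<and> \<rho>' i 0 = int l"
        using runb_Put[of dst "V k" "f (Get dst (V k)) e" \<rho>] d(2) l(3)
        by (intro exI[of _ "\<rho>(dst := (\<rho> dst)(aval (V k) \<rho> := aval (f (Get dst (V k)) e) \<rho>))"] conjI) auto
    next
      fix l \<rho> zz assume "K l \<rho>"
      then show "K l (setc \<rho> i zz)" using d by (auto simp: K_def I_def)
    next
      fix l \<rho> assume l: "K l \<rho>"
      then have k: "\<rho> k = (\<sigma> k)(0 := int j)" by - (rule fun_upd_eqI[where z = 0], auto simp: K_def I_def)
      have "aval M \<rho> = aval M (setc \<sigma> k (int j))"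
        using d k l by (intro aval_cong) (auto simp: K_def I_def)
      then show "aval M \<rho> = int (MM j)" using M j by simp
    qed
    then obtain \<rho> where \<rho>: "runb ?in \<tau>1 (MM j * (1 + 3) + 3) \<rho>" "K (MM j) \<rho>" by blast
    have "1 + 1 + (MM j * (1 + 3) + 3) \<le> 4 * B + 5" using B[OF j(1)] by simp
    then have "runb ?body \<tau> (4 * B + 5) \<rho>" using runb_Seq[OF r1 \<rho>(1)] by (rule runb_mono[rotated])
    moreover have "I (Suc j) \<rho> \<and> \<rho> k 0 = int j" using \<rho>(2) by (auto simp: K_def I_def less_Suc_eq)
    ultimately show "\<exists>\<rho>. runb ?body \<tau> (4 * B + 5) \<rho> \<and> I (Suc j) \<rho> \<and> \<rho> k 0 = int j" by blast
  next
    fix j \<tau> assume "I j \<tau>"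
    then have "aval N \<tau> = aval N \<sigma>" using d by (intro aval_cong) (auto simp: I_def)
    then show "aval N \<tau> = int NN" using N by simp
  qed (use d in \<open>auto simp: I_def\<close>)
  then show ?thesis unfolding Fold_def I_def by (auto simp: algebra_simps)
qed

lemma SumA_runb:
  assumes d: "dst \<noteq> k" "dst \<noteq> i" "i \<noteq> k" "dst \<notin> rds e" "dst \<notin> rds N" "k \<notin> rds N" "i \<notin> rds N" "dst \<notin> rds M" "i \<notin> rds M"
    and N: "aval N \<sigma> = int NN" and M: "\<And>j. j < NN \<Longrightarrow> aval M (setc \<sigma> k (int j)) = int (MM j)"
    and B: "\<And>j. j < NN \<Longrightarrow> MM j \<le> B"
  shows "\<exists>\<tau>. runb (SumA dst k N i M e) \<sigma> (NN * (4 * B + 8) + 3) \<tau> \<and>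
    (\<forall>j<NN. \<tau> dst (int j) = (\<Sum>l<MM j. aval e (setc (setc \<sigma> k (int j)) i (int l)))) \<and>
    (\<forall>v. v \<noteq> dst \<longrightarrow> v \<noteq> k \<longrightarrow> v \<noteq> i \<longrightarrow> \<tau> v = \<sigma> v)"
  by (rule Fold_runb[where g = plus and F = "\<lambda>j L. \<Sum>l<L. aval e (setc (setc \<sigma> k (int j)) i (int l))"])
    (use assms in auto)

lemma ProdA_runb:
  assumes d: "dst \<noteq> k" "dst \<noteq> i" "i \<noteq> k" "dst \<notin> rds e" "dst \<notin> rds N" "k \<notin> rds N" "i \<notin> rds N" "dst \<notin> rds M" "i \<notin> rds M"
    and N: "aval N \<sigma> = int NN" and M: "\<And>j. j < NN \<Longrightarrow> aval M (setc \<sigma> k (int j)) = int (MM j)"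
    and B: "\<And>j. j < NN \<Longrightarrow> MM j \<le> B"
  shows "\<exists>\<tau>. runb (ProdA dst k N i M e) \<sigma> (NN * (4 * B + 8) + 3) \<tau> \<and>
    (\<forall>j<NN. \<tau> dst (int j) = (\<Prod>l<MM j. aval e (setc (setc \<sigma> k (int j)) i (int l)))) \<and>
    (\<forall>v. v \<noteq> dst \<longrightarrow> v \<noteq> k \<longrightarrow> v \<noteq> i \<longrightarrow> \<tau> v = \<sigma> v)"
  by (rule Fold_runb[where g = times and F = "\<lambda>j L. \<Prod>l<L. aval e (setc (setc \<sigma> k (int j)) i (int l))"])
    (use assms in auto)

text \<open>The quotient has the shape that the ranking recognises as a truth value, so a comparison
  has rank 0 whatever it compares.\<close>

definition Lt :: "aexp \<Rightarrow> aexp \<Rightarrow> aexp" where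
  "Lt a b = Minus (Const 0) (Quot (Minus a b) (Plus (Const 1) (Times (Minus a b) (Minus a b))))"

lemma aval_Lt [simp]: "aval (Lt a b) \<sigma> = of_bool (aval a \<sigma> < aval b \<sigma>)"
  unfolding Lt_def by (simp add: div_square)

lemma rds_Lt [simp]: "rds (Lt a b) = rds a \<union> rds b"
  by (auto simp: Lt_def)

section \<open>One step of the walk as a program\<close>

abbreviation (input) row_at :: "string \<Rightarrow> string \<Rightarrow> aexp" where
  "row_at r c \<equiv> Get ''bb'' (Plus (Times (V r) (V ''m'')) (V c))"

section \<open>Program text of the direction search\<close>

text \<open>Computes \<open>pj\<close> of \<open>v2\<close> into \<open>v\<close>, with mask
  \<open>al\<close> of size \<open>na\<close>, \<open>bal\<close> in \<open>bp\<close> and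
  \<open>\<kappa>\<close> in \<open>kp\<close>.\<close>

definition proj_code :: "com list" where
  "proj_code =
   [SumA ''sm'' ''k'' (Const 1) ''i'' (V ''m'') (Get ''v2'' (V ''i'')),
    Asg ''v3'' ''k'' (V ''m'') (Times (Get ''al'' (V ''k'')) (Minus (Times (V ''na'') (Get ''v2'' (V ''k''))) (V ''sm''))),
    SumA ''pp'' ''k'' (Const 1) ''i'' (V ''m'') (Times (Get ''bp'' (V ''i'')) (Get ''v3'' (V ''i''))),
    Asg ''v'' ''k'' (V ''m'') (Minus (Times (V ''kp'') (Get ''v3'' (V ''k''))) (Times (V ''pp'') (Get ''bp'' (V ''k''))))]"

definition pow4m :: aexp where "pow4m = Times (Times (V ''m'') (V ''m'')) (Times (V ''m'') (V ''m''))"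

text \<open>One \<open>pstep\<close> on \<open>v\<close>: \<open>dv\<close> holds the inner products
  with the constraints, \<open>rr\<close> the value of \<open>rad\<close>, and the constant is
  \<open>16 * m ^ 9 * G\<^sup>2\<close>.\<close>

definition iter_code :: com where
  "iter_code = blk (
   [SumA ''dv'' ''k'' (V ''N'') ''i'' (V ''m'') (Times (row_at ''k'' ''i'') (Get ''v'' (V ''i''))),
    SumA ''rr'' ''k'' (V ''m'') ''i'' (V ''N'')
      (Times (Times (Get ''kf'' (V ''i'')) (row_at ''i'' ''k'')) (Get ''dv'' (V ''i''))),
    Asg ''v2'' ''k'' (V ''m'') (Times (Get ''al'' (V ''k''))
      (Minus (Times (Times (Times (Const 16) (Times pow4m (Times pow4m (V ''m'')))) (Times (V ''G'') (V ''G'')))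
        (Get ''v'' (V ''k''))) (Get ''rr'' (V ''k''))))] @ proj_code)"

text \<open>The two comparisons multiply to the indicator of \<open>k = w\<close>, so the start is a
  masked unit vector. After the iteration the flag \<open>gd\<close> decides whether
  \<open>u\<close> is replaced by the end vector. The test \<open>m < 2 * na\<close> rejects
  everything once half of the coordinates are frozen.\<close>

definition try_code :: com where
  "try_code = blk (
   [Asg ''v2'' ''k'' (V ''m'') (Times (Times (Minus (Const 1) (Lt (V ''k'') (V ''w'')))
      (Minus (Const 1) (Lt (V ''w'') (V ''k'')))) (Get ''al'' (V ''k'')))] @ proj_code @
   [For ''t'' (Times (Const 1024) (Times (Times pow4m pow4m) (Times (V ''m'') (V ''m'')))) iter_code,
    SumA ''dv'' ''k'' (V ''N'') ''i'' (V ''m'') (Times (row_at ''k'' ''i'') (Get ''v'' (V ''i''))),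
    SumA ''qv'' ''k'' (Const 1) ''i'' (V ''N'')
      (Times (Times (Get ''kf'' (V ''i'')) (Get ''dv'' (V ''i''))) (Get ''dv'' (V ''i''))),
    SumA ''nv'' ''k'' (Const 1) ''i'' (V ''m'') (Times (Get ''v'' (V ''i'')) (Get ''v'' (V ''i''))),
    Asg ''gd'' ''k'' (Const 1) (Times (Lt (V ''m'') (Times (Const 2) (V ''na'')))
      (Times (Lt (Const 0) (V ''nv''))
        (Minus (Const 1) (Lt (Times (Times (V ''G'') (V ''G'')) (V ''nv'')) (Times (Const 16) (V ''qv'')))))),
    Asg ''u2'' ''k'' (V ''m'') (Plus (Times (V ''gd'') (Get ''v'' (V ''k'')))
      (Times (Minus (Const 1) (V ''gd'')) (Get ''u'' (V ''k'')))),
    Asg ''u'' ''k'' (V ''m'') (Get ''u2'' (V ''k''))])"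

definition search_code :: com where
  "search_code = For ''w'' (V ''m'') try_code"

definition rv :: "store \<Rightarrow> string \<Rightarrow> nat \<Rightarrow> real" where
  "rv \<sigma> a p = real_of_int (\<sigma> a (int p))"

lemma Asg_runb_uniform:
  assumes "dst \<noteq> k" "dst \<notin> rds e" "dst \<notin> rds N" "k \<notin> rds N" "aval N \<sigma> = int M" "M \<le> Bd" "1 \<le> Bd"
  shows "\<exists>\<tau>. runb (Asg dst k N e) \<sigma> (15 * Bd) \<tau> \<and>
    (\<forall>j<M. \<tau> dst (int j) = aval e (setc \<sigma> k (int j))) \<and> (\<forall>v. v \<notin> {dst, k} \<longrightarrow> \<tau> v = \<sigma> v)"
proof -
  have "4 * M + 3 \<le> 15 * Bd" using assms by linarith
  with Asg_runb[OF assms(1-5)] show ?thesis by (auto intro: runb_mono)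
qed

lemma SumA_runb_uniform:
  assumes d: "dst \<noteq> k" "dst \<noteq> i" "i \<noteq> k" "dst \<notin> rds e" "dst \<notin> rds N" "k \<notin> rds N" "i \<notin> rds N"
      "dst \<notin> rds M" "i \<notin> rds M" "k \<notin> rds M"
    and N: "aval N \<sigma> = int NN" "aval M \<sigma> = int MM" and B: "NN * MM \<le> Bd" "NN \<le> Bd" "1 \<le> Bd"
  shows "\<exists>\<tau>. runb (SumA dst k N i M e) \<sigma> (15 * Bd) \<tau> \<and>
    (\<forall>j<NN. \<tau> dst (int j) = (\<Sum>l<MM. aval e (setc (setc \<sigma> k (int j)) i (int l)))) \<and>
    (\<forall>v. v \<notin> {dst, k, i} \<longrightarrow> \<tau> v = \<sigma> v)"
proof -
  have "NN * (4 * MM + 8) + 3 \<le> 15 * Bd" using B by (simp add: algebra_simps)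
  moreover have "aval M (setc \<sigma> k z) = int MM" for z
    using aval_cong[of M "setc \<sigma> k z" \<sigma>] d(10) N(2) by (metis fun_upd_other)
  moreover note SumA_runb[OF d(1-9) N(1), of "\<lambda>_. MM" MM]
  ultimately show ?thesis by (auto intro: runb_mono)
qed

lemma blk_Cons_uniform: "runb c \<sigma> U \<tau> \<Longrightarrow> runb (blk cs) \<tau> (n * (U + 1) + 1) \<rho> \<Longrightarrow>
    runb (blk (c # cs)) \<sigma> (Suc n * (U + 1) + 1) \<rho>"
  using blk_Cons[of c \<sigma> U \<tau> cs "n * (U + 1) + 1" \<rho>] by (simp add: algebra_simps)

lemma blk_append: "runb (blk cs) \<sigma> B \<tau> \<Longrightarrow> runb (blk ds) \<tau> B' \<rho> \<Longrightarrow> runb (blk (cs @ ds)) \<sigma> (B + B') \<rho>"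
proof (induction cs arbitrary: \<sigma> B)
  case Nil
  then obtain S where "S \<le> B" "run Skip \<sigma> S \<tau>" by (auto simp: runb_def)
  then have "\<tau> = \<sigma>" by (auto elim: run.cases)
  then show ?case using Nil by (auto intro: runb_mono)
next
  case (Cons c cs)
  then obtain S where S: "S \<le> B" "run (Seq c (blk cs)) \<sigma> S \<tau>" by (auto simp: runb_def)
  from S(2) obtain S1 S2 \<tau>1 where "S = 1 + S1 + S2" "run c \<sigma> S1 \<tau>1" "run (blk cs) \<tau>1 S2 \<tau>"
    by (cases rule: run.cases) auto
  then have r: "runb c \<sigma> S1 \<tau>1" "runb (blk cs) \<tau>1 S2 \<tau>" "1 + S1 + S2 \<le> B" using S(1) by (auto simp: runb_def)
  from blk_Cons[OF r(1) Cons.IH[OF r(2) Cons.prems(2)]] show ?case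
    using r(3) by (auto intro: runb_mono)
qed

text \<open>A store determines vectors only below \<open>m\<close>, so the operators have to be
  insensitive to values beyond.\<close>

lemma pj_cong:
  assumes "\<And>p. p < m \<Longrightarrow> v p = v' p" "q < m"
  shows "pj m a \<beta> \<kappa> v q = pj m a \<beta> \<kappa> v' q"
proof -
  have "center m a v p = center m a v' p" if "p < m" for p
    using assms(1) that by (simp add: center_def)
  then show ?thesis using assms(2) unfolding pj_def by (simp cong: dot_cong)
qed

lemma pstep_cong:
  assumes "\<And>p. p < m \<Longrightarrow> v p = v' p" "q < m"
  shows "pstep m a \<beta> \<kappa> b N k c v q = pstep m a \<beta> \<kappa> b N k c v' q"
proof -
  have "dot m (b i) v = dot m (b i) v'" for i using assms(1) by (intro dot_cong) auto
  then have "rad m b N k v p = rad m b N k v' p" for p by (simp add: rad_def)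
  then show ?thesis unfolding pstep_def using assms by (intro pj_cong) auto
qed

definition try_cost :: "nat \<Rightarrow> nat \<Rightarrow> nat" where
  "try_cost m Bd = 11 * (15 * Bd + 1) + 3 + ((1024 * m ^ 10) * ((7 * (15 * Bd + 1) + 1) + 3) + 3)"

section \<open>Correctness of the direction search\<close>

context walk
begin

definition "penv a \<kappa> \<sigma> \<longleftrightarrow> \<sigma> ''m'' 0 = int m \<and> (\<forall>p<m. rv \<sigma> ''al'' p = a p) \<and>
  real_of_int (\<sigma> ''na'' 0) = (\<Sum>p<m. a p) \<and> (\<forall>p<m. rv \<sigma> ''bp'' p = bal m a \<beta> p) \<and>
  real_of_int (\<sigma> ''kp'' 0) = \<kappa>"

lemma proj_code_runb:
  assumes e: "penv a \<kappa> \<sigma>" and Bd: "m \<le> Bd" "1 \<le> Bd"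
  shows "\<exists>\<tau>. runb (blk proj_code) \<sigma> (4 * (15 * Bd + 1) + 1) \<tau> \<and>
    (\<forall>p<m. rv \<tau> ''v'' p = pj m a \<beta> \<kappa> (rv \<sigma> ''v2'') p) \<and>
    (\<forall>v. v \<notin> {''sm'', ''v3'', ''pp'', ''v'', ''k'', ''i''} \<longrightarrow> \<tau> v = \<sigma> v)"
proof -
  have m0: "\<sigma> ''m'' 0 = int m" using e by (simp add: penv_def)
  obtain \<sigma>1 where 1: "runb (SumA ''sm'' ''k'' (Const 1) ''i'' (V ''m'') (Get ''v2'' (V ''i''))) \<sigma> (15 * Bd) \<sigma>1"
    "\<sigma>1 ''sm'' 0 = (\<Sum>l<m. \<sigma> ''v2'' (int l))" "\<And>v. v \<notin> {''sm'', ''k'', ''i''} \<Longrightarrow> \<sigma>1 v = \<sigma> v"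
    using SumA_runb_uniform[of "''sm''" "''k''" "''i''" "Get ''v2'' (V ''i'')" "Const 1" "V ''m''" \<sigma> 1 m Bd] Bd m0 by auto
  obtain \<sigma>2 where 2: "runb (Asg ''v3'' ''k'' (V ''m'') (Times (Get ''al'' (V ''k'')) (Minus (Times (V ''na'') (Get ''v2'' (V ''k''))) (V ''sm'')))) \<sigma>1 (15 * Bd) \<sigma>2"
    "\<And>p. p < m \<Longrightarrow> \<sigma>2 ''v3'' (int p) = \<sigma> ''al'' (int p) * (\<sigma> ''na'' 0 * \<sigma> ''v2'' (int p) - \<sigma>1 ''sm'' 0)"
    "\<And>v. v \<notin> {''v3'', ''k''} \<Longrightarrow> \<sigma>2 v = \<sigma>1 v"
    using Asg_runb_uniform[of "''v3''" "''k''" "Times (Get ''al'' (V ''k'')) (Minus (Times (V ''na'') (Get ''v2'' (V ''k''))) (V ''sm''))" "V ''m''" \<sigma>1 m Bd] Bd m0 1(3)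
    by auto
  obtain \<sigma>3 where 3: "runb (SumA ''pp'' ''k'' (Const 1) ''i'' (V ''m'') (Times (Get ''bp'' (V ''i'')) (Get ''v3'' (V ''i'')))) \<sigma>2 (15 * Bd) \<sigma>3"
    "\<sigma>3 ''pp'' 0 = (\<Sum>l<m. \<sigma> ''bp'' (int l) * \<sigma>2 ''v3'' (int l))" "\<And>v. v \<notin> {''pp'', ''k'', ''i''} \<Longrightarrow> \<sigma>3 v = \<sigma>2 v"
    using SumA_runb_uniform[of "''pp''" "''k''" "''i''" "Times (Get ''bp'' (V ''i'')) (Get ''v3'' (V ''i''))" "Const 1" "V ''m''" \<sigma>2 1 m Bd] Bd m0 1(3) 2(3) by auto
  obtain \<sigma>4 where 4: "runb (Asg ''v'' ''k'' (V ''m'') (Minus (Times (V ''kp'') (Get ''v3'' (V ''k''))) (Times (V ''pp'') (Get ''bp'' (V ''k''))))) \<sigma>3 (15 * Bd) \<sigma>4"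
    "\<And>p. p < m \<Longrightarrow> \<sigma>4 ''v'' (int p) = \<sigma> ''kp'' 0 * \<sigma>2 ''v3'' (int p) - \<sigma>3 ''pp'' 0 * \<sigma> ''bp'' (int p)"
    "\<And>v. v \<notin> {''v'', ''k''} \<Longrightarrow> \<sigma>4 v = \<sigma>3 v"
    using Asg_runb_uniform[of "''v''" "''k''" "Minus (Times (V ''kp'') (Get ''v3'' (V ''k''))) (Times (V ''pp'') (Get ''bp'' (V ''k'')))" "V ''m''" \<sigma>3 m Bd] Bd m0 1(3) 2(3) 3(3)
    by auto
  have "runb (blk proj_code) \<sigma> (Suc (Suc (Suc (Suc 0))) * (15 * Bd + 1) + 1) \<sigma>4"
    unfolding proj_code_def
    by (intro blk_Cons_uniform[OF 1(1)] blk_Cons_uniform[OF 2(1)] blk_Cons_uniform[OF 3(1)] blk_Cons_uniform[OF 4(1)])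
      (use blk_Nil in simp)
  moreover have "rv \<sigma>4 ''v'' p = pj m a \<beta> \<kappa> (rv \<sigma> ''v2'') p" if p: "p < m" for p
  proof -
    have v3: "real_of_int (\<sigma>2 ''v3'' (int q)) = center m a (rv \<sigma> ''v2'') q" if "q < m" for q
      using e that 2(2)[OF that] 1(2) by (simp add: penv_def center_def rv_def)
    have "real_of_int (\<sigma>3 ''pp'' 0) = dot m (bal m a \<beta>) (center m a (rv \<sigma> ''v2''))"
      using e v3 3(2) by (simp add: penv_def dot_def rv_def)
    then show ?thesis using e v3[OF p] 4(2)[OF p] p by (simp add: penv_def pj_def rv_def)
  qed
  moreover have "\<sigma>4 v = \<sigma> v" if "v \<notin> {''sm'', ''v3'', ''pp'', ''v'', ''k'', ''i''}" for v
    using that 1(3)[of v] 2(3)[of v] 3(3)[of v] 4(3)[of v] by auto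
  ultimately show ?thesis by (intro exI[of _ \<sigma>4]) (simp add: numeral_eq_Suc)
qed

definition "benv st \<sigma> \<longleftrightarrow> \<sigma> ''N'' 0 = int N \<and> real_of_int (\<sigma> ''G'' 0) = G \<and>
  (\<forall>i<N. \<forall>p<m. real_of_int (\<sigma> ''bb'' (int i * int m + int p)) = b i p) \<and> (\<forall>i<N. rv \<sigma> ''kf'' i = st i)"

definition "pc = 16 * real m ^ 9 * G\<^sup>2"

lemma penv_cong: "(\<And>v. v \<in> {''m'', ''al'', ''na'', ''bp'', ''kp''} \<Longrightarrow> \<tau> v = \<sigma> v) \<Longrightarrow> penv a \<kappa> \<tau> = penv a \<kappa> \<sigma>"
  by (simp add: penv_def rv_def)

lemma benv_cong: "(\<And>v. v \<in> {''N'', ''G'', ''bb'', ''kf''} \<Longrightarrow> \<tau> v = \<sigma> v) \<Longrightarrow> benv st \<tau> = benv st \<sigma>"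
  by (simp add: benv_def rv_def)

lemma dv_runb:
  assumes m0: "\<sigma> ''m'' 0 = int m" and e: "benv st \<sigma>" and Bd: "N * m \<le> Bd" "N \<le> Bd" "1 \<le> Bd"
    and d: "dst \<notin> {''k'', ''i'', ''m'', ''N'', ''bb'', src}" "src \<notin> {''k'', ''i''}"
  shows "\<exists>\<tau>. runb (SumA dst ''k'' (V ''N'') ''i'' (V ''m'') (Times (row_at ''k'' ''i'') (Get src (V ''i'')))) \<sigma> (15 * Bd) \<tau> \<and>
    (\<forall>i<N. rv \<tau> dst i = dot m (b i) (rv \<sigma> src)) \<and> (\<forall>v. v \<notin> {dst, ''k'', ''i''} \<longrightarrow> \<tau> v = \<sigma> v)"
proof -
  have N0: "\<sigma> ''N'' 0 = int N" using e by (simp add: benv_def)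
  obtain \<tau> where \<tau>: "runb (SumA dst ''k'' (V ''N'') ''i'' (V ''m'') (Times (row_at ''k'' ''i'') (Get src (V ''i'')))) \<sigma> (15 * Bd) \<tau>"
    "\<And>i. i < N \<Longrightarrow> \<tau> dst (int i) = (\<Sum>l<m. \<sigma> ''bb'' (int i * int m + int l) * \<sigma> src (int l))"
    "\<And>v. v \<notin> {dst, ''k'', ''i''} \<Longrightarrow> \<tau> v = \<sigma> v"
    using SumA_runb_uniform[of dst "''k''" "''i''" "Times (row_at ''k'' ''i'') (Get src (V ''i''))" "V ''N''" "V ''m''" \<sigma> N m Bd] Bd m0 N0 d
    by auto
  have "rv \<tau> dst i = dot m (b i) (rv \<sigma> src)" if "i < N" for i
    using e that \<tau>(2)[OF that] by (simp add: benv_def dot_def rv_def)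
  then show ?thesis using \<tau> by blast
qed

lemma iter_code_runb:
  assumes p: "penv a \<kappa> \<sigma>" and e: "benv st \<sigma>" and Bd: "m \<le> Bd" "N * m \<le> Bd" "N \<le> Bd" "1 \<le> Bd"
  shows "\<exists>\<tau>. runb iter_code \<sigma> (7 * (15 * Bd + 1) + 1) \<tau> \<and>
    (\<forall>p<m. rv \<tau> ''v'' p = pstep m a \<beta> \<kappa> b N st pc (rv \<sigma> ''v'') p) \<and>
    (\<forall>v. v \<notin> {''dv'', ''rr'', ''v2'', ''sm'', ''v3'', ''pp'', ''v'', ''k'', ''i''} \<longrightarrow> \<tau> v = \<sigma> v)"
proof -
  have m0: "\<sigma> ''m'' 0 = int m" using p by (simp add: penv_def)
  have N0: "\<sigma> ''N'' 0 = int N" using e by (simp add: benv_def)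
  obtain \<sigma>1 where 1: "runb (SumA ''dv'' ''k'' (V ''N'') ''i'' (V ''m'') (Times (row_at ''k'' ''i'') (Get ''v'' (V ''i'')))) \<sigma> (15 * Bd) \<sigma>1"
    "\<And>i. i < N \<Longrightarrow> rv \<sigma>1 ''dv'' i = dot m (b i) (rv \<sigma> ''v'')" "\<And>v. v \<notin> {''dv'', ''k'', ''i''} \<Longrightarrow> \<sigma>1 v = \<sigma> v"
    using dv_runb[OF m0 e, of Bd "''dv''" "''v''"] Bd by auto
  obtain \<sigma>2 where 2: "runb (SumA ''rr'' ''k'' (V ''m'') ''i'' (V ''N'')
      (Times (Times (Get ''kf'' (V ''i'')) (row_at ''i'' ''k'')) (Get ''dv'' (V ''i'')))) \<sigma>1 (15 * Bd) \<sigma>2"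
    "\<And>q. q < m \<Longrightarrow> \<sigma>2 ''rr'' (int q) = (\<Sum>l<N. \<sigma> ''kf'' (int l) * \<sigma> ''bb'' (int l * int m + int q) * \<sigma>1 ''dv'' (int l))"
    "\<And>v. v \<notin> {''rr'', ''k'', ''i''} \<Longrightarrow> \<sigma>2 v = \<sigma>1 v"
    using SumA_runb_uniform[of "''rr''" "''k''" "''i''" "Times (Times (Get ''kf'' (V ''i'')) (row_at ''i'' ''k'')) (Get ''dv'' (V ''i''))" "V ''m''" "V ''N''" \<sigma>1 m N Bd] Bd m0 N0 1(3)
    by (auto simp: mult.commute[of m N])
  let ?e = "Times (Get ''al'' (V ''k''))
      (Minus (Times (Times (Times (Const 16) (Times pow4m (Times pow4m (V ''m'')))) (Times (V ''G'') (V ''G'')))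
        (Get ''v'' (V ''k''))) (Get ''rr'' (V ''k'')))"
  obtain \<sigma>3 where 3: "runb (Asg ''v2'' ''k'' (V ''m'') ?e) \<sigma>2 (15 * Bd) \<sigma>3"
    "\<And>q. q < m \<Longrightarrow> \<sigma>3 ''v2'' (int q) = \<sigma> ''al'' (int q) * (16 * (int m ^ 9) * (\<sigma> ''G'' 0 * \<sigma> ''G'' 0) * \<sigma> ''v'' (int q) - \<sigma>2 ''rr'' (int q))"
    "\<And>v. v \<notin> {''v2'', ''k''} \<Longrightarrow> \<sigma>3 v = \<sigma>2 v"
    using Asg_runb_uniform[of "''v2''" "''k''" ?e "V ''m''" \<sigma>2 m Bd] Bd m0 1(3) 2(3)
    by (auto simp: pow4m_def eval_nat_numeral mult_ac)
  have fr3: "\<sigma>3 v = \<sigma> v" if "v \<notin> {''v2'', ''rr'', ''dv'', ''k'', ''i''}" for v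
    using that 1(3)[of v] 2(3)[of v] 3(3)[of v] by auto
  have "penv a \<kappa> \<sigma>3 = penv a \<kappa> \<sigma>" by (rule penv_cong, rule fr3) auto
  then have "penv a \<kappa> \<sigma>3" using p by simp
  from proj_code_runb[OF this Bd(1,4)] obtain \<sigma>4 where
    4: "runb (blk proj_code) \<sigma>3 (4 * (15 * Bd + 1) + 1) \<sigma>4" "\<And>p. p < m \<Longrightarrow> rv \<sigma>4 ''v'' p = pj m a \<beta> \<kappa> (rv \<sigma>3 ''v2'') p"
    "\<And>v. v \<notin> {''sm'', ''v3'', ''pp'', ''v'', ''k'', ''i''} \<Longrightarrow> \<sigma>4 v = \<sigma>3 v" by auto
  have "runb (blk proj_code) \<sigma>3 (Suc (Suc (Suc (Suc 0))) * (15 * Bd + 1) + 1) \<sigma>4" using 4(1) by (simp add: numeral_eq_Suc)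
  then have "runb iter_code \<sigma> (Suc (Suc (Suc (Suc (Suc (Suc (Suc 0)))))) * (15 * Bd + 1) + 1) \<sigma>4"
    unfolding iter_code_def append_Cons append_Nil
    by (intro blk_Cons_uniform[OF 1(1)] blk_Cons_uniform[OF 2(1)] blk_Cons_uniform[OF 3(1)])
  moreover have "rv \<sigma>3 ''v2'' q = a q * (pc * rv \<sigma> ''v'' q - rad m b N st (rv \<sigma> ''v'') q)" if q: "q < m" for q
  proof -
    have "real_of_int (\<sigma>2 ''rr'' (int q)) = rad m b N st (rv \<sigma> ''v'') q"
      using 2(2)[OF q] e q 1(2) unfolding rad_def benv_def rv_def by (simp add: mult_ac)
    then show ?thesis using 3(2)[OF q] p q e
      by (simp add: rv_def pc_def penv_def benv_def power2_eq_square)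
  qed
  then have "pj m a \<beta> \<kappa> (rv \<sigma>3 ''v2'') q = pstep m a \<beta> \<kappa> b N st pc (rv \<sigma> ''v'') q" if "q < m" for q
    unfolding pstep_def using that by (intro pj_cong) auto
  moreover have "\<sigma>4 v = \<sigma> v" if "v \<notin> {''dv'', ''rr'', ''v2'', ''sm'', ''v3'', ''pp'', ''v'', ''k'', ''i''}" for v
    using that 4(3)[of v] fr3[of v] by auto
  ultimately show ?thesis using 4(2) by (intro exI[of _ \<sigma>4]) (simp add: numeral_eq_Suc)
qed

definition "cand a \<kappa> st w = (pstep m a \<beta> \<kappa> b N st pc ^^ (1024 * m ^ 10)) (pstart m a \<beta> \<kappa> w)"
text \<open>The part of \<open>gooddir\<close> that can fail, with the test that more than half of
  the coordinates move; admissibility holds for all iterates. For integral data it is decided by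
  comparing integers.\<close>

definition "good_cand a \<kappa> st w \<longleftrightarrow> real m < 2 * (\<Sum>p<m. a p) \<and> 0 < dot m (cand a \<kappa> st w) (cand a \<kappa> st w) \<and>
  16 * (\<Sum>i<N. st i * (dot m (b i) (cand a \<kappa> st w))\<^sup>2) \<le> G\<^sup>2 * dot m (cand a \<kappa> st w) (cand a \<kappa> st w)"

lemma iterate_runb:
  assumes p: "penv a \<kappa> \<sigma>" and e: "benv st \<sigma>" and Bd: "m \<le> Bd" "N * m \<le> Bd" "N \<le> Bd" "1 \<le> Bd"
  shows "\<exists>\<tau>. runb (For ''t'' (Times (Const 1024) (Times (Times pow4m pow4m) (Times (V ''m'') (V ''m'')))) iter_code) \<sigma>
      (1024 * m ^ 10 * ((7 * (15 * Bd + 1) + 1) + 3) + 3) \<tau> \<and>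
    (\<forall>p<m. rv \<tau> ''v'' p = (pstep m a \<beta> \<kappa> b N st pc ^^ (1024 * m ^ 10)) (rv \<sigma> ''v'') p) \<and>
    (\<forall>v. v \<notin> {''t'', ''dv'', ''rr'', ''v2'', ''sm'', ''v3'', ''pp'', ''v'', ''k'', ''i''} \<longrightarrow> \<tau> v = \<sigma> v)"
proof -
  let ?P = "pstep m a \<beta> \<kappa> b N st pc"
  define W where "W = {''t'', ''dv'', ''rr'', ''v2'', ''sm'', ''v3'', ''pp'', ''v'', ''k'', ''i''}"
  define I where "I j \<tau> \<longleftrightarrow> (\<forall>p<m. rv \<tau> ''v'' p = (?P ^^ j) (rv \<sigma> ''v'') p) \<and>
    (\<forall>v. v \<notin> W \<longrightarrow> \<tau> v = \<sigma> v)" for j \<tau>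
  have "\<exists>\<tau>. runb (For ''t'' (Times (Const 1024) (Times (Times pow4m pow4m) (Times (V ''m'') (V ''m'')))) iter_code) \<sigma>
      (1024 * m ^ 10 * ((7 * (15 * Bd + 1) + 1) + 3) + 3) \<tau> \<and> I (1024 * m ^ 10) \<tau> \<and> \<tau> ''t'' 0 = int (1024 * m ^ 10)"
  proof (rule For_runb)
    show "I 0 \<sigma>" by (simp add: I_def)
  next
    fix j \<tau> assume j: "I j \<tau>" "\<tau> ''t'' 0 = int j"
    have fr: "\<tau> v = \<sigma> v" if "v \<notin> W" for v
      using j(1) that unfolding I_def by blast
    have "penv a \<kappa> \<tau> = penv a \<kappa> \<sigma>" by (rule penv_cong, rule fr) (auto simp: W_def)
    moreover have "benv st \<tau> = benv st \<sigma>" by (rule benv_cong, rule fr) (auto simp: W_def)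
    ultimately have "penv a \<kappa> \<tau>" "benv st \<tau>" using p e by auto
    from iter_code_runb[OF this Bd] obtain \<rho> where r: "runb iter_code \<tau> (7 * (15 * Bd + 1) + 1) \<rho>"
      "\<And>p. p < m \<Longrightarrow> rv \<rho> ''v'' p = ?P (rv \<tau> ''v'') p"
      "\<And>v. v \<notin> {''dv'', ''rr'', ''v2'', ''sm'', ''v3'', ''pp'', ''v'', ''k'', ''i''} \<Longrightarrow> \<rho> v = \<tau> v" by blast
    have "rv \<rho> ''v'' q = (?P ^^ Suc j) (rv \<sigma> ''v'') q" if "q < m" for q
      using r(2)[OF that] pstep_cong[of m "rv \<tau> ''v''" "(?P ^^ j) (rv \<sigma> ''v'')" q] j that by (simp add: I_def)
    moreover have "\<rho> v = \<sigma> v" if "v \<notin> W" for v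
      using that fr[of v] r(3)[of v] by (auto simp: W_def)
    moreover have "\<rho> ''t'' 0 = int j" using r(3)[of "''t''"] j(2) by simp
    ultimately show "\<exists>\<rho>. runb iter_code \<tau> (7 * (15 * Bd + 1) + 1) \<rho> \<and> I (Suc j) \<rho> \<and> \<rho> ''t'' 0 = int j"
      using r(1) unfolding I_def by blast
  next
    fix j \<tau> z assume "I j \<tau>"
    then show "I j (setc \<tau> ''t'' z)" by (simp add: I_def rv_def W_def)
  next
    fix j \<tau> assume "I j \<tau>"
    then have "\<tau> ''m'' 0 = int m" using p by (simp add: I_def penv_def W_def)
    then show "aval (Times (Const 1024) (Times (Times pow4m pow4m) (Times (V ''m'') (V ''m'')))) \<tau> = int (1024 * m ^ 10)"
      by (simp add: pow4m_def eval_nat_numeral mult_ac)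
  qed
  then show ?thesis unfolding I_def W_def[symmetric] by blast
qed

end

context walk
begin

lemma funpow_pstep_cong:
  assumes "\<And>p. p < m \<Longrightarrow> v p = v' p" "q < m"
  shows "(pstep m a \<beta> \<kappa> b N st pc ^^ j) v q = (pstep m a \<beta> \<kappa> b N st pc ^^ j) v' q"
  using assms(2)
proof (induction j arbitrary: q)
  case 0
  then show ?case using assms by simp
next
  case (Suc j)
  then show ?case using pstep_cong[of m "(pstep m a \<beta> \<kappa> b N st pc ^^ j) v" "(pstep m a \<beta> \<kappa> b N st pc ^^ j) v'" q] by simp
qed

lemma try_code_runb:
  assumes p: "penv a \<kappa> \<sigma>" and e: "benv st \<sigma>" and Bd: "m \<le> Bd" "N * m \<le> Bd" "N \<le> Bd" "1 \<le> Bd"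
    and w: "\<sigma> ''w'' 0 = int w"
  shows "\<exists>\<tau>. runb try_code \<sigma> (try_cost m Bd) \<tau> \<and>
    (\<forall>p<m. rv \<tau> ''u'' p = (if good_cand a \<kappa> st w then cand a \<kappa> st w p else rv \<sigma> ''u'' p)) \<and>
    (\<forall>v. v \<notin> {''gd'', ''nv'', ''qv'', ''u'', ''u2'', ''t'', ''dv'', ''rr'', ''v2'', ''sm'', ''v3'', ''pp'', ''v'', ''k'', ''i''} \<longrightarrow> \<tau> v = \<sigma> v)"
proof -
  define W where "W = {''gd'', ''nv'', ''qv'', ''u'', ''u2'', ''t'', ''dv'', ''rr'', ''v2'', ''sm'', ''v3'', ''pp'', ''v'', ''k'', ''i''}"
  have m0: "\<sigma> ''m'' 0 = int m" using p by (simp add: penv_def)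
  have N0: "\<sigma> ''N'' 0 = int N" using e by (simp add: benv_def)
  let ?e1 = "Times (Times (Minus (Const 1) (Lt (V ''k'') (V ''w'')))
      (Minus (Const 1) (Lt (V ''w'') (V ''k'')))) (Get ''al'' (V ''k''))"
  obtain \<sigma>1 where 1: "runb (Asg ''v2'' ''k'' (V ''m'') ?e1) \<sigma> (15 * Bd) \<sigma>1"
    "\<And>q. q < m \<Longrightarrow> \<sigma>1 ''v2'' (int q) = of_bool (q = w) * \<sigma> ''al'' (int q)"
    "\<And>v. v \<notin> {''v2'', ''k''} \<Longrightarrow> \<sigma>1 v = \<sigma> v"
    using Asg_runb_uniform[of "''v2''" "''k''" ?e1 "V ''m''" \<sigma> m Bd] Bd m0 w
    by (auto simp: of_bool_def)
  have f1: "\<sigma>1 v = \<sigma> v" if "v \<notin> W" for v using 1(3)[of v] that by (auto simp: W_def)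
  have "penv a \<kappa> \<sigma>1 = penv a \<kappa> \<sigma>" by (rule penv_cong, rule 1(3)) auto
  then have p1: "penv a \<kappa> \<sigma>1" using p by simp
  from proj_code_runb[OF p1 Bd(1,4)] obtain \<sigma>2 where
    2: "runb (blk proj_code) \<sigma>1 (4 * (15 * Bd + 1) + 1) \<sigma>2" "\<And>p. p < m \<Longrightarrow> rv \<sigma>2 ''v'' p = pj m a \<beta> \<kappa> (rv \<sigma>1 ''v2'') p"
    "\<And>v. v \<notin> {''sm'', ''v3'', ''pp'', ''v'', ''k'', ''i''} \<Longrightarrow> \<sigma>2 v = \<sigma>1 v" by auto
  have f2: "\<sigma>2 v = \<sigma> v" if "v \<notin> W" for v using f1[OF that] 2(3)[of v] that by (auto simp: W_def)
  have "penv a \<kappa> \<sigma>2 = penv a \<kappa> \<sigma>" by (rule penv_cong, rule f2) (auto simp: W_def)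
  moreover have "benv st \<sigma>2 = benv st \<sigma>" by (rule benv_cong, rule f2) (auto simp: W_def)
  ultimately have e2: "penv a \<kappa> \<sigma>2" "benv st \<sigma>2" using p e by auto
  have v2: "rv \<sigma>2 ''v'' q = pstart m a \<beta> \<kappa> w q" if "q < m" for q
  proof -
    have "pj m a \<beta> \<kappa> (rv \<sigma>1 ''v2'') q = pj m a \<beta> \<kappa> (\<lambda>p. of_bool (p = w) * a p) q"
      using p 1(2) that by (intro pj_cong) (auto simp: rv_def penv_def of_bool_def)
    then show ?thesis using 2(2)[OF that] by (simp add: pstart_def)
  qed
  obtain \<sigma>3 where 3: "runb (For ''t'' (Times (Const 1024) (Times (Times pow4m pow4m) (Times (V ''m'') (V ''m'')))) iter_code) \<sigma>2
      (1024 * m ^ 10 * ((7 * (15 * Bd + 1) + 1) + 3) + 3) \<sigma>3"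
    "\<And>p. p < m \<Longrightarrow> rv \<sigma>3 ''v'' p = (pstep m a \<beta> \<kappa> b N st pc ^^ (1024 * m ^ 10)) (rv \<sigma>2 ''v'') p"
    "\<And>v. v \<notin> {''t'', ''dv'', ''rr'', ''v2'', ''sm'', ''v3'', ''pp'', ''v'', ''k'', ''i''} \<Longrightarrow> \<sigma>3 v = \<sigma>2 v"
    using iterate_runb[OF e2 Bd] by auto
  have v3: "rv \<sigma>3 ''v'' q = cand a \<kappa> st w q" if "q < m" for q
    unfolding cand_def using 3(2)[OF that] funpow_pstep_cong[OF v2 that] by simp
  have f3: "\<sigma>3 v = \<sigma> v" if "v \<notin> W" for v using f2[OF that] 3(3)[of v] that by (auto simp: W_def)
  have "penv a \<kappa> \<sigma>3 = penv a \<kappa> \<sigma>" by (rule penv_cong, rule f3) (auto simp: W_def)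
  moreover have "benv st \<sigma>3 = benv st \<sigma>" by (rule benv_cong, rule f3) (auto simp: W_def)
  ultimately have e3: "penv a \<kappa> \<sigma>3" "benv st \<sigma>3" using p e by auto
  have u3: "\<sigma>3 ''u'' = \<sigma> ''u''" using 1(3)[of "''u''"] 2(3)[of "''u''"] 3(3)[of "''u''"] by simp
  have m3: "\<sigma>3 ''m'' 0 = int m" using e3 by (simp add: penv_def)
  have N3: "\<sigma>3 ''N'' 0 = int N" using e3 by (simp add: benv_def)
  obtain \<sigma>4 where 4: "runb (SumA ''dv'' ''k'' (V ''N'') ''i'' (V ''m'') (Times (row_at ''k'' ''i'') (Get ''v'' (V ''i'')))) \<sigma>3 (15 * Bd) \<sigma>4"
    "\<And>i. i < N \<Longrightarrow> rv \<sigma>4 ''dv'' i = dot m (b i) (rv \<sigma>3 ''v'')" "\<And>v. v \<notin> {''dv'', ''k'', ''i''} \<Longrightarrow> \<sigma>4 v = \<sigma>3 v"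
    using dv_runb[OF m3 e3(2), of Bd "''dv''" "''v''"] Bd by auto
  let ?e5 = "Times (Times (Get ''kf'' (V ''i'')) (Get ''dv'' (V ''i''))) (Get ''dv'' (V ''i''))"
  obtain \<sigma>5 where 5: "runb (SumA ''qv'' ''k'' (Const 1) ''i'' (V ''N'') ?e5) \<sigma>4 (15 * Bd) \<sigma>5"
    "\<sigma>5 ''qv'' 0 = (\<Sum>l<N. \<sigma>3 ''kf'' (int l) * \<sigma>4 ''dv'' (int l) * \<sigma>4 ''dv'' (int l))"
    "\<And>v. v \<notin> {''qv'', ''k'', ''i''} \<Longrightarrow> \<sigma>5 v = \<sigma>4 v"
    using SumA_runb_uniform[of "''qv''" "''k''" "''i''" ?e5 "Const 1" "V ''N''" \<sigma>4 1 N Bd] Bd N3 4(3) by auto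
  let ?e6 = "Times (Get ''v'' (V ''i'')) (Get ''v'' (V ''i''))"
  obtain \<sigma>6 where 6: "runb (SumA ''nv'' ''k'' (Const 1) ''i'' (V ''m'') ?e6) \<sigma>5 (15 * Bd) \<sigma>6"
    "\<sigma>6 ''nv'' 0 = (\<Sum>l<m. \<sigma>3 ''v'' (int l) * \<sigma>3 ''v'' (int l))"
    "\<And>v. v \<notin> {''nv'', ''k'', ''i''} \<Longrightarrow> \<sigma>6 v = \<sigma>5 v"
    using SumA_runb_uniform[of "''nv''" "''k''" "''i''" ?e6 "Const 1" "V ''m''" \<sigma>5 1 m Bd] Bd m3 4(3) 5(3) by auto
  let ?e7 = "Times (Lt (V ''m'') (Times (Const 2) (V ''na'')))
      (Times (Lt (Const 0) (V ''nv''))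
        (Minus (Const 1) (Lt (Times (Times (V ''G'') (V ''G'')) (V ''nv'')) (Times (Const 16) (V ''qv'')))))"
  obtain \<sigma>7 where 7: "runb (Asg ''gd'' ''k'' (Const 1) ?e7) \<sigma>6 (15 * Bd) \<sigma>7"
    "\<sigma>7 ''gd'' 0 = of_bool (int m < 2 * \<sigma>3 ''na'' 0) * (of_bool (0 < \<sigma>6 ''nv'' 0) * (1 - of_bool (\<sigma>3 ''G'' 0 * \<sigma>3 ''G'' 0 * \<sigma>6 ''nv'' 0 < 16 * \<sigma>5 ''qv'' 0)))"
    "\<And>v. v \<notin> {''gd'', ''k''} \<Longrightarrow> \<sigma>7 v = \<sigma>6 v"
    using Asg_runb_uniform[of "''gd''" "''k''" ?e7 "Const 1" \<sigma>6 1 Bd] Bd m3 4(3) 5(3) 6(3)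
    by (auto simp del: mult_eq_0_iff split del: if_split)
  let ?e8 = "Plus (Times (V ''gd'') (Get ''v'' (V ''k''))) (Times (Minus (Const 1) (V ''gd'')) (Get ''u'' (V ''k'')))"
  obtain \<sigma>8 where 8: "runb (Asg ''u2'' ''k'' (V ''m'') ?e8) \<sigma>7 (15 * Bd) \<sigma>8"
    "\<And>q. q < m \<Longrightarrow> \<sigma>8 ''u2'' (int q) = \<sigma>7 ''gd'' 0 * \<sigma>3 ''v'' (int q) + (1 - \<sigma>7 ''gd'' 0) * \<sigma> ''u'' (int q)"
    "\<And>v. v \<notin> {''u2'', ''k''} \<Longrightarrow> \<sigma>8 v = \<sigma>7 v"
    using Asg_runb_uniform[of "''u2''" "''k''" ?e8 "V ''m''" \<sigma>7 m Bd] Bd m3 u3 4(3) 5(3) 6(3) 7(3)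
    by auto
  obtain \<sigma>9 where 9: "runb (Asg ''u'' ''k'' (V ''m'') (Get ''u2'' (V ''k''))) \<sigma>8 (15 * Bd) \<sigma>9"
    "\<And>q. q < m \<Longrightarrow> \<sigma>9 ''u'' (int q) = \<sigma>8 ''u2'' (int q)"
    "\<And>v. v \<notin> {''u'', ''k''} \<Longrightarrow> \<sigma>9 v = \<sigma>8 v"
    using Asg_runb_uniform[of "''u''" "''k''" "Get ''u2'' (V ''k'')" "V ''m''" \<sigma>8 m Bd] Bd m3 4(3) 5(3) 6(3) 7(3) 8(3)
    by auto
  have f9: "\<sigma>9 v = \<sigma> v" if "v \<notin> W" for v
    using f3[OF that] 4(3)[of v] 5(3)[of v] 6(3)[of v] 7(3)[of v] 8(3)[of v] 9(3)[of v] that by (auto simp: W_def)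
  have tl: "runb (blk [SumA ''dv'' ''k'' (V ''N'') ''i'' (V ''m'') (Times (row_at ''k'' ''i'') (Get ''v'' (V ''i''))),
    SumA ''qv'' ''k'' (Const 1) ''i'' (V ''N'') ?e5, SumA ''nv'' ''k'' (Const 1) ''i'' (V ''m'') ?e6,
    Asg ''gd'' ''k'' (Const 1) ?e7, Asg ''u2'' ''k'' (V ''m'') ?e8, Asg ''u'' ''k'' (V ''m'') (Get ''u2'' (V ''k''))]) \<sigma>3
    (Suc (Suc (Suc (Suc (Suc (Suc 0))))) * (15 * Bd + 1) + 1) \<sigma>9"
    by (intro blk_Cons_uniform[OF 4(1)] blk_Cons_uniform[OF 5(1)] blk_Cons_uniform[OF 6(1)] blk_Cons_uniform[OF 7(1)] blk_Cons_uniform[OF 8(1)] blk_Cons_uniform[OF 9(1)])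
      (use blk_Nil in simp)
  note whole = blk_Cons[OF 1(1) blk_append[OF 2(1) blk_Cons[OF 3(1) tl]]]
  have run: "runb try_code \<sigma> (try_cost m Bd) \<sigma>9"
    using whole unfolding try_code_def try_cost_def append_Cons append_Nil
    by (rule runb_mono) (simp add: algebra_simps)
  have gd: "\<sigma>7 ''gd'' 0 = of_bool (good_cand a \<kappa> st w)"
  proof -
    have na: "real_of_int (\<sigma>3 ''na'' 0) = (\<Sum>p<m. a p)" using e3 by (simp add: penv_def)
    have GG: "real_of_int (\<sigma>3 ''G'' 0) = G" using e3 by (simp add: benv_def)
    have nv: "real_of_int (\<sigma>6 ''nv'' 0) = dot m (cand a \<kappa> st w) (cand a \<kappa> st w)"
      using v3 by (simp add: 6(2) dot_def rv_def)
    have "dot m (b i) (rv \<sigma>3 ''v'') = dot m (b i) (cand a \<kappa> st w)" for i using v3 by (intro dot_cong) auto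
    then have qv: "real_of_int (\<sigma>5 ''qv'' 0) = (\<Sum>i<N. st i * (dot m (b i) (cand a \<kappa> st w))\<^sup>2)"
      using e3(2) 4(2) by (simp add: 5(2) benv_def rv_def power2_eq_square mult_ac)
    have "int m < 2 * \<sigma>3 ''na'' 0 \<longleftrightarrow> real m < 2 * (\<Sum>p<m. a p)"
      unfolding na[symmetric] by linarith
    moreover have "0 < \<sigma>6 ''nv'' 0 \<longleftrightarrow> 0 < dot m (cand a \<kappa> st w) (cand a \<kappa> st w)"
      unfolding nv[symmetric] by simp
    moreover have "\<sigma>3 ''G'' 0 * \<sigma>3 ''G'' 0 * \<sigma>6 ''nv'' 0 < 16 * \<sigma>5 ''qv'' 0 \<longleftrightarrow>
        G\<^sup>2 * dot m (cand a \<kappa> st w) (cand a \<kappa> st w) < 16 * (\<Sum>i<N. st i * (dot m (b i) (cand a \<kappa> st w))\<^sup>2)"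
    proof -
      have "\<sigma>3 ''G'' 0 * \<sigma>3 ''G'' 0 * \<sigma>6 ''nv'' 0 < 16 * \<sigma>5 ''qv'' 0 \<longleftrightarrow>
        real_of_int (\<sigma>3 ''G'' 0 * \<sigma>3 ''G'' 0 * \<sigma>6 ''nv'' 0) < real_of_int (16 * \<sigma>5 ''qv'' 0)"
        by (simp only: of_int_less_iff)
      then show ?thesis unfolding of_int_mult of_int_numeral nv qv GG by (simp add: power2_eq_square)
    qed
    ultimately show ?thesis unfolding 7(2) good_cand_def by (auto simp: not_less of_bool_def)
  qed
  have "rv \<sigma>9 ''u'' q = (if good_cand a \<kappa> st w then cand a \<kappa> st w q else rv \<sigma> ''u'' q)" if "q < m" for q
    using v3[OF that] 9(2)[OF that] 8(2)[OF that] gd by (simp add: rv_def)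
  with run f9 show ?thesis unfolding W_def[symmetric] by blast
qed

lemma gooddir_cong: "(\<And>p. p < m \<Longrightarrow> v p = v' p) \<Longrightarrow> gooddir y v = gooddir y v'"
proof -
  assume v: "\<And>p. p < m \<Longrightarrow> v p = v' p"
  have "dot m w v = dot m w v'" for w using v by (intro dot_cong) auto
  moreover have "dot m v v = dot m v' v'" using v by (intro dot_cong) auto
  ultimately show ?thesis using v unfolding gooddir_def admdir_def qform_def by auto
qed

text \<open>While more than half of the coordinates move, some start succeeds; later failures keep
  \<open>u\<close>, and later successes replace it by another good direction. Otherwise no candidate
  passes the test and \<open>u\<close> stays 0, which makes the step idle.\<close>

lemma search_code_runb:
  fixes y :: "nat \<Rightarrow> real"
  defines "a \<equiv> \<lambda>p. of_bool (alive y p)"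
  assumes inv: "winv k y" and tot: "(\<Sum>i<N. dot m (b i) (b i)) \<le> real m ^ 5 * G\<^sup>2"
    and \<kappa>: "0 < \<kappa>" "dot m (bal m a \<beta>) (bal m a \<beta>) = 0 \<or> \<kappa> = dot m (bal m a \<beta>) (bal m a \<beta>)"
    and p: "penv a \<kappa> \<sigma>" and e: "benv (stiff y) \<sigma>" and Bd: "m \<le> Bd" "N * m \<le> Bd" "N \<le> Bd" "1 \<le> Bd"
    and u: "\<forall>p<m. \<sigma> ''u'' (int p) = 0"
  shows "\<exists>\<tau>. runb search_code \<sigma> (m * (try_cost m Bd + 3) + 3) \<tau> \<and>
    (if 2 * frozen y < m then gooddir y (rv \<tau> ''u'') else (\<forall>p<m. rv \<tau> ''u'' p = 0)) \<and>
    (\<forall>v. v \<notin> {''w'', ''gd'', ''nv'', ''qv'', ''u'', ''u2'', ''t'', ''dv'', ''rr'', ''v2'', ''sm'', ''v3'', ''pp'', ''v'', ''k'', ''i''} \<longrightarrow> \<tau> v = \<sigma> v)"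
proof -
  define W where "W = {''w'', ''gd'', ''nv'', ''qv'', ''u'', ''u2'', ''t'', ''dv'', ''rr'', ''v2'', ''sm'', ''v3'', ''pp'', ''v'', ''k'', ''i''}"
  have suma: "(\<Sum>p<m. a p) = real m - real (frozen y)"
  proof -
    have "{..<m} = {p. p < m \<and> alive y p} \<union> {p. p < m \<and> \<not> alive y p}" by auto
    then have "m = card ({p. p < m \<and> alive y p} \<union> {p. p < m \<and> \<not> alive y p})" by (metis card_lessThan)
    also have "\<dots> = card {p. p < m \<and> alive y p} + frozen y"
      unfolding frozen_def by (intro card_Un_disjoint) auto
    finally have "real (card {p. p < m \<and> alive y p}) = real m - real (frozen y)" by simp
    moreover have "{..<m} \<inter> {p. alive y p} = {p. p < m \<and> alive y p}" by auto
    ultimately show ?thesis by (simp add: a_def)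
  qed
  have unf: "real m < 2 * (\<Sum>p<m. a p) \<longleftrightarrow> 2 * frozen y < m" 
  proof -
    have "2 * frozen y < m \<longleftrightarrow> real (2 * frozen y) < real m" by (simp only: of_nat_less_iff)
    then show ?thesis unfolding suma by (simp add: algebra_simps)
  qed
  have good: "gooddir y (cand a \<kappa> (stiff y) w)" if "good_cand a \<kappa> (stiff y) w" for w
    using that search_gooddir(2)[OF inv _ tot \<kappa>, of "stiff y"] unf
    unfolding good_cand_def gooddir_def qform_def cand_def pc_def by (auto simp: a_def)
  have ex: "\<exists>w<m. good_cand a \<kappa> (stiff y) w" if "2 * frozen y < m"
    using search_gooddir(1)[OF inv that tot \<kappa>, of "stiff y"] unf that
    unfolding good_cand_def gooddir_def qform_def cand_def pc_def by (auto simp: a_def)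
  define I where "I j \<tau> \<longleftrightarrow> ((\<forall>p<m. rv \<tau> ''u'' p = 0) \<or> gooddir y (rv \<tau> ''u'')) \<and>
    ((\<exists>w<j. good_cand a \<kappa> (stiff y) w) \<longrightarrow> gooddir y (rv \<tau> ''u'')) \<and>
    (\<not> 2 * frozen y < m \<longrightarrow> (\<forall>p<m. rv \<tau> ''u'' p = 0)) \<and> (\<forall>v. v \<notin> W \<longrightarrow> \<tau> v = \<sigma> v)" for j \<tau>
  have "\<exists>\<tau>. runb (For ''w'' (V ''m'') try_code) \<sigma> (m * (try_cost m Bd + 3) + 3) \<tau> \<and> I m \<tau> \<and> \<tau> ''w'' 0 = int m"
  proof (rule For_runb)
    show "I 0 \<sigma>" using u by (simp add: I_def rv_def)
  next
    fix j \<tau> assume j: "j < m" "I j \<tau>" "\<tau> ''w'' 0 = int j"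
    have fr: "\<tau> v = \<sigma> v" if "v \<notin> W" for v using j(2) that unfolding I_def by blast
    have "penv a \<kappa> \<tau> = penv a \<kappa> \<sigma>" by (rule penv_cong, rule fr) (auto simp: W_def)
    moreover have "benv (stiff y) \<tau> = benv (stiff y) \<sigma>" by (rule benv_cong, rule fr) (auto simp: W_def)
    ultimately have "penv a \<kappa> \<tau>" "benv (stiff y) \<tau>" using p e by auto
    from try_code_runb[OF this Bd j(3)] obtain \<rho> where r: "runb try_code \<tau> (try_cost m Bd) \<rho>"
      "\<And>p. p < m \<Longrightarrow> rv \<rho> ''u'' p = (if good_cand a \<kappa> (stiff y) j then cand a \<kappa> (stiff y) j p else rv \<tau> ''u'' p)"
      "\<forall>v. v \<notin> {''gd'', ''nv'', ''qv'', ''u'', ''u2'', ''t'', ''dv'', ''rr'', ''v2'', ''sm'', ''v3'', ''pp'', ''v'', ''k'', ''i''} \<longrightarrow> \<rho> v = \<tau> v"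
      by auto
    have "I (Suc j) \<rho>"
    proof (cases "good_cand a \<kappa> (stiff y) j")
      case True
      then have "gooddir y (rv \<rho> ''u'')" using r(2) good[OF True] gooddir_cong[of "rv \<rho> ''u''" "cand a \<kappa> (stiff y) j" y] by simp
      moreover have "2 * frozen y < m" using True unf by (simp add: good_cand_def)
      moreover have "\<rho> v = \<sigma> v" if "v \<notin> W" for v using fr[OF that] r(3) that by (auto simp: W_def)
      ultimately show ?thesis by (simp add: I_def)
    next
      case False
      then have eq: "\<And>p. p < m \<Longrightarrow> rv \<rho> ''u'' p = rv \<tau> ''u'' p" using r(2) by simp
      then have "gooddir y (rv \<rho> ''u'') = gooddir y (rv \<tau> ''u'')" by (rule gooddir_cong)
      moreover have "\<rho> v = \<sigma> v" if "v \<notin> W" for v using fr[OF that] r(3) that by (auto simp: W_def)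
      moreover have "(\<exists>w<Suc j. good_cand a \<kappa> (stiff y) w) = (\<exists>w<j. good_cand a \<kappa> (stiff y) w)"
        using False less_Suc_eq by auto
      ultimately show ?thesis using j(2) eq by (simp add: I_def)
    qed
    moreover have "\<rho> ''w'' 0 = int j" using r(3) j(3) by simp
    ultimately show "\<exists>\<rho>. runb try_code \<tau> (try_cost m Bd) \<rho> \<and> I (Suc j) \<rho> \<and> \<rho> ''w'' 0 = int j"
      using r(1) by blast
  next
    fix j \<tau> z assume "I j \<tau>"
    moreover have "rv (setc \<tau> ''w'' z) ''u'' = rv \<tau> ''u''" by (simp add: rv_def fun_eq_iff)
    moreover have "setc \<tau> ''w'' z v = \<tau> v" if "v \<notin> W" for v using that by (auto simp: W_def)
    ultimately show "I j (setc \<tau> ''w'' z)" unfolding I_def by metis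
  next
    fix j \<tau> assume "I j \<tau>"
    then have "\<tau> ''m'' = \<sigma> ''m''" by (simp add: I_def W_def)
    then show "aval (V ''m'') \<tau> = int m" using p by (simp add: penv_def)
  qed
  then obtain \<tau> where \<tau>: "runb search_code \<sigma> (m * (try_cost m Bd + 3) + 3) \<tau>" "I m \<tau>"
    unfolding search_code_def by blast
  have "if 2 * frozen y < m then gooddir y (rv \<tau> ''u'') else (\<forall>p<m. rv \<tau> ''u'' p = 0)"
    using \<tau>(2) ex by (simp add: I_def)
  moreover have "\<forall>v. v \<notin> W \<longrightarrow> \<tau> v = \<sigma> v" using \<tau>(2) unfolding I_def by blast
  ultimately show ?thesis using \<tau>(1) unfolding W_def[symmetric] by blast
qed

end

section \<open>Program text of one step\<close>

text \<open>\<open>kp\<close> is the squared norm of \<open>bal\<close>, or 1 if that is 0.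
  \<open>Z\<close> and \<open>dz\<close> are the displacement and its inner products with the
  constraints, scaled by \<open>D * Dx\<close>. \<open>tg\<close> flags the active constraints by
  comparing squares, and \<open>kf\<close> holds the weights \<open>stiff\<close>.\<close>

definition prep_code :: "com list" where
  "prep_code =
   [Asg ''al'' ''k'' (V ''m'') (Times (Lt (Const 0) (Get ''Y'' (V ''k''))) (Lt (Get ''Y'' (V ''k'')) (V ''D''))),
    SumA ''na'' ''k'' (Const 1) ''i'' (V ''m'') (Get ''al'' (V ''i'')),
    SumA ''sb'' ''k'' (Const 1) ''i'' (V ''m'') (Times (Get ''al'' (V ''i'')) (Get ''beta'' (V ''i''))),
    Asg ''bp'' ''k'' (V ''m'') (Times (Get ''al'' (V ''k'')) (Minus (Times (V ''na'')
      (Times (Get ''al'' (V ''k'')) (Get ''beta'' (V ''k'')))) (V ''sb''))),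
    SumA ''kq'' ''k'' (Const 1) ''i'' (V ''m'') (Times (Get ''bp'' (V ''i'')) (Get ''bp'' (V ''i''))),
    Asg ''kp'' ''k'' (Const 1) (Plus (V ''kq'') (Lt (V ''kq'') (Const 1))),
    Asg ''Z'' ''k'' (V ''m'') (Minus (Times (Get ''Y'' (V ''k'')) (V ''Dx'')) (Times (Get ''X'' (V ''k'')) (V ''D''))),
    SumA ''dz'' ''k'' (V ''N'') ''i'' (V ''m'') (Times (row_at ''k'' ''i'') (Get ''Z'' (V ''i''))),
    Asg ''tg'' ''k'' (V ''N'') (Minus (Const 1) (Times (Minus (Const 1) (Get ''hd'' (V ''k'')))
      (Lt (Times (Get ''dz'' (V ''k'')) (Get ''dz'' (V ''k'')))
        (Times (Times (V ''G'') (Times (V ''D'') (V ''Dx''))) (Times (V ''G'') (Times (V ''D'') (V ''Dx''))))))),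
    Asg ''kf'' ''k'' (V ''N'') (Plus (Const 1) (Times (Minus (Times (Const 16) pow4m) (Const 1)) (Get ''tg'' (V ''k'')))),
    Asg ''u'' ''k'' (V ''m'') (Const 0)]"

text \<open>\<open>ng\<close> detects a negative slope, and \<open>us\<close> is the direction with
  its sign corrected. The step length is encoded as \<open>num / (D * den)\<close>:
  \<open>rm\<close> is the room of a coordinate times \<open>D\<close>, and initially
  \<open>num = D\<close>, \<open>den = W\<close> stand for the sum norm limit \<open>1 / W\<close>.
  An idle direction has \<open>W = 0\<close>, and \<open>den\<close> becomes 1.\<close>

definition dir_code :: "com list" where
  "dir_code =
   [SumA ''du'' ''k'' (V ''N'') ''i'' (V ''m'') (Times (row_at ''k'' ''i'') (Get ''u'' (V ''i''))),
    SumA ''e1'' ''k'' (Const 1) ''i'' (V ''m'') (Times (Get ''Z'' (V ''i'')) (Get ''u'' (V ''i''))),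
    SumA ''e2'' ''k'' (Const 1) ''i'' (V ''N'') (Times (Times (Minus (Const 1) (Get ''hd'' (V ''i''))) (Get ''dz'' (V ''i''))) (Get ''du'' (V ''i''))),
    Asg ''ng'' ''k'' (Const 1) (Lt (Times (Times (V ''G'') (V ''G'')) (V ''e1'')) (Times (Const 8) (V ''e2''))),
    Asg ''us'' ''k'' (V ''m'') (Times (Minus (Const 1) (Times (Const 2) (V ''ng''))) (Get ''u'' (V ''k''))),
    Asg ''au'' ''k'' (V ''m'') (Times (Get ''us'' (V ''k'')) (Minus (Const 1) (Times (Const 2) (Lt (Get ''us'' (V ''k'')) (Const 0))))),
    Asg ''rm'' ''k'' (V ''m'') (Plus (Times (Lt (Const 0) (Get ''us'' (V ''k''))) (Minus (V ''D'') (Get ''Y'' (V ''k''))))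
      (Times (Minus (Const 1) (Lt (Const 0) (Get ''us'' (V ''k'')))) (Get ''Y'' (V ''k'')))),
    SumA ''W'' ''k'' (Const 1) ''i'' (V ''m'') (Get ''au'' (V ''i'')),
    Asg ''den'' ''k'' (Const 1) (Plus (V ''W'') (Lt (V ''W'') (Const 1))),
    Asg ''num'' ''k'' (Const 1) (V ''D'')]"

text \<open>A running minimum of fractions \<open>rm / au\<close>, compared by cross multiplication.
  A coordinate with \<open>au = 0\<close> never wins, because \<open>rm * den\<close> is not
  negative.\<close>

definition min_code :: com where
  "min_code = For ''w'' (V ''m'') (blk
   [Asg ''fl'' ''k'' (Const 1) (Lt (Times (Get ''rm'' (V ''w'')) (V ''den'')) (Times (V ''num'') (Get ''au'' (V ''w'')))),
    Asg ''num2'' ''k'' (Const 1) (Plus (Times (V ''fl'') (Get ''rm'' (V ''w''))) (Times (Minus (Const 1) (V ''fl'')) (V ''num''))),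
    Asg ''den2'' ''k'' (Const 1) (Plus (Times (V ''fl'') (Get ''au'' (V ''w''))) (Times (Minus (Const 1) (V ''fl'')) (V ''den''))),
    Asg ''num'' ''k'' (Const 1) (V ''num2''),
    Asg ''den'' ''k'' (Const 1) (V ''den2'')])"

text \<open>The new point over the common denominator \<open>D * den\<close>. Fractions are never
  reduced; the ranks control their size.\<close>

definition move_code :: "com list" where
  "move_code =
   [Asg ''Y2'' ''k'' (V ''m'') (Plus (Times (Get ''Y'' (V ''k'')) (V ''den'')) (Times (V ''num'') (Get ''us'' (V ''k'')))),
    Asg ''Y'' ''k'' (V ''m'') (Get ''Y2'' (V ''k'')),
    Asg ''D2'' ''k'' (Const 1) (Times (V ''D'') (V ''den'')),
    Asg ''D'' ''k'' (Const 1) (V ''D2'')]"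

definition body_code :: com where
  "body_code = blk (prep_code @ [search_code] @ dir_code @ [min_code] @ move_code)"

definition body_cost :: "nat \<Rightarrow> nat \<Rightarrow> nat" where
  "body_cost m Bd = (11 * (15 * Bd + 1) + 1) + (1 + (m * (try_cost m Bd + 3) + 3) + ((10 * (15 * Bd + 1) + 1) +
    (1 + (m * ((5 * (15 * Bd + 1) + 1) + 3) + 3) + (4 * (15 * Bd + 1) + 1))))"

section \<open>Correctness of one step\<close>

context walk
begin

definition "menv \<sigma> \<longleftrightarrow> \<sigma> ''m'' 0 = int m \<and> \<sigma> ''N'' 0 = int N \<and> real_of_int (\<sigma> ''G'' 0) = G \<and>
  (\<forall>i<N. \<forall>p<m. real_of_int (\<sigma> ''bb'' (int i * int m + int p)) = b i p) \<and>
  (\<forall>i<N. \<sigma> ''hd'' (int i) = of_bool (hard i)) \<and> (\<forall>p<m. rv \<sigma> ''beta'' p = \<beta> p) \<and>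
  0 < \<sigma> ''Dx'' 0 \<and> (\<forall>p<m. rv \<sigma> ''X'' p = real_of_int (\<sigma> ''Dx'' 0) * x p)"

definition "at_point y \<sigma> \<longleftrightarrow> 0 < \<sigma> ''D'' 0 \<and> (\<forall>p<m. rv \<sigma> ''Y'' p = real_of_int (\<sigma> ''D'' 0) * y p)"

lemma menv_cong: "(\<And>v. v \<in> {''m'', ''N'', ''G'', ''bb'', ''hd'', ''beta'', ''Dx'', ''X''} \<Longrightarrow> \<tau> v = \<sigma> v) \<Longrightarrow> menv \<tau> = menv \<sigma>"
  by (simp add: menv_def rv_def)

lemma at_point_cong: "(\<And>v. v \<in> {''D'', ''Y''} \<Longrightarrow> \<tau> v = \<sigma> v) \<Longrightarrow> at_point y \<tau> = at_point y \<sigma>"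
  by (simp add: at_point_def rv_def)

lemma prep_code_runb:
  fixes y :: "nat \<Rightarrow> real"
  defines "a \<equiv> \<lambda>p. of_bool (alive y p)"
  assumes e: "menv \<sigma>" and y: "at_point y \<sigma>" and Bd: "m \<le> Bd" "N * m \<le> Bd" "N \<le> Bd" "1 \<le> Bd"
  shows "\<exists>\<tau> \<kappa>. runb (blk prep_code) \<sigma> (11 * (15 * Bd + 1) + 1) \<tau> \<and>
    0 < \<kappa> \<and> (dot m (bal m a \<beta>) (bal m a \<beta>) = 0 \<or> \<kappa> = dot m (bal m a \<beta>) (bal m a \<beta>)) \<and>
    penv a \<kappa> \<tau> \<and> benv (stiff y) \<tau> \<and> (\<forall>p<m. \<tau> ''u'' (int p) = 0) \<and>
    (\<forall>p<m. rv \<tau> ''Z'' p = real_of_int (\<sigma> ''D'' 0 * \<sigma> ''Dx'' 0) * disp y p) \<and>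
    (\<forall>i<N. rv \<tau> ''dz'' i = real_of_int (\<sigma> ''D'' 0 * \<sigma> ''Dx'' 0) * dot m (b i) (disp y)) \<and>
    (\<forall>v. v \<notin> {''al'', ''na'', ''sb'', ''bp'', ''kq'', ''kp'', ''Z'', ''dz'', ''tg'', ''kf'', ''u'', ''k'', ''i''} \<longrightarrow> \<tau> v = \<sigma> v)"
proof -
  define W where "W = {''al'', ''na'', ''sb'', ''bp'', ''kq'', ''kp'', ''Z'', ''dz'', ''tg'', ''kf'', ''u'', ''k'', ''i''}"
  have m0: "\<sigma> ''m'' 0 = int m" and N0: "\<sigma> ''N'' 0 = int N" using e by (auto simp: menv_def)
  have D0: "0 < \<sigma> ''D'' 0" and Dx0: "0 < \<sigma> ''Dx'' 0" using e y by (auto simp: menv_def at_point_def)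
  let ?e1 = "Times (Lt (Const 0) (Get ''Y'' (V ''k''))) (Lt (Get ''Y'' (V ''k'')) (V ''D''))"
  obtain \<sigma>1 where 1: "runb (Asg ''al'' ''k'' (V ''m'') ?e1) \<sigma> (15 * Bd) \<sigma>1"
    "\<And>p. p < m \<Longrightarrow> \<sigma>1 ''al'' (int p) = of_bool (0 < \<sigma> ''Y'' (int p)) * of_bool (\<sigma> ''Y'' (int p) < \<sigma> ''D'' 0)"
    "\<And>v. v \<notin> {''al'', ''k''} \<Longrightarrow> \<sigma>1 v = \<sigma> v"
    using Asg_runb_uniform[of "''al''" "''k''" ?e1 "V ''m''" \<sigma> m Bd] Bd m0 by (auto simp del: mult_eq_0_iff split del: if_split)
  obtain \<sigma>2 where 2: "runb (SumA ''na'' ''k'' (Const 1) ''i'' (V ''m'') (Get ''al'' (V ''i''))) \<sigma>1 (15 * Bd) \<sigma>2"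
    "\<sigma>2 ''na'' 0 = (\<Sum>l<m. \<sigma>1 ''al'' (int l))" "\<And>v. v \<notin> {''na'', ''k'', ''i''} \<Longrightarrow> \<sigma>2 v = \<sigma>1 v"
    using SumA_runb_uniform[of "''na''" "''k''" "''i''" "Get ''al'' (V ''i'')" "Const 1" "V ''m''" \<sigma>1 1 m Bd] Bd m0 1(3) by auto
  let ?e3 = "Times (Get ''al'' (V ''i'')) (Get ''beta'' (V ''i''))"
  obtain \<sigma>3 where 3: "runb (SumA ''sb'' ''k'' (Const 1) ''i'' (V ''m'') ?e3) \<sigma>2 (15 * Bd) \<sigma>3"
    "\<sigma>3 ''sb'' 0 = (\<Sum>l<m. \<sigma>1 ''al'' (int l) * \<sigma> ''beta'' (int l))" "\<And>v. v \<notin> {''sb'', ''k'', ''i''} \<Longrightarrow> \<sigma>3 v = \<sigma>2 v"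
    using SumA_runb_uniform[of "''sb''" "''k''" "''i''" ?e3 "Const 1" "V ''m''" \<sigma>2 1 m Bd] Bd m0 1(3) 2(3) by auto
  let ?e4 = "Times (Get ''al'' (V ''k'')) (Minus (Times (V ''na'') (Times (Get ''al'' (V ''k'')) (Get ''beta'' (V ''k'')))) (V ''sb''))"
  obtain \<sigma>4 where 4: "runb (Asg ''bp'' ''k'' (V ''m'') ?e4) \<sigma>3 (15 * Bd) \<sigma>4"
    "\<And>p. p < m \<Longrightarrow> \<sigma>4 ''bp'' (int p) = \<sigma>1 ''al'' (int p) * (\<sigma>2 ''na'' 0 * (\<sigma>1 ''al'' (int p) * \<sigma> ''beta'' (int p)) - \<sigma>3 ''sb'' 0)"
    "\<And>v. v \<notin> {''bp'', ''k''} \<Longrightarrow> \<sigma>4 v = \<sigma>3 v"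
    using Asg_runb_uniform[of "''bp''" "''k''" ?e4 "V ''m''" \<sigma>3 m Bd] Bd m0 1(3) 2(3) 3(3) by auto
  let ?e5 = "Times (Get ''bp'' (V ''i'')) (Get ''bp'' (V ''i''))"
  obtain \<sigma>5 where 5: "runb (SumA ''kq'' ''k'' (Const 1) ''i'' (V ''m'') ?e5) \<sigma>4 (15 * Bd) \<sigma>5"
    "\<sigma>5 ''kq'' 0 = (\<Sum>l<m. \<sigma>4 ''bp'' (int l) * \<sigma>4 ''bp'' (int l))" "\<And>v. v \<notin> {''kq'', ''k'', ''i''} \<Longrightarrow> \<sigma>5 v = \<sigma>4 v"
    using SumA_runb_uniform[of "''kq''" "''k''" "''i''" ?e5 "Const 1" "V ''m''" \<sigma>4 1 m Bd] Bd m0 1(3) 2(3) 3(3) 4(3) by auto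
  let ?e6 = "Plus (V ''kq'') (Lt (V ''kq'') (Const 1))"
  obtain \<sigma>6 where 6: "runb (Asg ''kp'' ''k'' (Const 1) ?e6) \<sigma>5 (15 * Bd) \<sigma>6"
    "\<sigma>6 ''kp'' 0 = \<sigma>5 ''kq'' 0 + of_bool (\<sigma>5 ''kq'' 0 < 1)"
    "\<And>v. v \<notin> {''kp'', ''k''} \<Longrightarrow> \<sigma>6 v = \<sigma>5 v"
    using Asg_runb_uniform[of "''kp''" "''k''" ?e6 "Const 1" \<sigma>5 1 Bd] Bd by (auto split del: if_split)
  have f6: "\<sigma>6 v = \<sigma> v" if "v \<notin> W" for v
    using 1(3)[of v] 2(3)[of v] 3(3)[of v] 4(3)[of v] 5(3)[of v] 6(3)[of v] that by (auto simp: W_def)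
  have vv: "\<sigma>6 ''Y'' = \<sigma> ''Y''" "\<sigma>6 ''D'' = \<sigma> ''D''" "\<sigma>6 ''X'' = \<sigma> ''X''" "\<sigma>6 ''Dx'' = \<sigma> ''Dx''" "\<sigma>6 ''m'' = \<sigma> ''m''"
    "\<sigma>6 ''N'' = \<sigma> ''N''" "\<sigma>6 ''G'' = \<sigma> ''G''" "\<sigma>6 ''hd'' = \<sigma> ''hd''" "\<sigma>6 ''bb'' = \<sigma> ''bb''"
    by (rule f6, simp add: W_def)+
  let ?e7 = "Minus (Times (Get ''Y'' (V ''k'')) (V ''Dx'')) (Times (Get ''X'' (V ''k'')) (V ''D''))"
  obtain \<sigma>7 where 7: "runb (Asg ''Z'' ''k'' (V ''m'') ?e7) \<sigma>6 (15 * Bd) \<sigma>7"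
    "\<And>p. p < m \<Longrightarrow> \<sigma>7 ''Z'' (int p) = \<sigma> ''Y'' (int p) * \<sigma> ''Dx'' 0 - \<sigma> ''X'' (int p) * \<sigma> ''D'' 0"
    "\<And>v. v \<notin> {''Z'', ''k''} \<Longrightarrow> \<sigma>7 v = \<sigma>6 v"
    using Asg_runb_uniform[of "''Z''" "''k''" ?e7 "V ''m''" \<sigma>6 m Bd] Bd m0 vv by auto
  let ?e8 = "Times (row_at ''k'' ''i'') (Get ''Z'' (V ''i''))"
  obtain \<sigma>8 where 8: "runb (SumA ''dz'' ''k'' (V ''N'') ''i'' (V ''m'') ?e8) \<sigma>7 (15 * Bd) \<sigma>8"
    "\<And>i. i < N \<Longrightarrow> \<sigma>8 ''dz'' (int i) = (\<Sum>l<m. \<sigma> ''bb'' (int i * int m + int l) * \<sigma>7 ''Z'' (int l))"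
    "\<And>v. v \<notin> {''dz'', ''k'', ''i''} \<Longrightarrow> \<sigma>8 v = \<sigma>7 v"
    using SumA_runb_uniform[of "''dz''" "''k''" "''i''" ?e8 "V ''N''" "V ''m''" \<sigma>7 N m Bd] Bd m0 N0 vv 7(3) by auto
  let ?gd = "Times (V ''G'') (Times (V ''D'') (V ''Dx''))"
  let ?e9 = "Minus (Const 1) (Times (Minus (Const 1) (Get ''hd'' (V ''k''))) (Lt (Times (Get ''dz'' (V ''k'')) (Get ''dz'' (V ''k''))) (Times ?gd ?gd)))"
  let ?gg = "\<sigma> ''G'' 0 * (\<sigma> ''D'' 0 * \<sigma> ''Dx'' 0)"
  obtain \<sigma>9 where 9: "runb (Asg ''tg'' ''k'' (V ''N'') ?e9) \<sigma>8 (15 * Bd) \<sigma>9"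
    "\<And>i. i < N \<Longrightarrow> \<sigma>9 ''tg'' (int i) = 1 - (1 - \<sigma> ''hd'' (int i)) * of_bool (\<sigma>8 ''dz'' (int i) * \<sigma>8 ''dz'' (int i) < ?gg * ?gg)"
    "\<And>v. v \<notin> {''tg'', ''k''} \<Longrightarrow> \<sigma>9 v = \<sigma>8 v"
    using Asg_runb_uniform[of "''tg''" "''k''" ?e9 "V ''N''" \<sigma>8 N Bd] Bd N0 vv 7(3) 8(3)
    by (auto simp del: mult_eq_0_iff split del: if_split)
  let ?e10 = "Plus (Const 1) (Times (Minus (Times (Const 16) pow4m) (Const 1)) (Get ''tg'' (V ''k'')))"
  obtain \<sigma>10 where 10: "runb (Asg ''kf'' ''k'' (V ''N'') ?e10) \<sigma>9 (15 * Bd) \<sigma>10"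
    "\<And>i. i < N \<Longrightarrow> \<sigma>10 ''kf'' (int i) = 1 + (16 * int m ^ 4 - 1) * \<sigma>9 ''tg'' (int i)"
    "\<And>v. v \<notin> {''kf'', ''k''} \<Longrightarrow> \<sigma>10 v = \<sigma>9 v"
    using Asg_runb_uniform[of "''kf''" "''k''" ?e10 "V ''N''" \<sigma>9 N Bd] Bd N0 m0 vv 7(3) 8(3) 9(3)
    by (auto simp: pow4m_def power4_eq_xxxx mult_ac)
  obtain \<sigma>11 where 11: "runb (Asg ''u'' ''k'' (V ''m'') (Const 0)) \<sigma>10 (15 * Bd) \<sigma>11"
    "\<And>p. p < m \<Longrightarrow> \<sigma>11 ''u'' (int p) = 0"
    "\<And>v. v \<notin> {''u'', ''k''} \<Longrightarrow> \<sigma>11 v = \<sigma>10 v"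
    using Asg_runb_uniform[of "''u''" "''k''" "Const 0" "V ''m''" \<sigma>10 m Bd] Bd m0 vv 7(3) 8(3) 9(3) 10(3) by auto
  have f11: "\<sigma>11 v = \<sigma> v" if "v \<notin> W" for v
    using f6[OF that] 7(3)[of v] 8(3)[of v] 9(3)[of v] 10(3)[of v] 11(3)[of v] that by (auto simp: W_def)
  have run: "runb (blk prep_code) \<sigma> (Suc (Suc (Suc (Suc (Suc (Suc (Suc (Suc (Suc (Suc (Suc 0)))))))))) * (15 * Bd + 1) + 1) \<sigma>11"
    unfolding prep_code_def
    by (intro blk_Cons_uniform[OF 1(1)] blk_Cons_uniform[OF 2(1)] blk_Cons_uniform[OF 3(1)] blk_Cons_uniform[OF 4(1)] blk_Cons_uniform[OF 5(1)]
        blk_Cons_uniform[OF 6(1)] blk_Cons_uniform[OF 7(1)] blk_Cons_uniform[OF 8(1)] blk_Cons_uniform[OF 9(1)] blk_Cons_uniform[OF 10(1)] blk_Cons_uniform[OF 11(1)])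
      (use blk_Nil in simp)
  have al: "rv \<sigma>1 ''al'' p = a p" if p: "p < m" for p
  proof -
    have Y: "real_of_int (\<sigma> ''Y'' (int p)) = real_of_int (\<sigma> ''D'' 0) * y p" using y p by (simp add: at_point_def rv_def)
    have "0 < \<sigma> ''Y'' (int p) \<longleftrightarrow> 0 < real_of_int (\<sigma> ''Y'' (int p))" by simp
    then have a1: "0 < \<sigma> ''Y'' (int p) \<longleftrightarrow> 0 < y p" unfolding Y using D0 by (simp add: zero_less_mult_iff)
    have "\<sigma> ''Y'' (int p) < \<sigma> ''D'' 0 \<longleftrightarrow> real_of_int (\<sigma> ''Y'' (int p)) < real_of_int (\<sigma> ''D'' 0)" by simp
    then have a2: "\<sigma> ''Y'' (int p) < \<sigma> ''D'' 0 \<longleftrightarrow> y p < 1" unfolding Y using D0 by simp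
    show ?thesis using 1(2)[OF p] a1 a2 by (simp add: rv_def a_def alive_def)
  qed
  have be: "rv \<sigma> ''beta'' p = \<beta> p" if "p < m" for p using e that by (simp add: menv_def)
  have na: "real_of_int (\<sigma>2 ''na'' 0) = (\<Sum>p<m. a p)" using al by (simp add: 2(2) rv_def)
  have sb: "real_of_int (\<sigma>3 ''sb'' 0) = (\<Sum>p<m. a p * \<beta> p)" using al be by (simp add: 3(2) rv_def)
  have bp: "rv \<sigma>4 ''bp'' p = bal m a \<beta> p" if p: "p < m" for p
    using al[OF p] be[OF p] na sb 4(2)[OF p] by (simp add: rv_def bal_def center_def)
  have kq: "real_of_int (\<sigma>5 ''kq'' 0) = dot m (bal m a \<beta>) (bal m a \<beta>)"
    using bp by (simp add: 5(2) rv_def dot_def)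
  define \<kappa> where "\<kappa> = real_of_int (\<sigma>6 ''kp'' 0)"
  \<comment> \<open>An integral squared norm below 1 is 0, and then \<open>\<kappa>\<close> is
    1.\<close>
  have kap: "0 < \<kappa> \<and> (dot m (bal m a \<beta>) (bal m a \<beta>) = 0 \<or> \<kappa> = dot m (bal m a \<beta>) (bal m a \<beta>))"
  proof (cases "\<sigma>5 ''kq'' 0 < 1")
    case True
    have "0 \<le> real_of_int (\<sigma>5 ''kq'' 0)" unfolding kq by simp
    then have "\<sigma>5 ''kq'' 0 = 0" using True by simp
    then show ?thesis using kq by (simp add: \<kappa>_def 6(2))
  next
    case False
    then show ?thesis using kq by (simp add: \<kappa>_def 6(2))
  qed
  have s: "\<sigma>11 ''al'' = \<sigma>1 ''al''" "\<sigma>11 ''na'' = \<sigma>2 ''na''" "\<sigma>11 ''bp'' = \<sigma>4 ''bp''" "\<sigma>11 ''kp'' = \<sigma>6 ''kp''" "\<sigma>11 ''m'' = \<sigma> ''m''"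
      "\<sigma>11 ''Z'' = \<sigma>7 ''Z''" "\<sigma>11 ''dz'' = \<sigma>8 ''dz''" "\<sigma>11 ''kf'' = \<sigma>10 ''kf''"
    using vv 2(3) 3(3) 4(3) 5(3) 6(3) 7(3) 8(3) 9(3) 10(3) 11(3) by auto
  have pen: "penv a \<kappa> \<sigma>11"
    using al na bp m0 by (simp add: penv_def s rv_def \<kappa>_def)
  have Z: "rv \<sigma>7 ''Z'' p = real_of_int (\<sigma> ''D'' 0 * \<sigma> ''Dx'' 0) * disp y p" if p: "p < m" for p
  proof -
    have "real_of_int (\<sigma> ''Y'' (int p)) = real_of_int (\<sigma> ''D'' 0) * y p"
      "real_of_int (\<sigma> ''X'' (int p)) = real_of_int (\<sigma> ''Dx'' 0) * x p"
      using e y p by (auto simp: rv_def menv_def at_point_def)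
    then show ?thesis unfolding rv_def 7(2)[OF p] of_int_diff of_int_mult disp_def by (simp add: algebra_simps)
  qed
  have dz: "rv \<sigma>8 ''dz'' i = real_of_int (\<sigma> ''D'' 0 * \<sigma> ''Dx'' 0) * dot m (b i) (disp y)" if i: "i < N" for i
  proof -
    have "rv \<sigma>8 ''dz'' i = dot m (b i) (rv \<sigma>7 ''Z'')"
      using 8(2)[OF i] e i by (simp add: rv_def menv_def dot_def)
    also have "\<dots> = dot m (b i) (\<lambda>p. real_of_int (\<sigma> ''D'' 0 * \<sigma> ''Dx'' 0) * disp y p)" using Z by (intro dot_cong) auto
    finally show ?thesis by (simp only: dot_scale_right)
  qed
  \<comment> \<open>The absolute error is compared with \<open>G\<close> through squares; both sides
    carry the positive factor \<open>D * Dx\<close>.\<close>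
  have kf: "rv \<sigma>10 ''kf'' i = stiff y i" if i: "i < N" for i
  proof -
    let ?c = "real_of_int (\<sigma> ''D'' 0 * \<sigma> ''Dx'' 0)"
    have c: "0 < ?c" using D0 Dx0 by simp
    have sq: "(C * A)\<^sup>2 < (C * B)\<^sup>2 \<longleftrightarrow> A\<^sup>2 < B\<^sup>2" if "0 < C" for A B C :: real
      using that by (simp add: power_mult_distrib)
    have GG: "real_of_int (\<sigma> ''G'' 0) = G" using e by (simp add: menv_def)
    have hd: "\<sigma> ''hd'' (int i) = of_bool (hard i)" using e i by (simp add: menv_def)
    have "\<sigma>8 ''dz'' (int i) * \<sigma>8 ''dz'' (int i) < ?gg * ?gg \<longleftrightarrow>
        (rv \<sigma>8 ''dz'' i)\<^sup>2 < (real_of_int ?gg)\<^sup>2" unfolding rv_def power2_eq_square of_int_mult[symmetric] by (simp only: of_int_less_iff)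
    also have "real_of_int ?gg = ?c * G" unfolding GG[symmetric] by simp
    also have "(rv \<sigma>8 ''dz'' i)\<^sup>2 < (?c * G)\<^sup>2 \<longleftrightarrow> (dot m (b i) (disp y))\<^sup>2 < G\<^sup>2"
      unfolding dz[OF i] by (rule sq[OF c])
    also have "\<dots> \<longleftrightarrow> \<bar>dot m (b i) (disp y)\<bar> < G"
      using G by (metis abs_le_square_iff abs_of_pos not_less)
    finally have lt: "\<sigma>8 ''dz'' (int i) * \<sigma>8 ''dz'' (int i) < ?gg * ?gg \<longleftrightarrow> \<bar>dot m (b i) (disp y)\<bar> < G" .
    have "\<sigma>9 ''tg'' (int i) = of_bool (active y i)"
      unfolding 9(2)[OF i] lt hd active_def by (auto simp: not_less of_bool_def)
    then show ?thesis unfolding rv_def 10(2)[OF i] stiff_def by simp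
  qed
  have ben: "benv (stiff y) \<sigma>11"
  proof -
    have "\<sigma>11 ''N'' = \<sigma> ''N''" "\<sigma>11 ''G'' = \<sigma> ''G''" "\<sigma>11 ''bb'' = \<sigma> ''bb''" by (rule f11, simp add: W_def)+
    then show ?thesis using e kf by (simp add: benv_def menv_def s rv_def)
  qed
  have Z': "\<forall>p<m. rv \<sigma>11 ''Z'' p = real_of_int (\<sigma> ''D'' 0 * \<sigma> ''Dx'' 0) * disp y p"
    using Z by (simp add: rv_def s)
  have dz': "\<forall>i<N. rv \<sigma>11 ''dz'' i = real_of_int (\<sigma> ''D'' 0 * \<sigma> ''Dx'' 0) * dot m (b i) (disp y)"
    using dz by (simp add: rv_def s)
  have run': "runb (blk prep_code) \<sigma> (11 * (15 * Bd + 1) + 1) \<sigma>11" using run by (simp add: numeral_eq_Suc)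
  show ?thesis unfolding W_def[symmetric]
    using run' kap pen ben Z' dz' 11(2) f11 by blast
qed

lemma dir_code_runb:
  assumes e: "menv \<sigma>" and y: "at_point y \<sigma>" and Bd: "m \<le> Bd" "N * m \<le> Bd" "N \<le> Bd" "1 \<le> Bd"
    and Z: "\<forall>p<m. rv \<sigma> ''Z'' p = c * disp y p" and dz: "\<forall>i<N. rv \<sigma> ''dz'' i = c * dot m (b i) (disp y)" and c: "0 < c"
  shows "\<exists>\<tau>. runb (blk dir_code) \<sigma> (10 * (15 * Bd + 1) + 1) \<tau> \<and>
    ((\<forall>p<m. rv \<tau> ''us'' p = rv \<sigma> ''u'' p) \<or> (\<forall>p<m. rv \<tau> ''us'' p = - 1 * rv \<sigma> ''u'' p)) \<and>
    0 \<le> slope y (rv \<tau> ''us'') \<and> (\<forall>p<m. \<tau> ''au'' (int p) = \<bar>\<tau> ''us'' (int p)\<bar>) \<and>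
    (\<forall>p<m. \<tau> ''rm'' (int p) = (if 0 < \<tau> ''us'' (int p) then \<sigma> ''D'' 0 - \<sigma> ''Y'' (int p) else \<sigma> ''Y'' (int p))) \<and>
    \<tau> ''num'' 0 = \<sigma> ''D'' 0 \<and>
    \<tau> ''den'' 0 = (\<Sum>p<m. \<bar>\<tau> ''us'' (int p)\<bar>) + of_bool ((\<Sum>p<m. \<bar>\<tau> ''us'' (int p)\<bar>) < 1) \<and>
    (\<forall>v. v \<notin> {''du'', ''e1'', ''e2'', ''ng'', ''us'', ''au'', ''rm'', ''W'', ''den'', ''num'', ''k'', ''i''} \<longrightarrow> \<tau> v = \<sigma> v)"
proof -
  define W where "W = {''du'', ''e1'', ''e2'', ''ng'', ''us'', ''au'', ''rm'', ''W'', ''den'', ''num'', ''k'', ''i''}"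
  have m0: "\<sigma> ''m'' 0 = int m" and N0: "\<sigma> ''N'' 0 = int N" using e by (auto simp: menv_def)
  let ?e1 = "Times (row_at ''k'' ''i'') (Get ''u'' (V ''i''))"
  obtain \<sigma>1 where 1: "runb (SumA ''du'' ''k'' (V ''N'') ''i'' (V ''m'') ?e1) \<sigma> (15 * Bd) \<sigma>1"
    "\<And>i. i < N \<Longrightarrow> \<sigma>1 ''du'' (int i) = (\<Sum>l<m. \<sigma> ''bb'' (int i * int m + int l) * \<sigma> ''u'' (int l))"
    "\<And>v. v \<notin> {''du'', ''k'', ''i''} \<Longrightarrow> \<sigma>1 v = \<sigma> v"
    using SumA_runb_uniform[of "''du''" "''k''" "''i''" ?e1 "V ''N''" "V ''m''" \<sigma> N m Bd] Bd m0 N0 by auto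
  let ?e2 = "Times (Get ''Z'' (V ''i'')) (Get ''u'' (V ''i''))"
  obtain \<sigma>2 where 2: "runb (SumA ''e1'' ''k'' (Const 1) ''i'' (V ''m'') ?e2) \<sigma>1 (15 * Bd) \<sigma>2"
    "\<sigma>2 ''e1'' 0 = (\<Sum>l<m. \<sigma> ''Z'' (int l) * \<sigma> ''u'' (int l))" "\<And>v. v \<notin> {''e1'', ''k'', ''i''} \<Longrightarrow> \<sigma>2 v = \<sigma>1 v"
    using SumA_runb_uniform[of "''e1''" "''k''" "''i''" ?e2 "Const 1" "V ''m''" \<sigma>1 1 m Bd] Bd m0 1(3) by auto
  let ?e3 = "Times (Times (Minus (Const 1) (Get ''hd'' (V ''i''))) (Get ''dz'' (V ''i''))) (Get ''du'' (V ''i''))"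
  obtain \<sigma>3 where 3: "runb (SumA ''e2'' ''k'' (Const 1) ''i'' (V ''N'') ?e3) \<sigma>2 (15 * Bd) \<sigma>3"
    "\<sigma>3 ''e2'' 0 = (\<Sum>l<N. (1 - \<sigma> ''hd'' (int l)) * \<sigma> ''dz'' (int l) * \<sigma>1 ''du'' (int l))" "\<And>v. v \<notin> {''e2'', ''k'', ''i''} \<Longrightarrow> \<sigma>3 v = \<sigma>2 v"
    using SumA_runb_uniform[of "''e2''" "''k''" "''i''" ?e3 "Const 1" "V ''N''" \<sigma>2 1 N Bd] Bd N0 1(3) 2(3) by auto
  let ?e4 = "Lt (Times (Times (V ''G'') (V ''G'')) (V ''e1'')) (Times (Const 8) (V ''e2''))"
  obtain \<sigma>4 where 4: "runb (Asg ''ng'' ''k'' (Const 1) ?e4) \<sigma>3 (15 * Bd) \<sigma>4"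
    "\<sigma>4 ''ng'' 0 = of_bool (\<sigma> ''G'' 0 * \<sigma> ''G'' 0 * \<sigma>2 ''e1'' 0 < 8 * \<sigma>3 ''e2'' 0)"
    "\<And>v. v \<notin> {''ng'', ''k''} \<Longrightarrow> \<sigma>4 v = \<sigma>3 v"
    using Asg_runb_uniform[of "''ng''" "''k''" ?e4 "Const 1" \<sigma>3 1 Bd] Bd 1(3) 2(3) 3(3) by (auto split del: if_split)
  let ?e5 = "Times (Minus (Const 1) (Times (Const 2) (V ''ng''))) (Get ''u'' (V ''k''))"
  obtain \<sigma>5 where 5: "runb (Asg ''us'' ''k'' (V ''m'') ?e5) \<sigma>4 (15 * Bd) \<sigma>5"
    "\<And>p. p < m \<Longrightarrow> \<sigma>5 ''us'' (int p) = (1 - 2 * \<sigma>4 ''ng'' 0) * \<sigma> ''u'' (int p)"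
    "\<And>v. v \<notin> {''us'', ''k''} \<Longrightarrow> \<sigma>5 v = \<sigma>4 v"
    using Asg_runb_uniform[of "''us''" "''k''" ?e5 "V ''m''" \<sigma>4 m Bd] Bd m0 1(3) 2(3) 3(3) 4(3) by auto
  let ?e6 = "Times (Get ''us'' (V ''k'')) (Minus (Const 1) (Times (Const 2) (Lt (Get ''us'' (V ''k'')) (Const 0))))"
  obtain \<sigma>6 where 6: "runb (Asg ''au'' ''k'' (V ''m'') ?e6) \<sigma>5 (15 * Bd) \<sigma>6"
    "\<And>p. p < m \<Longrightarrow> \<sigma>6 ''au'' (int p) = \<sigma>5 ''us'' (int p) * (1 - 2 * of_bool (\<sigma>5 ''us'' (int p) < 0))"
    "\<And>v. v \<notin> {''au'', ''k''} \<Longrightarrow> \<sigma>6 v = \<sigma>5 v"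
    using Asg_runb_uniform[of "''au''" "''k''" ?e6 "V ''m''" \<sigma>5 m Bd] Bd m0 1(3) 2(3) 3(3) 4(3) 5(3)
    by (auto simp del: mult_eq_0_iff split del: if_split)
  let ?e7 = "Plus (Times (Lt (Const 0) (Get ''us'' (V ''k''))) (Minus (V ''D'') (Get ''Y'' (V ''k''))))
      (Times (Minus (Const 1) (Lt (Const 0) (Get ''us'' (V ''k'')))) (Get ''Y'' (V ''k'')))"
  obtain \<sigma>7 where 7: "runb (Asg ''rm'' ''k'' (V ''m'') ?e7) \<sigma>6 (15 * Bd) \<sigma>7"
    "\<And>p. p < m \<Longrightarrow> \<sigma>7 ''rm'' (int p) = of_bool (0 < \<sigma>5 ''us'' (int p)) * (\<sigma> ''D'' 0 - \<sigma> ''Y'' (int p)) +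
      (1 - of_bool (0 < \<sigma>5 ''us'' (int p))) * \<sigma> ''Y'' (int p)"
    "\<And>v. v \<notin> {''rm'', ''k''} \<Longrightarrow> \<sigma>7 v = \<sigma>6 v"
    using Asg_runb_uniform[of "''rm''" "''k''" ?e7 "V ''m''" \<sigma>6 m Bd] Bd m0 1(3) 2(3) 3(3) 4(3) 5(3) 6(3)
    by (auto simp del: mult_eq_0_iff split del: if_split)
  obtain \<sigma>8 where 8: "runb (SumA ''W'' ''k'' (Const 1) ''i'' (V ''m'') (Get ''au'' (V ''i''))) \<sigma>7 (15 * Bd) \<sigma>8"
    "\<sigma>8 ''W'' 0 = (\<Sum>l<m. \<sigma>6 ''au'' (int l))" "\<And>v. v \<notin> {''W'', ''k'', ''i''} \<Longrightarrow> \<sigma>8 v = \<sigma>7 v"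
    using SumA_runb_uniform[of "''W''" "''k''" "''i''" "Get ''au'' (V ''i'')" "Const 1" "V ''m''" \<sigma>7 1 m Bd] Bd m0 1(3) 2(3) 3(3) 4(3) 5(3) 6(3) 7(3) by auto
  let ?e9 = "Plus (V ''W'') (Lt (V ''W'') (Const 1))"
  obtain \<sigma>9 where 9: "runb (Asg ''den'' ''k'' (Const 1) ?e9) \<sigma>8 (15 * Bd) \<sigma>9"
    "\<sigma>9 ''den'' 0 = \<sigma>8 ''W'' 0 + of_bool (\<sigma>8 ''W'' 0 < 1)"
    "\<And>v. v \<notin> {''den'', ''k''} \<Longrightarrow> \<sigma>9 v = \<sigma>8 v"
    using Asg_runb_uniform[of "''den''" "''k''" ?e9 "Const 1" \<sigma>8 1 Bd] Bd by (auto split del: if_split)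
  obtain \<sigma>10 where 10: "runb (Asg ''num'' ''k'' (Const 1) (V ''D'')) \<sigma>9 (15 * Bd) \<sigma>10"
    "\<sigma>10 ''num'' 0 = \<sigma> ''D'' 0" "\<And>v. v \<notin> {''num'', ''k''} \<Longrightarrow> \<sigma>10 v = \<sigma>9 v"
    using Asg_runb_uniform[of "''num''" "''k''" "V ''D''" "Const 1" \<sigma>9 1 Bd] Bd 1(3) 2(3) 3(3) 4(3) 5(3) 6(3) 7(3) 8(3) 9(3) by auto
  have f10: "\<sigma>10 v = \<sigma> v" if "v \<notin> W" for v
    using 1(3)[of v] 2(3)[of v] 3(3)[of v] 4(3)[of v] 5(3)[of v] 6(3)[of v] 7(3)[of v] 8(3)[of v] 9(3)[of v] 10(3)[of v] that
    by (auto simp: W_def)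
  have "runb (blk dir_code) \<sigma> (Suc (Suc (Suc (Suc (Suc (Suc (Suc (Suc (Suc (Suc 0))))))))) * (15 * Bd + 1) + 1) \<sigma>10"
    unfolding dir_code_def
    by (intro blk_Cons_uniform[OF 1(1)] blk_Cons_uniform[OF 2(1)] blk_Cons_uniform[OF 3(1)] blk_Cons_uniform[OF 4(1)] blk_Cons_uniform[OF 5(1)]
        blk_Cons_uniform[OF 6(1)] blk_Cons_uniform[OF 7(1)] blk_Cons_uniform[OF 8(1)] blk_Cons_uniform[OF 9(1)] blk_Cons_uniform[OF 10(1)])
      (use blk_Nil in simp)
  then have run: "runb (blk dir_code) \<sigma> (10 * (15 * Bd + 1) + 1) \<sigma>10" by (simp add: numeral_eq_Suc)
  have s: "\<sigma>10 ''us'' = \<sigma>5 ''us''" "\<sigma>10 ''au'' = \<sigma>6 ''au''" "\<sigma>10 ''rm'' = \<sigma>7 ''rm''" "\<sigma>10 ''den'' = \<sigma>9 ''den''"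
    using 6(3) 7(3) 8(3) 9(3) 10(3) by auto
  have au: "\<sigma>6 ''au'' (int p) = \<bar>\<sigma>5 ''us'' (int p)\<bar>" if "p < m" for p using 6(2)[OF that] by (auto simp: of_bool_def)
  have rm: "\<sigma>7 ''rm'' (int p) = (if 0 < \<sigma>5 ''us'' (int p) then \<sigma> ''D'' 0 - \<sigma> ''Y'' (int p) else \<sigma> ''Y'' (int p))" if "p < m" for p
    using 7(2)[OF that] by (auto simp: of_bool_def)
  have den: "\<sigma>10 ''den'' 0 = (\<Sum>p<m. \<bar>\<sigma>10 ''us'' (int p)\<bar>) + of_bool ((\<Sum>p<m. \<bar>\<sigma>10 ''us'' (int p)\<bar>) < 1)"
    using 9(2) 8(2) au by (simp add: s)
  let ?u = "rv \<sigma> ''u''"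
  have GG: "real_of_int (\<sigma> ''G'' 0) = G" using e by (simp add: menv_def)
  have E1: "real_of_int (\<sigma>2 ''e1'' 0) = c * dot m (disp y) ?u"
    using Z by (simp add: 2(2) rv_def dot_def sum_distrib_left mult.assoc)
  have du: "real_of_int (\<sigma>1 ''du'' (int i)) = dot m (b i) ?u" if "i < N" for i
    using 1(2)[OF that] e that by (simp add: menv_def dot_def rv_def)
  have E2: "real_of_int (\<sigma>3 ''e2'' 0) = c * (\<Sum>i | i < N \<and> \<not> hard i. dot m (b i) (disp y) * dot m (b i) ?u)"
  proof -
    have "real_of_int (\<sigma>3 ''e2'' 0) = (\<Sum>i<N. if \<not> hard i then c * (dot m (b i) (disp y) * dot m (b i) ?u) else 0)"
      unfolding 3(2) of_int_sum using dz du e by (intro sum.cong refl) (auto simp: rv_def menv_def)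
    also have "\<dots> = (\<Sum>i | i < N \<and> \<not> hard i. c * (dot m (b i) (disp y) * dot m (b i) ?u))"
      by (intro sum.mono_neutral_cong_right) auto
    finally show ?thesis by (simp add: sum_distrib_left)
  qed
  \<comment> \<open>Multiplying \<open>slope\<close> by \<open>8 * G\<^sup>2\<close> and by the
    positive scale \<open>c\<close> turns its sign into a comparison of integers.\<close>
  have cond: "\<sigma> ''G'' 0 * \<sigma> ''G'' 0 * \<sigma>2 ''e1'' 0 < 8 * \<sigma>3 ''e2'' 0 \<longleftrightarrow> slope y ?u < 0"
  proof -
    let ?S = "\<Sum>i | i < N \<and> \<not> hard i. dot m (b i) (disp y) * dot m (b i) ?u"
    have "\<sigma> ''G'' 0 * \<sigma> ''G'' 0 * \<sigma>2 ''e1'' 0 < 8 * \<sigma>3 ''e2'' 0 \<longleftrightarrow>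
      real_of_int (\<sigma> ''G'' 0 * \<sigma> ''G'' 0 * \<sigma>2 ''e1'' 0) < real_of_int (8 * \<sigma>3 ''e2'' 0)" by (simp only: of_int_less_iff)
    also have "\<dots> \<longleftrightarrow> c * (G * G * dot m (disp y) ?u) < c * (8 * ?S)"
      unfolding of_int_mult of_int_numeral E1 E2 GG by (simp add: mult_ac)
    also have "\<dots> \<longleftrightarrow> G * G * dot m (disp y) ?u < 8 * ?S" by (simp only: mult_less_cancel_left_pos[OF c])
    also have "\<dots> \<longleftrightarrow> slope y ?u < 0" unfolding slope_def using G by (simp add: field_simps power2_eq_square)
    finally show ?thesis .
  qed
  have sl: "((\<forall>p<m. rv \<sigma>10 ''us'' p = ?u p) \<or> (\<forall>p<m. rv \<sigma>10 ''us'' p = - 1 * ?u p)) \<and> 0 \<le> slope y (rv \<sigma>10 ''us'')"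
  proof (cases "slope y ?u < 0")
    case False
    then have us: "rv \<sigma>10 ''us'' p = ?u p" if "p < m" for p using 5(2)[OF that] 4(2) cond by (simp add: rv_def s)
    then have "dot m w (rv \<sigma>10 ''us'') = dot m w ?u" for w by (intro dot_cong) auto
    then have "slope y (rv \<sigma>10 ''us'') = slope y ?u" by (simp add: slope_def)
    then show ?thesis using False us by auto
  next
    case True
    then have us: "rv \<sigma>10 ''us'' p = - 1 * ?u p" if "p < m" for p using 5(2)[OF that] 4(2) cond by (simp add: rv_def s)
    then have "dot m w (rv \<sigma>10 ''us'') = dot m w (\<lambda>p. - 1 * ?u p)" for w by (intro dot_cong) auto
    then have "dot m w (rv \<sigma>10 ''us'') = - 1 * dot m w ?u" for w by (simp only: dot_scale_right)
    then have "slope y (rv \<sigma>10 ''us'') = - slope y ?u" by (simp add: slope_def sum_negf)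
    then show ?thesis using True us by auto
  qed
  have au': "\<forall>p<m. \<sigma>10 ''au'' (int p) = \<bar>\<sigma>10 ''us'' (int p)\<bar>" using au by (simp add: s)
  have rm': "\<forall>p<m. \<sigma>10 ''rm'' (int p) = (if 0 < \<sigma>10 ''us'' (int p) then \<sigma> ''D'' 0 - \<sigma> ''Y'' (int p) else \<sigma> ''Y'' (int p))"
    using rm by (simp add: s)
  have fr: "\<forall>v. v \<notin> W \<longrightarrow> \<sigma>10 v = \<sigma> v" using f10 by blast
  show ?thesis unfolding W_def[symmetric]
    by (intro exI[of _ \<sigma>10] conjI run sl[THEN conjunct1] sl[THEN conjunct2] au' rm' den 10(2) fr)
qed

text \<open>The disjunction records where the minimum is attained: the initial fraction or the room
  of a moving coordinate. It supplies \<open>hit\<close> in \<open>winv_step\<close>.\<close>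

lemma min_code_runb:
  assumes m0: "\<sigma> ''m'' 0 = int m" and Bd: "m \<le> Bd" "1 \<le> Bd"
    and r: "\<forall>p<m. 0 \<le> \<sigma> ''rm'' (int p)" and a: "\<forall>p<m. 0 \<le> \<sigma> ''au'' (int p)"
    and n0: "0 \<le> \<sigma> ''num'' 0" and d0: "0 < \<sigma> ''den'' 0"
  shows "\<exists>\<tau>. runb min_code \<sigma> (m * ((5 * (15 * Bd + 1) + 1) + 3) + 3) \<tau> \<and>
    0 < \<tau> ''den'' 0 \<and> 0 \<le> \<tau> ''num'' 0 \<and> \<tau> ''num'' 0 * \<sigma> ''den'' 0 \<le> \<sigma> ''num'' 0 * \<tau> ''den'' 0 \<and>
    (\<forall>p<m. \<tau> ''num'' 0 * \<sigma> ''au'' (int p) \<le> \<sigma> ''rm'' (int p) * \<tau> ''den'' 0) \<and>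
    (\<tau> ''num'' 0 = \<sigma> ''num'' 0 \<and> \<tau> ''den'' 0 = \<sigma> ''den'' 0 \<or>
      (\<exists>p<m. \<sigma> ''au'' (int p) \<noteq> 0 \<and> \<tau> ''num'' 0 = \<sigma> ''rm'' (int p) \<and> \<tau> ''den'' 0 = \<sigma> ''au'' (int p))) \<and>
    (\<forall>v. v \<notin> {''w'', ''fl'', ''num2'', ''den2'', ''num'', ''den'', ''k''} \<longrightarrow> \<tau> v = \<sigma> v)"
proof -
  define W where "W = {''w'', ''fl'', ''num2'', ''den2'', ''num'', ''den'', ''k''}"
  define P where "P j n d \<longleftrightarrow> 0 < d \<and> 0 \<le> n \<and> n * \<sigma> ''den'' 0 \<le> \<sigma> ''num'' 0 * d \<and>
    (\<forall>p<j. n * \<sigma> ''au'' (int p) \<le> \<sigma> ''rm'' (int p) * d) \<and>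
    (n = \<sigma> ''num'' 0 \<and> d = \<sigma> ''den'' 0 \<or> (\<exists>p<m. \<sigma> ''au'' (int p) \<noteq> 0 \<and> n = \<sigma> ''rm'' (int p) \<and> d = \<sigma> ''au'' (int p)))" for j n d
  define I where "I j \<tau> \<longleftrightarrow> P j (\<tau> ''num'' 0) (\<tau> ''den'' 0) \<and> (\<forall>v. v \<notin> W \<longrightarrow> \<tau> v = \<sigma> v)" for j \<tau>
  let ?e1 = "Lt (Times (Get ''rm'' (V ''w'')) (V ''den'')) (Times (V ''num'') (Get ''au'' (V ''w'')))"
  let ?e2 = "Plus (Times (V ''fl'') (Get ''rm'' (V ''w''))) (Times (Minus (Const 1) (V ''fl'')) (V ''num''))"
  let ?e3 = "Plus (Times (V ''fl'') (Get ''au'' (V ''w''))) (Times (Minus (Const 1) (V ''fl'')) (V ''den''))"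
  let ?body = "blk [Asg ''fl'' ''k'' (Const 1) ?e1, Asg ''num2'' ''k'' (Const 1) ?e2, Asg ''den2'' ''k'' (Const 1) ?e3,
    Asg ''num'' ''k'' (Const 1) (V ''num2''), Asg ''den'' ''k'' (Const 1) (V ''den2'')]"
  have "\<exists>\<tau>. runb (For ''w'' (V ''m'') ?body) \<sigma> (m * ((5 * (15 * Bd + 1) + 1) + 3) + 3) \<tau> \<and> I m \<tau> \<and> \<tau> ''w'' 0 = int m"
  proof (rule For_runb)
    show "I 0 \<sigma>" using n0 d0 by (simp add: I_def P_def)
  next
    fix j \<tau> assume j: "j < m" "I j \<tau>" "\<tau> ''w'' 0 = int j"
    have fr: "\<tau> v = \<sigma> v" if "v \<notin> W" for v using j(2) that unfolding I_def by blast
    have rmau: "\<tau> ''rm'' = \<sigma> ''rm''" "\<tau> ''au'' = \<sigma> ''au''" by (rule fr, simp add: W_def)+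
    let ?n = "\<tau> ''num'' 0" and ?d = "\<tau> ''den'' 0" and ?r = "\<sigma> ''rm'' (int j)" and ?a = "\<sigma> ''au'' (int j)"
    let ?f = "?r * ?d < ?n * ?a"
    obtain \<sigma>1 where 1: "runb (Asg ''fl'' ''k'' (Const 1) ?e1) \<tau> (15 * Bd) \<sigma>1"
      "\<sigma>1 ''fl'' 0 = of_bool ?f" "\<And>v. v \<notin> {''fl'', ''k''} \<Longrightarrow> \<sigma>1 v = \<tau> v"
      using Asg_runb_uniform[of "''fl''" "''k''" ?e1 "Const 1" \<tau> 1 Bd] Bd j(3) rmau by (auto split del: if_split)
    obtain \<sigma>2 where 2: "runb (Asg ''num2'' ''k'' (Const 1) ?e2) \<sigma>1 (15 * Bd) \<sigma>2"
      "\<sigma>2 ''num2'' 0 = of_bool ?f * ?r + (1 - of_bool ?f) * ?n" "\<And>v. v \<notin> {''num2'', ''k''} \<Longrightarrow> \<sigma>2 v = \<sigma>1 v"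
      using Asg_runb_uniform[of "''num2''" "''k''" ?e2 "Const 1" \<sigma>1 1 Bd] Bd j(3) rmau 1(2,3)
      by (auto simp del: mult_eq_0_iff split del: if_split)
    obtain \<sigma>3 where 3: "runb (Asg ''den2'' ''k'' (Const 1) ?e3) \<sigma>2 (15 * Bd) \<sigma>3"
      "\<sigma>3 ''den2'' 0 = of_bool ?f * ?a + (1 - of_bool ?f) * ?d" "\<And>v. v \<notin> {''den2'', ''k''} \<Longrightarrow> \<sigma>3 v = \<sigma>2 v"
      using Asg_runb_uniform[of "''den2''" "''k''" ?e3 "Const 1" \<sigma>2 1 Bd] Bd j(3) rmau 1(2,3) 2(3)
      by (auto simp del: mult_eq_0_iff split del: if_split)
    obtain \<sigma>4 where 4: "runb (Asg ''num'' ''k'' (Const 1) (V ''num2'')) \<sigma>3 (15 * Bd) \<sigma>4"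
      "\<sigma>4 ''num'' 0 = \<sigma>2 ''num2'' 0" "\<And>v. v \<notin> {''num'', ''k''} \<Longrightarrow> \<sigma>4 v = \<sigma>3 v"
      using Asg_runb_uniform[of "''num''" "''k''" "V ''num2''" "Const 1" \<sigma>3 1 Bd] Bd 3(3) by auto
    obtain \<sigma>5 where 5: "runb (Asg ''den'' ''k'' (Const 1) (V ''den2'')) \<sigma>4 (15 * Bd) \<sigma>5"
      "\<sigma>5 ''den'' 0 = \<sigma>3 ''den2'' 0" "\<And>v. v \<notin> {''den'', ''k''} \<Longrightarrow> \<sigma>5 v = \<sigma>4 v"
      using Asg_runb_uniform[of "''den''" "''k''" "V ''den2''" "Const 1" \<sigma>4 1 Bd] Bd 4(3) by auto
    have "runb ?body \<tau> (Suc (Suc (Suc (Suc (Suc 0)))) * (15 * Bd + 1) + 1) \<sigma>5"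
      by (intro blk_Cons_uniform[OF 1(1)] blk_Cons_uniform[OF 2(1)] blk_Cons_uniform[OF 3(1)] blk_Cons_uniform[OF 4(1)] blk_Cons_uniform[OF 5(1)])
        (use blk_Nil in simp)
    then have run: "runb ?body \<tau> (5 * (15 * Bd + 1) + 1) \<sigma>5" by (simp add: numeral_eq_Suc)
    have nd: "\<sigma>5 ''num'' 0 = (if ?f then ?r else ?n)" "\<sigma>5 ''den'' 0 = (if ?f then ?a else ?d)"
      using 2(2) 3(2) 4(2) 5(2,3) by auto
    have Pj: "P j ?n ?d" using j(2) by (simp add: I_def)
    have "P (Suc j) (\<sigma>5 ''num'' 0) (\<sigma>5 ''den'' 0)"
    proof (cases ?f)
      case False
      then show ?thesis using Pj nd by (auto simp: P_def less_Suc_eq)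
    next
      case True
      have d: "0 < ?d" "0 \<le> ?n" using Pj by (auto simp: P_def)
      have r0: "0 \<le> ?r" "0 \<le> ?a" using r a j(1) by auto
      have "0 < ?n * ?a" using True r0 d by (smt (verit) mult_nonneg_nonneg)
      then have apos: "0 < ?a" using r0 by (cases "?a = 0") auto
      \<comment> \<open>Transitivity for fractions with denominators cleared: \<open>?r / ?a\<close>
        lies below \<open>?n / ?d\<close>, which in turn lies below \<open>w / z\<close>.\<close>
      have less: "?r * z \<le> w * ?a" if "?n * z \<le> w * ?d" "0 \<le> z" for z w
      proof -
        have "?r * z * ?d \<le> ?n * ?a * z" using True that(2) mult_right_mono[of "?r * ?d" "?n * ?a" z] by (simp add: mult_ac)
        also have "\<dots> = ?a * (?n * z)" by simp
        also have "\<dots> \<le> ?a * (w * ?d)" using that(1) apos by (intro mult_left_mono) auto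
        finally have "(?r * z) * ?d \<le> (w * ?a) * ?d" by (simp add: mult_ac)
        then show ?thesis using d by simp
      qed
      have "?r * \<sigma> ''den'' 0 \<le> \<sigma> ''num'' 0 * ?a" using Pj d0 by (intro less) (auto simp: P_def)
      moreover have "?r * \<sigma> ''au'' (int p) \<le> \<sigma> ''rm'' (int p) * ?a" if "p < Suc j" for p
      proof (cases "p = j")
        case False
        then show ?thesis using Pj that a j(1) by (intro less) (auto simp: P_def)
      qed simp
      ultimately show ?thesis using True nd apos r0 j(1) unfolding P_def by auto
    qed
    moreover have "\<sigma>5 v = \<sigma> v" if "v \<notin> W" for v
      using fr[OF that] 1(3)[of v] 2(3)[of v] 3(3)[of v] 4(3)[of v] 5(3)[of v] that by (auto simp: W_def)
    moreover have "\<sigma>5 ''w'' 0 = int j" using 1(3) 2(3) 3(3) 4(3) 5(3) j(3) by simp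
    ultimately show "\<exists>\<rho>. runb ?body \<tau> (5 * (15 * Bd + 1) + 1) \<rho> \<and> I (Suc j) \<rho> \<and> \<rho> ''w'' 0 = int j"
      using run unfolding I_def by blast
  next
    fix j \<tau> z assume "I j \<tau>"
    moreover have "setc \<tau> ''w'' z v = \<tau> v" if "v \<notin> W" for v using that by (auto simp: W_def)
    ultimately show "I j (setc \<tau> ''w'' z)" unfolding I_def by simp
  next
    fix j \<tau> assume "I j \<tau>"
    then have "\<tau> ''m'' = \<sigma> ''m''" by (simp add: I_def W_def)
    then show "aval (V ''m'') \<tau> = int m" using m0 by simp
  qed
  then show ?thesis unfolding min_code_def[symmetric] W_def[symmetric] I_def P_def by blast
qed

lemma move_code_runb:
  assumes m0: "\<sigma> ''m'' 0 = int m" and Bd: "m \<le> Bd" "1 \<le> Bd"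
  shows "\<exists>\<tau>. runb (blk move_code) \<sigma> (4 * (15 * Bd + 1) + 1) \<tau> \<and>
    (\<forall>p<m. \<tau> ''Y'' (int p) = \<sigma> ''Y'' (int p) * \<sigma> ''den'' 0 + \<sigma> ''num'' 0 * \<sigma> ''us'' (int p)) \<and>
    \<tau> ''D'' 0 = \<sigma> ''D'' 0 * \<sigma> ''den'' 0 \<and>
    (\<forall>v. v \<notin> {''Y2'', ''Y'', ''D2'', ''D'', ''k''} \<longrightarrow> \<tau> v = \<sigma> v)"
proof -
  let ?e1 = "Plus (Times (Get ''Y'' (V ''k'')) (V ''den'')) (Times (V ''num'') (Get ''us'' (V ''k'')))"
  obtain \<sigma>1 where 1: "runb (Asg ''Y2'' ''k'' (V ''m'') ?e1) \<sigma> (15 * Bd) \<sigma>1"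
    "\<And>p. p < m \<Longrightarrow> \<sigma>1 ''Y2'' (int p) = \<sigma> ''Y'' (int p) * \<sigma> ''den'' 0 + \<sigma> ''num'' 0 * \<sigma> ''us'' (int p)"
    "\<And>v. v \<notin> {''Y2'', ''k''} \<Longrightarrow> \<sigma>1 v = \<sigma> v"
    using Asg_runb_uniform[of "''Y2''" "''k''" ?e1 "V ''m''" \<sigma> m Bd] Bd m0 by auto
  obtain \<sigma>2 where 2: "runb (Asg ''Y'' ''k'' (V ''m'') (Get ''Y2'' (V ''k''))) \<sigma>1 (15 * Bd) \<sigma>2"
    "\<And>p. p < m \<Longrightarrow> \<sigma>2 ''Y'' (int p) = \<sigma>1 ''Y2'' (int p)" "\<And>v. v \<notin> {''Y'', ''k''} \<Longrightarrow> \<sigma>2 v = \<sigma>1 v"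
    using Asg_runb_uniform[of "''Y''" "''k''" "Get ''Y2'' (V ''k'')" "V ''m''" \<sigma>1 m Bd] Bd m0 1(3) by auto
  obtain \<sigma>3 where 3: "runb (Asg ''D2'' ''k'' (Const 1) (Times (V ''D'') (V ''den''))) \<sigma>2 (15 * Bd) \<sigma>3"
    "\<sigma>3 ''D2'' 0 = \<sigma> ''D'' 0 * \<sigma> ''den'' 0" "\<And>v. v \<notin> {''D2'', ''k''} \<Longrightarrow> \<sigma>3 v = \<sigma>2 v"
    using Asg_runb_uniform[of "''D2''" "''k''" "Times (V ''D'') (V ''den'')" "Const 1" \<sigma>2 1 Bd] Bd 1(3) 2(3) by auto
  obtain \<sigma>4 where 4: "runb (Asg ''D'' ''k'' (Const 1) (V ''D2'')) \<sigma>3 (15 * Bd) \<sigma>4"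
    "\<sigma>4 ''D'' 0 = \<sigma>3 ''D2'' 0" "\<And>v. v \<notin> {''D'', ''k''} \<Longrightarrow> \<sigma>4 v = \<sigma>3 v"
    using Asg_runb_uniform[of "''D''" "''k''" "V ''D2''" "Const 1" \<sigma>3 1 Bd] Bd by auto
  have "runb (blk move_code) \<sigma> (Suc (Suc (Suc (Suc 0))) * (15 * Bd + 1) + 1) \<sigma>4"
    unfolding move_code_def
    by (intro blk_Cons_uniform[OF 1(1)] blk_Cons_uniform[OF 2(1)] blk_Cons_uniform[OF 3(1)] blk_Cons_uniform[OF 4(1)]) (use blk_Nil in simp)
  then have run: "runb (blk move_code) \<sigma> (4 * (15 * Bd + 1) + 1) \<sigma>4" by (simp add: numeral_eq_Suc)
  have "\<forall>p<m. \<sigma>4 ''Y'' (int p) = \<sigma> ''Y'' (int p) * \<sigma> ''den'' 0 + \<sigma> ''num'' 0 * \<sigma> ''us'' (int p)"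
    using 1(2) 2(2) 3(3) 4(3) by simp
  moreover have "\<sigma>4 ''D'' 0 = \<sigma> ''D'' 0 * \<sigma> ''den'' 0" using 3(2) 4(2) by simp
  moreover have "\<sigma>4 v = \<sigma> v" if "v \<notin> {''Y2'', ''Y'', ''D2'', ''D'', ''k''}" for v
    using 1(3)[of v] 2(3)[of v] 3(3)[of v] 4(3)[of v] that by auto
  ultimately show ?thesis using run by (intro exI[of _ \<sigma>4]) simp
qed

lemma gooddir_neg: "gooddir y u \<Longrightarrow> gooddir y (\<lambda>p. - 1 * u p)"
  unfolding gooddir_def admdir_def qform_def
  by (simp only: dot_scale_right dot_scale_left) (simp add: sum_negf)

lemma body_code_runb:
  assumes e: "menv \<sigma>" and y: "at_point y \<sigma>" and inv: "winv k y"
    and tot: "(\<Sum>i<N. dot m (b i) (b i)) \<le> real m ^ 5 * G\<^sup>2"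
    and Bd: "m \<le> Bd" "N * m \<le> Bd" "N \<le> Bd" "1 \<le> Bd"
  shows "\<exists>\<tau> y'. runb body_code \<sigma> (body_cost m Bd) \<tau> \<and> menv \<tau> \<and> at_point y' \<tau> \<and> winv (Suc k) y' \<and> \<tau> ''r'' = \<sigma> ''r''"
proof -
  let ?a = "\<lambda>p. of_bool (alive y p) :: real"
  define c where "c = real_of_int (\<sigma> ''D'' 0 * \<sigma> ''Dx'' 0)"
  have D0: "0 < \<sigma> ''D'' 0" and c0: "0 < c" using e y by (auto simp: menv_def at_point_def c_def)
  obtain \<sigma>1 \<kappa> where 1: "runb (blk prep_code) \<sigma> (11 * (15 * Bd + 1) + 1) \<sigma>1" "0 < \<kappa>"
    "dot m (bal m ?a \<beta>) (bal m ?a \<beta>) = 0 \<or> \<kappa> = dot m (bal m ?a \<beta>) (bal m ?a \<beta>)"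
    "penv ?a \<kappa> \<sigma>1" "benv (stiff y) \<sigma>1" "\<forall>p<m. \<sigma>1 ''u'' (int p) = 0"
    "\<forall>p<m. rv \<sigma>1 ''Z'' p = real_of_int (\<sigma> ''D'' 0 * \<sigma> ''Dx'' 0) * disp y p"
    "\<forall>i<N. rv \<sigma>1 ''dz'' i = real_of_int (\<sigma> ''D'' 0 * \<sigma> ''Dx'' 0) * dot m (b i) (disp y)"
    and g1: "\<forall>v. v \<notin> {''al'', ''na'', ''sb'', ''bp'', ''kq'', ''kp'', ''Z'', ''dz'', ''tg'', ''kf'', ''u'', ''k'', ''i''} \<longrightarrow> \<sigma>1 v = \<sigma> v"
    using prep_code_runb[OF e y Bd] by (elim exE conjE) (rule that; assumption)
  have f1: "\<sigma>1 v = \<sigma> v" if "v \<notin> {''al'', ''na'', ''sb'', ''bp'', ''kq'', ''kp'', ''Z'', ''dz'', ''tg'', ''kf'', ''u'', ''k'', ''i''}" for v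
    by (rule g1[rule_format, OF that])
  from search_code_runb[OF inv tot 1(2-5) Bd 1(6)] obtain \<sigma>2 where 2: "runb search_code \<sigma>1 (m * (try_cost m Bd + 3) + 3) \<sigma>2"
    "if 2 * frozen y < m then gooddir y (rv \<sigma>2 ''u'') else (\<forall>p<m. rv \<sigma>2 ''u'' p = 0)"
    and g2: "\<forall>v. v \<notin> {''w'', ''gd'', ''nv'', ''qv'', ''u'', ''u2'', ''t'', ''dv'', ''rr'', ''v2'', ''sm'', ''v3'', ''pp'', ''v'', ''k'', ''i''} \<longrightarrow> \<sigma>2 v = \<sigma>1 v"
    by (elim exE conjE) (rule that; assumption)
  have f2: "\<sigma>2 v = \<sigma>1 v" if "v \<notin> {''w'', ''gd'', ''nv'', ''qv'', ''u'', ''u2'', ''t'', ''dv'', ''rr'', ''v2'', ''sm'', ''v3'', ''pp'', ''v'', ''k'', ''i''}" for v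
    by (rule g2[rule_format, OF that])
  have "menv \<sigma>2 = menv \<sigma>1" by (rule menv_cong, rule f2) auto
  also have "menv \<sigma>1 = menv \<sigma>" by (rule menv_cong, rule f1) auto
  finally have e2: "menv \<sigma>2" using e by simp
  have "at_point y \<sigma>2 = at_point y \<sigma>1" by (rule at_point_cong, rule f2) auto
  also have "at_point y \<sigma>1 = at_point y \<sigma>" by (rule at_point_cong, rule f1) auto
  finally have y2: "at_point y \<sigma>2" using y by simp
  have zz: "\<sigma>2 ''Z'' = \<sigma>1 ''Z''" "\<sigma>2 ''dz'' = \<sigma>1 ''dz''" by (rule f2, simp)+
  have Z2: "\<forall>p<m. rv \<sigma>2 ''Z'' p = c * disp y p" "\<forall>i<N. rv \<sigma>2 ''dz'' i = c * dot m (b i) (disp y)"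
    using 1(7,8) unfolding c_def by (simp_all add: rv_def zz)
  from dir_code_runb[OF e2 y2 Bd Z2 c0] obtain \<sigma>3 where 3: "runb (blk dir_code) \<sigma>2 (10 * (15 * Bd + 1) + 1) \<sigma>3"
    "(\<forall>p<m. rv \<sigma>3 ''us'' p = rv \<sigma>2 ''u'' p) \<or> (\<forall>p<m. rv \<sigma>3 ''us'' p = - 1 * rv \<sigma>2 ''u'' p)"
    "0 \<le> slope y (rv \<sigma>3 ''us'')" "\<forall>p<m. \<sigma>3 ''au'' (int p) = \<bar>\<sigma>3 ''us'' (int p)\<bar>"
    "\<forall>p<m. \<sigma>3 ''rm'' (int p) = (if 0 < \<sigma>3 ''us'' (int p) then \<sigma>2 ''D'' 0 - \<sigma>2 ''Y'' (int p) else \<sigma>2 ''Y'' (int p))"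
    "\<sigma>3 ''num'' 0 = \<sigma>2 ''D'' 0"
    "\<sigma>3 ''den'' 0 = (\<Sum>p<m. \<bar>\<sigma>3 ''us'' (int p)\<bar>) + of_bool ((\<Sum>p<m. \<bar>\<sigma>3 ''us'' (int p)\<bar>) < 1)"
    and g3: "\<forall>v. v \<notin> {''du'', ''e1'', ''e2'', ''ng'', ''us'', ''au'', ''rm'', ''W'', ''den'', ''num'', ''k'', ''i''} \<longrightarrow> \<sigma>3 v = \<sigma>2 v"
    by (elim exE conjE) (rule that; assumption)
  have f3: "\<sigma>3 v = \<sigma>2 v" if "v \<notin> {''du'', ''e1'', ''e2'', ''ng'', ''us'', ''au'', ''rm'', ''W'', ''den'', ''num'', ''k'', ''i''}" for v
    by (rule g3[rule_format, OF that])
  have DY: "\<sigma>2 ''D'' = \<sigma> ''D''" "\<sigma>2 ''Y'' = \<sigma> ''Y''"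
    by (rule trans[OF f2 f1], simp, simp)+
  have ybox: "0 \<le> y p \<and> y p \<le> 1" if "p < m" for p using inv that by (auto simp: winv_def)
  have Yp: "real_of_int (\<sigma> ''Y'' (int p)) = real_of_int (\<sigma> ''D'' 0) * y p" if "p < m" for p
    using y that by (simp add: at_point_def rv_def)
  let ?v = "rv \<sigma>3 ''us''"
  have room: "real_of_int (\<sigma>3 ''rm'' (int p)) = real_of_int (\<sigma> ''D'' 0) * (if 0 < ?v p then 1 - y p else y p)" if "p < m" for p
    using 3(5) Yp[OF that] that DY by (simp add: rv_def algebra_simps)
  have rm0: "\<forall>p<m. 0 \<le> \<sigma>3 ''rm'' (int p)"
  proof (intro allI impI)
    fix p assume that: "p < m"
    have "0 \<le> real_of_int (\<sigma>3 ''rm'' (int p))" unfolding room[OF that] using ybox[OF that] D0 by simp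
    then show "0 \<le> \<sigma>3 ''rm'' (int p)" by simp
  qed
  have m3: "\<sigma>3 ''m'' 0 = int m" using e2 f3[of "''m''"] by (simp add: menv_def)
  define W where "W = (\<Sum>p<m. \<bar>\<sigma>3 ''us'' (int p)\<bar>)"
  have W0: "0 \<le> W" unfolding W_def by (intro sum_nonneg) auto
  have den0: "0 < \<sigma>3 ''den'' 0" using 3(7) W0 unfolding W_def[symmetric] by (cases "W = 0") auto
  have au0: "\<forall>p<m. 0 \<le> \<sigma>3 ''au'' (int p)" using 3(4) by simp
  have num0: "0 \<le> \<sigma>3 ''num'' 0" using 3(6) D0 DY by simp
  from min_code_runb[OF m3 Bd(1,4) rm0 au0 num0 den0] obtain \<sigma>4 where
    4: "runb min_code \<sigma>3 (m * ((5 * (15 * Bd + 1) + 1) + 3) + 3) \<sigma>4" "0 < \<sigma>4 ''den'' 0" "0 \<le> \<sigma>4 ''num'' 0"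
    "\<sigma>4 ''num'' 0 * \<sigma>3 ''den'' 0 \<le> \<sigma>3 ''num'' 0 * \<sigma>4 ''den'' 0"
    "\<forall>p<m. \<sigma>4 ''num'' 0 * \<sigma>3 ''au'' (int p) \<le> \<sigma>3 ''rm'' (int p) * \<sigma>4 ''den'' 0"
    "\<sigma>4 ''num'' 0 = \<sigma>3 ''num'' 0 \<and> \<sigma>4 ''den'' 0 = \<sigma>3 ''den'' 0 \<or>
      (\<exists>p<m. \<sigma>3 ''au'' (int p) \<noteq> 0 \<and> \<sigma>4 ''num'' 0 = \<sigma>3 ''rm'' (int p) \<and> \<sigma>4 ''den'' 0 = \<sigma>3 ''au'' (int p))"
    and g4: "\<forall>v. v \<notin> {''w'', ''fl'', ''num2'', ''den2'', ''num'', ''den'', ''k''} \<longrightarrow> \<sigma>4 v = \<sigma>3 v"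
    by (elim exE conjE) (rule that; assumption)
  have f4: "\<sigma>4 v = \<sigma>3 v" if "v \<notin> {''w'', ''fl'', ''num2'', ''den2'', ''num'', ''den'', ''k''}" for v
    by (rule g4[rule_format, OF that])
  have m4: "\<sigma>4 ''m'' 0 = int m" using m3 f4[of "''m''"] by simp
  from move_code_runb[of \<sigma>4, OF m4 Bd(1,4)] obtain \<sigma>5 where 5: "runb (blk move_code) \<sigma>4 (4 * (15 * Bd + 1) + 1) \<sigma>5"
    "\<forall>p<m. \<sigma>5 ''Y'' (int p) = \<sigma>4 ''Y'' (int p) * \<sigma>4 ''den'' 0 + \<sigma>4 ''num'' 0 * \<sigma>4 ''us'' (int p)"
    "\<sigma>5 ''D'' 0 = \<sigma>4 ''D'' 0 * \<sigma>4 ''den'' 0"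
    and g5: "\<forall>v. v \<notin> {''Y2'', ''Y'', ''D2'', ''D'', ''k''} \<longrightarrow> \<sigma>5 v = \<sigma>4 v" by (elim exE conjE) (rule that; assumption)
  have f5: "\<sigma>5 v = \<sigma>4 v" if "v \<notin> {''Y2'', ''Y'', ''D2'', ''D'', ''k''}" for v
    by (rule g5[rule_format, OF that])
  have run: "runb body_code \<sigma> (body_cost m Bd) \<sigma>5"
    unfolding body_code_def append_Cons append_Nil body_cost_def
    by (rule blk_append[OF 1(1) blk_Cons[OF 2(1) blk_append[OF 3(1) blk_Cons[OF 4(1) 5(1)]]]])
  have "menv \<sigma>5 = menv \<sigma>4" by (rule menv_cong, rule f5) auto
  also have "menv \<sigma>4 = menv \<sigma>3" by (rule menv_cong, rule f4) auto
  also have "menv \<sigma>3 = menv \<sigma>2" by (rule menv_cong, rule f3) auto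
  finally have e5: "menv \<sigma>5" using e2 by simp
  have rr: "\<sigma>5 ''r'' = \<sigma> ''r''" using f5[of "''r''"] f4[of "''r''"] f3[of "''r''"] f2[of "''r''"] f1[of "''r''"] by simp
  have DY4: "\<sigma>4 ''D'' = \<sigma> ''D''" "\<sigma>4 ''Y'' = \<sigma> ''Y''" "\<sigma>4 ''us'' = \<sigma>3 ''us''"
    using f4[of "''D''"] f4[of "''Y''"] f4[of "''us''"] f3[of "''D''"] f3[of "''Y''"] DY by simp_all
  let ?n = "real_of_int (\<sigma>4 ''num'' 0)" and ?d = "real_of_int (\<sigma>4 ''den'' 0)" and ?D = "real_of_int (\<sigma> ''D'' 0)"
  have pos: "0 < ?d" "0 \<le> ?n" "0 < ?D" using 4(2,3) D0 by auto
  \<comment> \<open>The rooms and the initial \<open>num\<close> are scaled by \<open>D\<close>,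
    which accounts for the extra factor in the denominator.\<close>
  define \<theta> where "\<theta> = ?n / (?D * ?d)"
  have \<theta>0: "0 \<le> \<theta>" using pos by (simp add: \<theta>_def)
  have at5: "at_point (\<lambda>p. y p + \<theta> * ?v p) \<sigma>5"
  proof -
    have "real_of_int (\<sigma>5 ''Y'' (int p)) = ?D * ?d * (y p + \<theta> * ?v p)" if p: "p < m" for p
    proof -
      have "real_of_int (\<sigma>5 ''Y'' (int p)) = ?D * y p * ?d + ?n * ?v p"
        using 5(2) p Yp[OF p] by (simp add: DY4 rv_def)
      also have "\<dots> = ?D * ?d * (y p + \<theta> * ?v p)" using pos by (simp add: \<theta>_def field_simps)
      finally show ?thesis .
    qed
    then show ?thesis using 5(3) 4(2) D0 by (simp add: at_point_def rv_def DY4)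
  qed
  have "winv (Suc k) (\<lambda>p. y p + \<theta> * ?v p)"
  proof (cases "2 * frozen y < m")
    case True
    then have gu: "gooddir y (rv \<sigma>2 ''u'')" using 2(2) by simp
    have gv: "gooddir y ?v"
      using 3(2)
    proof
      assume "\<forall>p<m. ?v p = rv \<sigma>2 ''u'' p"
      then show ?thesis using gu gooddir_cong[of ?v "rv \<sigma>2 ''u''" y] by simp
    next
      assume "\<forall>p<m. ?v p = - 1 * rv \<sigma>2 ''u'' p"
      then show ?thesis using gooddir_neg[OF gu] gooddir_cong[of ?v "\<lambda>p. - 1 * rv \<sigma>2 ''u'' p" y] by simp
    qed
    have Wv: "real_of_int W = (\<Sum>p<m. \<bar>?v p\<bar>)" by (simp add: W_def rv_def)
    have "W \<noteq> 0"
    proof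
      assume "W = 0"
      then have "\<forall>p<m. ?v p = 0" using Wv by (simp add: sum_nonneg_eq_0_iff)
      then have "dot m ?v ?v = 0" by (simp add: dot_def)
      then show False using gv by (simp add: gooddir_def)
    qed
    then have W1: "1 \<le> W" using W0 by linarith
    then have dW: "\<sigma>3 ''den'' 0 = W" using 3(7) unfolding W_def[symmetric] by simp
    have nD: "\<sigma>3 ''num'' 0 = \<sigma> ''D'' 0" using 3(6) DY by simp
    have auv: "real_of_int (\<sigma>3 ''au'' (int p)) = \<bar>?v p\<bar>" if "p < m" for p using 3(4) that by (simp add: rv_def)
    show ?thesis
    proof (rule winv_step[OF inv gv 3(3) \<theta>0])
      have "real_of_int (\<sigma>4 ''num'' 0 * \<sigma>3 ''den'' 0) \<le> real_of_int (\<sigma>3 ''num'' 0 * \<sigma>4 ''den'' 0)"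
        using 4(4) by (simp only: of_int_le_iff)
      then have "?n * real_of_int W \<le> ?D * ?d" by (simp add: dW nD)
      then show "\<theta> * (\<Sum>p<m. \<bar>?v p\<bar>) \<le> 1" using pos by (simp add: \<theta>_def Wv[symmetric] divide_le_eq)
      show "\<theta> * \<bar>?v p\<bar> \<le> (if 0 < ?v p then 1 - y p else y p)" if p: "p < m" for p
      proof -
        have "real_of_int (\<sigma>4 ''num'' 0 * \<sigma>3 ''au'' (int p)) \<le> real_of_int (\<sigma>3 ''rm'' (int p) * \<sigma>4 ''den'' 0)"
          using 4(5) p by (simp only: of_int_le_iff)
        then have "?n * \<bar>?v p\<bar> \<le> (?D * ?d) * (if 0 < ?v p then 1 - y p else y p)"
          unfolding of_int_mult auv[OF p] room[OF p] by (simp add: mult_ac)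
        then show ?thesis using pos unfolding \<theta>_def by (simp add: divide_le_eq mult.commute del: if_split)
      qed
      show "\<theta> * (\<Sum>p<m. \<bar>?v p\<bar>) = 1 \<or> (\<exists>p<m. ?v p \<noteq> 0 \<and> \<theta> * \<bar>?v p\<bar> = (if 0 < ?v p then 1 - y p else y p))"
        using 4(6)
      proof (elim disjE conjE exE)
        assume "\<sigma>4 ''num'' 0 = \<sigma>3 ''num'' 0" "\<sigma>4 ''den'' 0 = \<sigma>3 ''den'' 0"
        then have "\<theta> * (\<Sum>p<m. \<bar>?v p\<bar>) = 1" using pos W1 unfolding \<theta>_def Wv[symmetric] by (simp add: nD dW)
        then show ?thesis ..
      next
        fix p assume p: "p < m" "\<sigma>3 ''au'' (int p) \<noteq> 0" "\<sigma>4 ''num'' 0 = \<sigma>3 ''rm'' (int p)" "\<sigma>4 ''den'' 0 = \<sigma>3 ''au'' (int p)"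
        have v0: "?v p \<noteq> 0" using auv[OF p(1)] p(2) by auto
        have "?n = ?D * (if 0 < ?v p then 1 - y p else y p)" "?d = \<bar>?v p\<bar>"
          using room[OF p(1)] auv[OF p(1)] p(3,4) by simp_all
        then have "\<theta> * \<bar>?v p\<bar> = (if 0 < ?v p then 1 - y p else y p)"
          unfolding \<theta>_def using pos v0 by simp
        then show ?thesis using p(1) v0 by blast
      qed
    qed simp
  next
    case False
    \<comment> \<open>The search has left \<open>u = 0\<close>, so the point is unchanged below
      \<open>m\<close> and only the step count advances.\<close>
    then have vz: "?v p = 0" if "p < m" for p using 2(2) 3(2) that by auto
    have eq: "y p + \<theta> * ?v p = y p" if "p < m" for p using vz[OF that] by simp
    define y0 where "y0 = (\<lambda>p. y p + \<theta> * ?v p)"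
    have y0: "y0 p = y p" if "p < m" for p unfolding y0_def by (rule eq[OF that])
    have w: "winv (Suc k) y" using winv_stay[OF inv] False by simp
    have d: "dot m z (disp y0) = dot m z (disp y)" for z
      using y0 by (intro dot_cong) (auto simp: disp_def)
    have d2: "dot m (disp y0) (disp y0) = dot m (disp y) (disp y)"
      using y0 by (intro dot_cong) (auto simp: disp_def)
    have "{p. p < m \<and> \<not> alive y0 p} = {p. p < m \<and> \<not> alive y p}"
      unfolding alive_def using y0 by (intro Collect_cong conj_cong refl) simp
    then have "frozen y0 = frozen y" unfolding frozen_def by simp
    moreover have "(\<Sum>p<m. disp y0 p) = (\<Sum>p<m. disp y p)"
      using y0 by (intro sum.cong) (auto simp: disp_def)
    moreover have "potential y0 = potential y" unfolding potential_def d2 by (simp add: d)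
    ultimately have "winv (Suc k) y0" using w y0 unfolding winv_def d by simp
    then show ?thesis by (simp add: y0_def)
  qed
  then show ?thesis using run e5 at5 rr by blast
qed

end

section \<open>Computing the constraints\<close>

lemma SumA_runb_prefix:
  assumes d: "dst \<noteq> k" "dst \<noteq> i" "i \<noteq> k" "dst \<notin> rds e" "dst \<notin> rds N" "k \<notin> rds N" "i \<notin> rds N"
    and N: "aval N \<sigma> = int NN" and B: "NN * NN \<le> Bd" "NN \<le> Bd" "1 \<le> Bd"
  shows "\<exists>\<tau>. runb (SumA dst k N i (V k) e) \<sigma> (15 * Bd) \<tau> \<and>
    (\<forall>j<NN. \<tau> dst (int j) = (\<Sum>l<j. aval e (setc (setc \<sigma> k (int j)) i (int l)))) \<and>
    (\<forall>v. v \<notin> {dst, k, i} \<longrightarrow> \<tau> v = \<sigma> v)"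
proof -
  have "NN * (4 * NN + 8) + 3 \<le> 15 * Bd" using B by (simp add: algebra_simps)
  moreover note SumA_runb[of dst k i e N "V k" \<sigma> NN "\<lambda>j. j" NN]
  ultimately show ?thesis using d N by (auto intro: runb_mono)
qed

lemma ProdA_runb_prefix:
  assumes d: "dst \<noteq> k" "dst \<noteq> i" "i \<noteq> k" "dst \<notin> rds e" "dst \<notin> rds N" "k \<notin> rds N" "i \<notin> rds N"
    and N: "aval N \<sigma> = int NN" and B: "NN * NN \<le> Bd" "NN \<le> Bd" "1 \<le> Bd"
  shows "\<exists>\<tau>. runb (ProdA dst k N i (V k) e) \<sigma> (15 * Bd) \<tau> \<and>
    (\<forall>j<NN. \<tau> dst (int j) = (\<Prod>l<j. aval e (setc (setc \<sigma> k (int j)) i (int l)))) \<and>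
    (\<forall>v. v \<notin> {dst, k, i} \<longrightarrow> \<tau> v = \<sigma> v)"
proof -
  have "NN * (4 * NN + 8) + 3 \<le> 15 * Bd" using B by (simp add: algebra_simps)
  moreover note ProdA_runb[of dst k i e N "V k" \<sigma> NN "\<lambda>j. j" NN]
  ultimately show ?thesis using d N by (auto intro: runb_mono)
qed

lemma ProdA_runb_single:
  assumes d: "dst \<noteq> k" "dst \<noteq> i" "i \<noteq> k" "dst \<notin> rds e" "dst \<notin> rds M" "i \<notin> rds M" "k \<notin> rds M"
    and N: "aval M \<sigma> = int MM" and B: "MM \<le> Bd" "1 \<le> Bd"
  shows "\<exists>\<tau>. runb (ProdA dst k (Const 1) i M e) \<sigma> (15 * Bd) \<tau> \<and>
    \<tau> dst 0 = (\<Prod>l<MM. aval e (setc (setc \<sigma> k 0) i (int l))) \<and>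
    (\<forall>v. v \<notin> {dst, k, i} \<longrightarrow> \<tau> v = \<sigma> v)"
proof -
  have "1 * (4 * MM + 8) + 3 \<le> 15 * Bd" using B by simp
  moreover have "aval M (setc \<sigma> k z) = int MM" for z
    using aval_cong[of M "setc \<sigma> k z" \<sigma>] d(7) N by (metis fun_upd_other)
  moreover note ProdA_runb[of dst k i e "Const 1" M \<sigma> 1 "\<lambda>_. MM" MM]
  ultimately show ?thesis using d by (auto intro: runb_mono)
qed

lemma rat_num_den: "0 < rat_den r" "real_of_rat r = real_of_int (rat_num r) / real_of_int (rat_den r)"
proof -
  have q: "quotient_of r = (rat_num r, rat_den r)" by (simp add: rat_num_def rat_den_def)
  show "0 < rat_den r" using quotient_of_denom_pos[OF q] .
  show "real_of_rat r = real_of_int (rat_num r) / real_of_int (rat_den r)"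
    by (subst quotient_of_div[OF q]) (simp add: of_rat_divide)
qed

text \<open>In \<open>Lm\<close>, lengths \<open>0\<close> are replaced by \<open>1\<close>, which keeps the product a common multiple that is not \<open>0\<close>.\<close>

definition scaling_code :: "com list" where
  "scaling_code =
   [ProdA ''Ds'' ''k'' (Const 1) ''i'' (V ''n'') (Get ''s_den'' (V ''i'')),
    Asg ''S'' ''k'' (V ''n'') (Times (Get ''s_num'' (V ''k'')) (Quot (V ''Ds'') (Get ''s_den'' (V ''k'')))),
    ProdA ''Dx'' ''k'' (Const 1) ''i'' (V ''m'') (Get ''x_den'' (V ''i'')),
    Asg ''X'' ''k'' (V ''m'') (Times (Get ''x_num'' (V ''k'')) (Quot (V ''Dx'') (Get ''x_den'' (V ''k'')))),
    SumA ''L'' ''k'' (V ''n'') ''i'' (V ''m'') (Times (Get ''S'' (V ''k'')) (Get ''A'' (Plus (Times (V ''k'') (V ''m'')) (V ''i'')))),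
    SumA ''cum'' ''k'' (V ''n'') ''i'' (V ''k'') (Get ''L'' (V ''i'')),
    ProdA ''Lm'' ''k'' (Const 1) ''i'' (V ''n'') (Plus (Get ''L'' (V ''i'')) (Lt (Get ''L'' (V ''i'')) (Const 1))),
    ProdA ''e8'' ''k'' (Plus (V ''m'') (Const 2)) ''i'' (V ''k'') (Const 8),
    ProdA ''pw'' ''k'' (Plus (V ''m'') (Const 2)) ''i'' (V ''k'') (Const 2),
    SumA ''H'' ''k'' (Const 1) ''i'' (V ''m'') (Lt (Get ''e8'' (V ''i'')) (V ''m'')),
    SumA ''R'' ''k'' (Const 1) ''i'' (V ''m'') (Minus (Const 1) (Lt (V ''delta_den'')
      (Times (Times (Plus (V ''i'') (Const 1)) (Plus (V ''i'') (Const 1))) (V ''delta_num'')))),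
    Asg ''big'' ''k'' (V ''n'') (Lt (Times (V ''eps_num'') (Get ''s_den'' (V ''k''))) (Times (Get ''s_num'' (V ''k'')) (V ''eps_den''))),
    SumA ''beta'' ''k'' (V ''m'') ''i'' (V ''n'') (Times (Get ''big'' (V ''i'')) (Get ''A'' (Plus (Times (V ''i'') (V ''m'')) (V ''k''))))]"

locale rinst =
  fixes n m :: nat and A :: "nat \<Rightarrow> nat \<Rightarrow> nat" and s x :: "nat \<Rightarrow> rat" and \<delta> \<epsilon> :: rat
  assumes inst: "inst n m A (\<lambda>i. real_of_rat (s i)) (\<lambda>p. real_of_rat (x p)) (real_of_rat \<delta>) (real_of_rat \<epsilon>)"
    and n0: "0 < n"
begin

sublocale inst n m A "\<lambda>i. real_of_rat (s i)" "\<lambda>p. real_of_rat (x p)" "real_of_rat \<delta>" "real_of_rat \<epsilon>"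
  by (rule inst)

definition "input \<sigma> \<longleftrightarrow> \<sigma> ''n'' 0 = int n \<and> \<sigma> ''m'' 0 = int m \<and>
  (\<forall>j<n. \<forall>p<m. \<sigma> ''A'' (int j * int m + int p) = int (A j p)) \<and>
  (\<forall>j<n. \<sigma> ''s_num'' (int j) = rat_num (s j) \<and> \<sigma> ''s_den'' (int j) = rat_den (s j)) \<and>
  (\<forall>p<m. \<sigma> ''x_num'' (int p) = rat_num (x p) \<and> \<sigma> ''x_den'' (int p) = rat_den (x p)) \<and>
  \<sigma> ''delta_num'' 0 = rat_num \<delta> \<and> \<sigma> ''delta_den'' 0 = rat_den \<delta> \<and>
  \<sigma> ''eps_num'' 0 = rat_num \<epsilon> \<and> \<sigma> ''eps_den'' 0 = rat_den \<epsilon>"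

definition "base \<sigma> \<longleftrightarrow> \<sigma> ''n'' 0 = int n \<and> \<sigma> ''m'' 0 = int m \<and>
  (\<forall>j<n. \<forall>p<m. \<sigma> ''A'' (int j * int m + int p) = int (A j p)) \<and>
  0 < \<sigma> ''Ds'' 0 \<and> (\<forall>j<n. rv \<sigma> ''S'' j = real_of_int (\<sigma> ''Ds'' 0) * real_of_rat (s j)) \<and>
  (\<forall>j<n. rv \<sigma> ''L'' j = real_of_int (\<sigma> ''Ds'' 0) * len j) \<and>
  (\<forall>j<n. rv \<sigma> ''cum'' j = real_of_int (\<sigma> ''Ds'' 0) * cum j) \<and>
  0 < \<sigma> ''Lm'' 0 \<and> (\<forall>j<n. (\<sigma> ''L'' (int j) + of_bool (\<sigma> ''L'' (int j) < 1)) dvd \<sigma> ''Lm'' 0) \<and>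
  (\<forall>k<m + 2. \<sigma> ''e8'' (int k) = 8 ^ k) \<and> (\<forall>k<m + 2. \<sigma> ''pw'' (int k) = 2 ^ k) \<and>
  \<sigma> ''H'' 0 = int H \<and> \<sigma> ''R'' 0 = int R \<and> (\<forall>j<n. \<sigma> ''big'' (int j) = of_bool (big j)) \<and>
  (\<forall>p<m. rv \<sigma> ''beta'' p = lead p) \<and> 0 < \<sigma> ''Dx'' 0 \<and>
  (\<forall>p<m. rv \<sigma> ''X'' p = real_of_int (\<sigma> ''Dx'' 0) * real_of_rat (x p))"

text \<open>Each denominator divides the product of all denominators, so the integer division is
  exact.\<close>

lemma scaled_rat:
  assumes "finite I" "j \<in> I"
  shows "real_of_int (rat_num (r j) * ((\<Prod>l\<in>I. rat_den (r l)) div rat_den (r j))) =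
    real_of_int (\<Prod>l\<in>I. rat_den (r l)) * real_of_rat (r j)"
proof -
  have "rat_den (r j) dvd (\<Prod>l\<in>I. rat_den (r l))" using assms by (rule dvd_prodI)
  then have "real_of_int ((\<Prod>l\<in>I. rat_den (r l)) div rat_den (r j)) = real_of_int (\<Prod>l\<in>I. rat_den (r l)) / real_of_int (rat_den (r j))"
    by (rule real_of_int_div)
  then show ?thesis unfolding of_int_mult rat_num_den(2)[of "r j"] by simp
qed

lemma scaling_code_runb:
  assumes e: "input \<sigma>" and Bd: "n * m \<le> Bd" "n \<le> Bd" "m \<le> Bd" "n * n \<le> Bd" "(m + 2) * (m + 2) \<le> Bd" "1 \<le> Bd"
  shows "\<exists>\<tau>. runb (blk scaling_code) \<sigma> (13 * (15 * Bd + 1) + 1) \<tau> \<and> base \<tau>"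
proof -
  have i0: "\<sigma> ''n'' 0 = int n" "\<sigma> ''m'' 0 = int m"
    "\<And>j p. j < n \<Longrightarrow> p < m \<Longrightarrow> \<sigma> ''A'' (int j * int m + int p) = int (A j p)"
    "\<And>j. j < n \<Longrightarrow> \<sigma> ''s_num'' (int j) = rat_num (s j)" "\<And>j. j < n \<Longrightarrow> \<sigma> ''s_den'' (int j) = rat_den (s j)"
    "\<And>p. p < m \<Longrightarrow> \<sigma> ''x_num'' (int p) = rat_num (x p)" "\<And>p. p < m \<Longrightarrow> \<sigma> ''x_den'' (int p) = rat_den (x p)"
    "\<sigma> ''delta_num'' 0 = rat_num \<delta>" "\<sigma> ''delta_den'' 0 = rat_den \<delta>" "\<sigma> ''eps_num'' 0 = rat_num \<epsilon>" "\<sigma> ''eps_den'' 0 = rat_den \<epsilon>"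
    using e by (auto simp: input_def)
  have m2: "m + 2 \<le> Bd" using Bd(5) by (simp add: algebra_simps)
  obtain \<sigma>1 where 1: "runb (ProdA ''Ds'' ''k'' (Const 1) ''i'' (V ''n'') (Get ''s_den'' (V ''i''))) \<sigma> (15 * Bd) \<sigma>1"
    "\<sigma>1 ''Ds'' 0 = (\<Prod>l<n. \<sigma> ''s_den'' (int l))" "\<And>v. v \<notin> {''Ds'', ''k'', ''i''} \<Longrightarrow> \<sigma>1 v = \<sigma> v"
    using ProdA_runb_single[of "''Ds''" "''k''" "''i''" "Get ''s_den'' (V ''i'')" "V ''n''" \<sigma> n Bd] Bd i0(1) by auto
  let ?e2 = "Times (Get ''s_num'' (V ''k'')) (Quot (V ''Ds'') (Get ''s_den'' (V ''k'')))"
  obtain \<sigma>2 where 2: "runb (Asg ''S'' ''k'' (V ''n'') ?e2) \<sigma>1 (15 * Bd) \<sigma>2"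
    "\<And>j. j < n \<Longrightarrow> \<sigma>2 ''S'' (int j) = \<sigma> ''s_num'' (int j) * (\<sigma>1 ''Ds'' 0 div \<sigma> ''s_den'' (int j))"
    "\<And>v. v \<notin> {''S'', ''k''} \<Longrightarrow> \<sigma>2 v = \<sigma>1 v"
    using Asg_runb_uniform[of "''S''" "''k''" ?e2 "V ''n''" \<sigma>1 n Bd] Bd i0(1) 1(3) by auto
  obtain \<sigma>3 where 3: "runb (ProdA ''Dx'' ''k'' (Const 1) ''i'' (V ''m'') (Get ''x_den'' (V ''i''))) \<sigma>2 (15 * Bd) \<sigma>3"
    "\<sigma>3 ''Dx'' 0 = (\<Prod>l<m. \<sigma> ''x_den'' (int l))" "\<And>v. v \<notin> {''Dx'', ''k'', ''i''} \<Longrightarrow> \<sigma>3 v = \<sigma>2 v"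
    using ProdA_runb_single[of "''Dx''" "''k''" "''i''" "Get ''x_den'' (V ''i'')" "V ''m''" \<sigma>2 m Bd] Bd i0(2) 1(3) 2(3) by auto
  let ?e4 = "Times (Get ''x_num'' (V ''k'')) (Quot (V ''Dx'') (Get ''x_den'' (V ''k'')))"
  obtain \<sigma>4 where 4: "runb (Asg ''X'' ''k'' (V ''m'') ?e4) \<sigma>3 (15 * Bd) \<sigma>4"
    "\<And>j. j < m \<Longrightarrow> \<sigma>4 ''X'' (int j) = \<sigma> ''x_num'' (int j) * (\<sigma>3 ''Dx'' 0 div \<sigma> ''x_den'' (int j))"
    "\<And>v. v \<notin> {''X'', ''k''} \<Longrightarrow> \<sigma>4 v = \<sigma>3 v"
    using Asg_runb_uniform[of "''X''" "''k''" ?e4 "V ''m''" \<sigma>3 m Bd] Bd i0(2) 1(3) 2(3) 3(3) by auto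
  have f4: "\<sigma>4 v = \<sigma> v" if "v \<notin> {''X'', ''Dx'', ''S'', ''Ds'', ''k'', ''i''}" for v
    using that 1(3)[of v] 2(3)[of v] 3(3)[of v] 4(3)[of v] by auto
  have s4: "\<sigma>4 ''n'' = \<sigma> ''n''" "\<sigma>4 ''m'' = \<sigma> ''m''" "\<sigma>4 ''A'' = \<sigma> ''A''" "\<sigma>4 ''S'' = \<sigma>2 ''S''" "\<sigma>4 ''s_num'' = \<sigma> ''s_num''" "\<sigma>4 ''s_den'' = \<sigma> ''s_den''"
    "\<sigma>4 ''delta_num'' = \<sigma> ''delta_num''" "\<sigma>4 ''delta_den'' = \<sigma> ''delta_den''" "\<sigma>4 ''eps_num'' = \<sigma> ''eps_num''" "\<sigma>4 ''eps_den'' = \<sigma> ''eps_den''"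
    using f4 3(3) 4(3) by auto
  let ?e5 = "Times (Get ''S'' (V ''k'')) (Get ''A'' (Plus (Times (V ''k'') (V ''m'')) (V ''i'')))"
  obtain \<sigma>5 where 5: "runb (SumA ''L'' ''k'' (V ''n'') ''i'' (V ''m'') ?e5) \<sigma>4 (15 * Bd) \<sigma>5"
    "\<And>j. j < n \<Longrightarrow> \<sigma>5 ''L'' (int j) = (\<Sum>l<m. \<sigma>2 ''S'' (int j) * \<sigma> ''A'' (int j * int m + int l))"
    "\<And>v. v \<notin> {''L'', ''k'', ''i''} \<Longrightarrow> \<sigma>5 v = \<sigma>4 v"
    using SumA_runb_uniform[of "''L''" "''k''" "''i''" ?e5 "V ''n''" "V ''m''" \<sigma>4 n m Bd] Bd i0(1,2) s4 by auto
  obtain \<sigma>6 where 6: "runb (SumA ''cum'' ''k'' (V ''n'') ''i'' (V ''k'') (Get ''L'' (V ''i''))) \<sigma>5 (15 * Bd) \<sigma>6"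
    "\<And>j. j < n \<Longrightarrow> \<sigma>6 ''cum'' (int j) = (\<Sum>l<j. \<sigma>5 ''L'' (int l))"
    "\<And>v. v \<notin> {''cum'', ''k'', ''i''} \<Longrightarrow> \<sigma>6 v = \<sigma>5 v"
    using SumA_runb_prefix[of "''cum''" "''k''" "''i''" "Get ''L'' (V ''i'')" "V ''n''" \<sigma>5 n Bd] Bd i0(1) s4 5(3) by auto
  let ?e7 = "Plus (Get ''L'' (V ''i'')) (Lt (Get ''L'' (V ''i'')) (Const 1))"
  obtain \<sigma>7 where 7: "runb (ProdA ''Lm'' ''k'' (Const 1) ''i'' (V ''n'') ?e7) \<sigma>6 (15 * Bd) \<sigma>7"
    "\<sigma>7 ''Lm'' 0 = (\<Prod>l<n. \<sigma>5 ''L'' (int l) + of_bool (\<sigma>5 ''L'' (int l) < 1))"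
    "\<And>v. v \<notin> {''Lm'', ''k'', ''i''} \<Longrightarrow> \<sigma>7 v = \<sigma>6 v"
    using ProdA_runb_single[of "''Lm''" "''k''" "''i''" ?e7 "V ''n''" \<sigma>6 n Bd] Bd i0(1) s4 5(3) 6(3) by (auto split del: if_split)
  have s7: "\<sigma>7 ''n'' = \<sigma> ''n''" "\<sigma>7 ''m'' = \<sigma> ''m''" using s4 5(3) 6(3) 7(3) by auto
  obtain \<sigma>8 where 8: "runb (ProdA ''e8'' ''k'' (Plus (V ''m'') (Const 2)) ''i'' (V ''k'') (Const 8)) \<sigma>7 (15 * Bd) \<sigma>8"
    "\<And>j. j < m + 2 \<Longrightarrow> \<sigma>8 ''e8'' (int j) = 8 ^ j" "\<And>v. v \<notin> {''e8'', ''k'', ''i''} \<Longrightarrow> \<sigma>8 v = \<sigma>7 v"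
    using ProdA_runb_prefix[of "''e8''" "''k''" "''i''" "Const 8" "Plus (V ''m'') (Const 2)" \<sigma>7 "m + 2" Bd] Bd m2 i0(2) s7 by auto
  obtain \<sigma>9 where 9: "runb (ProdA ''pw'' ''k'' (Plus (V ''m'') (Const 2)) ''i'' (V ''k'') (Const 2)) \<sigma>8 (15 * Bd) \<sigma>9"
    "\<And>j. j < m + 2 \<Longrightarrow> \<sigma>9 ''pw'' (int j) = 2 ^ j" "\<And>v. v \<notin> {''pw'', ''k'', ''i''} \<Longrightarrow> \<sigma>9 v = \<sigma>8 v"
    using ProdA_runb_prefix[of "''pw''" "''k''" "''i''" "Const 2" "Plus (V ''m'') (Const 2)" \<sigma>8 "m + 2" Bd] Bd m2 i0(2) s7 8(3) by auto
  have s9: "\<sigma>9 ''n'' = \<sigma> ''n''" "\<sigma>9 ''m'' = \<sigma> ''m''" "\<sigma>9 ''delta_num'' = \<sigma> ''delta_num''" "\<sigma>9 ''delta_den'' = \<sigma> ''delta_den''"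
     "\<sigma>9 ''eps_num'' = \<sigma> ''eps_num''" "\<sigma>9 ''eps_den'' = \<sigma> ''eps_den''" "\<sigma>9 ''s_num'' = \<sigma> ''s_num''" "\<sigma>9 ''s_den'' = \<sigma> ''s_den''"
     "\<sigma>9 ''A'' = \<sigma> ''A''" "\<sigma>9 ''e8'' = \<sigma>8 ''e8''"
    using s4 s7 5(3) 6(3) 7(3) 8(3) 9(3) by auto
  obtain \<sigma>10 where 10: "runb (SumA ''H'' ''k'' (Const 1) ''i'' (V ''m'') (Lt (Get ''e8'' (V ''i'')) (V ''m''))) \<sigma>9 (15 * Bd) \<sigma>10"
    "\<sigma>10 ''H'' 0 = (\<Sum>l<m. of_bool (\<sigma>8 ''e8'' (int l) < int m))" "\<And>v. v \<notin> {''H'', ''k'', ''i''} \<Longrightarrow> \<sigma>10 v = \<sigma>9 v"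
    using SumA_runb_uniform[of "''H''" "''k''" "''i''" "Lt (Get ''e8'' (V ''i'')) (V ''m'')" "Const 1" "V ''m''" \<sigma>9 1 m Bd] Bd i0(2) s9 
    by (auto split del: if_split simp del: sum_of_bool_eq)
  let ?e11 = "Minus (Const 1) (Lt (V ''delta_den'') (Times (Times (Plus (V ''i'') (Const 1)) (Plus (V ''i'') (Const 1))) (V ''delta_num'')))"
  obtain \<sigma>11 where 11: "runb (SumA ''R'' ''k'' (Const 1) ''i'' (V ''m'') ?e11) \<sigma>10 (15 * Bd) \<sigma>11"
    "\<sigma>11 ''R'' 0 = (\<Sum>l<m. 1 - of_bool (rat_den \<delta> < (int l + 1) * (int l + 1) * rat_num \<delta>))" "\<And>v. v \<notin> {''R'', ''k'', ''i''} \<Longrightarrow> \<sigma>11 v = \<sigma>10 v"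
    using SumA_runb_uniform[of "''R''" "''k''" "''i''" ?e11 "Const 1" "V ''m''" \<sigma>10 1 m Bd] Bd i0(2,8,9) s9 10(3)
    by (auto split del: if_split simp del: sum_of_bool_eq sum_subtractf)
  let ?e12 = "Lt (Times (V ''eps_num'') (Get ''s_den'' (V ''k''))) (Times (Get ''s_num'' (V ''k'')) (V ''eps_den''))"
  obtain \<sigma>12 where 12: "runb (Asg ''big'' ''k'' (V ''n'') ?e12) \<sigma>11 (15 * Bd) \<sigma>12"
    "\<And>j. j < n \<Longrightarrow> \<sigma>12 ''big'' (int j) = of_bool (rat_num \<epsilon> * \<sigma> ''s_den'' (int j) < \<sigma> ''s_num'' (int j) * rat_den \<epsilon>)"
    "\<And>v. v \<notin> {''big'', ''k''} \<Longrightarrow> \<sigma>12 v = \<sigma>11 v"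
    using Asg_runb_uniform[of "''big''" "''k''" ?e12 "V ''n''" \<sigma>11 n Bd] Bd i0(1,10,11) s9 10(3) 11(3) by (auto split del: if_split)
  let ?e13 = "Times (Get ''big'' (V ''i'')) (Get ''A'' (Plus (Times (V ''i'') (V ''m'')) (V ''k'')))"
  obtain \<sigma>13 where 13: "runb (SumA ''beta'' ''k'' (V ''m'') ''i'' (V ''n'') ?e13) \<sigma>12 (15 * Bd) \<sigma>13"
    "\<And>p. p < m \<Longrightarrow> \<sigma>13 ''beta'' (int p) = (\<Sum>l<n. \<sigma>12 ''big'' (int l) * \<sigma> ''A'' (int l * int m + int p))"
    "\<And>v. v \<notin> {''beta'', ''k'', ''i''} \<Longrightarrow> \<sigma>13 v = \<sigma>12 v"
    using SumA_runb_uniform[of "''beta''" "''k''" "''i''" ?e13 "V ''m''" "V ''n''" \<sigma>12 m n Bd] Bd i0(1,2) s9 10(3) 11(3) 12(3)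
    by (auto simp: mult.commute[of m n])
  have "runb (blk scaling_code) \<sigma> (Suc (Suc (Suc (Suc (Suc (Suc (Suc (Suc (Suc (Suc (Suc (Suc (Suc 0)))))))))))) * (15 * Bd + 1) + 1) \<sigma>13"
    unfolding scaling_code_def
    by (intro blk_Cons_uniform[OF 1(1)] blk_Cons_uniform[OF 2(1)] blk_Cons_uniform[OF 3(1)] blk_Cons_uniform[OF 4(1)] blk_Cons_uniform[OF 5(1)]
        blk_Cons_uniform[OF 6(1)] blk_Cons_uniform[OF 7(1)] blk_Cons_uniform[OF 8(1)] blk_Cons_uniform[OF 9(1)] blk_Cons_uniform[OF 10(1)] blk_Cons_uniform[OF 11(1)]
        blk_Cons_uniform[OF 12(1)] blk_Cons_uniform[OF 13(1)])
      (use blk_Nil in simp)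
  then have run: "runb (blk scaling_code) \<sigma> (13 * (15 * Bd + 1) + 1) \<sigma>13" by (simp add: numeral_eq_Suc)
  have f: "\<sigma>13 ''n'' = \<sigma> ''n''" "\<sigma>13 ''m'' = \<sigma> ''m''" "\<sigma>13 ''A'' = \<sigma> ''A''" "\<sigma>13 ''Ds'' = \<sigma>1 ''Ds''" "\<sigma>13 ''S'' = \<sigma>2 ''S''"
    "\<sigma>13 ''Dx'' = \<sigma>3 ''Dx''" "\<sigma>13 ''X'' = \<sigma>4 ''X''" "\<sigma>13 ''L'' = \<sigma>5 ''L''" "\<sigma>13 ''cum'' = \<sigma>6 ''cum''" "\<sigma>13 ''Lm'' = \<sigma>7 ''Lm''"
    "\<sigma>13 ''e8'' = \<sigma>8 ''e8''" "\<sigma>13 ''pw'' = \<sigma>9 ''pw''" "\<sigma>13 ''H'' = \<sigma>10 ''H''" "\<sigma>13 ''R'' = \<sigma>11 ''R''" "\<sigma>13 ''big'' = \<sigma>12 ''big''"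
    using s9 2(3) 3(3) 4(3) 5(3) 6(3) 7(3) 8(3) 9(3) 10(3) 11(3) 12(3) 13(3) by simp_all
  have Ds: "\<sigma>1 ''Ds'' 0 = (\<Prod>l<n. rat_den (s l))" using 1(2) i0(5) by simp
  have Dspos: "0 < \<sigma>1 ''Ds'' 0" unfolding Ds by (intro prod_pos) (simp add: rat_num_den)
  have Dx: "\<sigma>3 ''Dx'' 0 = (\<Prod>l<m. rat_den (x l))" using 3(2) i0(7) by simp
  have Dxpos: "0 < \<sigma>3 ''Dx'' 0" unfolding Dx by (intro prod_pos) (simp add: rat_num_den)
  have S: "real_of_int (\<sigma>2 ''S'' (int j)) = real_of_int (\<sigma>1 ''Ds'' 0) * real_of_rat (s j)" if "j < n" for j
    using scaled_rat[of "{..<n}" j s] that i0(4,5) 2(2)[OF that] Ds by simp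
  have X: "real_of_int (\<sigma>4 ''X'' (int j)) = real_of_int (\<sigma>3 ''Dx'' 0) * real_of_rat (x j)" if "j < m" for j
    using scaled_rat[of "{..<m}" j x] that i0(6,7) 4(2)[OF that] Dx by simp
  have L: "real_of_int (\<sigma>5 ''L'' (int j)) = real_of_int (\<sigma>1 ''Ds'' 0) * len j" if "j < n" for j
    using S[OF that] i0(3) that by (simp add: 5(2)[OF that] len_def wt_def sum_distrib_left mult.assoc)
  have cum: "real_of_int (\<sigma>6 ''cum'' (int j)) = real_of_int (\<sigma>1 ''Ds'' 0) * cum j" if "j < n" for j
    using L that by (simp add: 6(2)[OF that] cum_def sum_distrib_left)
  have L0: "0 \<le> \<sigma>5 ''L'' (int j)" if "j < n" for j
  proof -
    have "0 \<le> real_of_int (\<sigma>5 ''L'' (int j))" unfolding L[OF that] using Dspos len0[OF that] by simp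
    then show ?thesis by simp
  qed
  have Lm: "0 < \<sigma>7 ''Lm'' 0" unfolding 7(2) using L0 by (intro prod_pos) (auto simp: of_bool_def intro: add_nonneg_pos)
  have Ld: "(\<sigma>5 ''L'' (int j) + of_bool (\<sigma>5 ''L'' (int j) < 1)) dvd \<sigma>7 ''Lm'' 0" if "j < n" for j
    unfolding 7(2) using that by (intro dvd_prodI) auto
  have H: "\<sigma>10 ''H'' 0 = int H"
  proof -
    have "(\<sigma>8 ''e8'' (int l) < int m) = (8 ^ l < m)" if "l < m" for l
    proof -
      have "int (8 ^ l) < int m \<longleftrightarrow> 8 ^ l < m" by (simp only: of_nat_less_iff)
      then show ?thesis using 8(2)[of l] that by simp
    qed
    then have "\<sigma>10 ''H'' 0 = (\<Sum>l<m. of_bool (8 ^ l < m))" unfolding 10(2) by (intro sum.cong) auto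
    also have "\<dots> = int (card ({..<m} \<inter> {l. 8 ^ l < m}))" by simp
    also have "{..<m} \<inter> {l. 8 ^ l < m} = {k. k < m \<and> 8 ^ k < m}" by auto
    finally show ?thesis by (simp add: H_def depth_def)
  qed
  have R: "\<sigma>11 ''R'' 0 = int R"
  proof -
    \<comment> \<open>Multiplication by the positive denominator of \<open>\<delta>\<close> turns
      the condition in \<open>rate\<close> into a negated strict comparison of integers.\<close>
    have "1 - of_bool (rat_den \<delta> < (int l + 1) * (int l + 1) * rat_num \<delta>) = (of_bool (real (Suc l) ^ 2 * real_of_rat \<delta> \<le> 1) :: int)" for l
    proof -
      have "(rat_den \<delta> < (int l + 1) * (int l + 1) * rat_num \<delta>) \<longleftrightarrow>
        real_of_int (rat_den \<delta>) < real_of_int ((int l + 1) * (int l + 1) * rat_num \<delta>)" by (simp only: of_int_less_iff)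
      also have "\<dots> \<longleftrightarrow> \<not> real (Suc l) ^ 2 * real_of_rat \<delta> \<le> 1"
      proof -
        have g: "D < P * a \<longleftrightarrow> \<not> P * (a / D) \<le> 1" if "0 < D" for D P a :: real
          using that by (simp add: field_simps not_le)
        have eq: "real_of_int ((int l + 1) * (int l + 1) * rat_num \<delta>) = real (Suc l) ^ 2 * real_of_int (rat_num \<delta>)"
          by (simp add: power2_eq_square algebra_simps)
        show ?thesis unfolding rat_num_den(2)[of \<delta>] eq by (rule g) (use rat_num_den(1)[of \<delta>] in simp)
      qed
      finally show ?thesis by (simp add: of_bool_def)
    qed
    then have "\<sigma>11 ''R'' 0 = (\<Sum>l<m. of_bool (real (Suc l) ^ 2 * real_of_rat \<delta> \<le> 1))" unfolding 11(2) by (intro sum.cong) auto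
    also have "\<dots> = int (card ({..<m} \<inter> {l. real (Suc l) ^ 2 * real_of_rat \<delta> \<le> 1}))" by simp
    also have "{..<m} \<inter> {l. real (Suc l) ^ 2 * real_of_rat \<delta> \<le> 1} = {r. r < m \<and> real (Suc r) ^ 2 * real_of_rat \<delta> \<le> 1}" by auto
    finally show ?thesis by (simp add: R_def rate_def)
  qed
  have big: "\<sigma>12 ''big'' (int j) = of_bool (big j)" if "j < n" for j
  proof -
    have "rat_num \<epsilon> * rat_den (s j) < rat_num (s j) * rat_den \<epsilon> \<longleftrightarrow>
      real_of_int (rat_num \<epsilon> * rat_den (s j)) < real_of_int (rat_num (s j) * rat_den \<epsilon>)" by (simp only: of_int_less_iff)
    also have "\<dots> \<longleftrightarrow> real_of_rat \<epsilon> < real_of_rat (s j)"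
      unfolding rat_num_den(2)[of \<epsilon>] rat_num_den(2)[of "s j"] using rat_num_den(1)[of \<epsilon>] rat_num_den(1)[of "s j"]
      by (simp add: field_simps)
    finally show ?thesis using 12(2)[OF that] i0(4,5) that by (simp add: big_def)
  qed
  have beta: "real_of_int (\<sigma>13 ''beta'' (int p)) = lead p" if "p < m" for p
    using big i0(3) that by (simp add: 13(2)[OF that] lead_def)
  have "base \<sigma>13"
    unfolding base_def rv_def f using i0(1-3) Dspos S L cum Lm Ld 8(2) 9(2) H R big beta Dxpos X by auto
  then show ?thesis using run by blast
qed

end

text \<open>\<open>d\<close> times the negated flag of \<open>d < 0\<close> is its positive part;
  the excess of this over \<open>M\<close> is subtracted if there is one.\<close>

definition Clamp :: "aexp \<Rightarrow> aexp \<Rightarrow> aexp" where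
  "Clamp d M = Minus (Times d (Minus (Const 1) (Lt d (Const 0))))
    (Times (Minus (Times d (Minus (Const 1) (Lt d (Const 0)))) M)
      (Lt M (Times d (Minus (Const 1) (Lt d (Const 0))))))"

lemma aval_Clamp [simp]: "aval (Clamp d M) \<sigma> = min (max (aval d \<sigma>) 0) (aval M \<sigma>)"
  by (auto simp: Clamp_def min_def max_def)

lemma rds_Clamp [simp]: "rds (Clamp d M) = rds d \<union> rds M"
  by (auto simp: Clamp_def)

section \<open>Grid points and constraint vectors\<close>

text \<open>Grid points \<open>64 * q / 8 ^ h\<close> are stored times \<open>Ds * 8 ^ H\<close>,
  which makes them integral since \<open>h \<le> H\<close> and gives them the scale of
  \<open>8 ^ H\<close> times \<open>cum\<close>. The remainder \<open>qq\<close> is formed by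
  subtraction, as expressions have no modulus.\<close>

definition grid_code :: "com list" where
  "grid_code =
   [Asg ''Qm'' ''k'' (Const 1) (Plus (Times (V ''m'') (Get ''e8'' (V ''H''))) (Const 1)),
    Asg ''N'' ''k'' (Const 1) (Times (Plus (V ''H'') (Const 2)) (V ''Qm'')),
    Asg ''kk'' ''k'' (V ''N'') (Quot (V ''k'') (V ''Qm'')),
    Asg ''qq'' ''k'' (V ''N'') (Minus (V ''k'') (Times (V ''Qm'') (Get ''kk'' (V ''k'')))),
    Asg ''hh'' ''k'' (V ''N'') (Minus (Get ''kk'' (V ''k'')) (Lt (Const 0) (Get ''kk'' (V ''k'')))),
    Asg ''in'' ''k'' (V ''N'') (Minus (Const 1) (Lt (Times (V ''m'') (Get ''e8'' (Get ''hh'' (V ''k''))))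
      (Times (Const 64) (Get ''qq'' (V ''k''))))),
    Asg ''hd'' ''k'' (V ''N'') (Times (Get ''in'' (V ''k'')) (Lt (Get ''kk'' (V ''k'')) (Const 2))),
    Asg ''t1'' ''k'' (V ''N'') (Times (Times (Times (Const 64) (Get ''qq'' (V ''k''))) (V ''Ds''))
      (Get ''e8'' (Minus (V ''H'') (Get ''hh'' (V ''k''))))),
    Asg ''t2'' ''k'' (V ''N'') (Times (Lt (Const 0) (Get ''hh'' (V ''k'')))
      (Times (Times (Times (Const 64) (Times (Const 8) (Quot (Get ''qq'' (V ''k'')) (Const 8)))) (V ''Ds''))
      (Get ''e8'' (Minus (V ''H'') (Get ''hh'' (V ''k'')))))),
    Asg ''mu'' ''k'' (V ''N'') (Times (Times (Get ''in'' (V ''k'')) (Get ''pw'' (Get ''hh'' (V ''k'')))) (V ''R''))]"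

context rinst
begin

definition "level \<sigma> \<longleftrightarrow> \<sigma> ''N'' 0 = int N \<and> (\<forall>i<N. \<sigma> ''kk'' (int i) = int (kd i)) \<and>
  (\<forall>i<N. \<sigma> ''hd'' (int i) = of_bool (hard i)) \<and>
  (\<forall>i<N. rv \<sigma> ''t1'' i = real_of_int (\<sigma> ''Ds'' 0) * 8 ^ H * t1 i) \<and>
  (\<forall>i<N. rv \<sigma> ''t2'' i = real_of_int (\<sigma> ''Ds'' 0) * 8 ^ H * t2 i) \<and>
  (\<forall>i<N. rv \<sigma> ''mu'' i = of_bool (inr i) * 2 ^ ht i * real R)"

text \<open>Keeps the addresses \<open>ht i\<close> and \<open>H - ht i\<close> inside the tables of
  powers.\<close>

lemma ht_le: "i < N \<Longrightarrow> ht i \<le> H"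
proof -
  assume "i < N"
  then have "kd i < H + 2" unfolding kd_def N_def using Qpos by (simp add: less_mult_imp_div_less)
  then show ?thesis by (simp add: ht_def)
qed

lemma grid_code_runb:
  assumes e: "base \<sigma>" and Bd: "N \<le> Bd" "1 \<le> Bd"
  shows "\<exists>\<tau>. runb (blk grid_code) \<sigma> (10 * (15 * Bd + 1) + 1) \<tau> \<and> level \<tau> \<and>
    (\<forall>v. v \<notin> {''Qm'', ''N'', ''kk'', ''qq'', ''hh'', ''in'', ''hd'', ''t1'', ''t2'', ''mu'', ''k''} \<longrightarrow> \<tau> v = \<sigma> v)"
proof -
  define W where "W = {''Qm'', ''N'', ''kk'', ''qq'', ''hh'', ''in'', ''hd'', ''t1'', ''t2'', ''mu'', ''k''}"
  have i0: "\<sigma> ''m'' 0 = int m" "\<sigma> ''H'' 0 = int H" "\<sigma> ''R'' 0 = int R"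
    "\<And>k. k < m + 2 \<Longrightarrow> \<sigma> ''e8'' (int k) = 8 ^ k" "\<And>k. k < m + 2 \<Longrightarrow> \<sigma> ''pw'' (int k) = 2 ^ k"
    using e by (auto simp: base_def)
  obtain \<sigma>1 where 1: "runb (Asg ''Qm'' ''k'' (Const 1) (Plus (Times (V ''m'') (Get ''e8'' (V ''H''))) (Const 1))) \<sigma> (15 * Bd) \<sigma>1"
    "\<sigma>1 ''Qm'' 0 = int m * \<sigma> ''e8'' (\<sigma> ''H'' 0) + 1" "\<And>v. v \<notin> {''Qm'', ''k''} \<Longrightarrow> \<sigma>1 v = \<sigma> v"
    using Asg_runb_uniform[of "''Qm''" "''k''" "Plus (Times (V ''m'') (Get ''e8'' (V ''H''))) (Const 1)" "Const 1" \<sigma> 1 Bd] Bd i0(1) by auto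
  have Qm: "\<sigma>1 ''Qm'' 0 = int Q" using 1(2) i0(2) i0(4)[of H] H(2) by (simp add: Q_def)
  obtain \<sigma>2 where 2: "runb (Asg ''N'' ''k'' (Const 1) (Times (Plus (V ''H'') (Const 2)) (V ''Qm''))) \<sigma>1 (15 * Bd) \<sigma>2"
    "\<sigma>2 ''N'' 0 = (int H + 2) * int Q" "\<And>v. v \<notin> {''N'', ''k''} \<Longrightarrow> \<sigma>2 v = \<sigma>1 v"
    using Asg_runb_uniform[of "''N''" "''k''" "Times (Plus (V ''H'') (Const 2)) (V ''Qm'')" "Const 1" \<sigma>1 1 Bd] Bd i0(2) Qm 1(3) by auto
  have N0: "\<sigma>2 ''N'' 0 = int N" using 2(2) by (simp add: N_def algebra_simps)
  obtain \<sigma>3 where 3: "runb (Asg ''kk'' ''k'' (V ''N'') (Quot (V ''k'') (V ''Qm''))) \<sigma>2 (15 * Bd) \<sigma>3"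
    "\<And>i. i < N \<Longrightarrow> \<sigma>3 ''kk'' (int i) = int i div int Q" "\<And>v. v \<notin> {''kk'', ''k''} \<Longrightarrow> \<sigma>3 v = \<sigma>2 v"
    using Asg_runb_uniform[of "''kk''" "''k''" "Quot (V ''k'') (V ''Qm'')" "V ''N''" \<sigma>2 N Bd] Bd N0 Qm 2(3) by auto
  let ?e4 = "Minus (V ''k'') (Times (V ''Qm'') (Get ''kk'' (V ''k'')))"
  obtain \<sigma>4 where 4: "runb (Asg ''qq'' ''k'' (V ''N'') ?e4) \<sigma>3 (15 * Bd) \<sigma>4"
    "\<And>i. i < N \<Longrightarrow> \<sigma>4 ''qq'' (int i) = int i - int Q * \<sigma>3 ''kk'' (int i)" "\<And>v. v \<notin> {''qq'', ''k''} \<Longrightarrow> \<sigma>4 v = \<sigma>3 v"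
    using Asg_runb_uniform[of "''qq''" "''k''" ?e4 "V ''N''" \<sigma>3 N Bd] Bd N0 Qm 2(3) 3(3) by auto
  let ?e5 = "Minus (Get ''kk'' (V ''k'')) (Lt (Const 0) (Get ''kk'' (V ''k'')))"
  obtain \<sigma>5 where 5: "runb (Asg ''hh'' ''k'' (V ''N'') ?e5) \<sigma>4 (15 * Bd) \<sigma>5"
    "\<And>i. i < N \<Longrightarrow> \<sigma>5 ''hh'' (int i) = \<sigma>3 ''kk'' (int i) - of_bool (0 < \<sigma>3 ''kk'' (int i))" "\<And>v. v \<notin> {''hh'', ''k''} \<Longrightarrow> \<sigma>5 v = \<sigma>4 v"
    using Asg_runb_uniform[of "''hh''" "''k''" ?e5 "V ''N''" \<sigma>4 N Bd] Bd N0 3(3) 4(3) by (auto split del: if_split)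
  have s5: "\<sigma>5 ''m'' = \<sigma> ''m''" "\<sigma>5 ''e8'' = \<sigma> ''e8''" "\<sigma>5 ''pw'' = \<sigma> ''pw''" "\<sigma>5 ''qq'' = \<sigma>4 ''qq''" "\<sigma>5 ''N'' = \<sigma>2 ''N''"
    "\<sigma>5 ''kk'' = \<sigma>3 ''kk''" "\<sigma>5 ''Ds'' = \<sigma> ''Ds''" "\<sigma>5 ''H'' = \<sigma> ''H''" "\<sigma>5 ''R'' = \<sigma> ''R''"
    using 1(3) 2(3) 3(3) 4(3) 5(3) by auto
  let ?e6 = "Minus (Const 1) (Lt (Times (V ''m'') (Get ''e8'' (Get ''hh'' (V ''k'')))) (Times (Const 64) (Get ''qq'' (V ''k''))))"
  obtain \<sigma>6 where 6: "runb (Asg ''in'' ''k'' (V ''N'') ?e6) \<sigma>5 (15 * Bd) \<sigma>6"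
    "\<And>i. i < N \<Longrightarrow> \<sigma>6 ''in'' (int i) = 1 - of_bool (int m * \<sigma> ''e8'' (\<sigma>5 ''hh'' (int i)) < 64 * \<sigma>4 ''qq'' (int i))"
    "\<And>v. v \<notin> {''in'', ''k''} \<Longrightarrow> \<sigma>6 v = \<sigma>5 v"
    using Asg_runb_uniform[of "''in''" "''k''" ?e6 "V ''N''" \<sigma>5 N Bd] Bd N0 i0(1) s5 by (auto split del: if_split)
  let ?e7 = "Times (Get ''in'' (V ''k'')) (Lt (Get ''kk'' (V ''k'')) (Const 2))"
  obtain \<sigma>7 where 7: "runb (Asg ''hd'' ''k'' (V ''N'') ?e7) \<sigma>6 (15 * Bd) \<sigma>7"
    "\<And>i. i < N \<Longrightarrow> \<sigma>7 ''hd'' (int i) = \<sigma>6 ''in'' (int i) * of_bool (\<sigma>3 ''kk'' (int i) < 2)"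
    "\<And>v. v \<notin> {''hd'', ''k''} \<Longrightarrow> \<sigma>7 v = \<sigma>6 v"
    using Asg_runb_uniform[of "''hd''" "''k''" ?e7 "V ''N''" \<sigma>6 N Bd] Bd N0 s5 6(3) by (auto split del: if_split simp del: mult_eq_0_iff)
  have s7: "\<sigma>7 ''qq'' = \<sigma>4 ''qq''" "\<sigma>7 ''Ds'' = \<sigma> ''Ds''" "\<sigma>7 ''e8'' = \<sigma> ''e8''" "\<sigma>7 ''H'' = \<sigma> ''H''" "\<sigma>7 ''hh'' = \<sigma>5 ''hh''" "\<sigma>7 ''N'' = \<sigma>2 ''N''"
    "\<sigma>7 ''in'' = \<sigma>6 ''in''" "\<sigma>7 ''pw'' = \<sigma> ''pw''" "\<sigma>7 ''R'' = \<sigma> ''R''"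
    using s5 6(3) 7(3) by auto
  let ?E = "Get ''e8'' (Minus (V ''H'') (Get ''hh'' (V ''k'')))"
  let ?e8 = "Times (Times (Times (Const 64) (Get ''qq'' (V ''k''))) (V ''Ds'')) ?E"
  obtain \<sigma>8 where 8: "runb (Asg ''t1'' ''k'' (V ''N'') ?e8) \<sigma>7 (15 * Bd) \<sigma>8"
    "\<And>i. i < N \<Longrightarrow> \<sigma>8 ''t1'' (int i) = 64 * \<sigma>4 ''qq'' (int i) * \<sigma> ''Ds'' 0 * \<sigma> ''e8'' (int H - \<sigma>5 ''hh'' (int i))"
    "\<And>v. v \<notin> {''t1'', ''k''} \<Longrightarrow> \<sigma>8 v = \<sigma>7 v"
    using Asg_runb_uniform[of "''t1''" "''k''" ?e8 "V ''N''" \<sigma>7 N Bd] Bd N0 s7 i0(2) by (auto simp del: mult_eq_0_iff)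
  let ?e9 = "Times (Lt (Const 0) (Get ''hh'' (V ''k''))) (Times (Times (Times (Const 64) (Times (Const 8) (Quot (Get ''qq'' (V ''k'')) (Const 8)))) (V ''Ds'')) ?E)"
  obtain \<sigma>9 where 9: "runb (Asg ''t2'' ''k'' (V ''N'') ?e9) \<sigma>8 (15 * Bd) \<sigma>9"
    "\<And>i. i < N \<Longrightarrow> \<sigma>9 ''t2'' (int i) = of_bool (0 < \<sigma>5 ''hh'' (int i)) * (64 * (8 * (\<sigma>4 ''qq'' (int i) div 8)) * \<sigma> ''Ds'' 0 * \<sigma> ''e8'' (int H - \<sigma>5 ''hh'' (int i)))"
    "\<And>v. v \<notin> {''t2'', ''k''} \<Longrightarrow> \<sigma>9 v = \<sigma>8 v"
    using Asg_runb_uniform[of "''t2''" "''k''" ?e9 "V ''N''" \<sigma>8 N Bd] Bd N0 s7 i0(2) 8(3) by (auto split del: if_split simp del: mult_eq_0_iff)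
  let ?e10 = "Times (Times (Get ''in'' (V ''k'')) (Get ''pw'' (Get ''hh'' (V ''k'')))) (V ''R'')"
  obtain \<sigma>10 where 10: "runb (Asg ''mu'' ''k'' (V ''N'') ?e10) \<sigma>9 (15 * Bd) \<sigma>10"
    "\<And>i. i < N \<Longrightarrow> \<sigma>10 ''mu'' (int i) = \<sigma>6 ''in'' (int i) * \<sigma> ''pw'' (\<sigma>5 ''hh'' (int i)) * int R"
    "\<And>v. v \<notin> {''mu'', ''k''} \<Longrightarrow> \<sigma>10 v = \<sigma>9 v"
    using Asg_runb_uniform[of "''mu''" "''k''" ?e10 "V ''N''" \<sigma>9 N Bd] Bd N0 s7 i0(3) 8(3) 9(3) by (auto simp del: mult_eq_0_iff)
  have "runb (blk grid_code) \<sigma> (Suc (Suc (Suc (Suc (Suc (Suc (Suc (Suc (Suc (Suc 0))))))))) * (15 * Bd + 1) + 1) \<sigma>10"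
    unfolding grid_code_def
    by (intro blk_Cons_uniform[OF 1(1)] blk_Cons_uniform[OF 2(1)] blk_Cons_uniform[OF 3(1)] blk_Cons_uniform[OF 4(1)] blk_Cons_uniform[OF 5(1)]
        blk_Cons_uniform[OF 6(1)] blk_Cons_uniform[OF 7(1)] blk_Cons_uniform[OF 8(1)] blk_Cons_uniform[OF 9(1)] blk_Cons_uniform[OF 10(1)])
      (use blk_Nil in simp)
  then have run: "runb (blk grid_code) \<sigma> (10 * (15 * Bd + 1) + 1) \<sigma>10" by (simp add: numeral_eq_Suc)
  have fr: "\<sigma>10 v = \<sigma> v" if "v \<notin> W" for v
    using 1(3)[of v] 2(3)[of v] 3(3)[of v] 4(3)[of v] 5(3)[of v] 6(3)[of v] 7(3)[of v] 8(3)[of v] 9(3)[of v] 10(3)[of v] that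
    by (auto simp: W_def)
  have kk: "\<sigma>3 ''kk'' (int i) = int (kd i)" if "i < N" for i using 3(2)[OF that] by (simp add: kd_def zdiv_int)
  have qq: "\<sigma>4 ''qq'' (int i) = int (loc i)" if "i < N" for i
  proof -
    have "int i = int (Q * (i div Q) + i mod Q)" by simp
    then have "int i = int Q * int (kd i) + int (loc i)" unfolding kd_def loc_def of_nat_add of_nat_mult .
    then show ?thesis using 4(2)[OF that] unfolding kk[OF that] by linarith
  qed
  have hh: "\<sigma>5 ''hh'' (int i) = int (ht i)" if "i < N" for i
    using 5(2)[OF that] kk[OF that] by (cases "kd i") (auto simp: ht_def)
  have e8h: "\<sigma> ''e8'' (int (ht i)) = 8 ^ ht i" if "i < N" for i using i0(4)[of "ht i"] ht_le[OF that] H(2) by simp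
  have e2h: "\<sigma> ''pw'' (int (ht i)) = 2 ^ ht i" if "i < N" for i using i0(5)[of "ht i"] ht_le[OF that] H(2) by simp
  have e8d: "real_of_int (\<sigma> ''e8'' (int H - int (ht i))) = 8 ^ H / 8 ^ ht i" if "i < N" for i
  proof -
    have eq: "int H - int (ht i) = int (H - ht i)" using ht_le[OF that] by simp
    have "H - ht i < m + 2" using H(2) by simp
    then have "\<sigma> ''e8'' (int H - int (ht i)) = 8 ^ (H - ht i)" unfolding eq by (rule i0(4))
    then have "real_of_int (\<sigma> ''e8'' (int H - int (ht i))) = 8 ^ (H - ht i)" by (simp only: of_int_power of_int_numeral)
    also have "\<dots> = 8 ^ H / 8 ^ ht i" using ht_le[OF that] by (simp add: power_diff)
    finally show ?thesis .
  qed
  have inr: "\<sigma>6 ''in'' (int i) = of_bool (inr i)" if "i < N" for i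
  proof -
    have "(int m * 8 ^ ht i < 64 * int (loc i)) = (int (m * 8 ^ ht i) < int (64 * loc i))" by simp
    also have "\<dots> = (\<not> inr i)" unfolding of_nat_less_iff inr_def by (simp add: not_le)
    finally show ?thesis using 6(2)[OF that] by (simp add: qq[OF that] hh[OF that] e8h[OF that])
  qed
  have hd: "\<sigma>7 ''hd'' (int i) = of_bool (hard i)" if "i < N" for i
    using 7(2)[OF that] inr[OF that] kk[OF that] by (simp add: hard_def)
  have t1: "real_of_int (\<sigma>8 ''t1'' (int i)) = real_of_int (\<sigma> ''Ds'' 0) * 8 ^ H * t1 i" if "i < N" for i
    using 8(2)[OF that] e8d[OF that] by (simp add: qq[OF that] hh[OF that] t1_def)
  have t2: "real_of_int (\<sigma>9 ''t2'' (int i)) = real_of_int (\<sigma> ''Ds'' 0) * 8 ^ H * t2 i" if "i < N" for i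
  proof -
    have "int (loc i) div 8 = int (loc i div 8)" by (simp add: zdiv_int)
    then show ?thesis using 9(2)[OF that] e8d[OF that] by (simp add: qq[OF that] hh[OF that] t2_def)
  qed
  have mu: "real_of_int (\<sigma>10 ''mu'' (int i)) = of_bool (inr i) * 2 ^ ht i * real R" if "i < N" for i
    using 10(2)[OF that] by (simp add: hh[OF that] e2h[OF that] inr[OF that])
  have s10: "\<sigma>10 ''N'' = \<sigma>2 ''N''" "\<sigma>10 ''kk'' = \<sigma>3 ''kk''" "\<sigma>10 ''hd'' = \<sigma>7 ''hd''" "\<sigma>10 ''t1'' = \<sigma>8 ''t1''" "\<sigma>10 ''t2'' = \<sigma>9 ''t2''" "\<sigma>10 ''Ds'' = \<sigma> ''Ds''"
    using s5 s7 6(3) 7(3) 8(3) 9(3) 10(3) by auto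
  have lev: "level \<sigma>10" unfolding level_def rv_def s10 using N0 kk hd t1 t2 mu by simp
  have fr': "\<forall>v. v \<notin> W \<longrightarrow> \<sigma>10 v = \<sigma> v" using fr by blast
  show ?thesis unfolding W_def[symmetric] by (intro exI[of _ \<sigma>10] conjI run lev fr')
qed

end

text \<open>The index \<open>k = i * n + j\<close> pairs a constraint with a row; the value is
  \<open>clp\<close> of row \<open>j\<close> at a grid point of constraint \<open>i\<close>, scaled
  by \<open>Ds * 8 ^ H\<close>.\<close>

definition clip_at :: "string \<Rightarrow> aexp" where
  "clip_at t = Clamp (Minus (Get t (Quot (V ''k'') (V ''n''))) (Times (Get ''e8'' (V ''H''))
      (Get ''cum'' (Minus (V ''k'') (Times (V ''n'') (Quot (V ''k'') (V ''n'')))))))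
    (Times (Get ''e8'' (V ''H'')) (Get ''L'' (Minus (V ''k'') (Times (V ''n'') (Quot (V ''k'') (V ''n''))))))"

text \<open>The arithmetic form of \<open>sel\<close>, an equivalence of two truth values.\<close>

definition match_code :: aexp where
  "match_code = Plus (Times (Get ''big'' (Minus (V ''k'') (Times (V ''n'') (Quot (V ''k'') (V ''n'')))))
      (Lt (Get ''kk'' (Quot (V ''k'') (V ''n''))) (Const 1)))
    (Times (Minus (Const 1) (Get ''big'' (Minus (V ''k'') (Times (V ''n'') (Quot (V ''k'') (V ''n''))))))
      (Minus (Const 1) (Lt (Get ''kk'' (Quot (V ''k'') (V ''n''))) (Const 1))))"

definition constraint_code :: "com list" where
  "constraint_code =
   [Asg ''cf'' ''k'' (Times (V ''N'') (V ''n'')) (Times (Times (Times (Minus (clip_at ''t1'') (clip_at ''t2''))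
      (Quot (V ''Lm'') (Plus (Get ''L'' (Minus (V ''k'') (Times (V ''n'') (Quot (V ''k'') (V ''n'')))))
        (Lt (Get ''L'' (Minus (V ''k'') (Times (V ''n'') (Quot (V ''k'') (V ''n''))))) (Const 1)))))
      (Get ''S'' (Minus (V ''k'') (Times (V ''n'') (Quot (V ''k'') (V ''n'')))))) match_code),
    SumA ''bb'' ''k'' (Times (V ''N'') (V ''m'')) ''i'' (V ''n'') (Times (Times
      (Get ''cf'' (Plus (Times (Quot (V ''k'') (V ''m'')) (V ''n'')) (V ''i''))) (Get ''mu'' (Quot (V ''k'') (V ''m''))))
      (Get ''A'' (Plus (Times (V ''i'') (V ''m'')) (Minus (V ''k'') (Times (V ''m'') (Quot (V ''k'') (V ''m''))))))),
    Asg ''G'' ''k'' (Const 1) (Times (Times (Times (Const 2048) (Get ''e8'' (V ''H''))) (V ''Lm'')) (V ''Ds'')),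
    Asg ''D'' ''k'' (Const 1) (V ''Dx''),
    Asg ''Y'' ''k'' (V ''m'') (Get ''X'' (V ''k''))]"

lemma divmod_pair:
  assumes "(j::nat) < n"
  shows "int (i * n + j) div int n = int i" "int (i * n + j) - int n * (int (i * n + j) div int n) = int j"
proof -
  have "(i * n + j) div n = i" using assms by simp
  then show 1: "int (i * n + j) div int n = int i" by (metis zdiv_int)
  show "int (i * n + j) - int n * (int (i * n + j) div int n) = int j" unfolding 1 by simp
qed

lemma pair_less: "(i::nat) < N \<Longrightarrow> j < n \<Longrightarrow> i * n + j < N * n"
proof -
  assume "i < N" "j < n"
  then have "i * n + j < Suc i * n" by simp
  also have "\<dots> \<le> N * n" using \<open>i < N\<close> by (intro mult_le_mono1) simp
  finally show ?thesis .
qed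

lemma aval_clip_at:
  assumes "\<sigma> ''n'' 0 = int n" "j < n"
  shows "aval (clip_at t) (setc \<sigma> ''k'' (int (i * n + j))) =
    min (max (setc \<sigma> ''k'' (int (i * n + j)) t (int i) - \<sigma> ''e8'' (\<sigma> ''H'' 0) * \<sigma> ''cum'' (int j)) 0)
      (\<sigma> ''e8'' (\<sigma> ''H'' 0) * \<sigma> ''L'' (int j))"
  using divmod_pair[OF assms(2), of i] assms(1) unfolding clip_at_def by simp

lemma aval_match_code:
  assumes "\<sigma> ''n'' 0 = int n" "j < n" "\<sigma> ''big'' (int j) = of_bool B" "\<sigma> ''kk'' (int i) = int K"
  shows "aval match_code (setc \<sigma> ''k'' (int (i * n + j))) = of_bool (B \<longleftrightarrow> K = 0)"
  using divmod_pair[OF assms(2), of i] assms(1,3,4) unfolding match_code_def by simp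

context rinst
begin

lemma clp_scale: "0 \<le> c \<Longrightarrow> min (max (c * t - c * cum j) 0) (c * len j) = c * clp t j"
  unfolding clp_def right_diff_distrib[symmetric]
  by (metis max_mult_distrib_left min_mult_distrib_left mult_zero_right)

text \<open>For a row of length 0 both clipped lengths are 0, so the denominator 1 put in its place
  is harmless. Otherwise the scaled length is a positive integer and no replacement happens.\<close>

lemma coef:
  fixes E D0 Lm c :: real and l0 :: int
  assumes L: "real_of_int l0 = D0 * len j" and D0: "0 < D0" and j: "j < n"
  shows "(D0 * E * clp t j - D0 * E * clp t' j) * (Lm / real_of_int (l0 + of_bool (l0 < 1))) * (D0 * c) =
    D0 * E * Lm * ((clp t j - clp t' j) / len j) * c"
proof (cases "len j = 0")
  case True
  then have "clp t j = 0" "clp t' j = 0" using clp0[OF j, of t] clp0[OF j, of t'] clp_le[of t j] clp_le[of t' j] by auto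
  then show ?thesis by simp
next
  case False
  then have "0 < real_of_int l0" unfolding L using len0[OF j] D0 by simp
  then have "\<not> l0 < 1" by simp
  then have "real_of_int (l0 + of_bool (l0 < 1)) = D0 * len j" using L by simp
  then show ?thesis using False D0 by (simp add: field_simps)
qed

lemma constraint_code_runb:
  assumes e: "base \<sigma>" and l: "level \<sigma>" and Bd: "N * m * n \<le> Bd" "N * n \<le> Bd" "N * m \<le> Bd" "m \<le> Bd" "1 \<le> Bd"
  shows "\<exists>\<tau> Gr. runb (blk constraint_code) \<sigma> (5 * (15 * Bd + 1) + 1) \<tau> \<and> 0 < Gr \<and>
    walk.menv m N (\<lambda>i p. Gr * g i p) Gr hard lead (\<lambda>p. real_of_rat (x p)) \<tau> \<and>
    walk.at_point m (\<lambda>p. real_of_rat (x p)) \<tau>"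
proof -
  have i0: "\<sigma> ''n'' 0 = int n" "\<sigma> ''m'' 0 = int m" "\<sigma> ''N'' 0 = int N" "\<sigma> ''H'' 0 = int H"
    using e l by (auto simp: base_def level_def)
  have ii: "\<And>j p. j < n \<Longrightarrow> p < m \<Longrightarrow> \<sigma> ''A'' (int j * int m + int p) = int (A j p)"
    "0 < \<sigma> ''Ds'' 0" "\<And>j. j < n \<Longrightarrow> real_of_int (\<sigma> ''S'' (int j)) = real_of_int (\<sigma> ''Ds'' 0) * real_of_rat (s j)"
    "\<And>j. j < n \<Longrightarrow> real_of_int (\<sigma> ''L'' (int j)) = real_of_int (\<sigma> ''Ds'' 0) * len j"
    "\<And>j. j < n \<Longrightarrow> real_of_int (\<sigma> ''cum'' (int j)) = real_of_int (\<sigma> ''Ds'' 0) * cum j"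
    "0 < \<sigma> ''Lm'' 0" "\<And>j. j < n \<Longrightarrow> (\<sigma> ''L'' (int j) + of_bool (\<sigma> ''L'' (int j) < 1)) dvd \<sigma> ''Lm'' 0"
    "\<And>j. j < n \<Longrightarrow> \<sigma> ''big'' (int j) = of_bool (big j)" "\<And>p. p < m \<Longrightarrow> rv \<sigma> ''beta'' p = lead p" "0 < \<sigma> ''Dx'' 0"
    "\<And>p. p < m \<Longrightarrow> rv \<sigma> ''X'' p = real_of_int (\<sigma> ''Dx'' 0) * real_of_rat (x p)"
    using e by (auto simp: base_def rv_def)
  have il: "\<And>i. i < N \<Longrightarrow> \<sigma> ''kk'' (int i) = int (kd i)" "\<And>i. i < N \<Longrightarrow> \<sigma> ''hd'' (int i) = of_bool (hard i)"
    "\<And>i. i < N \<Longrightarrow> real_of_int (\<sigma> ''t1'' (int i)) = real_of_int (\<sigma> ''Ds'' 0) * 8 ^ H * t1 i"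
    "\<And>i. i < N \<Longrightarrow> real_of_int (\<sigma> ''t2'' (int i)) = real_of_int (\<sigma> ''Ds'' 0) * 8 ^ H * t2 i"
    "\<And>i. i < N \<Longrightarrow> real_of_int (\<sigma> ''mu'' (int i)) = of_bool (inr i) * 2 ^ ht i * real R"
    using l by (auto simp: level_def rv_def)
  have e8: "\<sigma> ''e8'' (\<sigma> ''H'' 0) = 8 ^ H" using e H(2) by (simp add: base_def)
  define D0 where "D0 = real_of_int (\<sigma> ''Ds'' 0)"
  define Lr where "Lr = real_of_int (\<sigma> ''Lm'' 0)"
  have D0: "0 < D0" and Lr: "0 < Lr" using ii(2,6) by (auto simp: D0_def Lr_def)
  define e1 where "e1 = Times (Times (Times (Minus (clip_at ''t1'') (clip_at ''t2''))
      (Quot (V ''Lm'') (Plus (Get ''L'' (Minus (V ''k'') (Times (V ''n'') (Quot (V ''k'') (V ''n'')))))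
        (Lt (Get ''L'' (Minus (V ''k'') (Times (V ''n'') (Quot (V ''k'') (V ''n''))))) (Const 1)))))
      (Get ''S'' (Minus (V ''k'') (Times (V ''n'') (Quot (V ''k'') (V ''n'')))))) match_code"
  have rds1: "''cf'' \<notin> rds e1" by (simp add: e1_def clip_at_def match_code_def)
  have cf: "real_of_int (aval e1 (setc \<sigma> ''k'' (int (i * n + j)))) =
      D0 * 8 ^ H * Lr * ((clp (t1 i) j - clp (t2 i) j) / len j) * real_of_rat (s j) * of_bool (sel i j)"
    if i: "i < N" and j: "j < n" for i j
  proof -
    let ?l = "\<sigma> ''L'' (int j) + of_bool (\<sigma> ''L'' (int j) < 1)"
    have q: "real_of_int (\<sigma> ''Lm'' 0 div ?l) = Lr / real_of_int ?l"
      unfolding Lr_def using ii(7)[OF j] by (rule real_of_int_div)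
    have sc: "min (max (D0 * 8 ^ H * t - 8 ^ H * (D0 * cum j)) 0) (8 ^ H * (D0 * len j)) = D0 * 8 ^ H * clp t j" for t
      using clp_scale[of "D0 * 8 ^ H" t j] D0 by (simp add: mult_ac)
    have c: "real_of_int (aval (clip_at ''t1'') (setc \<sigma> ''k'' (int (i * n + j)))) = D0 * 8 ^ H * clp (t1 i) j"
      "real_of_int (aval (clip_at ''t2'') (setc \<sigma> ''k'' (int (i * n + j)))) = D0 * 8 ^ H * clp (t2 i) j"
      unfolding aval_clip_at[of \<sigma>, OF i0(1) j]
      by (simp_all add: e8 il(3,4)[OF i] ii(4,5)[OF j] of_int_min of_int_max D0_def[symmetric] sc)
    have "real_of_int (aval e1 (setc \<sigma> ''k'' (int (i * n + j)))) =
       (D0 * 8 ^ H * clp (t1 i) j - D0 * 8 ^ H * clp (t2 i) j) * (Lr / real_of_int ?l) * (D0 * real_of_rat (s j)) * of_bool (sel i j)"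
      unfolding e1_def aval.simps of_int_mult of_int_diff c aval_match_code[of \<sigma>, OF i0(1) j ii(8)[OF j] il(1)[OF i]]
      using divmod_pair[OF j, of i] by (simp add: i0(1) q[simplified] ii(3)[OF j] D0_def[symmetric] sel_def del: mult_eq_0_iff)
    also have "(D0 * 8 ^ H * clp (t1 i) j - D0 * 8 ^ H * clp (t2 i) j) * (Lr / real_of_int ?l) * (D0 * real_of_rat (s j)) =
       D0 * 8 ^ H * Lr * ((clp (t1 i) j - clp (t2 i) j) / len j) * real_of_rat (s j)"
      by (rule coef) (use ii(4)[OF j] D0 j in \<open>auto simp: D0_def\<close>)
    finally show ?thesis .
  qed
  obtain \<sigma>1 where 1: "runb (Asg ''cf'' ''k'' (Times (V ''N'') (V ''n'')) e1) \<sigma> (15 * Bd) \<sigma>1"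
    "\<And>k. k < N * n \<Longrightarrow> \<sigma>1 ''cf'' (int k) = aval e1 (setc \<sigma> ''k'' (int k))" "\<And>v. v \<notin> {''cf'', ''k''} \<Longrightarrow> \<sigma>1 v = \<sigma> v"
    using Asg_runb_uniform[of "''cf''" "''k''" e1 "Times (V ''N'') (V ''n'')" \<sigma> "N * n" Bd] rds1 Bd(2,5) i0(1,3) by auto
  let ?e2 = "Times (Times (Get ''cf'' (Plus (Times (Quot (V ''k'') (V ''m'')) (V ''n'')) (V ''i''))) (Get ''mu'' (Quot (V ''k'') (V ''m''))))
      (Get ''A'' (Plus (Times (V ''i'') (V ''m'')) (Minus (V ''k'') (Times (V ''m'') (Quot (V ''k'') (V ''m''))))))"
  obtain \<sigma>2 where 2: "runb (SumA ''bb'' ''k'' (Times (V ''N'') (V ''m'')) ''i'' (V ''n'') ?e2) \<sigma>1 (15 * Bd) \<sigma>2"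
    "\<And>k. k < N * m \<Longrightarrow> \<sigma>2 ''bb'' (int k) = (\<Sum>l<n. \<sigma>1 ''cf'' (int k div int m * int n + int l) * \<sigma> ''mu'' (int k div int m) *
       \<sigma> ''A'' (int l * int m + (int k - int m * (int k div int m))))"
    "\<And>v. v \<notin> {''bb'', ''k'', ''i''} \<Longrightarrow> \<sigma>2 v = \<sigma>1 v"
    using SumA_runb_uniform[of "''bb''" "''k''" "''i''" ?e2 "Times (V ''N'') (V ''m'')" "V ''n''" \<sigma>1 "N * m" n Bd] Bd i0 1(3)
    by (auto simp: mult_ac)
  let ?e3 = "Times (Times (Times (Const 2048) (Get ''e8'' (V ''H''))) (V ''Lm'')) (V ''Ds'')"
  obtain \<sigma>3 where 3: "runb (Asg ''G'' ''k'' (Const 1) ?e3) \<sigma>2 (15 * Bd) \<sigma>3"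
    "\<sigma>3 ''G'' 0 = 2048 * 8 ^ H * \<sigma> ''Lm'' 0 * \<sigma> ''Ds'' 0" "\<And>v. v \<notin> {''G'', ''k''} \<Longrightarrow> \<sigma>3 v = \<sigma>2 v"
    using Asg_runb_uniform[of "''G''" "''k''" ?e3 "Const 1" \<sigma>2 1 Bd] Bd e8 1(3) 2(3) by auto
  obtain \<sigma>4 where 4: "runb (Asg ''D'' ''k'' (Const 1) (V ''Dx'')) \<sigma>3 (15 * Bd) \<sigma>4"
    "\<sigma>4 ''D'' 0 = \<sigma> ''Dx'' 0" "\<And>v. v \<notin> {''D'', ''k''} \<Longrightarrow> \<sigma>4 v = \<sigma>3 v"
    using Asg_runb_uniform[of "''D''" "''k''" "V ''Dx''" "Const 1" \<sigma>3 1 Bd] Bd 1(3) 2(3) 3(3) by auto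
  obtain \<sigma>5 where 5: "runb (Asg ''Y'' ''k'' (V ''m'') (Get ''X'' (V ''k''))) \<sigma>4 (15 * Bd) \<sigma>5"
    "\<And>p. p < m \<Longrightarrow> \<sigma>5 ''Y'' (int p) = \<sigma> ''X'' (int p)" "\<And>v. v \<notin> {''Y'', ''k''} \<Longrightarrow> \<sigma>5 v = \<sigma>4 v"
    using Asg_runb_uniform[of "''Y''" "''k''" "Get ''X'' (V ''k'')" "V ''m''" \<sigma>4 m Bd] Bd i0 1(3) 2(3) 3(3) 4(3) by auto
  have "runb (blk constraint_code) \<sigma> (Suc (Suc (Suc (Suc (Suc 0)))) * (15 * Bd + 1) + 1) \<sigma>5"
    unfolding constraint_code_def e1_def[symmetric]
    by (intro blk_Cons_uniform[OF 1(1)] blk_Cons_uniform[OF 2(1)] blk_Cons_uniform[OF 3(1)] blk_Cons_uniform[OF 4(1)] blk_Cons_uniform[OF 5(1)])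
      (use blk_Nil in simp)
  then have run: "runb (blk constraint_code) \<sigma> (5 * (15 * Bd + 1) + 1) \<sigma>5" by (simp add: numeral_eq_Suc)
  \<comment> \<open>\<open>2048\<close> clears the normalisation in \<open>g\<close>,
    \<open>8 ^ H\<close> the grid points, \<open>Lm\<close> the divisions by row lengths and
    \<open>Ds\<close> the weights. One factor \<open>Ds\<close> suffices, as that of the clipped
    lengths cancels against that of \<open>L\<close>.\<close>
  define Gr where "Gr = 2048 * 8 ^ H * Lr * D0"
  have Gr: "0 < Gr" using D0 Lr by (simp add: Gr_def)
  interpret W: walk m N "\<lambda>i p. Gr * g i p" Gr hard lead "\<lambda>p. real_of_rat (x p)" by (rule walk_scaled[OF Gr])
  have s5: "\<sigma>5 ''m'' = \<sigma> ''m''" "\<sigma>5 ''N'' = \<sigma> ''N''" "\<sigma>5 ''G'' = \<sigma>3 ''G''" "\<sigma>5 ''bb'' = \<sigma>2 ''bb''" "\<sigma>5 ''hd'' = \<sigma> ''hd''"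
     "\<sigma>5 ''beta'' = \<sigma> ''beta''" "\<sigma>5 ''Dx'' = \<sigma> ''Dx''" "\<sigma>5 ''X'' = \<sigma> ''X''" "\<sigma>5 ''D'' = \<sigma>4 ''D''"
    using 1(3) 2(3) 3(3) 4(3) 5(3) by auto
  have bb: "real_of_int (\<sigma>2 ''bb'' (int i * int m + int p)) = Gr * g i p" if i: "i < N" and p: "p < m" for i p
  proof -
    have ix: "int i * int m + int p = int (i * m + p)" by simp
    have "real_of_int (\<sigma>2 ''bb'' (int i * int m + int p)) =
      (\<Sum>l<n. real_of_int (aval e1 (setc \<sigma> ''k'' (int (i * n + l)))) * (of_bool (inr i) * 2 ^ ht i * real R) * real (A l p))"
      unfolding ix 2(2)[OF pair_less[OF i p]] unfolding divmod_pair(2)[OF p] unfolding divmod_pair(1)[OF p] of_int_sum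
    proof (rule sum.cong[OF refl])
      fix l assume "l \<in> {..<n}"
      then have l: "l < n" by simp
      have iy: "int i * int n + int l = int (i * n + l)" by simp
      show "real_of_int (\<sigma>1 ''cf'' (int i * int n + int l) * \<sigma> ''mu'' (int i) * \<sigma> ''A'' (int l * int m + int p)) =
        real_of_int (aval e1 (setc \<sigma> ''k'' (int (i * n + l)))) * (of_bool (inr i) * 2 ^ ht i * real R) * real (A l p)"
        unfolding iy 1(2)[OF pair_less[OF i l]] ii(1)[OF l p] of_int_mult il(5)[OF i] by simp
    qed
    also have "\<dots> = (\<Sum>l<n. Gr * (of_bool (inr i) * 2 ^ ht i * real R / 2048) *
        (of_bool (sel i l) * ((clp (t1 i) l - clp (t2 i) l) / len l) * wt l p))"
    proof (rule sum.cong[OF refl])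
      fix l assume "l \<in> {..<n}"
      then have l: "l < n" by simp
      show "real_of_int (aval e1 (setc \<sigma> ''k'' (int (i * n + l)))) * (of_bool (inr i) * 2 ^ ht i * real R) * real (A l p) =
        Gr * (of_bool (inr i) * 2 ^ ht i * real R / 2048) *
        (of_bool (sel i l) * ((clp (t1 i) l - clp (t2 i) l) / len l) * wt l p)"
        unfolding cf[OF i l] Gr_def wt_def by simp
    qed
    also have "\<dots> = Gr * g i p" unfolding g_def piece_def flow_diff by (simp add: sum_distrib_left mult.assoc)
    finally show ?thesis .
  qed
  have "W.menv \<sigma>5" unfolding W.menv_def rv_def s5
    using i0 il(2) ii(9,10,11) bb 3(2) by (auto simp: rv_def Gr_def D0_def Lr_def)
  moreover have "W.at_point (\<lambda>p. real_of_rat (x p)) \<sigma>5" unfolding W.at_point_def rv_def s5 4(2)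
    using ii(10,11) 5(2) by (auto simp: rv_def)
  ultimately show ?thesis using run Gr by blast
qed

end

section \<open>The whole program\<close>

definition rounding_code :: com where
  "rounding_code = blk (scaling_code @ grid_code @ constraint_code @
    [For ''r'' (Times (Const 4) (Times (V ''m'') (V ''m''))) body_code,
     Asg ''y_num'' ''k'' (V ''m'') (Get ''Y'' (V ''k'')),
     Asg ''y_den'' ''k'' (V ''m'') (V ''D'')])"

text \<open>Covers the lengths of all nested array loops; the first summand is for
  \<open>N * m * n\<close>, the largest of them.\<close>

definition loop_bound :: "nat \<Rightarrow> nat" where
  "loop_bound X = (X + 2) * (8 * X * X + 1) * X * X + (X + 2) * (X + 2)"

definition step_bound :: "nat \<Rightarrow> nat" where
  "step_bound X = (13 * (15 * loop_bound X + 1) + 1) + ((10 * (15 * loop_bound X + 1) + 1) + ((5 * (15 * loop_bound X + 1) + 1) +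
    (1 + (4 * X * X * (body_cost X (loop_bound X) + 3) + 3) + (2 * (15 * loop_bound X + 1) + 1))))"

lemma body_cost_mono: "m \<le> X \<Longrightarrow> body_cost m B \<le> body_cost X B"
  unfolding body_cost_def try_cost_def by (intro add_mono mult_le_mono power_mono order_refl) auto

lemma good_rounding_cong:
  assumes "\<And>p. p < m \<Longrightarrow> y p = y' p"
  shows "good_rounding C n m A s x \<delta> \<epsilon> y = good_rounding C n m A s x \<delta> \<epsilon> y'"
proof -
  have "{p. p < m \<and> y p \<in> {0, 1}} = {p. p < m \<and> y' p \<in> {0, 1}}"
    using assms by (intro Collect_cong conj_cong refl) simp
  moreover have "(\<Sum>p<m. y p) = (\<Sum>p<m. y' p)" using assms by (intro sum.cong) auto
  moreover have "(\<Sum>p<m. real (A j p) * (y p - x p)) = (\<Sum>p<m. real (A j p) * (y' p - x p))" for j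
    using assms by (intro sum.cong) auto
  ultimately show ?thesis unfolding good_rounding_def using assms by auto
qed

context rinst
begin

lemma base_cong: "(\<And>v. v \<in> {''n'', ''m'', ''A'', ''Ds'', ''S'', ''L'', ''cum'', ''Lm'', ''e8'', ''pw'', ''H'', ''R'', ''big'', ''beta'', ''Dx'', ''X''} \<Longrightarrow> \<tau> v = \<sigma> v) \<Longrightarrow> base \<tau> = base \<sigma>"
  by (simp add: base_def rv_def)

text \<open>The levels stop at the first power of 8 that reaches \<open>m\<close>, so
  \<open>8 ^ H \<le> 8 * m\<close> and the number of constraints is polynomial.\<close>

lemma N_le: "N \<le> (m + 2) * (8 * m * m + 1)"
proof -
  have "m * 8 ^ H \<le> m * (8 * m)" using H(3) by (rule mult_le_mono2)
  then have "Q \<le> 8 * m * m + 1" by (simp add: Q_def mult_ac)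
  then show ?thesis unfolding N_def using H(2) by (intro mult_le_mono) auto
qed

lemma loop_bound:
  assumes X: "m \<le> X" "n \<le> X"
  shows "n * m \<le> loop_bound X" "n \<le> loop_bound X" "m \<le> loop_bound X" "n * n \<le> loop_bound X"
    "(m + 2) * (m + 2) \<le> loop_bound X" "1 \<le> loop_bound X" "N * m * n \<le> loop_bound X"
    "N * n \<le> loop_bound X" "N * m \<le> loop_bound X" "N \<le> loop_bound X"
proof -
  let ?P = "(X + 2) * (8 * X * X + 1)"
  have X1: "1 \<le> X" using n0 X by simp
  have sq: "a * b \<le> loop_bound X" if "a \<le> X + 2" "b \<le> X + 2" for a b
    using mult_le_mono[OF that] unfolding loop_bound_def by (rule trans_le_add2)
  have N: "N \<le> ?P" using N_le X by (intro order_trans[OF N_le] mult_le_mono add_mono) auto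
  have cube: "N * a * b \<le> loop_bound X" if "a \<le> X" "b \<le> X" for a b
    using mult_le_mono[OF mult_le_mono[OF N that(1)] that(2)] unfolding loop_bound_def by (rule trans_le_add1)
  show "n * m \<le> loop_bound X" "n * n \<le> loop_bound X" "(m + 2) * (m + 2) \<le> loop_bound X"
    using X by (intro sq; simp)+
  show "n \<le> loop_bound X" "m \<le> loop_bound X" "1 \<le> loop_bound X"
    using sq[of n 1] sq[of m 1] sq[of 1 1] X X1 by auto
  show "N * m * n \<le> loop_bound X" "N * n \<le> loop_bound X" "N * m \<le> loop_bound X" "N \<le> loop_bound X"
    using cube[of m n] cube[of n 1] cube[of m 1] cube[of 1 1] X X1 by auto
qed

lemma rounding_code_runb:
  assumes e: "input \<sigma>" and X: "m \<le> X" "n \<le> X"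
  shows "\<exists>\<tau>. runb rounding_code \<sigma> (step_bound X) \<tau> \<and> well_formed_output m \<tau> \<and>
    good_rounding 100000 n m A (\<lambda>i. real_of_rat (s i)) (\<lambda>p. real_of_rat (x p)) (real_of_rat \<delta>) (real_of_rat \<epsilon>) (output_vector \<tau>)"
proof -
  let ?B = "loop_bound X" and ?x = "\<lambda>p. real_of_rat (x p)"
  note B = loop_bound[OF X]
  obtain \<sigma>1 where 1: "runb (blk scaling_code) \<sigma> (13 * (15 * ?B + 1) + 1) \<sigma>1" "base \<sigma>1"
    using scaling_code_runb[OF e B(1-6)] by blast
  obtain \<sigma>2 where 2: "runb (blk grid_code) \<sigma>1 (10 * (15 * ?B + 1) + 1) \<sigma>2" "level \<sigma>2"
    and g2: "\<forall>v. v \<notin> {''Qm'', ''N'', ''kk'', ''qq'', ''hh'', ''in'', ''hd'', ''t1'', ''t2'', ''mu'', ''k''} \<longrightarrow> \<sigma>2 v = \<sigma>1 v"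
    using grid_code_runb[OF 1(2) B(10,6)] by (elim exE conjE) (rule that; assumption)
  have "base \<sigma>2 = base \<sigma>1" by (rule base_cong, rule g2[rule_format]) auto
  then have b2: "base \<sigma>2" using 1(2) by simp
  obtain \<sigma>3 Gr where 3: "runb (blk constraint_code) \<sigma>2 (5 * (15 * ?B + 1) + 1) \<sigma>3" "0 < Gr"
      "walk.menv m N (\<lambda>i p. Gr * g i p) Gr hard lead ?x \<sigma>3" "walk.at_point m ?x \<sigma>3"
    using constraint_code_runb[OF b2 2(2) B(7,8,9,3,6)] by (elim exE conjE) (rule that; assumption)
  interpret W: walk m N "\<lambda>i p. Gr * g i p" Gr hard lead ?x by (rule walk_scaled[OF 3(2)])
  define I where "I k \<tau> \<longleftrightarrow> (\<exists>y. W.menv \<tau> \<and> W.at_point y \<tau> \<and> W.winv k y)" for k \<tau>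
  have "\<exists>\<tau>. runb (For ''r'' (Times (Const 4) (Times (V ''m'') (V ''m''))) body_code) \<sigma>3 (4 * m\<^sup>2 * (body_cost m ?B + 3) + 3) \<tau> \<and>
    I (4 * m\<^sup>2) \<tau> \<and> \<tau> ''r'' 0 = int (4 * m\<^sup>2)"
  proof (rule For_runb)
    show "I 0 \<sigma>3" using 3(3,4) W.winv_start unfolding I_def by blast
  next
    fix k \<tau> assume k: "I k \<tau>" "\<tau> ''r'' 0 = int k"
    then obtain y where y: "W.menv \<tau>" "W.at_point y \<tau>" "W.winv k y" unfolding I_def by blast
    obtain \<rho> y' where r: "runb body_code \<tau> (body_cost m ?B) \<rho>" "W.menv \<rho>" "W.at_point y' \<rho>" "W.winv (Suc k) y'" "\<rho> ''r'' = \<tau> ''r''"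
      using W.body_code_runb[OF y total_scaled B(3,9,10,6)] by (elim exE conjE) (rule that; assumption)
    have "I (Suc k) \<rho>" unfolding I_def using r(2-4) by blast
    then show "\<exists>\<rho>. runb body_code \<tau> (body_cost m ?B) \<rho> \<and> I (Suc k) \<rho> \<and> \<rho> ''r'' 0 = int k"
      using r(1,5) k(2) by (intro exI[of _ \<rho>]) simp
  next
    fix k \<tau> z assume "I k \<tau>"
    moreover have "W.menv (setc \<tau> ''r'' z) = W.menv \<tau>" by (rule W.menv_cong) auto
    moreover have "W.at_point y (setc \<tau> ''r'' z) = W.at_point y \<tau>" for y by (rule W.at_point_cong) auto
    ultimately show "I k (setc \<tau> ''r'' z)" unfolding I_def by simp
  next
    fix k \<tau> assume "I k \<tau>"
    then show "aval (Times (Const 4) (Times (V ''m'') (V ''m''))) \<tau> = int (4 * m\<^sup>2)"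
      unfolding I_def by (auto simp: W.menv_def power2_eq_square)
  qed
  then obtain \<sigma>4 where 4: "runb (For ''r'' (Times (Const 4) (Times (V ''m'') (V ''m''))) body_code) \<sigma>3 (4 * m\<^sup>2 * (body_cost m ?B + 3) + 3) \<sigma>4"
    "I (4 * m\<^sup>2) \<sigma>4" by blast
  then obtain y where y: "W.menv \<sigma>4" "W.at_point y \<sigma>4" "W.winv (4 * m\<^sup>2) y" unfolding I_def by blast
  have m0: "\<sigma>4 ''m'' 0 = int m" using y(1) by (simp add: W.menv_def)
  obtain \<sigma>5 where 5: "runb (Asg ''y_num'' ''k'' (V ''m'') (Get ''Y'' (V ''k''))) \<sigma>4 (15 * ?B) \<sigma>5"
    "\<And>p. p < m \<Longrightarrow> \<sigma>5 ''y_num'' (int p) = \<sigma>4 ''Y'' (int p)" "\<And>v. v \<notin> {''y_num'', ''k''} \<Longrightarrow> \<sigma>5 v = \<sigma>4 v"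
    using Asg_runb_uniform[of "''y_num''" "''k''" "Get ''Y'' (V ''k'')" "V ''m''" \<sigma>4 m ?B] B(3,6) m0 by auto
  obtain \<sigma>6 where 6: "runb (Asg ''y_den'' ''k'' (V ''m'') (V ''D'')) \<sigma>5 (15 * ?B) \<sigma>6"
    "\<And>p. p < m \<Longrightarrow> \<sigma>6 ''y_den'' (int p) = \<sigma>4 ''D'' 0" "\<And>v. v \<notin> {''y_den'', ''k''} \<Longrightarrow> \<sigma>6 v = \<sigma>5 v"
    using Asg_runb_uniform[of "''y_den''" "''k''" "V ''D''" "V ''m''" \<sigma>5 m ?B] B(3,6) m0 5(3) by auto
  have tl: "runb (blk [Asg ''y_num'' ''k'' (V ''m'') (Get ''Y'' (V ''k'')), Asg ''y_den'' ''k'' (V ''m'') (V ''D'')]) \<sigma>4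
      (Suc (Suc 0) * (15 * ?B + 1) + 1) \<sigma>6"
    by (intro blk_Cons_uniform[OF 5(1)] blk_Cons_uniform[OF 6(1)]) (use blk_Nil in simp)
  have "4 * m\<^sup>2 * (body_cost m ?B + 3) + 3 \<le> 4 * X * X * (body_cost X ?B + 3) + 3"
    unfolding power2_eq_square mult.assoc[symmetric] by (intro add_mono mult_le_mono body_cost_mono X order_refl)
  note 4 = runb_mono[OF 4(1) this]
  have run: "runb rounding_code \<sigma> (step_bound X) \<sigma>6"
    unfolding rounding_code_def step_bound_def
    using blk_append[OF 1(1) blk_append[OF 2(1) blk_append[OF 3(1) blk_Cons[OF 4 tl]]]]
    by (rule runb_mono) simp
  have D0: "0 < \<sigma>4 ''D'' 0" and Y: "\<And>p. p < m \<Longrightarrow> real_of_int (\<sigma>4 ''Y'' (int p)) = real_of_int (\<sigma>4 ''D'' 0) * y p"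
    using y(2) by (auto simp: W.at_point_def rv_def)
  have out: "output_vector \<sigma>6 p = y p" if "p < m" for p
    using 5(2)[OF that] 6(2)[OF that] 6(3)[of "''y_num''"] Y[OF that] D0 by (simp add: output_vector_def)
  have "well_formed_output m \<sigma>6" using 6(2) D0 by (simp add: well_formed_output_def)
  moreover have "good_rounding 100000 n m A (\<lambda>i. real_of_rat (s i)) ?x (real_of_rat \<delta>) (real_of_rat \<epsilon>) y"
    by (rule good_rounding_walk[OF 3(2) y(3)])
  ultimately show ?thesis using run good_rounding_cong[of m "output_vector \<sigma>6" y, OF out] by blast
qed

end

section \<open>Ranks of the program variables\<close>

text \<open>Variables that feed back into each other share a rank: the power iteration has rank 8,
  with the constraints below it as coefficients, and the point of the walk with its denominator has
  rank 9, with the direction as coefficient. Flags sit at rank 1, since a product even of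
  comparisons needs a target above rank 0. Unlisted names, among them the input and the counters,
  have rank 0.\<close>

definition rank_table :: "(string \<times> nat) list" where
  "rank_table = [(''Ds'', 1), (''Dx'', 1), (''e8'', 1), (''pw'', 1), (''H'', 1), (''R'', 1), (''big'', 1), (''al'', 1),
    (''kk'', 1), (''hh'', 1), (''in'', 1), (''gd'', 1), (''ng'', 1), (''fl'', 1),
    (''S'', 2), (''X'', 2), (''beta'', 2), (''na'', 2), (''Qm'', 2), (''hd'', 2),
    (''L'', 3), (''cum'', 3), (''N'', 3), (''sb'', 3), (''qq'', 3), (''tg'', 3),
    (''Lm'', 4), (''bp'', 4), (''kf'', 4), (''mu'', 4), (''kq'', 5), (''kp'', 5), (''t1'', 5), (''t2'', 5),
    (''cf'', 6), (''G'', 6), (''bb'', 7),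
    (''v'', 8), (''v2'', 8), (''v3'', 8), (''sm'', 8), (''pp'', 8), (''dv'', 8), (''rr'', 8), (''u'', 8), (''u2'', 8),
    (''us'', 8), (''au'', 8), (''du'', 8), (''W'', 8), (''den'', 8), (''den2'', 8),
    (''Y'', 9), (''Y2'', 9), (''D'', 9), (''D2'', 9), (''Z'', 9), (''dz'', 9), (''e1'', 9), (''e2'', 9), (''rm'', 9),
    (''num'', 9), (''num2'', 9), (''qv'', 9), (''nv'', 9), (''y_num'', 9), (''y_den'', 9)]"

definition rank :: "string \<Rightarrow> nat" where
  "rank v = (case map_of rank_table v of None \<Rightarrow> 0 | Some r \<Rightarrow> r)"

lemma rank_le: "rank v \<le> 9"
proof (cases "map_of rank_table v")
  case (Some r)
  then have "(v, r) \<in> set rank_table" by (rule map_of_SomeD)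
  then have "r \<in> snd ` set rank_table" by force
  then have "r \<le> 9" unfolding rank_table_def by auto
  then show ?thesis using Some by (simp add: rank_def)
qed (simp add: rank_def)

lemma rank_simps:
  "rank ''n'' = 0" "rank ''m'' = 0" "rank ''A'' = 0" "rank ''s_num'' = 0" "rank ''s_den'' = 0" "rank ''x_num'' = 0" "rank ''x_den'' = 0"
  "rank ''delta_num'' = 0" "rank ''delta_den'' = 0" "rank ''eps_num'' = 0" "rank ''eps_den'' = 0"
  "rank ''k'' = 0" "rank ''i'' = 0" "rank ''t'' = 0" "rank ''w'' = 0" "rank ''r'' = 0"
  "rank ''Ds'' = 1" "rank ''Dx'' = 1" "rank ''e8'' = 1" "rank ''pw'' = 1" "rank ''H'' = 1" "rank ''R'' = 1" "rank ''big'' = 1" "rank ''al'' = 1"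
  "rank ''kk'' = 1" "rank ''hh'' = 1" "rank ''in'' = 1" "rank ''gd'' = 1" "rank ''ng'' = 1" "rank ''fl'' = 1"
  "rank ''S'' = 2" "rank ''X'' = 2" "rank ''beta'' = 2" "rank ''na'' = 2" "rank ''Qm'' = 2" "rank ''hd'' = 2"
  "rank ''L'' = 3" "rank ''cum'' = 3" "rank ''N'' = 3" "rank ''sb'' = 3" "rank ''qq'' = 3" "rank ''tg'' = 3"
  "rank ''Lm'' = 4" "rank ''bp'' = 4" "rank ''kf'' = 4" "rank ''mu'' = 4" "rank ''kq'' = 5" "rank ''kp'' = 5" "rank ''t1'' = 5" "rank ''t2'' = 5"
  "rank ''cf'' = 6" "rank ''G'' = 6" "rank ''bb'' = 7"
  "rank ''v'' = 8" "rank ''v2'' = 8" "rank ''v3'' = 8" "rank ''sm'' = 8" "rank ''pp'' = 8" "rank ''dv'' = 8" "rank ''rr'' = 8" "rank ''u'' = 8"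
  "rank ''u2'' = 8" "rank ''us'' = 8" "rank ''au'' = 8" "rank ''du'' = 8" "rank ''W'' = 8" "rank ''den'' = 8" "rank ''den2'' = 8"
  "rank ''Y'' = 9" "rank ''Y2'' = 9" "rank ''D'' = 9" "rank ''D2'' = 9" "rank ''Z'' = 9" "rank ''dz'' = 9" "rank ''e1'' = 9" "rank ''e2'' = 9"
  "rank ''rm'' = 9" "rank ''num'' = 9" "rank ''num2'' = 9" "rank ''qv'' = 9" "rank ''nv'' = 9" "rank ''y_num'' = 9" "rank ''y_den'' = 9"
  by (simp_all add: rank_def rank_table_def)

lemma (in ranks) Lt_rank [simp]: "arank (Lt a b) = 0" "lin r (Lt a b)"
  by (simp_all add: Lt_def)

lemma ranked_rounding_code: "ranks.ranked rank rounding_code"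
  by (simp add: rounding_code_def scaling_code_def grid_code_def constraint_code_def body_code_def prep_code_def
      dir_code_def min_code_def move_code_def search_code_def try_code_def iter_code_def proj_code_def pow4m_def
      For_def Asg_def Fold_def Clamp_def clip_at_def match_code_def ranks.Lt_rank ranks.ranked.simps ranks.lin.simps ranks.arank.simps rank_simps)

section \<open>Running time\<close>

definition poly_bounded :: "(nat \<Rightarrow> nat) \<Rightarrow> bool" where
  "poly_bounded f \<longleftrightarrow> (\<exists>q. \<forall>X. f X \<le> poly q X)"

lemma poly_bounded_const: "poly_bounded (\<lambda>X. c)"
  unfolding poly_bounded_def by (rule exI[of _ "[:c:]"]) simp

lemma poly_bounded_id: "poly_bounded (\<lambda>X. X)"
  unfolding poly_bounded_def by (rule exI[of _ "[:0, 1:]"]) simp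

lemma poly_bounded_add: "poly_bounded f \<Longrightarrow> poly_bounded g \<Longrightarrow> poly_bounded (\<lambda>X. f X + g X)"
proof -
  assume "poly_bounded f" "poly_bounded g"
  then obtain p q where "\<forall>X. f X \<le> poly p X" "\<forall>X. g X \<le> poly q X" unfolding poly_bounded_def by blast
  then have "\<forall>X. f X + g X \<le> poly (p + q) X" by (simp add: add_mono)
  then show ?thesis unfolding poly_bounded_def by blast
qed

lemma poly_bounded_mult: "poly_bounded f \<Longrightarrow> poly_bounded g \<Longrightarrow> poly_bounded (\<lambda>X. f X * g X)"
proof -
  assume "poly_bounded f" "poly_bounded g"
  then obtain p q where "\<forall>X. f X \<le> poly p X" "\<forall>X. g X \<le> poly q X" unfolding poly_bounded_def by blast
  then have "\<forall>X. f X * g X \<le> poly (p * q) X" by (simp add: mult_le_mono)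
  then show ?thesis unfolding poly_bounded_def by blast
qed

lemma poly_bounded_power: "poly_bounded f \<Longrightarrow> poly_bounded (\<lambda>X. f X ^ k)"
  by (induction k) (auto intro: poly_bounded_const poly_bounded_mult)

lemmas poly_bounded_intros = poly_bounded_const poly_bounded_id poly_bounded_add poly_bounded_mult poly_bounded_power

text \<open>Each rank multiplies by one more factor \<open>\<kappa> * t\<close>, so a fixed number
  of ranks keeps the bound polynomial.\<close>

lemma poly_bounded_size_bound:
  "poly_bounded L \<Longrightarrow> poly_bounded t \<Longrightarrow> poly_bounded (\<lambda>X. size_bound \<kappa> (L X) (t X) r)"
  by (induction r) (auto intro!: poly_bounded_intros)

lemma poly_bounded_step_bound: "poly_bounded step_bound"
proof -
  have "poly_bounded (\<lambda>X. step_bound X)"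
    unfolding step_bound_def body_cost_def try_cost_def loop_bound_def by (intro poly_bounded_intros)
  then show ?thesis by simp
qed

text \<open>The number of commands times the cost of one. The clock starts at 1, and 9 is the
  highest rank.\<close>

definition time_bound :: "nat \<Rightarrow> nat" where
  "time_bound X = step_bound X * step_cost (csz rounding_code + 1) (size_bound (csz rounding_code + 1) X (1 + step_bound X) 9)"

lemma poly_bounded_time_bound: "poly_bounded time_bound"
proof -
  have "poly_bounded (\<lambda>X. time_bound X)"
    unfolding time_bound_def step_cost_def cst_def
    by (intro poly_bounded_intros poly_bounded_size_bound poly_bounded_step_bound)
  then show ?thesis by simp
qed

lemma bits_ge: "2 \<le> rat_bits r" "1 \<le> bits k"
  by (simp_all add: rat_bits_def bits_def)

context
  fixes n m :: nat and A :: "nat \<Rightarrow> nat \<Rightarrow> nat" and s x :: "nat \<Rightarrow> rat" and \<delta> \<epsilon> :: rat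
begin

lemma le_input_size: "n \<le> input_size n m A s x \<delta> \<epsilon>" "m \<le> input_size n m A s x \<delta> \<epsilon>" "1 \<le> input_size n m A s x \<delta> \<epsilon>"
proof -
  have "(\<Sum>i<n. 1) \<le> (\<Sum>i<n. rat_bits (s i))" using bits_ge(1) by (intro sum_mono) (meson order_trans one_le_numeral)
  then show "n \<le> input_size n m A s x \<delta> \<epsilon>" by (simp add: input_size_def)
  have "(\<Sum>i<m. 1) \<le> (\<Sum>i<m. rat_bits (x i))" using bits_ge(1) by (intro sum_mono) (meson order_trans one_le_numeral)
  then show "m \<le> input_size n m A s x \<delta> \<epsilon>" by (simp add: input_size_def)
  show "1 \<le> input_size n m A s x \<delta> \<epsilon>" using bits_ge(2)[of "int n"] by (simp add: input_size_def)
qed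

text \<open>Every stored number contributes its own bit length to \<open>input_size\<close>.\<close>

lemma cell_le: "\<bar>input_store n m A s x \<delta> \<epsilon> v k\<bar> \<le> 2 ^ input_size n m A s x \<delta> \<epsilon>"
proof -
  let ?X = "input_size n m A s x \<delta> \<epsilon>"
  have le: "\<bar>arr l f k\<bar> \<le> 2 ^ ?X" if "\<And>j. j < l \<Longrightarrow> bits (f j) \<le> ?X" for l f
  proof (cases "0 \<le> k \<and> k < int l")
    case True
    then have "bits (f (nat k)) \<le> ?X" by (intro that) auto
    then have "(2::int) ^ bits (f (nat k)) \<le> 2 ^ ?X" by (intro power_increasing) auto
    then have "\<bar>f (nat k)\<bar> \<le> 2 ^ ?X" using abs_le_bits[of "f (nat k)"] by linarith
    then show ?thesis using True by (simp add: arr_def)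
  qed (auto simp: arr_def)
  have s: "rat_bits (s i) \<le> ?X" if "i < n" for i
    using member_le_sum[of i "{..<n}" "\<lambda>i. rat_bits (s i)"] that by (simp add: input_size_def)
  have x: "rat_bits (x p) \<le> ?X" if "p < m" for p
    using member_le_sum[of p "{..<m}" "\<lambda>i. rat_bits (x i)"] that by (simp add: input_size_def)
  have A: "bits (int (A (j div m) (j mod m))) \<le> ?X" if j: "j < n * m" for j
  proof -
    have "0 < m" using j by (cases m) auto
    then have "j div m < n" "j mod m < m" using j by (auto simp: less_mult_imp_div_less)
    then have "bits (int (A (j div m) (j mod m))) \<le> (\<Sum>p<m. bits (int (A (j div m) p)))"
      by (intro member_le_sum[of "j mod m" "{..<m}" "\<lambda>p. bits (int (A (j div m) p))"]) auto
    also have "\<dots> \<le> (\<Sum>i<n. \<Sum>p<m. bits (int (A i p)))"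
      using \<open>j div m < n\<close> by (intro member_le_sum[of "j div m" "{..<n}" "\<lambda>i. \<Sum>p<m. bits (int (A i p))"]) auto
    finally show ?thesis by (simp add: input_size_def)
  qed
  have q: "bits (rat_num (s i)) \<le> ?X" "bits (rat_den (s i)) \<le> ?X" if "i < n" for i
    using s[OF that] by (simp_all add: rat_bits_def)
  have q': "bits (rat_num (x i)) \<le> ?X" "bits (rat_den (x i)) \<le> ?X" if "i < m" for i
    using x[OF that] by (simp_all add: rat_bits_def)
  have r: "bits (int n) \<le> ?X" "bits (int m) \<le> ?X" "bits (rat_num \<delta>) \<le> ?X" "bits (rat_den \<delta>) \<le> ?X"
    "bits (rat_num \<epsilon>) \<le> ?X" "bits (rat_den \<epsilon>) \<le> ?X" by (simp_all add: input_size_def rat_bits_def)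
  have upd: "\<bar>(\<sigma>(w := f)) v k\<bar> \<le> 2 ^ ?X" if "\<bar>f k\<bar> \<le> 2 ^ ?X" "\<bar>\<sigma> v k\<bar> \<le> 2 ^ ?X" for \<sigma> w f
    using that by (cases "v = w") auto
  have "\<bar>0 :: int\<bar> \<le> 2 ^ ?X" by simp
  then show ?thesis unfolding input_store_def by (intro upd le A q q' r)
qed

end

lemma (in rinst) input_input_store: "input (input_store n m A s x \<delta> \<epsilon>)"
proof -
  have A: "arr (n * m) (\<lambda>k. int (A (k div m) (k mod m))) (int j * int m + int p) = int (A j p)" if "j < n" "p < m" for j p
  proof -
    have e: "int j * int m + int p = int (j * m + p)" by simp
    show ?thesis unfolding e arr_def using pair_less[OF that] that by (simp del: of_nat_add of_nat_mult)
  qed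
  show ?thesis unfolding input_def by (simp add: input_store_def A) (simp add: arr_def)
qed

lemma rounding_code_exec:
  assumes "admissible n m A (\<lambda>i. real_of_rat (s i)) (\<lambda>p. real_of_rat (x p)) (real_of_rat \<delta>) (real_of_rat \<epsilon>)"
  shows "\<exists>u \<tau>. exec rounding_code (input_store n m A s x \<delta> \<epsilon>) [] u \<tau> \<and>
    u \<le> time_bound (input_size n m A s x \<delta> \<epsilon>) \<and> well_formed_output m \<tau> \<and>
    good_rounding 100000 n m A (\<lambda>i. real_of_rat (s i)) (\<lambda>p. real_of_rat (x p)) (real_of_rat \<delta>) (real_of_rat \<epsilon>) (output_vector \<tau>)"
proof -
  let ?\<sigma> = "input_store n m A s x \<delta> \<epsilon>" and ?X = "input_size n m A s x \<delta> \<epsilon>"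
  let ?\<kappa> = "csz rounding_code + 1"
  interpret rinst n m A s x \<delta> \<epsilon>
    by (intro rinst.intro inst_if_admissible assms) (use assms in \<open>simp add: admissible_def\<close>)
  obtain \<tau> where \<tau>: "runb rounding_code ?\<sigma> (step_bound ?X) \<tau>" "well_formed_output m \<tau>"
    "good_rounding 100000 n m A (\<lambda>i. real_of_rat (s i)) (\<lambda>p. real_of_rat (x p)) (real_of_rat \<delta>) (real_of_rat \<epsilon>) (output_vector \<tau>)"
    using rounding_code_runb[OF input_input_store le_input_size(2,1)[where A = A and s = s and x = x and \<delta> = \<delta> and \<epsilon> = \<epsilon>]] by (elim exE conjE) (rule that; assumption)
  obtain S where S: "S \<le> step_bound ?X" "run rounding_code ?\<sigma> S \<tau>" using \<tau>(1) unfolding runb_def by blast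
  have start: "\<bar>?\<sigma> v k\<bar> \<le> 2 ^ size_bound ?\<kappa> ?X 1 (rank v)" for v k
  proof -
    have "(2::int) ^ ?X \<le> 2 ^ size_bound ?\<kappa> ?X 1 (rank v)" by (intro power_increasing size_bound_ge) auto
    then show ?thesis using cell_le[of n m A s x \<delta> \<epsilon> v k] by linarith
  qed
  obtain u where u: "exec rounding_code ?\<sigma> [] u \<tau>" "u \<le> S * step_cost ?\<kappa> (size_bound ?\<kappa> ?X (1 + S) 9)"
  proof -
    have "(\<forall>v k. \<bar>\<tau> v k\<bar> \<le> 2 ^ size_bound ?\<kappa> ?X (1 + S) (rank v)) \<and>
      (\<exists>u. exec rounding_code ?\<sigma> [] u \<tau> \<and> u \<le> S * step_cost ?\<kappa> (size_bound ?\<kappa> ?X (1 + S) 9))"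
      by (rule ranks.run_exec[OF S(2) ranked_rounding_code]; (rule start | rule rank_le | rule le_input_size | simp))
    then show ?thesis using that by blast
  qed
  note u(2)
  also have "S * step_cost ?\<kappa> (size_bound ?\<kappa> ?X (1 + S) 9) \<le> time_bound ?X"
    unfolding time_bound_def step_cost_def using S(1)
    by (intro mult_le_mono add_mono cst_mono size_bound_mono_t order_refl) auto
  finally show ?thesis using u(1) \<tau>(2,3) by blast
qed

text \<open>The empty coin list is a prefix of every coin sequence, so the running time is constant
  on the probability space.\<close>

lemma expected_run_time_exec:
  assumes "exec c \<sigma> [] u \<tau>"
  shows "expected_run_time c \<sigma> = of_nat u"
proof -
  interpret prob_space coin_space
    unfolding coin_space_def by (rule prob_space.prob_space_stream_space) (rule measure_pmf.prob_space_axioms)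
  have "run_time c \<sigma> = (\<lambda>\<omega>. of_nat u)"
    using run_time_exec[of c \<sigma> 0 _ u \<tau>] assms by (intro ext) simp
  then show ?thesis unfolding expected_run_time_def by (simp add: emeasure_space_1)
qed

theorem theorem11:
  shows "\<exists>C::real.
    (\<exists>(prog::com) (q::nat poly). computes_rounding_in_expected_poly_time C prog q) \<and>
    (\<forall>n m (A::nat \<Rightarrow> nat \<Rightarrow> nat) (s::nat \<Rightarrow> real) (x::nat \<Rightarrow> real) (\<delta>::real) (\<epsilon>::real).
       admissible n m A s x \<delta> \<epsilon> \<longrightarrow> (\<exists>y::nat \<Rightarrow> real. good_rounding C n m A s x \<delta> \<epsilon> y))"
proof (intro exI[of _ 100000] conjI allI impI)
  obtain q where q: "\<And>X. time_bound X \<le> poly q X" using poly_bounded_time_bound unfolding poly_bounded_def by blast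
  have "computes_rounding_in_expected_poly_time 100000 rounding_code q"
    unfolding computes_rounding_in_expected_poly_time_def
  proof (intro allI impI conjI)
    fix n m A s x \<delta> \<epsilon>
    assume a: "admissible n m A (\<lambda>i. real_of_rat (s i)) (\<lambda>p. real_of_rat (x p)) (real_of_rat \<delta>) (real_of_rat \<epsilon>)"
    let ?\<sigma> = "input_store n m A s x \<delta> \<epsilon>"
    obtain u \<tau> where e: "exec rounding_code ?\<sigma> [] u \<tau>" "u \<le> time_bound (input_size n m A s x \<delta> \<epsilon>)" "well_formed_output m \<tau>"
      "good_rounding 100000 n m A (\<lambda>i. real_of_rat (s i)) (\<lambda>p. real_of_rat (x p)) (real_of_rat \<delta>) (real_of_rat \<epsilon>) (output_vector \<tau>)"
      using rounding_code_exec[OF a] by blast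
    show "expected_run_time rounding_code ?\<sigma> \<le> of_nat (poly q (input_size n m A s x \<delta> \<epsilon>))"
      unfolding expected_run_time_exec[OF e(1)] using order_trans[OF e(2) q] by simp
    fix cs t \<rho> assume "exec rounding_code ?\<sigma> cs t \<rho>"
    \<comment> \<open>A run without coins is compatible with every other run, so determinism
      identifies the two.\<close>
    then have "\<rho> = \<tau>" using exec_deterministic[OF e(1), of cs t \<rho> cs "[]"] by simp
    then show "well_formed_output m \<rho>"
      "good_rounding 100000 n m A (\<lambda>i. real_of_rat (s i)) (\<lambda>p. real_of_rat (x p)) (real_of_rat \<delta>) (real_of_rat \<epsilon>) (output_vector \<rho>)"
      using e(3,4) by auto
  qed
  then show "\<exists>prog q. computes_rounding_in_expected_poly_time 100000 prog q" by blast
next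
  fix n m A s x \<delta> \<epsilon>
  assume "admissible n m A s x \<delta> \<epsilon>"
  then show "\<exists>y. good_rounding 100000 n m A s x \<delta> \<epsilon> y"
    by (intro inst.rounding_exists inst_if_admissible)
qed

end
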